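(* Assume that the primes have level of distribution $\vartheta$ for some fixed $\vartheta>\frac12$. Then there exist an integer $k(\vartheta)$ and a constant $c_5(\vartheta)>0$ such that for every fixed sufficiently small $\eta>0$, \[ \liminf_{N\to\infty} \frac{\#\{j : N < p_j \le 2N,\ p_{j+1}-p_j \le \eta\log N\}}{N/\log N} \ \ge\ c_5(\vartheta)\,\eta^{k(\vartheta)-1}. \]
   Context: $p_j$ denotes the $j$-th prime. The primes are said to have level of distribution $\vartheta$ if for every $A>0$ and every $\epsilon>0$, with $Q=N^{\vartheta-\epsilon}$, \[ \sum_{q\le Q}\max_{a:\,(a,q)=1}\Big|\sum_{\substack{p\le N \text{ prime}\\ p\equiv a \ (\mathrm{mod}\ q)}}\log p - \frac{N}{\phi(q)}\Big| \ll_{\epsilon,A} \frac{N}{(\log N)^A}. \] *)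

theory Defs
  imports "HOL-Number_Theory.Number_Theory" "HOL-Analysis.Analysis"
begin

text \<open>
  Indexing from 0, so the sequence starts with 2, 3, 5. Only the number of indices with a
  given property of consecutive primes is used below, which does not depend on the offset.
\<close>
definition nth_prime :: "nat \<Rightarrow> nat" where
  "nth_prime = enumerate {p. prime p}"

definition theta_progression :: "nat \<Rightarrow> nat \<Rightarrow> nat \<Rightarrow> real" where
  "theta_progression N q a = (\<Sum>p | prime p \<and> p \<le> N \<and> [p = a] (mod q). ln (real p))"

text \<open>
  The error term depends only on the residue class of a modulo q, so the maximum over all a
  coprime to q is taken over the representatives in \<^term>\<open>totatives q\<close>.
\<close>
definition level_of_distribution :: "real \<Rightarrow> bool" where
  "level_of_distribution \<theta> \<longleftrightarrow>
     (\<forall>A>0. \<forall>\<epsilon>>0. \<exists>C. \<forall>N\<ge>2.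
        (\<Sum>q | 1 \<le> q \<and> real q \<le> real N powr (\<theta> - \<epsilon>).
           Max ((\<lambda>a. \<bar>theta_progression N q a - real N / real (totient q)\<bar>) ` totatives q))
        \<le> C * (real N / ln (real N) powr A))"

definition small_gap_indices :: "real \<Rightarrow> nat \<Rightarrow> nat set" where
  "small_gap_indices \<eta> N =
     {j. N < nth_prime j \<and> nth_prime j \<le> 2 * N \<and>
         real (nth_prime (Suc j)) - real (nth_prime j) \<le> \<eta> * ln (real N)}"

end

theory Submission
  imports Defs "HOL-Real_Asymp.Real_Asymp"
begin

text \<open>
  The primes in short intervals are detected by the weights of Goldston, Pintz and Yildirim.
  For a set \<open>H\<close> of \<open>k\<close> shifts and a sieve level \<open>R\<close>, the weight of \<open>n\<close> is the square of a sum of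
  \<open>\<lambda>\<^sub>d\<close> over the divisors \<open>d \<le> R\<close> of \<open>\<Prod>h\<in>H. n + h\<close>, where \<open>n\<close> is confined to a residue class modulo the product \<open>W\<close>
  of the small primes and of the primes dividing a difference of two shifts. Squarefree divisors are
  represented by finite sets of primes.

  In Selberg's variables \<open>y\<^sub>r = (ln (R / r)) ^ l\<close> all main terms are given by exact identities. They are compared
  with each other without any asymptotic formula: the sum of dimension \<open>k\<close> splits into sums of dimension \<open>k - 1\<close>
  and \<open>1\<close>, the latter are bounded from both sides by elementary means, and the remaining ratio of
  two consecutive moments of the sum of dimension \<open>k - 1\<close> follows from \<open>ln r = \<Sum>p dvd r. ln p\<close> and Mertens' upper bound.
  With \<open>k = l\<^sup>2\<close> the expected number of primes among the \<open>n + h\<close> tends to \<open>2 * \<theta> > 1\<close> as \<open>l\<close> grows.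

  Replacing \<open>y\<^sub>r\<close> by \<open>y\<^sub>r - y\<^sub>r\<^sub>p\<close> shows that the \<open>n\<close> for which some \<open>n + h\<close> has a prime factor below a small power of \<open>N\<close>
  contribute little, and on the other \<open>n\<close> the weight is bounded. Hence, uniformly in \<open>H\<close>, there are at least
  \<open>c * N / (ln N) ^ k\<close> integers \<open>n\<close> in the range such that two of the \<open>n + h\<close> are prime and all are free of small prime factors.
  Summing over all \<open>H\<close> inside an interval of length \<open>\<eta> * ln N\<close>, and controlling the \<open>n\<close> with too many shifts free of small prime factors
  by an upper bound sieve for \<open>k + 1\<close> shifts, gives a proportion \<open>\<eta> ^ k\<close> of integers \<open>n\<close> that
  are followed by two primes within \<open>\<eta> * ln N\<close>; each small gap accounts for at most \<open>\<eta> * ln N\<close> of them.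
\<close>

subsection \<open>Selberg's quadratic form\<close>

text \<open>The shifts range over an interval of length comparable to \<open>ln N\<close>, so every
  estimate must be uniform in \<open>H\<close>, which asymptotic formulas with a singular series
  would make laborious. Putting into \<open>W\<close> each prime modulo which two shifts coincide
  removes the obstacle: modulo the remaining primes the shifts are distinct, the local densities are
  exactly \<open>k / p\<close> for integers and \<open>(k - 1) / (p - 1)\<close> for shifted primes,
  and \<open>H\<close> enters the main terms only through \<open>W\<close> and the product of
  \<open>1 - 1 / p\<close> over the primes of \<open>W\<close>. As \<open>W\<close> is at most a
  fixed power of \<open>ln N\<close>, both \<open>ln W\<close> and the reciprocal of that product
  are at most of order \<open>ln (ln N)\<close>, negligible against \<open>X = ln R\<close>.

  Since two divisors combine to a modulus as large as the square of \<open>R\<close>,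
  \<open>X\<close> is just below \<open>\<theta> / 2 * ln N\<close>. The choice
  \<open>k = l ^ 2\<close> turns the ratio of the prime sum to \<open>ln N\<close> times the sum of
  all weights into nearly \<open>l ^ 2 * (2 * l + 1) * \<theta> / (l + 1) ^ 3\<close>, which exceeds
  1 for some \<open>l\<close> exactly when \<open>\<theta> > 1 / 2\<close>.\<close>

lemma sum_Pow_insert:
  fixes f :: "'a set \<Rightarrow> 'b::comm_monoid_add"
  assumes "finite P" "p \<notin> P"
  shows "(\<Sum>A\<in>Pow (insert p P). f A) = (\<Sum>A\<in>Pow P. f A + f (insert p A))"
proof -
  have "(\<Sum>A\<in>Pow (insert p P). f A) = (\<Sum>A\<in>Pow P. f A) + (\<Sum>A\<in>insert p ` Pow P. f A)"
    unfolding Pow_insert using assms by (intro sum.union_disjoint) auto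
  also have "(\<Sum>A\<in>insert p ` Pow P. f A) = (\<Sum>A\<in>Pow P. f (insert p A))"
    using assms by (subst sum.reindex) (auto simp: inj_on_def insert_ident subset_iff)
  finally show ?thesis by (simp add: sum.distrib)
qed

text \<open>Expanding the product assigns \<open>a\<close> or \<open>b\<close> to each element;
  collecting the elements that receive \<open>a\<close> leaves a sum over disjoint pairs. For
  squarefree integers this is the factorisation into two coprime factors, used to change densities
  and to split off one dimension.\<close>

lemma sum_Pow_split:
  fixes a b :: "'a \<Rightarrow> 'b::comm_semiring_1" and F :: "'a set \<Rightarrow> 'b"
  assumes "finite P"
  shows "(\<Sum>A\<in>Pow P. (\<Prod>p\<in>A. a p + b p) * F A) =
         (\<Sum>A\<in>Pow P. (\<Prod>p\<in>A. a p) * (\<Sum>B\<in>Pow (P - A). (\<Prod>p\<in>B. b p) * F (A \<union> B)))"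
  using assms
proof (induction P arbitrary: F rule: finite_induct)
  case empty
  then show ?case by simp
next
  case (insert p P)
  note [simp] = insert.hyps
  have np: "p \<notin> A" "finite A" if "A \<in> Pow P" for A
    using that insert.hyps by (auto intro: finite_subset)
  have "(\<Sum>A\<in>Pow (insert p P). (\<Prod>p\<in>A. a p + b p) * F A) =
     (\<Sum>A\<in>Pow P. (\<Prod>p\<in>A. a p + b p) * (F A + (a p + b p) * F (insert p A)))"
    by (subst sum_Pow_insert) (auto intro!: sum.cong simp: np algebra_simps)
  also have "\<dots> = (\<Sum>A\<in>Pow P. (\<Prod>p\<in>A. a p) * (\<Sum>B\<in>Pow (P - A). (\<Prod>p\<in>B. b p) *
       (F (A \<union> B) + (a p + b p) * F (insert p (A \<union> B)))))"
    by (rule insert.IH)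
  also have "\<dots> = (\<Sum>A\<in>Pow P. (\<Prod>p\<in>A. a p) * (\<Sum>B\<in>Pow (insert p (P - A)). (\<Prod>p\<in>B. b p) * F (A \<union> B))
      + (\<Prod>p\<in>insert p A. a p) * (\<Sum>B\<in>Pow (P - A). (\<Prod>p\<in>B. b p) * F (insert p A \<union> B)))"
  proof (rule sum.cong[OF refl])
    fix A assume A: "A \<in> Pow P"
    have np': "p \<notin> B" "finite B" if "B \<in> Pow (P - A)" for B
      using that insert.hyps by (auto intro: finite_subset)
    show "(\<Prod>p\<in>A. a p) * (\<Sum>B\<in>Pow (P - A). (\<Prod>p\<in>B. b p) *
       (F (A \<union> B) + (a p + b p) * F (insert p (A \<union> B)))) =
      (\<Prod>p\<in>A. a p) * (\<Sum>B\<in>Pow (insert p (P - A)). (\<Prod>p\<in>B. b p) * F (A \<union> B))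
      + (\<Prod>p\<in>insert p A. a p) * (\<Sum>B\<in>Pow (P - A). (\<Prod>p\<in>B. b p) * F (insert p A \<union> B))"
      using A by (subst sum_Pow_insert)
        (auto simp: np np' sum_distrib_left sum.distrib[symmetric] algebra_simps intro!: sum.cong)
  qed
  also have "\<dots> = (\<Sum>A\<in>Pow (insert p P). (\<Prod>p\<in>A. a p) *
      (\<Sum>B\<in>Pow (insert p P - A). (\<Prod>p\<in>B. b p) * F (A \<union> B)))"
    by (subst sum_Pow_insert) (auto intro!: sum.cong simp: np insert_Diff_if)
  finally show ?case .
qed

text \<open>Sets of primes stand for squarefree integers, so the union is the least common multiple.
  If each \<open>p\<close> is put into a random set with probability \<open>u p\<close>
  independently, this is the expected square of the sum of \<open>l\<close> over the subsets of that
  random set.\<close>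

definition quad_form :: "('a \<Rightarrow> real) \<Rightarrow> 'a set \<Rightarrow> ('a set \<Rightarrow> real) \<Rightarrow> real" where
  "quad_form u P l = (\<Sum>A\<in>Pow P. \<Sum>B\<in>Pow P. l A * l B * (\<Prod>p\<in>A \<union> B. u p))"

text \<open>With \<open>u p = 1 / f p\<close> and \<open>g p = f p - 1\<close> this is Selberg's \<open>\<lambda>\<^sub>d = \<mu>(d) * f(d) * (\<Sum>r. y\<^sub>r / g(r))\<close>,
  the sum being over the multiples \<open>r\<close> of \<open>d\<close>.\<close>

definition selberg :: "('a \<Rightarrow> real) \<Rightarrow> 'a set \<Rightarrow> ('a set \<Rightarrow> real) \<Rightarrow> 'a set \<Rightarrow> real" where
  "selberg u P y A = (\<Prod>p\<in>A. - 1 / (1 - u p)) *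
     (\<Sum>B\<in>Pow (P - A). (\<Prod>p\<in>B. u p / (1 - u p)) * y (A \<union> B))"

lemma quad_form_cong:
  "(\<And>A. A \<subseteq> P \<Longrightarrow> l A = l' A) \<Longrightarrow> quad_form u P l = quad_form u P l'"
  unfolding quad_form_def by (intro sum.cong) auto

text \<open>Deleting one prime from \<open>P\<close> only changes the variables \<open>y\<close>;
  this is what makes induction over \<open>P\<close> with arbitrary \<open>y\<close>
  possible.\<close>

lemma selberg_insert_notin:
  assumes "finite P" "p \<notin> P" "A \<subseteq> P"
  shows "selberg u (insert p P) y A =
    selberg u P (\<lambda>M. y M + u p / (1 - u p) * y (insert p M)) A"
proof -
  have "insert p P - A = insert p (P - A)" "finite (P - A)" "p \<notin> P - A" using assms by auto
  moreover have "p \<notin> B" "finite B" if "B \<in> Pow (P - A)" for B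
    using that assms by (auto intro: finite_subset)
  ultimately show ?thesis
    by (auto simp: selberg_def sum_Pow_insert algebra_simps intro!: sum.cong)
qed

lemma selberg_insert_in:
  assumes "finite P" "p \<notin> P" "A \<subseteq> P"
  shows "selberg u (insert p P) y (insert p A) =
    - 1 / (1 - u p) * selberg u P (\<lambda>M. y (insert p M)) A"
proof -
  have "insert p P - insert p A = P - A" "finite A" "p \<notin> A" using assms by (auto intro: finite_subset)
  then show ?thesis by (simp add: selberg_def)
qed

lemma selberg_linear:
  "selberg u P (\<lambda>M. y M + c * z M) A = selberg u P y A + c * selberg u P z A"
  by (simp add: selberg_def sum.distrib sum_distrib_left algebra_simps)

text \<open>Reading \<open>u p\<close> as a probability, condition on \<open>p\<close>: if it is
  absent, \<open>l\<close> remains; if it is present, each \<open>A\<close> is paired with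
  \<open>insert p A\<close>.\<close>

lemma quad_form_insert:
  assumes "finite P" "p \<notin> P"
  shows "quad_form u (insert p P) l =
    (1 - u p) * quad_form u P l + u p * quad_form u P (\<lambda>A. l A + l (insert p A))"
proof -
  have "p \<notin> A \<union> B" "finite (A \<union> B)" "p \<notin> A" "p \<notin> B" "finite A" "finite B"
    if "A \<in> Pow P" "B \<in> Pow P" for A B
    using that assms by (auto intro: finite_subset)
  then show ?thesis
    unfolding quad_form_def sum_Pow_insert[OF assms] sum_distrib_left sum.distrib[symmetric]
    by (intro sum.cong refl) (simp add: algebra_simps)
qed

text \<open>The coefficients \<open>u p / (1 - u p)\<close> and \<open>- 1 / (1 - u p)\<close> of
  the part with \<open>y (insert p M)\<close> add up to \<open>- 1\<close>, so the pairing that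
  occurs when \<open>p\<close> divides turns \<open>y\<close> into a difference.\<close>

lemma selberg_add_insert:
  assumes "finite P" "p \<notin> P" "A \<subseteq> P" "u p \<noteq> 1"
  shows "selberg u (insert p P) y A + selberg u (insert p P) y (insert p A) =
    selberg u P (\<lambda>M. y M - y (insert p M)) A"
proof -
  have *: "s + u p / (1 - u p) * t + - 1 / (1 - u p) * t = s + (-1) * t" for s t
    using assms(4) by (simp add: divide_simps) (simp add: algebra_simps)
  have "selberg u P (\<lambda>M. y M - y (insert p M)) A = selberg u P (\<lambda>M. y M + (-1) * y (insert p M)) A"
    by simp
  then show ?thesis
    by (simp only: selberg_insert_notin[OF assms(1-3)] selberg_insert_in[OF assms(1-3)] selberg_linear *)
qed

text \<open>Selberg's diagonalisation. Conditioning on one more prime yields one square with the sum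
  \<open>y M + u p / (1 - u p) * y (insert p M)\<close> and one with the difference
  \<open>y M - y (insert p M)\<close>; with the weights \<open>1 - u p\<close> and
  \<open>u p\<close> the cross terms cancel.\<close>

theorem quad_form_selberg:
  assumes "finite P" "\<And>p. p \<in> P \<Longrightarrow> u p \<noteq> 1"
  shows "quad_form u P (selberg u P y) = (\<Sum>M\<in>Pow P. (\<Prod>p\<in>M. u p / (1 - u p)) * (y M)\<^sup>2)"
  using assms
proof (induction P arbitrary: y rule: finite_induct)
  case empty
  then show ?case by (simp add: quad_form_def selberg_def power2_eq_square)
next
  case (insert p P)
  let ?v = "\<lambda>p. u p / (1 - u p)"
  have np: "p \<notin> M" "finite M" if "M \<in> Pow P" for M
    using that insert.hyps by (auto intro: finite_subset)
  have u: "u p \<noteq> 1" by (simp add: insert.prems)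
  have "quad_form u (insert p P) (selberg u (insert p P) y) =
     (1 - u p) * quad_form u P (selberg u P (\<lambda>M. y M + ?v p * y (insert p M)))
     + u p * quad_form u P (selberg u P (\<lambda>M. y M - y (insert p M)))"
    unfolding quad_form_insert[OF insert.hyps]
    by (intro arg_cong2[of _ _ _ _ "(+)"] arg_cong2[of _ _ _ _ "(*)"] refl quad_form_cong)
       (rule selberg_insert_notin[OF insert.hyps] selberg_add_insert[where u = u, OF insert.hyps _ u]; assumption)+
  also have "\<dots> = (1 - u p) * (\<Sum>M\<in>Pow P. (\<Prod>p\<in>M. ?v p) * (y M + ?v p * y (insert p M))\<^sup>2)
     + u p * (\<Sum>M\<in>Pow P. (\<Prod>p\<in>M. ?v p) * (y M - y (insert p M))\<^sup>2)"
    using insert.IH insert.prems by simp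
  also have "\<dots> = (\<Sum>M\<in>Pow P. (\<Prod>p\<in>M. ?v p) *
      ((1 - u p) * (y M + ?v p * y (insert p M))\<^sup>2 + u p * (y M - y (insert p M))\<^sup>2))"
    by (simp add: sum_distrib_left sum.distrib[symmetric] algebra_simps)
  also have "\<dots> = (\<Sum>M\<in>Pow P. (\<Prod>p\<in>M. ?v p) * ((y M)\<^sup>2 + ?v p * (y (insert p M))\<^sup>2))"
  proof -
    have "(1 - u p) * (s + ?v p * t)\<^sup>2 + u p * (s - t)\<^sup>2 = s\<^sup>2 + ?v p * t\<^sup>2" for s t
      using u by (simp add: divide_simps power2_eq_square) (simp add: algebra_simps)
    then show ?thesis by simp
  qed
  also have "\<dots> = (\<Sum>M\<in>Pow (insert p P). (\<Prod>p\<in>M. ?v p) * (y M)\<^sup>2)"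
    by (subst sum_Pow_insert[OF insert.hyps]) (auto intro!: sum.cong simp: np algebra_simps)
  finally show ?case .
qed

text \<open>Integers and shifted primes carry the same coefficients but have different densities.
  These are the variables that diagonalise the form for the density \<open>u'\<close> when the
  coefficients were built from \<open>y\<close> with the density \<open>u\<close>.\<close>

definition selberg_change :: "('a \<Rightarrow> real) \<Rightarrow> ('a \<Rightarrow> real) \<Rightarrow> 'a set \<Rightarrow> ('a set \<Rightarrow> real) \<Rightarrow> 'a set \<Rightarrow> real" where
  "selberg_change u u' P y M = (\<Prod>p\<in>M. (1 - u' p) / (1 - u p)) *
     (\<Sum>B\<in>Pow (P - M). (\<Prod>p\<in>B. (u p - u' p) / (1 - u p)) * y (M \<union> B))"

text \<open>In Selberg's formula for \<open>u\<close>, write the numerator \<open>u p\<close> as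
  \<open>u' p + (u p - u' p)\<close> and split. The primes receiving \<open>u' p\<close> form the
  sum belonging to \<open>u'\<close>, the others form \<open>selberg_change\<close>.\<close>

theorem selberg_eq_selberg_change:
  assumes "finite P" "A \<subseteq> P" "\<And>p. p \<in> P \<Longrightarrow> u p \<noteq> 1 \<and> u' p \<noteq> 1"
  shows "selberg u P y A = selberg u' P (selberg_change u u' P y) A"
proof -
  let ?a = "\<lambda>p. u' p / (1 - u p)" and ?b = "\<lambda>p. (u p - u' p) / (1 - u p)"
  have "selberg u' P (selberg_change u u' P y) A =
    (\<Prod>p\<in>A. - 1 / (1 - u p)) * (\<Sum>B\<in>Pow (P - A). (\<Prod>p\<in>B. ?a p) *
      (\<Sum>C\<in>Pow (P - A - B). (\<Prod>p\<in>C. ?b p) * y (A \<union> (B \<union> C))))"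
  proof -
    have *: "(\<Prod>p\<in>A. - 1 / (1 - u' p)) * ((\<Prod>p\<in>B. u' p / (1 - u' p)) *
       (\<Prod>p\<in>A \<union> B. (1 - u' p) / (1 - u p))) = (\<Prod>p\<in>A. - 1 / (1 - u p)) * (\<Prod>p\<in>B. ?a p)"
      if B: "B \<in> Pow (P - A)" for B
    proof -
      have fin: "finite A" "finite B" using assms B by (auto intro: finite_subset)
      have "(\<Prod>p\<in>A. - 1 / (1 - u' p)) * ((\<Prod>p\<in>B. u' p / (1 - u' p)) *
       (\<Prod>p\<in>A \<union> B. (1 - u' p) / (1 - u p))) =
        (\<Prod>p\<in>A. - 1 / (1 - u' p) * ((1 - u' p) / (1 - u p))) *
        (\<Prod>p\<in>B. u' p / (1 - u' p) * ((1 - u' p) / (1 - u p)))"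
        using B fin by (subst prod.union_disjoint) (auto simp only: prod.distrib ac_simps)
      also have "\<dots> = (\<Prod>p\<in>A. - 1 / (1 - u p)) * (\<Prod>p\<in>B. ?a p)"
        using B assms by (intro arg_cong2[of _ _ _ _ "(*)"] prod.cong refl) auto
      finally show ?thesis .
    qed
    have D: "P - (A \<union> B) = P - A - B" for B by auto
    have "selberg u' P (selberg_change u u' P y) A = (\<Sum>B\<in>Pow (P - A).
        ((\<Prod>p\<in>A. - 1 / (1 - u' p)) * ((\<Prod>p\<in>B. u' p / (1 - u' p)) *
        (\<Prod>p\<in>A \<union> B. (1 - u' p) / (1 - u p)))) *
        (\<Sum>C\<in>Pow (P - A - B). (\<Prod>p\<in>C. ?b p) * y (A \<union> (B \<union> C))))"
      unfolding selberg_def selberg_change_def sum_distrib_left D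
      by (intro sum.cong refl) (simp only: D Un_assoc mult.assoc)
    also have "\<dots> = (\<Sum>B\<in>Pow (P - A). (\<Prod>p\<in>A. - 1 / (1 - u p)) * (\<Prod>p\<in>B. ?a p) *
        (\<Sum>C\<in>Pow (P - A - B). (\<Prod>p\<in>C. ?b p) * y (A \<union> (B \<union> C))))"
      by (intro sum.cong refl) (simp only: *)
    finally show ?thesis by (simp add: sum_distrib_left mult.assoc)
  qed
  also have "\<dots> = (\<Prod>p\<in>A. - 1 / (1 - u p)) * (\<Sum>B\<in>Pow (P - A). (\<Prod>p\<in>B. ?a p + ?b p) * y (A \<union> B))"
    using assms by (subst sum_Pow_split) auto
  also have "\<dots> = selberg u P y A"
    unfolding selberg_def by (simp add: add_divide_distrib[symmetric])
  finally show ?thesis ..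
qed

text \<open>If \<open>p\<close> lies in \<open>A\<close>, the factor \<open>1 / (1 - u p)\<close>
  equals \<open>1 + u p / (1 - u p)\<close>: the first summand is absorbed because \<open>y\<close>
  is decreasing, the second occurs literally in the value at the empty set. This is the uniform
  bound for the sieve coefficients in all error terms.\<close>

lemma selberg_abs_le:
  assumes "finite P" "A \<subseteq> P" "\<And>p. p \<in> P \<Longrightarrow> 0 \<le> u p \<and> u p < 1"
    and "\<And>M. 0 \<le> y M" "\<And>M M'. M \<subseteq> M' \<Longrightarrow> M' \<subseteq> P \<Longrightarrow> y M' \<le> y M"
  shows "\<bar>selberg u P y A\<bar> \<le> selberg u P y {}"
  using assms
proof (induction P arbitrary: y A rule: finite_induct)
  case empty
  then show ?case by (simp add: selberg_def)
next
  case (insert p P)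
  let ?v = "u p / (1 - u p)"
  let ?z = "\<lambda>M. y M + ?v * y (insert p M)"
  have u: "0 \<le> u p" "u p < 1" "0 \<le> ?v" using insert.prems(2)[of p] by auto
  have mono: "y (insert p M') \<le> y (insert p M)" "y M' \<le> y M" "y (insert p M) \<le> y M"
    if "M \<subseteq> M'" "M' \<subseteq> P" for M M'
    using that insert.prems(4) by (meson insert_mono subset_insertI subset_insertI2 order.trans)+
  have z: "\<bar>selberg u P ?z B\<bar> \<le> selberg u P ?z {}" if "B \<subseteq> P" for B
  proof (rule insert.IH[OF that])
    show "?z M' \<le> ?z M" if "M \<subseteq> M'" "M' \<subseteq> P" for M M'
      by (intro add_mono mult_left_mono mono that u)
    show "0 \<le> ?z M" for M by (intro add_nonneg_nonneg mult_nonneg_nonneg insert.prems u)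
  qed (use insert.prems u in auto)
  show ?case
  proof (cases "p \<in> A")
    case False
    then have "A \<subseteq> P" using insert.prems by auto
    then show ?thesis using z[of A] by (simp add: selberg_insert_notin insert.hyps)
  next
    case True
    define B where "B = A - {p}"
    have B: "A = insert p B" "B \<subseteq> P" using True insert.prems insert.hyps by (auto simp: B_def)
    have "\<bar>selberg u P (\<lambda>M. y (insert p M)) B\<bar> \<le> selberg u P (\<lambda>M. y (insert p M)) {}"
      by (rule insert.IH[OF B(2)]) (use insert.prems mono in auto)
    then have "\<bar>selberg u (insert p P) y A\<bar> \<le> 1 / (1 - u p) * selberg u P (\<lambda>M. y (insert p M)) {}"
      using u by (simp add: B(1) selberg_insert_in[OF insert.hyps B(2)] abs_mult divide_right_mono)
    also have "1 / (1 - u p) = 1 + ?v" using u by (simp add: field_simps)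
    also have "(1 + ?v) * selberg u P (\<lambda>M. y (insert p M)) {} \<le>
      selberg u P y {} + ?v * selberg u P (\<lambda>M. y (insert p M)) {}"
    proof -
      have "selberg u P (\<lambda>M. y (insert p M)) {} \<le> selberg u P y {}"
        unfolding selberg_def using insert.prems(2) mono
        by (auto intro!: sum_mono mult_left_mono prod_nonneg divide_nonneg_pos simp: subset_iff)
      then show ?thesis by (simp add: algebra_simps)
    qed
    also have "\<dots> = selberg u (insert p P) y {}"
      by (simp only: selberg_insert_notin[OF insert.hyps empty_subsetI] selberg_linear)
    finally show ?thesis .
  qed
qed

section \<open>Moments of multiplicative sums with a logarithmic cutoff\<close>

definition lnsum :: "nat set \<Rightarrow> real" where
  "lnsum A = (\<Sum>p\<in>A. ln (real p))"

lemma lnsum_empty [simp]: "lnsum {} = 0"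
  by (simp add: lnsum_def)

lemma lnsum_insert: "finite A \<Longrightarrow> p \<notin> A \<Longrightarrow> lnsum (insert p A) = ln (real p) + lnsum A"
  by (simp add: lnsum_def)

lemma lnsum_union: "finite A \<Longrightarrow> finite B \<Longrightarrow> A \<inter> B = {} \<Longrightarrow> lnsum (A \<union> B) = lnsum A + lnsum B"
  by (simp add: lnsum_def sum.union_disjoint)

lemma ln_le_iff_le_exp: "0 < x \<Longrightarrow> ln x \<le> y \<longleftrightarrow> x \<le> exp (y::real)"
  by (metis exp_le_cancel_iff exp_ln)

lemma ln_prime_pos: "prime (p::nat) \<Longrightarrow> ln (real p) > 0"
  using prime_gt_1_nat[of p] by simp

lemma lnsum_nonneg: "(\<And>p. p \<in> A \<Longrightarrow> prime p) \<Longrightarrow> 0 \<le> lnsum A"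
  unfolding lnsum_def by (intro sum_nonneg less_imp_le ln_prime_pos)

lemma lnsum_mono:
  assumes "finite B" "A \<subseteq> B" "\<And>p. p \<in> B \<Longrightarrow> prime p"
  shows "lnsum A \<le> lnsum B"
  unfolding lnsum_def using assms ln_prime_pos by (intro sum_mono2) (auto intro: less_imp_le)

lemma lnsum_eq_ln_prod:
  assumes "\<And>p. p \<in> A \<Longrightarrow> prime p"
  shows "lnsum A = ln (real (\<Prod>A))"
proof -
  have "\<And>p. p \<in> A \<Longrightarrow> real p > 0" using assms prime_gt_0_nat by auto
  then show ?thesis by (cases "finite A") (simp_all add: lnsum_def ln_prod)
qed

text \<open>For \<open>a p\<close> close to \<open>c / p\<close> this is a sum of dimension
  \<open>c\<close>, growing like \<open>X ^ (q + c)\<close>. A zeroth power is 1, so for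
  \<open>q = 0\<close> nothing would be truncated; this is why \<open>q \<ge> 1\<close> is assumed
  below.\<close>

definition msum :: "(nat \<Rightarrow> real) \<Rightarrow> nat set \<Rightarrow> nat \<Rightarrow> real \<Rightarrow> real" where
  "msum a P q X = (\<Sum>A\<in>Pow P. (\<Prod>p\<in>A. a p) * max 0 (X - lnsum A) ^ q)"

lemma msum_nonneg: "(\<And>p. p \<in> P \<Longrightarrow> 0 \<le> a p) \<Longrightarrow> 0 \<le> msum a P q X"
  unfolding msum_def by (intro sum_nonneg mult_nonneg_nonneg prod_nonneg) auto

lemma power_max_le: "(a::real) \<le> b \<Longrightarrow> max 0 a ^ q \<le> max 0 b ^ q"
  by (intro power_mono) auto

text \<open>Partial summation: \<open>max 0 (X - s) ^ q\<close> is the integral of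
  \<open>q * (X - t) ^ (q - 1)\<close> over \<open>t\<close> from \<open>s\<close> to
  \<open>X\<close>, so the sum becomes an integral against the summatory function of
  \<open>a\<close>, and the linear bound is inserted there.\<close>

lemma sum_power_max_abel:
  fixes a s :: "'a \<Rightarrow> real"
  assumes S: "finite S" and a: "\<And>i. i \<in> S \<Longrightarrow> 0 \<le> a i" and s: "\<And>i. i \<in> S \<Longrightarrow> 0 \<le> s i"
    and bd: "\<And>t. 0 \<le> t \<Longrightarrow> (\<Sum>i | i \<in> S \<and> s i \<le> t. a i) \<le> \<alpha> * t + \<beta>"
    and q: "q \<ge> 1" and X: "X \<ge> 0"
  shows "(\<Sum>i\<in>S. a i * max 0 (X - s i) ^ q) \<le> \<alpha> * X ^ (q + 1) / real (q + 1) + \<beta> * X ^ q"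
proof -
  obtain r where q': "q = Suc r" using q by (cases q) auto
  have der: "((\<lambda>t. - ((X - t) ^ Suc n)) has_real_derivative real (Suc n) * (X - t) ^ n) (at t within T)" for n t T
    by (auto intro!: derivative_eq_intros simp del: power_Suc)
  \<comment> \<open>\<open>G\<close> is the antiderivative of
    \<open>q * (X - t) ^ (q - 1) * (\<alpha> * t + \<beta>)\<close> that integration by parts
    gives.\<close>
  define G where "G = (\<lambda>t. - ((X - t) ^ Suc r) * (\<alpha> * t + \<beta>) + \<alpha> / real (r + 2) * - ((X - t) ^ Suc (Suc r)))"
  have der': "(G has_real_derivative real (Suc r) * (X - t) ^ r * (\<alpha> * t + \<beta>)) (at t within T)" for t T
  proof -
    have lin: "((\<lambda>t. \<alpha> * t + \<beta>) has_real_derivative \<alpha>) (at t within T)"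
      by (auto intro!: derivative_eq_intros)
    show ?thesis unfolding G_def
      by (rule DERIV_cong[OF DERIV_add[OF DERIV_mult[OF der lin] DERIV_cmult[OF der]]])
         (simp add: field_simps)
  qed
  have ker: "((\<lambda>t. a i * (if s i \<le> t then real (Suc r) * (X - t) ^ r else 0)) has_integral
      a i * max 0 (X - s i) ^ q) {0..X}" if i: "i \<in> S" for i
  proof (rule has_integral_mult_right, cases "s i \<le> X")
    case True
    have "((\<lambda>t. real (Suc r) * (X - t) ^ r) has_integral (- ((X - X) ^ Suc r) - - ((X - s i) ^ Suc r))) {s i..X}"
      using True
      by (intro fundamental_theorem_of_calculus)
         (auto simp: has_real_derivative_iff_has_vector_derivative[symmetric] simp del: power_Suc of_nat_Suc intro!: der)
    then have "((\<lambda>t. real (Suc r) * (X - t) ^ r) has_integral (max 0 (X - s i) ^ q)) {s i..X}"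
      using True by (simp add: q')
    then have "((\<lambda>t. if t \<in> {s i..X} then real (Suc r) * (X - t) ^ r else 0) has_integral
        (max 0 (X - s i) ^ q)) {0..X}"
      using s[OF i] by (subst has_integral_restrict) auto
    then show "((\<lambda>t. if s i \<le> t then real (Suc r) * (X - t) ^ r else 0) has_integral
        (max 0 (X - s i) ^ q)) {0..X}"
      by (rule has_integral_eq[rotated]) auto
  next
    case False
    then show "((\<lambda>t. if s i \<le> t then real (Suc r) * (X - t) ^ r else 0) has_integral
        (max 0 (X - s i) ^ q)) {0..X}"
      by (intro has_integral_eq[OF _ has_integral_0[of "{0..X}"], THEN has_integral_eq_rhs])
         (auto simp: q')
  qed
  have "((\<lambda>t. real (Suc r) * (X - t) ^ r * (\<alpha> * t + \<beta>)) has_integral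
     (G X - G 0)) {0..X}"
    using X
    by (intro fundamental_theorem_of_calculus)
       (auto simp: has_real_derivative_iff_has_vector_derivative[symmetric] simp del: power_Suc of_nat_Suc intro!: der')
  then have rhs: "((\<lambda>t. real (Suc r) * (X - t) ^ r * (\<alpha> * t + \<beta>)) has_integral
     (\<alpha> * X ^ (q + 1) / real (q + 1) + \<beta> * X ^ q)) {0..X}"
    by (simp add: q' G_def algebra_simps)
  have "((\<lambda>t. \<Sum>i\<in>S. a i * (if s i \<le> t then real (Suc r) * (X - t) ^ r else 0)) has_integral
      (\<Sum>i\<in>S. a i * max 0 (X - s i) ^ q)) {0..X}"
    by (intro has_integral_sum S ker)
  from this rhs show ?thesis
  proof (rule has_integral_le)
    fix t assume t: "t \<in> {0..X}"
    have "(\<Sum>i\<in>S. a i * (if s i \<le> t then real (Suc r) * (X - t) ^ r else 0)) =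
       real (Suc r) * (X - t) ^ r * (\<Sum>i | i \<in> S \<and> s i \<le> t. a i)"
      unfolding sum.inter_filter[OF S] sum_distrib_left by (intro sum.cong) auto
    also have "\<dots> \<le> real (Suc r) * (X - t) ^ r * (\<alpha> * t + \<beta>)"
      using t by (intro mult_left_mono bd) auto
    finally show "(\<Sum>i\<in>S. a i * (if s i \<le> t then real (Suc r) * (X - t) ^ r else 0)) \<le> \<dots>" .
  qed
qed

text \<open>The recursion \<open>ln r = \<Sum>p dvd r. ln p\<close> yields, from a Mertens-type bound alone,
  the ratio of consecutive moments that the asymptotic formula for a sum of dimension
  \<open>\<alpha>\<close> would give.\<close>

lemma msum_moment_ineq:
  assumes P: "finite P" "\<And>p. p \<in> P \<Longrightarrow> prime p" and a: "\<And>p. p \<in> P \<Longrightarrow> 0 \<le> a p"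
    and bd: "\<And>t. 0 \<le> t \<Longrightarrow> (\<Sum>p | p \<in> P \<and> ln (real p) \<le> t. a p * ln (real p)) \<le> \<alpha> * t + \<beta>"
    and q: "q \<ge> 1"
  shows "X * msum a P q X \<le> (1 + \<alpha> / real (q + 1)) * msum a P (q + 1) X + \<beta> * msum a P q X"
proof -
  let ?m = "\<lambda>x. max 0 (x::real)"
  have fin: "finite A" "\<And>p. p \<in> A \<Longrightarrow> prime p" "0 \<le> prod a A" "0 \<le> lnsum A"
    if "A \<in> Pow P" for A
  proof -
    show "finite A" "\<And>p. p \<in> A \<Longrightarrow> prime p" "0 \<le> prod a A"
      using that P a by (auto intro: finite_subset intro!: prod_nonneg)
    then show "0 \<le> lnsum A" by (intro lnsum_nonneg)
  qed
  have "X * msum a P q X = (\<Sum>A\<in>Pow P. prod a A * (X * ?m (X - lnsum A) ^ q))"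
    by (simp add: msum_def sum_distrib_left algebra_simps)
  \<comment> \<open>Write \<open>X\<close> as \<open>(X - lnsum A) + lnsum A\<close>; the second
    part is then expanded over the primes of \<open>A\<close>.\<close>
  also have "\<dots> \<le> (\<Sum>A\<in>Pow P. prod a A * (?m (X - lnsum A) ^ (q + 1) + lnsum A * ?m (X - lnsum A) ^ q))"
  proof (intro sum_mono mult_left_mono fin)
    show "X * ?m (X - lnsum A) ^ q \<le> ?m (X - lnsum A) ^ (q + 1) + lnsum A * ?m (X - lnsum A) ^ q" for A
      using q by (cases "lnsum A \<le> X") (auto simp: max_def algebra_simps power_0_left)
  qed
  also have "\<dots> = msum a P (q + 1) X + (\<Sum>A\<in>Pow P. prod a A * lnsum A * ?m (X - lnsum A) ^ q)"
    by (simp add: msum_def sum.distrib algebra_simps)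
  also have "(\<Sum>A\<in>Pow P. prod a A * lnsum A * ?m (X - lnsum A) ^ q) =
     (\<Sum>A\<in>Pow P. \<Sum>p\<in>P. if p \<in> A then prod a A * ln (real p) * ?m (X - lnsum A) ^ q else 0)"
  proof (rule sum.cong[OF refl])
    fix A assume A: "A \<in> Pow P"
    then have "(\<Sum>p\<in>P. if p \<in> A then prod a A * ln (real p) * ?m (X - lnsum A) ^ q else 0) =
       (\<Sum>p\<in>A. prod a A * ln (real p) * ?m (X - lnsum A) ^ q)"
      by (subst sum.inter_restrict[OF P(1), symmetric]) (simp add: Int_absorb1)
    then show "prod a A * lnsum A * ?m (X - lnsum A) ^ q =
       (\<Sum>p\<in>P. if p \<in> A then prod a A * ln (real p) * ?m (X - lnsum A) ^ q else 0)"
      by (simp add: lnsum_def sum_distrib_left sum_distrib_right)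
  qed
  also have "\<dots> = (\<Sum>p\<in>P. \<Sum>A\<in>Pow P. if p \<in> A then prod a A * ln (real p) * ?m (X - lnsum A) ^ q else 0)"
    by (rule sum.swap)
  also have "\<dots> \<le> (\<Sum>p\<in>P. \<Sum>A\<in>Pow P. prod a A * (a p * ln (real p) * ?m (X - lnsum A - ln (real p)) ^ q))"
  proof (rule sum_mono)
    fix p assume p: "p \<in> P"
    define Q where "Q = P - {p}"
    have Q: "P = insert p Q" "p \<notin> Q" "finite Q" using p P by (auto simp: Q_def)
    have "(\<Sum>A\<in>Pow P. if p \<in> A then prod a A * ln (real p) * ?m (X - lnsum A) ^ q else 0) =
      (\<Sum>A\<in>Pow Q. prod a A * (a p * ln (real p) * ?m (X - lnsum A - ln (real p)) ^ q))"
      unfolding Q(1) sum_Pow_insert[OF Q(3,2)]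
    proof (rule sum.cong[OF refl])
      fix A assume "A \<in> Pow Q"
      then have "p \<notin> A" "finite A" using Q by (auto intro: finite_subset)
      then show "(if p \<in> A then prod a A * ln (real p) * ?m (X - lnsum A) ^ q else 0) +
         (if p \<in> insert p A then prod a (insert p A) * ln (real p) * ?m (X - lnsum (insert p A)) ^ q else 0) =
         prod a A * (a p * ln (real p) * ?m (X - lnsum A - ln (real p)) ^ q)"
        by (simp add: lnsum_insert algebra_simps)
    qed
    \<comment> \<open>The condition that \<open>p\<close> is not in \<open>A\<close> is dropped,
      which only adds nonnegative terms and decouples the sum over \<open>p\<close> from
      \<open>A\<close>.\<close>
    also have "\<dots> \<le> (\<Sum>A\<in>Pow P. prod a A * (a p * ln (real p) * ?m (X - lnsum A - ln (real p)) ^ q))"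
    proof (rule sum_mono2)
      have "0 \<le> a p * ln (real p)" using a[OF p] ln_prime_pos[OF P(2)[OF p]] by simp
      then show "0 \<le> prod a A * (a p * ln (real p) * ?m (X - lnsum A - ln (real p)) ^ q)"
        if "A \<in> Pow P - Pow Q" for A
        using fin(3)[of A] that by (intro mult_nonneg_nonneg[OF _ mult_nonneg_nonneg]) auto
    qed (use P in \<open>auto simp: Q_def\<close>)
    finally show "(\<Sum>A\<in>Pow P. if p \<in> A then prod a A * ln (real p) * ?m (X - lnsum A) ^ q else 0) \<le> \<dots>" .
  qed
  also have "\<dots> = (\<Sum>A\<in>Pow P. prod a A * (\<Sum>p\<in>P. a p * ln (real p) * ?m (X - lnsum A - ln (real p)) ^ q))"
    by (subst sum.swap) (simp add: sum_distrib_left)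
  also have "\<dots> \<le> (\<Sum>A\<in>Pow P. prod a A * (\<alpha> * ?m (X - lnsum A) ^ (q + 1) / real (q + 1) + \<beta> * ?m (X - lnsum A) ^ q))"
  proof (intro sum_mono mult_left_mono fin)
    fix A assume A: "A \<in> Pow P"
    show "(\<Sum>p\<in>P. a p * ln (real p) * ?m (X - lnsum A - ln (real p)) ^ q) \<le>
       \<alpha> * ?m (X - lnsum A) ^ (q + 1) / real (q + 1) + \<beta> * ?m (X - lnsum A) ^ q"
    proof (cases "lnsum A \<le> X")
      case True
      then have "(\<Sum>p\<in>P. a p * ln (real p) * ?m ((X - lnsum A) - ln (real p)) ^ q) \<le>
         \<alpha> * (X - lnsum A) ^ (q + 1) / real (q + 1) + \<beta> * (X - lnsum A) ^ q"
        using P a q bd ln_prime_pos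
        by (intro sum_power_max_abel) (auto intro!: mult_nonneg_nonneg simp: less_imp_le)
      then show ?thesis using True by (simp add: max_def)
    next
      case False
      then have "(\<Sum>p\<in>P. a p * ln (real p) * ?m (X - lnsum A - ln (real p)) ^ q) = 0"
      proof (intro sum.neutral ballI)
        fix p assume "p \<in> P"
        then have "X - lnsum A - ln (real p) \<le> 0" using False P(2) ln_prime_pos[of p] by force
        then show "a p * ln (real p) * ?m (X - lnsum A - ln (real p)) ^ q = 0"
          using q by (simp add: max_def power_0_left)
      qed
      then show ?thesis using False q by (simp add: max_def power_0_left)
    qed
  qed
  also have "\<dots> = \<alpha> / real (q + 1) * msum a P (q + 1) X + \<beta> * msum a P q X"
    by (simp add: msum_def sum.distrib sum_distrib_left algebra_simps sum_divide_distrib)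
  finally show ?thesis by (simp add: algebra_simps)
qed

subsection \<open>Lower bounds for sums of dimension one\<close>

lemma msum_insert:
  assumes "finite P" "p \<notin> P"
  shows "msum a (insert p P) q X = msum a P q X + a p * msum a P q (X - ln (real p))"
proof -
  have "msum a (insert p P) q X = (\<Sum>A\<in>Pow P. prod a A * max 0 (X - lnsum A) ^ q +
     prod a (insert p A) * max 0 (X - lnsum (insert p A)) ^ q)"
    unfolding msum_def by (rule sum_Pow_insert[OF assms])
  also have "\<dots> = (\<Sum>A\<in>Pow P. prod a A * max 0 (X - lnsum A) ^ q +
     a p * (prod a A * max 0 (X - ln (real p) - lnsum A) ^ q))"
  proof (rule sum.cong[OF refl])
    fix A assume "A \<in> Pow P"
    then have "p \<notin> A" "finite A" using assms by (auto intro: finite_subset)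
    then show "prod a A * max 0 (X - lnsum A) ^ q +
     prod a (insert p A) * max 0 (X - lnsum (insert p A)) ^ q =
     prod a A * max 0 (X - lnsum A) ^ q + a p * (prod a A * max 0 (X - ln (real p) - lnsum A) ^ q)"
      by (simp add: lnsum_insert algebra_simps)
  qed
  finally show ?thesis by (simp add: msum_def sum.distrib sum_distrib_left)
qed

lemma msum_mono:
  assumes "\<And>p. p \<in> P \<Longrightarrow> 0 \<le> a p" "X \<le> Y"
  shows "msum a P q X \<le> msum a P q Y"
  unfolding msum_def using assms by (intro sum_mono mult_left_mono power_max_le prod_nonneg) auto

text \<open>Group the integers by their set \<open>A\<close> of prime divisors: the reciprocals in
  one group add up to at most the product of \<open>1 / (p - 1)\<close>, and each member has
  logarithm at least \<open>lnsum A\<close>. Peeling off one factor \<open>p\<close> at a time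
  avoids infinite geometric series.\<close>

lemma smooth_sum_le_msum:
  assumes P: "finite P" "\<And>p. p \<in> P \<Longrightarrow> prime p" and q: "q \<ge> 1"
  shows "(\<Sum>n | n \<in> {1..M} \<and> prime_factors n \<subseteq> P. max 0 (x - ln (real n)) ^ q / real n)
     \<le> msum (\<lambda>p. 1 / (real p - 1)) P q x"
  using P
proof (induction P arbitrary: x rule: finite_induct)
  case empty
  have "(\<Sum>n | n \<in> {1..M} \<and> prime_factors n \<subseteq> {}. max 0 (x - ln (real n)) ^ q / real n) \<le>
      (\<Sum>n\<in>{1}. max 0 (x - ln (real n)) ^ q / real n)"
    by (intro sum_mono2) (auto simp: prime_factorization_empty_iff)
  then show ?case by (simp add: msum_def)
next
  case (insert p P)
  have p: "prime p" "real p \<ge> 2" using insert.prems[of p] prime_ge_2_nat[of p] by auto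
  let ?a = "\<lambda>p. 1 / (real p - 1)"
  let ?f = "\<lambda>x n. max 0 (x - ln (real n)) ^ q / real n"
  let ?S = "\<lambda>P. {n. n \<in> {1..M} \<and> prime_factors n \<subseteq> P}"
  have nn: "0 \<le> msum ?a P q x" for x
    using insert.prems prime_ge_1_nat by (intro msum_nonneg) auto
  have nn': "0 \<le> msum ?a (insert p P) q x" for x
    using insert.prems prime_ge_1_nat by (intro msum_nonneg) auto
  have mono: "x \<le> y \<Longrightarrow> msum ?a P q x \<le> msum ?a P q y" for x y
    using insert.prems prime_ge_1_nat by (intro msum_mono) auto
  have IH: "sum (?f x) (?S P) \<le> msum ?a P q x" for x
    using insert by auto
  have rec: "sum (?f x) (?S (insert p P)) \<le> sum (?f x) (?S P) + 1 / real p * sum (?f (x - ln p)) (?S (insert p P))" for x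
  proof -
    have "sum (?f x) (?S (insert p P)) \<le> sum (?f x) (?S P \<union> (\<lambda>n. p * n) ` ?S (insert p P))"
    proof (rule sum_mono2)
      show "?S (insert p P) \<subseteq> ?S P \<union> (\<lambda>n. p * n) ` ?S (insert p P)"
      proof
        fix n assume n: "n \<in> ?S (insert p P)"
        show "n \<in> ?S P \<union> (\<lambda>n. p * n) ` ?S (insert p P)"
        proof (cases "p dvd n")
          case True
          then obtain m where m: "n = p * m" by auto
          have "n \<noteq> 0" using n by auto
          then have "prime_factors m \<subseteq> prime_factors n" "m \<le> n" "m \<noteq> 0"
            using m dvd_prime_factors[of n m] dvd_imp_le[of m n] by auto
          then have "m \<in> ?S (insert p P)" using n by auto
          then show ?thesis using m by auto
        next
          case False
          then have "p \<notin> prime_factors n" by auto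
          then show ?thesis using n by auto
        qed
      qed
    qed auto
    also have "\<dots> \<le> sum (?f x) (?S P) + sum (?f x) ((\<lambda>n. p * n) ` ?S (insert p P))"
      by (subst sum_Un) (auto intro!: sum_nonneg)
    also have "sum (?f x) ((\<lambda>n. p * n) ` ?S (insert p P)) = (\<Sum>n\<in>?S (insert p P). ?f x (p * n))"
      using p by (subst sum.reindex) (auto simp: inj_on_def)
    also have "\<dots> = 1 / real p * sum (?f (x - ln p)) (?S (insert p P))"
      unfolding sum_distrib_left using p
      by (intro sum.cong refl) (auto simp: ln_mult algebra_simps)
    finally show ?thesis by simp
  qed
  \<comment> \<open>Dividing out \<open>p\<close> lowers \<open>x\<close> by at least
    \<open>ln 2\<close>, and the sum vanishes for \<open>x \<le> 0\<close>; \<open>j\<close> bounds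
    the number of such descents.\<close>
  have main: "sum (?f x) (?S (insert p P)) \<le> msum ?a (insert p P) q x" if "x \<le> real j * ln 2" for j x
    using that
  proof (induction j arbitrary: x)
    case 0
    have "sum (?f x) (?S (insert p P)) = 0"
    proof (rule sum.neutral, safe)
      fix n assume "n \<in> {1..M}"
      then have "ln (real n) \<ge> 0" by simp
      then have "max 0 (x - ln (real n)) = 0" using 0 by simp
      then show "?f x n = 0" using q by simp
    qed
    then show ?case using nn' by simp
  next
    case (Suc j)
    let ?y = "x - ln (real p)"
    have "ln (real p) \<ge> ln 2" using p by simp
    then have y: "?y \<le> real j * ln 2" using Suc.prems by (simp add: algebra_simps)
    have "sum (?f x) (?S (insert p P)) \<le> msum ?a P q x + 1 / real p * msum ?a (insert p P) q ?y"
      using rec[of x] IH[of x] mult_left_mono[OF Suc.IH[OF y], of "1 / real p"] by simp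
    also have "msum ?a (insert p P) q ?y = msum ?a P q ?y + ?a p * msum ?a P q (?y - ln p)"
      by (rule msum_insert) fact+
    also have "\<dots> \<le> msum ?a P q ?y + ?a p * msum ?a P q ?y"
      using p by (intro add_left_mono mult_left_mono mono) auto
    \<comment> \<open>The factor \<open>1 + 1 / (p - 1)\<close> is \<open>p / (p - 1)\<close>, and
      the prefactor \<open>1 / p\<close> turns it into \<open>1 / (p - 1)\<close>, the weight of
      \<open>p\<close> in \<open>msum\<close>.\<close>
    also have "\<dots> = real p * ?a p * msum ?a P q ?y" using p by (simp add: field_simps)
    finally have "sum (?f x) (?S (insert p P)) \<le> msum ?a P q x + ?a p * msum ?a P q ?y"
      using p by (simp add: divide_right_mono)
    then show ?case by (subst msum_insert) (use insert.hyps in auto)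
  qed
  obtain j :: nat where "x / ln 2 \<le> real j" using real_arch_simple by blast
  then have "x \<le> real j * ln 2" by (simp add: field_simps)
  then show ?case by (rule main)
qed

text \<open>Comparison with an integral by telescoping: consecutive values of the cutoff differ by
  at most \<open>1 / n\<close>. The first hypothesis makes the cutoff vanish at
  \<open>Suc M\<close>, so nothing is lost at the end.\<close>

lemma sum_ge_power_div:
  assumes "x < ln (real (Suc M))" "x \<ge> 0"
  shows "x ^ (q + 1) / real (q + 1) \<le> (\<Sum>n\<in>{1..M}. max 0 (x - ln (real n)) ^ q / real n)"
proof -
  let ?g = "\<lambda>n::nat. max 0 (x - ln (real n))"
  have step: "(?g n ^ (q + 1) - ?g (Suc n) ^ (q + 1)) / real (q + 1) \<le> ?g n ^ q / real n" if "n \<ge> 1" for n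
  proof -
    have g: "?g (Suc n) \<le> ?g n" using that by (intro max.mono) auto
    have "ln (real (Suc n)) - ln (real n) = ln (1 + 1 / real n)"
      using that ln_div[of "real (Suc n)" "real n"] by (simp add: add_divide_distrib add.commute)
    also have "\<dots> \<le> 1 / real n" by (rule ln_add_one_self_le_self) auto
    finally have "ln (real (Suc n)) - ln (real n) \<le> 1 / real n" .
    moreover have "ln (real n) \<le> ln (real (Suc n))" using that by simp
    moreover have "max 0 a - max 0 b \<le> c" if "a - b \<le> c" "0 \<le> c" for a b c :: real
      using that by (auto simp: max_def)
    ultimately have d: "?g n - ?g (Suc n) \<le> 1 / real n" by simp
    have "?g n ^ (q + 1) - ?g (Suc n) ^ (q + 1) =
      (?g n - ?g (Suc n)) * (\<Sum>p<Suc q. ?g n ^ p * ?g (Suc n) ^ (q - p))"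
      using diff_power_eq_sum[of "?g n" q "?g (Suc n)"] by simp
    also have "\<dots> \<le> (1 / real n) * (\<Sum>p<Suc q. ?g n ^ q)"
    proof (intro mult_mono d sum_mono)
      fix p assume "p \<in> {..<Suc q}"
      then have "?g n ^ q = ?g n ^ p * ?g n ^ (q - p)" by (simp add: power_add[symmetric])
      then show "?g n ^ p * ?g (Suc n) ^ (q - p) \<le> ?g n ^ q"
        using g by (auto intro!: mult_left_mono power_mono)
    qed (auto intro!: sum_nonneg add_nonneg_nonneg mult_nonneg_nonneg)
    also have "\<dots> = real (q + 1) * (?g n ^ q / real n)" by simp
    finally show ?thesis by (simp add: field_simps)
  qed
  have "(\<Sum>n\<in>{1..M}. (?g n ^ (q + 1) - ?g (Suc n) ^ (q + 1)) / real (q + 1)) =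
     (?g 1 ^ (q + 1) - ?g (Suc M) ^ (q + 1)) / real (q + 1)"
  proof (induction M)
    case (Suc M)
    then show ?case by (simp add: field_simps)
  qed simp
  also have "\<dots> = x ^ (q + 1) / real (q + 1)" using assms by (simp add: max_def)
  finally have "x ^ (q + 1) / real (q + 1) =
    (\<Sum>n\<in>{1..M}. (?g n ^ (q + 1) - ?g (Suc n) ^ (q + 1)) / real (q + 1))" ..
  also have "\<dots> \<le> (\<Sum>n\<in>{1..M}. ?g n ^ q / real n)" by (intro sum_mono step) simp
  finally show ?thesis .
qed

lemma finite_ln_primes [simp]: "finite {p::nat. prime p \<and> ln (real p) \<le> X}"
proof (rule finite_subset)
  show "{p::nat. prime p \<and> ln (real p) \<le> X} \<subseteq> {..nat \<lfloor>exp X\<rfloor>}"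
  proof safe
    fix p :: nat assume "prime p" "ln (real p) \<le> X"
    then have "real p \<le> exp X" using prime_gt_0_nat[of p] by (simp add: ln_le_iff_le_exp)
    then show "p \<le> nat \<lfloor>exp X\<rfloor>" by linarith
  qed
qed auto

text \<open>For empty \<open>Z\<close> all integers up to \<open>exp X\<close> are composed of the
  available primes, and the harmonic sum gives the bound. Removing a prime shrinks the sum by a
  factor of at most \<open>1 + 1 / (p - 1)\<close>, the reciprocal of
  \<open>1 - 1 / p\<close>.\<close>

theorem msum_totient_lower:
  assumes "finite Z" "\<And>p. p \<in> Z \<Longrightarrow> prime p" "0 \<le> x" "x \<le> X" "q \<ge> 1"
  shows "(\<Prod>p\<in>Z. 1 - 1 / real p) * (x ^ (q + 1) / real (q + 1)) \<le>
    msum (\<lambda>p. 1 / (real p - 1)) ({p. prime p \<and> ln (real p) \<le> X} - Z) q x"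
  using assms(1,2)
proof (induction Z rule: finite_induct)
  case empty
  let ?P = "{p::nat. prime p \<and> ln (real p) \<le> X}"
  define M where "M = nat \<lfloor>exp X\<rfloor>"
  have M: "exp X < real (Suc M)" "real M \<le> exp X" unfolding M_def by (simp_all, linarith)
  have "x < ln (real (Suc M))" using M(1) assms(4) ln_le_iff_le_exp[of "real (Suc M)" x]
    by (meson exp_le_cancel_iff le_less_trans not_le of_nat_0_less_iff zero_less_Suc)
  then have "x ^ (q + 1) / real (q + 1) \<le> (\<Sum>n\<in>{1..M}. max 0 (x - ln (real n)) ^ q / real n)"
    by (rule sum_ge_power_div) fact
  also have "{1..M} = {n. n \<in> {1..M} \<and> prime_factors n \<subseteq> ?P}"
  proof -
    have "ln (real p) \<le> X" if "n \<in> {1..M}" "p \<in> prime_factors n" for n p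
    proof -
      have "p \<le> n" "p > 0" using that by (auto intro: dvd_imp_le prime_gt_0_nat simp: in_prime_factors_iff)
      then have "real p \<le> exp X" using that M by auto
      then show ?thesis using \<open>p > 0\<close> by (simp add: ln_le_iff_le_exp)
    qed
    then show ?thesis by auto
  qed
  also have "(\<Sum>n\<in>\<dots>. max 0 (x - ln (real n)) ^ q / real n) \<le> msum (\<lambda>p. 1 / (real p - 1)) ?P q x"
    by (rule smooth_sum_le_msum) (use assms in auto)
  finally show ?case by simp
next
  case (insert p Z)
  let ?a = "\<lambda>p::nat. 1 / (real p - 1)"
  let ?P = "{p::nat. prime p \<and> ln (real p) \<le> X} - Z"
  let ?r = "x ^ (q + 1) / real (q + 1)"
  have p: "prime p" "real p \<ge> 2" using insert.prems[of p] prime_ge_2_nat[of p] by auto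
  have IH: "(\<Prod>p\<in>Z. 1 - 1 / real p) * ?r \<le> msum ?a ?P q x" using insert by auto
  have nn: "0 \<le> (\<Prod>p\<in>Z. 1 - 1 / real p) * ?r"
    using insert.prems assms(3)
    by (intro mult_nonneg_nonneg prod_nonneg) (auto simp: divide_le_eq_1 prime_ge_1_nat)
  show ?case
  proof (cases "p \<in> ?P")
    case False
    then have "?P - {p} = ?P" by auto
    then have eq: "{p::nat. prime p \<and> ln (real p) \<le> X} - insert p Z = ?P" by auto
    have "(1 - 1 / real p) * ((\<Prod>p\<in>Z. 1 - 1 / real p) * ?r) \<le> 1 * ((\<Prod>p\<in>Z. 1 - 1 / real p) * ?r)"
      using nn by (intro mult_right_mono) auto
    then show ?thesis using IH insert.hyps unfolding eq by (simp add: mult.assoc)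
  next
    case True
    define Q where "Q = {p::nat. prime p \<and> ln (real p) \<le> X} - insert p Z"
    have Q: "?P = insert p Q" "p \<notin> Q" "finite Q" using True by (auto simp: Q_def)
    have "msum ?a ?P q x = msum ?a Q q x + ?a p * msum ?a Q q (x - ln (real p))"
      unfolding Q(1) by (rule msum_insert) (use Q in auto)
    also have "\<dots> \<le> msum ?a Q q x + ?a p * msum ?a Q q x"
      using p prime_ge_1_nat ln_prime_pos[of p]
      by (intro add_left_mono mult_left_mono msum_mono) (auto simp: Q_def)
    also have "\<dots> = msum ?a Q q x / (1 - 1 / real p)" using p by (simp add: field_simps)
    finally have "(\<Prod>p\<in>Z. 1 - 1 / real p) * ?r \<le> msum ?a Q q x / (1 - 1 / real p)"
      using IH by linarith
    moreover have "1 - 1 / real p > 0" using p by (simp add: field_simps)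
    ultimately have "(\<Prod>p\<in>Z. 1 - 1 / real p) * ?r * (1 - 1 / real p) \<le> msum ?a Q q x"
      by (simp only: pos_le_divide_eq)
    then show ?thesis using insert.hyps by (simp add: Q_def[symmetric] mult_ac)
  qed
qed

section \<open>Mertens' upper bound from a Chebyshev bound\<close>

lemma mertens_upper:
  assumes \<theta>: "\<And>n::nat. (\<Sum>p | prime p \<and> p \<le> n. ln (real p)) \<le> C * real n" and n: "n \<ge> 1"
  shows "(\<Sum>p | prime p \<and> p \<le> n. ln (real p) / real p) \<le> ln (real n) + C"
proof -
  let ?P = "{p. prime p \<and> p \<le> n}"
  have fin: "finite ?P" by simp
  have "(\<Sum>p\<in>?P. ln (real p) * (real n / real p - 1)) \<le> (\<Sum>p\<in>?P. ln (real p) * real (n div p))"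
  proof (rule sum_mono)
    fix p assume "p \<in> ?P"
    then have "prime p" by simp
    then have "p > 0" by (rule prime_gt_0_nat)
    have "real n / real p - 1 \<le> real (n div p)"
    proof -
      have "real n = real p * real (n div p) + real (n mod p)"
        by (metis mult_div_mod_eq of_nat_add of_nat_mult)
      moreover have "real (n mod p) \<le> real p" using \<open>p > 0\<close> by (simp add: less_imp_le)
      ultimately show ?thesis using \<open>p > 0\<close> by (simp add: field_simps)
    qed
    then show "ln (real p) * (real n / real p - 1) \<le> ln (real p) * real (n div p)"
      using ln_prime_pos[OF \<open>prime p\<close>] by simp
  qed
  also have "\<dots> = (\<Sum>p\<in>?P. \<Sum>m\<in>{1..n}. if p dvd m then ln (real p) else 0)"
  proof (rule sum.cong[OF refl])
    fix p assume p: "p \<in> ?P"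
    then have "p > 0" using prime_gt_0_nat by auto
    have "{m \<in> {1..n}. p dvd m} = (\<lambda>i. p * i) ` {1..n div p}"
    proof (intro equalityI subsetI)
      fix m assume "m \<in> {m \<in> {1..n}. p dvd m}"
      then obtain i where i: "m = p * i" "1 \<le> p * i" "p * i \<le> n" by auto
      then have "i \<in> {1..n div p}" using \<open>p > 0\<close> by (auto simp: less_eq_div_iff_mult_less_eq mult.commute Suc_le_eq)
      then show "m \<in> (\<lambda>i. p * i) ` {1..n div p}" using i by auto
    qed (use \<open>p > 0\<close> in \<open>auto simp: less_eq_div_iff_mult_less_eq mult.commute Suc_le_eq\<close>)
    moreover have "inj_on (\<lambda>i. p * i) {1..n div p}" using \<open>p > 0\<close> by (auto simp: inj_on_def)
    ultimately have "card {m \<in> {1..n}. p dvd m} = n div p" by (simp add: card_image)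
    then show "ln (real p) * real (n div p) = (\<Sum>m\<in>{1..n}. if p dvd m then ln (real p) else 0)"
      by (subst sum.inter_filter[symmetric]) simp_all
  qed
  also have "\<dots> = (\<Sum>m\<in>{1..n}. \<Sum>p\<in>?P. if p dvd m then ln (real p) else 0)"
    by (rule sum.swap)
  \<comment> \<open>After exchanging the sums the distinct primes dividing one \<open>m\<close> have
    product at most \<open>m\<close>, so no estimate for a factorial is required.\<close>
  also have "\<dots> \<le> (\<Sum>m\<in>{1..n}. ln (real n))"
  proof (rule sum_mono)
    fix m assume m: "m \<in> {1..n}"
    have "p \<le> n" if "p dvd m" for p using dvd_imp_le[OF that] m by simp
    then have *: "{p \<in> ?P. p dvd m} = prime_factors m"
      using m by (auto simp: in_prime_factors_iff)
    have "(\<Sum>p\<in>?P. if p dvd m then ln (real p) else 0) = lnsum (prime_factors m)"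
      unfolding lnsum_def *[symmetric] by (rule sum.inter_filter[symmetric]) simp
    also have "\<dots> = ln (real (\<Prod>(prime_factors m)))" by (rule lnsum_eq_ln_prod) auto
    also have "\<dots> \<le> ln (real n)"
    proof -
      have "\<Prod>(prime_factors m) dvd (\<Prod>p\<in>prime_factors m. p ^ multiplicity p m)"
        using m by (intro prod_dvd_prod) (auto simp: in_prime_factors_iff prime_multiplicity_gt_zero_iff
           dvd_power)
      also have "\<dots> = m" using m by (simp add: prime_factorization_nat[symmetric])
      finally have "\<Prod>(prime_factors m) \<le> m" using m by (intro dvd_imp_le) auto
      moreover have "\<Prod>(prime_factors m) > 0" by (intro prod_pos) (auto simp: in_prime_factors_iff prime_gt_0_nat)
      ultimately have "0 < real (\<Prod>(prime_factors m))" "real (\<Prod>(prime_factors m)) \<le> real n"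
        using m unfolding of_nat_0_less_iff of_nat_le_iff atLeastAtMost_iff by linarith+
      then show ?thesis by (intro ln_mono)
    qed
    finally show "(\<Sum>p\<in>?P. if p dvd m then ln (real p) else 0) \<le> ln (real n)" .
  qed
  also have "\<dots> = real n * ln (real n)" by simp
  finally have "real n * (\<Sum>p\<in>?P. ln (real p) / real p) - (\<Sum>p\<in>?P. ln (real p)) \<le> real n * ln (real n)"
    by (simp add: sum_distrib_left sum_subtractf[symmetric] algebra_simps)
  with \<theta>[of n] have "real n * (\<Sum>p\<in>?P. ln (real p) / real p) \<le> real n * (ln (real n) + C)"
    by (simp add: algebra_simps)
  then show ?thesis using n by simp
qed

lemma summable_ln_div_square: "summable (\<lambda>n::nat. ln (real n) / (real n)\<^sup>2)"
proof (rule summable_comparison_test_bigo)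
  show "summable (\<lambda>n::nat. norm (real n powr (-3/2)))"
    by (simp add: summable_real_powr_iff)
  show "(\<lambda>n::nat. ln (real n) / (real n)\<^sup>2) \<in> O(\<lambda>n. real n powr (-3/2))"
    by real_asymp
qed

lemma inverse_shift_le:
  assumes "real k \<ge> 0" "real p > 2 * real k" "p > 0"
  shows "1 / (real p - real k) \<le> 1 / real p + 2 * real k / (real p)\<^sup>2"
proof -
  have "1 / (real p - real k) = 1 / real p + real k / (real p * (real p - real k))"
    using assms by (simp add: divide_simps)
  also have "real k / (real p * (real p - real k)) \<le> real k / (real p * (real p / 2))"
    using assms by (intro divide_left_mono mult_left_mono mult_pos_pos) auto
  finally show ?thesis by (simp add: power2_eq_square mult.commute)
qed

text \<open>\<open>1 / (p - k)\<close> exceeds \<open>1 / p\<close> by at most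
  \<open>2 * k / p ^ 2\<close>, and the sum of \<open>ln n / n ^ 2\<close> converges. Hence
  \<open>D\<close> is independent of \<open>P\<close> and \<open>t\<close>, which matters because
  the set of sieving primes varies with the shifts.\<close>

lemma mertens_shift:
  assumes \<theta>: "\<And>n::nat. (\<Sum>p | prime p \<and> p \<le> n. ln (real p)) \<le> C * real n"
  obtains D where "D \<ge> 0"
    "\<And>P t. finite P \<Longrightarrow> (\<And>p. p \<in> P \<Longrightarrow> prime p \<and> p > 2 * k) \<Longrightarrow> 0 \<le> t \<Longrightarrow>
       (\<Sum>p | p \<in> P \<and> ln (real p) \<le> t. ln (real p) / (real p - real k)) \<le> t + D"
proof -
  define S where "S = (\<Sum>n::nat. ln (real n) / (real n)\<^sup>2)"
  have S: "(\<Sum>p\<in>P. ln (real p) / (real p)\<^sup>2) \<le> S" if "finite P" for P :: "nat set"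
    unfolding S_def
  proof (rule sum_le_suminf[OF summable_ln_div_square that])
    fix n :: nat
    have "ln (real n) \<ge> 0" by (cases "n = 0") auto
    then show "0 \<le> ln (real n) / (real n)\<^sup>2" by simp
  qed
  have "S \<ge> 0" using S[of "{}"] by simp
  show thesis
  proof (rule that[of "\<bar>C\<bar> + 2 * real k * S"])
    show "0 \<le> \<bar>C\<bar> + 2 * real k * S" using \<open>S \<ge> 0\<close> by simp
    fix P :: "nat set" and t :: real
    assume P: "finite P" "\<And>p. p \<in> P \<Longrightarrow> prime p \<and> p > 2 * k" and t: "0 \<le> t"
    define Q where "Q = {p. p \<in> P \<and> ln (real p) \<le> t}"
    define n where "n = nat \<lfloor>exp t\<rfloor>"
    have "exp t \<ge> 1" using t by simp
    then have "\<lfloor>exp t\<rfloor> \<ge> 1" by linarith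
    then have n: "n \<ge> 1" "real n \<le> exp t" unfolding n_def by linarith+
    have Q: "finite Q" "Q \<subseteq> {p. prime p \<and> p \<le> n}"
    proof -
      show "finite Q" using P by (simp add: Q_def)
      show "Q \<subseteq> {p. prime p \<and> p \<le> n}"
      proof
        fix p assume p: "p \<in> Q"
        then have "prime p" using P by (auto simp: Q_def)
        moreover from this have "real p \<le> exp t"
          using p prime_gt_0_nat[of p] by (simp add: Q_def ln_le_iff_le_exp)
        then have "p \<le> n" unfolding n_def by linarith
        ultimately show "p \<in> {p. prime p \<and> p \<le> n}" by simp
      qed
    qed
    have lnp: "0 \<le> ln (real p)" for p by (cases "p = 0") auto
    have "(\<Sum>p\<in>Q. ln (real p) / (real p - real k)) \<le> (\<Sum>p\<in>Q. ln (real p) / real p + 2 * real k * (ln (real p) / (real p)\<^sup>2))"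
    proof (rule sum_mono)
      fix p assume "p \<in> Q"
      then have "p > 2 * k" "p > 0" using P prime_gt_0_nat by (auto simp: Q_def)
      then have "1 / (real p - real k) \<le> 1 / real p + 2 * real k / (real p)\<^sup>2"
        by (intro inverse_shift_le) auto
      from mult_left_mono[OF this lnp[of p]]
      show "ln (real p) / (real p - real k) \<le> ln (real p) / real p + 2 * real k * (ln (real p) / (real p)\<^sup>2)"
        by (simp add: algebra_simps)
    qed
    also have "\<dots> = (\<Sum>p\<in>Q. ln (real p) / real p) + 2 * real k * (\<Sum>p\<in>Q. ln (real p) / (real p)\<^sup>2)"
      by (simp add: sum.distrib sum_distrib_left)
    also have "\<dots> \<le> (\<Sum>p | prime p \<and> p \<le> n. ln (real p) / real p) + 2 * real k * S"
      using Q lnp by (intro add_mono sum_mono2 mult_left_mono S) auto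
    also have "\<dots> \<le> ln (real n) + C + 2 * real k * S"
      using mertens_upper[OF \<theta> n(1)] by simp
    also have "ln (real n) \<le> t" using n by (subst ln_le_iff_le_exp) auto
    finally show "(\<Sum>p | p \<in> P \<and> ln (real p) \<le> t. ln (real p) / (real p - real k)) \<le> t + (\<bar>C\<bar> + 2 * real k * S)"
      unfolding Q_def by linarith
  qed
qed

subsection \<open>Upper bounds for sums of dimension one\<close>

lemma card_coprime_block:
  assumes "W \<ge> 1"
  shows "card {m \<in> {j * W<..(j + 1) * W}. coprime m W} = totient W"
proof -
  have "{m \<in> {j * W<..(j + 1) * W}. coprime m W} = (\<lambda>m. m + j * W) ` totatives W"
  proof (intro equalityI subsetI)
    fix m assume m: "m \<in> {m \<in> {j * W<..(j + 1) * W}. coprime m W}"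
    then have eq: "m = (m - j * W) + j * W" by auto
    then have "coprime (m - j * W) W" using m
      by (metis (no_types, lifting) coprime_iff_gcd_eq_1 gcd_add_mult mem_Collect_eq add.commute gcd.commute mult.commute)
    then have "m - j * W \<in> totatives W" using m by (auto simp: totatives_def)
    then show "m \<in> (\<lambda>m. m + j * W) ` totatives W" using eq by blast
  next
    fix m assume "m \<in> (\<lambda>m. m + j * W) ` totatives W"
    then obtain i where i: "m = i + j * W" "i \<in> totatives W" by auto
    then have "coprime m W"
      by (metis (no_types, lifting) coprime_iff_gcd_eq_1 gcd_add_mult in_totatives_iff add.commute gcd.commute mult.commute)
    then show "m \<in> {m \<in> {j * W<..(j + 1) * W}. coprime m W}"
      using i by (auto simp: totatives_def)
  qed
  then show ?thesis by (simp add: card_image totient_def)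
qed

lemma sum_inverse_le: "(\<Sum>m\<in>{1..n}. 1 / real m) \<le> 1 + ln (real n)" if "n \<ge> 1"
  using that
proof (induction n rule: nat_induct_at_least)
  case (Suc n)
  have "1 / real (Suc n) \<le> ln (real (Suc n)) - ln (real n)"
  proof -
    have "ln (real n / real (Suc n)) \<le> real n / real (Suc n) - 1"
      using Suc by (intro ln_le_minus_one) auto
    then show ?thesis using Suc by (simp add: ln_div field_simps)
  qed
  then show ?case using Suc by simp
qed simp

text \<open>Cut the range into blocks of length \<open>W\<close>, each with \<open>totient W\<close>
  integers coprime to \<open>W\<close>. The first block is bounded trivially and costs
  \<open>1 + ln W\<close>; the block above \<open>j * W\<close> contributes at most
  \<open>totient W / W\<close> times \<open>1 / j\<close>.\<close>

lemma sum_coprime_inverse_le: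
  assumes W: "W \<ge> 1" and M: "M \<ge> 1"
  shows "(\<Sum>m | m \<in> {1..M} \<and> coprime m W. 1 / real m) \<le>
    1 + ln (real W) + real (totient W) / real W * (1 + ln (real M))"
proof -
  let ?f = "\<lambda>M. \<Sum>m | m \<in> {1..M} \<and> coprime m W. 1 / real m"
  have step: "?f ((J + 1) * W) \<le> 1 + ln (real W) + real (totient W) / real W * (\<Sum>j\<in>{1..J}. 1 / real j)" for J
  proof (induction J)
    case 0
    have "?f W \<le> (\<Sum>m\<in>{1..W}. 1 / real m)" by (intro sum_mono2) auto
    also have "\<dots> \<le> 1 + ln (real W)" by (rule sum_inverse_le[OF W])
    finally show ?case by simp
  next
    case (Suc J)
    let ?B = "{m \<in> {Suc J * W<..(Suc J + 1) * W}. coprime m W}"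
    have eq: "?f ((Suc J + 1) * W) = ?f ((J + 1) * W) + (\<Sum>m\<in>?B. 1 / real m)"
      by (subst sum.union_disjoint[symmetric]) (auto intro!: sum.cong)
    have "(\<Sum>m\<in>?B. 1 / real m) \<le> (\<Sum>m\<in>?B. 1 / (real (Suc J) * real W))"
    proof (rule sum_mono)
      fix m assume "m \<in> ?B"
      then have "real (Suc J) * real W \<le> real m" unfolding of_nat_mult[symmetric] of_nat_le_iff by auto
      then show "1 / real m \<le> 1 / (real (Suc J) * real W)" using W
        by (intro frac_le) auto
    qed
    also have "\<dots> = real (totient W) / real W * (1 / real (Suc J))"
      unfolding sum_constant card_coprime_block[OF W] by simp
    finally have "?f ((Suc J + 1) * W) \<le> 1 + ln (real W) +
        real (totient W) / real W * (\<Sum>j\<in>{1..J}. 1 / real j) + real (totient W) / real W * (1 / real (Suc J))"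
      using Suc.IH eq by linarith
    then show ?case by (simp add: algebra_simps)
  qed
  define J where "J = M div W"
  have "M \<le> (J + 1) * W"
    using W by (simp add: J_def) (metis add.commute dividend_less_times_div less_imp_le mult.commute Suc_le_eq mult_Suc_right One_nat_def)
  then have "?f M \<le> ?f ((J + 1) * W)" by (intro sum_mono2) auto
  moreover have "?f ((J + 1) * W) \<le> 1 + ln (real W) + real (totient W) / real W * (\<Sum>j\<in>{1..J}. 1 / real j)"
    by (rule step)
  moreover have "(\<Sum>j\<in>{1..J}. 1 / real j) \<le> (\<Sum>j\<in>{1..M}. 1 / real j)"
    by (intro sum_mono2) (auto simp: J_def intro: order.trans[OF _ div_le_dividend])
  then have "(\<Sum>j\<in>{1..J}. 1 / real j) \<le> 1 + ln (real M)" using sum_inverse_le[OF M] by linarith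
  then have "real (totient W) / real W * (\<Sum>j\<in>{1..J}. 1 / real j) \<le> real (totient W) / real W * (1 + ln (real M))"
    by (rule mult_left_mono) simp
  ultimately show ?thesis by linarith
qed

lemma prime_dvd_prod_primes_iff:
  assumes "finite A" "\<And>q. q \<in> A \<Longrightarrow> prime q" "prime (p::nat)"
  shows "p dvd \<Prod>A \<longleftrightarrow> p \<in> A"
proof -
  have "p dvd q \<longleftrightarrow> p = q" if "q \<in> A" for q
    using assms(2)[OF that] assms(3) primes_dvd_imp_eq by auto
  then show ?thesis using assms(1,3) by (auto simp: prime_dvd_prod_iff)
qed

lemma inj_on_prod_primes:
  assumes "\<And>A. A \<in> F \<Longrightarrow> finite A \<and> (\<forall>p\<in>A. prime (p::nat))"
  shows "inj_on (\<lambda>A. \<Prod>A) F"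
proof (rule inj_onI)
  fix A B assume AB: "A \<in> F" "B \<in> F" "\<Prod>A = \<Prod>B"
  have "p \<in> A \<longleftrightarrow> p \<in> B" if "prime p" for p
    using prime_dvd_prod_primes_iff[of A p] prime_dvd_prod_primes_iff[of B p] assms AB that by auto
  then show "A = B" using assms AB(1,2) by blast
qed

lemma totient_prod_primes:
  assumes "finite Z" "\<And>p. p \<in> Z \<Longrightarrow> prime p"
  shows "real (totient (\<Prod>Z)) / real (\<Prod>Z) = (\<Prod>p\<in>Z. 1 - 1 / real p)"
proof -
  have "\<Prod>Z > 0" using assms by (intro prod_pos) (auto simp: prime_gt_0_nat)
  moreover have "prime_factors (\<Prod>Z) = Z"
    using \<open>\<Prod>Z > 0\<close> assms prime_dvd_prod_primes_iff[OF assms] by (auto simp: in_prime_factors_iff)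
  ultimately show ?thesis using totient_formula2[of "\<Prod>Z"]
    by (metis nonzero_mult_div_cancel_left of_nat_0_less_iff order_less_irrefl)
qed

text \<open>By unique factorisation distinct sets of primes have distinct products, and these are
  integers up to \<open>exp t\<close> coprime to the product of \<open>Z\<close>.\<close>

lemma sum_prod_inverse_le:
  assumes P: "finite P" "\<And>p. p \<in> P \<Longrightarrow> prime p" and Z: "finite Z" "\<And>p. p \<in> Z \<Longrightarrow> prime p"
    and PZ: "P \<inter> Z = {}" and t: "t \<ge> 0"
  shows "(\<Sum>A | A \<in> Pow P \<and> lnsum A \<le> t. \<Prod>p\<in>A. 1 / real p) \<le>
    1 + ln (real (\<Prod>Z)) + (\<Prod>p\<in>Z. 1 - 1 / real p) * (1 + t)"
proof -
  define M where "M = nat \<lfloor>exp t\<rfloor>"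
  have "exp t \<ge> 1" using t by simp
  then have "\<lfloor>exp t\<rfloor> \<ge> 1" by linarith
  then have M: "M \<ge> 1" "real M \<le> exp t" unfolding M_def by linarith+
  let ?F = "{A. A \<in> Pow P \<and> lnsum A \<le> t}"
  have F: "finite A \<and> (\<forall>p\<in>A. prime p)" if "A \<in> ?F" for A
    using that P by (auto intro: finite_subset)
  have "\<Prod>Z > 0" using Z by (intro prod_pos) (auto simp: prime_gt_0_nat)
  then have W: "\<Prod>Z \<ge> 1" by simp
  have "(\<Sum>A\<in>?F. \<Prod>p\<in>A. 1 / real p) = (\<Sum>A\<in>?F. 1 / real (\<Prod>A))"
    by (simp add: prod_dividef)
  also have "\<dots> = (\<Sum>m\<in>(\<lambda>A. \<Prod>A) ` ?F. 1 / real m)"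
    by (subst sum.reindex[OF inj_on_prod_primes[of ?F, OF F]]) (auto simp: o_def)
  also have "\<dots> \<le> (\<Sum>m | m \<in> {1..M} \<and> coprime m (\<Prod>Z). 1 / real m)"
  proof (rule sum_mono2)
    show "(\<lambda>A. \<Prod>A) ` ?F \<subseteq> {m. m \<in> {1..M} \<and> coprime m (\<Prod>Z)}"
    proof safe
      fix A assume A: "A \<subseteq> P" "lnsum A \<le> t"
      then have A': "finite A" "\<And>p. p \<in> A \<Longrightarrow> prime p" using P by (auto intro: finite_subset)
      have pos: "\<Prod>A > 0" using A' by (intro prod_pos) (auto simp: prime_gt_0_nat)
      have "ln (real (\<Prod>A)) \<le> t" using A lnsum_eq_ln_prod[of A] A' by simp
      then have "real (\<Prod>A) \<le> exp t" using pos by (simp only: ln_le_iff_le_exp of_nat_0_less_iff)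
      then have "\<Prod>A \<le> M" unfolding M_def by linarith
      then show "\<Prod>A \<in> {1..M}" using pos by simp
      show "coprime (\<Prod>A) (\<Prod>Z)"
        using A A' Z PZ by (intro prod_coprime_left prod_coprime_right primes_coprime) auto
    qed
  qed auto
  also have "\<dots> \<le> 1 + ln (real (\<Prod>Z)) + real (totient (\<Prod>Z)) / real (\<Prod>Z) * (1 + ln (real M))"
    by (rule sum_coprime_inverse_le[OF W M(1)])
  also have "real (totient (\<Prod>Z)) / real (\<Prod>Z) = (\<Prod>p\<in>Z. 1 - 1 / real p)"
    by (rule totient_prod_primes[OF Z])
  also have "(\<Prod>p\<in>Z. 1 - 1 / real p) * (1 + ln (real M)) \<le> (\<Prod>p\<in>Z. 1 - 1 / real p) * (1 + t)"
  proof (rule mult_left_mono)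
    show "1 + ln (real M) \<le> 1 + t" using M by (simp add: ln_le_iff_le_exp)
    show "0 \<le> (\<Prod>p\<in>Z. 1 - 1 / real p)" using Z by (intro prod_nonneg) (auto simp: divide_le_eq_1 prime_ge_1_nat)
  qed
  finally show ?thesis by simp
qed

text \<open>The counterpart of \<open>msum\<close> with a sharp cutoff. It is not the case
  \<open>q = 0\<close> of \<open>msum\<close>, whose zeroth power equals 1 beyond the cutoff as
  well.\<close>

definition osum :: "(nat \<Rightarrow> real) \<Rightarrow> nat set \<Rightarrow> real \<Rightarrow> real" where
  "osum a P t = (\<Sum>A\<in>Pow P. (\<Prod>p\<in>A. a p) * of_bool (lnsum A \<le> t))"

lemma osum_alt:
  assumes "finite P"
  shows "osum a P t = (\<Sum>A | A \<in> Pow P \<and> lnsum A \<le> t. \<Prod>p\<in>A. a p)"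
proof -
  have "osum a P t = (\<Sum>A\<in>Pow P. if lnsum A \<le> t then prod a A else 0)"
    unfolding osum_def by (intro sum.cong) auto
  also have "\<dots> = (\<Sum>A | A \<in> Pow P \<and> lnsum A \<le> t. prod a A)"
    by (rule sum.inter_filter[symmetric]) (simp add: assms)
  finally show ?thesis .
qed

lemma osum_insert:
  assumes "finite P" "p \<notin> P"
  shows "osum a (insert p P) t = osum a P t + a p * osum a P (t - ln (real p))"
proof -
  have "osum a (insert p P) t = (\<Sum>A\<in>Pow P. prod a A * of_bool (lnsum A \<le> t) +
     prod a (insert p A) * of_bool (lnsum (insert p A) \<le> t))"
    unfolding osum_def by (rule sum_Pow_insert[OF assms])
  also have "\<dots> = (\<Sum>A\<in>Pow P. prod a A * of_bool (lnsum A \<le> t) +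
     a p * (prod a A * of_bool (lnsum A \<le> t - ln (real p))))"
  proof (rule sum.cong[OF refl])
    fix A assume "A \<in> Pow P"
    then have "p \<notin> A" "finite A" using assms by (auto intro: finite_subset)
    then show "prod a A * of_bool (lnsum A \<le> t) + prod a (insert p A) * of_bool (lnsum (insert p A) \<le> t) =
      prod a A * of_bool (lnsum A \<le> t) + a p * (prod a A * of_bool (lnsum A \<le> t - ln (real p)))"
      by (simp add: lnsum_insert algebra_simps)
  qed
  finally show ?thesis by (simp add: osum_def sum.distrib sum_distrib_left)
qed

lemma osum_nonneg: "(\<And>p. p \<in> P \<Longrightarrow> 0 \<le> a p) \<Longrightarrow> 0 \<le> osum a P t"
  unfolding osum_def by (intro sum_nonneg mult_nonneg_nonneg prod_nonneg) auto

lemma osum_mono: "(\<And>p. p \<in> P \<Longrightarrow> 0 \<le> a p) \<Longrightarrow> t \<le> t' \<Longrightarrow> osum a P t \<le> osum a P t'"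
  unfolding osum_def by (intro sum_mono mult_left_mono prod_nonneg) auto

text \<open>Each prime costs a factor \<open>1 + 2 * k / p ^ 2\<close>: the surplus of
  \<open>1 / (p - k)\<close> over \<open>1 / p\<close> multiplies a sum with the smaller argument
  \<open>t - ln p\<close>, which monotonicity bounds by the sum at \<open>t\<close>.\<close>

lemma osum_shift_le:
  assumes "finite P" "\<And>p. p \<in> P \<Longrightarrow> prime p \<and> p > 2 * k"
  shows "osum (\<lambda>p. 1 / (real p - real k)) P t \<le>
    (\<Prod>p\<in>P. 1 + 2 * real k / (real p)\<^sup>2) * osum (\<lambda>p. 1 / real p) P t"
  using assms
proof (induction P arbitrary: t rule: finite_induct)
  case empty
  then show ?case by (simp add: osum_def)
next
  case (insert p P)
  let ?a = "\<lambda>p::nat. 1 / (real p - real k)" and ?b = "\<lambda>p::nat. 1 / real p"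
  let ?\<kappa> = "\<lambda>p::nat. 2 * real k / (real p)\<^sup>2"
  let ?K = "\<Prod>p\<in>P. 1 + ?\<kappa> p"
  let ?t = "t - ln (real p)"
  have p: "prime p" "p > 2 * k" "p > 0" using insert.prems[of p] prime_gt_0_nat by auto
  have K: "?K \<ge> 0" by (intro prod_nonneg) auto
  have IH: "osum ?a P t \<le> ?K * osum ?b P t" for t using insert by auto
  have mono: "osum ?b P ?t \<le> osum ?b P t" using ln_prime_pos[OF p(1)] by (intro osum_mono) auto
  have nn: "0 \<le> osum ?b P ?t" by (intro osum_nonneg) auto
  have nn': "0 \<le> osum ?a P ?t" using insert.prems by (intro osum_nonneg) force
  have "osum ?a (insert p P) t = osum ?a P t + ?a p * osum ?a P ?t"
    by (rule osum_insert) fact+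
  also have "\<dots> \<le> ?K * osum ?b P t + (?b p + ?\<kappa> p) * (?K * osum ?b P ?t)"
    using p K nn IH by (intro add_mono mult_mono inverse_shift_le) (auto intro: mult_nonneg_nonneg add_nonneg_nonneg nn')
  also have "\<dots> \<le> ?K * ((1 + ?\<kappa> p) * (osum ?b P t + ?b p * osum ?b P ?t))"
  proof -
    have "osum ?b P t + (?b p + ?\<kappa> p) * osum ?b P ?t \<le> (1 + ?\<kappa> p) * (osum ?b P t + ?b p * osum ?b P ?t)"
    proof -
      have "?\<kappa> p * osum ?b P ?t \<le> ?\<kappa> p * osum ?b P t" using mono by (intro mult_left_mono) auto
      moreover have "0 \<le> ?\<kappa> p * (?b p * osum ?b P ?t)" using nn by simp
      ultimately show ?thesis by (simp only: distrib_left distrib_right mult_1)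
    qed
    from mult_left_mono[OF this K] show ?thesis by (simp add: algebra_simps)
  qed
  also have "\<dots> = (\<Prod>p\<in>insert p P. 1 + ?\<kappa> p) * osum ?b (insert p P) t"
    using insert.hyps by (simp add: osum_insert)
  finally show ?case .
qed

lemma sum_inverse_squares_le:
  assumes "D \<ge> 1" "finite P" "\<And>p. p \<in> P \<Longrightarrow> p > D"
  shows "(\<Sum>p\<in>P. 1 / (real p)\<^sup>2) \<le> 1 / real D"
proof -
  have *: "(\<Sum>n\<in>{D<..D + j}. 1 / (real n)\<^sup>2) \<le> 1 / real D - 1 / real (D + j)" for j
  proof (induction j)
    case (Suc j)
    let ?x = "real (D + j)"
    have x: "?x > 0" using assms by simp
    have "{D<..D + Suc j} = insert (D + Suc j) {D<..D + j}" by auto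
    then have "(\<Sum>n\<in>{D<..D + Suc j}. 1 / (real n)\<^sup>2) = 1 / (?x + 1)\<^sup>2 + (\<Sum>n\<in>{D<..D + j}. 1 / (real n)\<^sup>2)"
      by (simp add: algebra_simps)
    also have "1 / (?x + 1)\<^sup>2 \<le> 1 / (?x * (?x + 1))"
      using x by (intro divide_left_mono mult_pos_pos) (auto simp: power2_eq_square)
    also have "\<dots> = 1 / ?x - 1 / (?x + 1)" using x by (simp add: field_simps)
    finally show ?case using Suc by (simp add: algebra_simps)
  qed simp
  define j where "j = Max (insert 0 P)"
  have "P \<subseteq> {D<..D + j}"
  proof
    fix p assume "p \<in> P"
    then have "p \<le> j" using assms by (auto simp: j_def)
    then show "p \<in> {D<..D + j}" using assms(3)[OF \<open>p \<in> P\<close>] by simp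
  qed
  then have "(\<Sum>p\<in>P. 1 / (real p)\<^sup>2) \<le> (\<Sum>n\<in>{D<..D + j}. 1 / (real n)\<^sup>2)"
    by (intro sum_mono2) auto
  also have "\<dots> \<le> 1 / real D"
  proof -
    have "0 \<le> 1 / real (D + j)" by simp
    then show ?thesis using *[of j] by linarith
  qed
  finally show ?thesis .
qed

lemma prod_one_plus_le_exp:
  fixes f :: "'a \<Rightarrow> real"
  assumes "\<And>p. p \<in> P \<Longrightarrow> 0 \<le> f p"
  shows "(\<Prod>p\<in>P. 1 + f p) \<le> exp (\<Sum>p\<in>P. f p)"
proof (cases "finite P")
  case True
  have "(\<Prod>p\<in>P. 1 + f p) \<le> (\<Prod>p\<in>P. exp (f p))"
    using assms by (intro prod_mono) (auto simp: exp_ge_add_one_self add_nonneg_nonneg)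
  then show ?thesis using True by (simp add: exp_sum)
qed simp

text \<open>All primes of \<open>P\<close> exceed \<open>D\<close>, so the corrections multiply to
  at most \<open>exp (2 * k / D)\<close>. A large \<open>D\<close> brings this close to 1, as the
  comparison of main terms requires: there a constant factor would be fatal.\<close>

lemma osum_shift_upper:
  assumes P: "finite P" "\<And>p. p \<in> P \<Longrightarrow> prime p \<and> p > D" and D: "D \<ge> 1" "D \<ge> 2 * k"
    and Z: "finite Z" "\<And>p. p \<in> Z \<Longrightarrow> prime p" and PZ: "P \<inter> Z = {}" and t: "t \<ge> 0"
  shows "osum (\<lambda>p. 1 / (real p - real k)) P t \<le>
    exp (2 * real k / real D) * (1 + ln (real (\<Prod>Z)) + (\<Prod>p\<in>Z. 1 - 1 / real p) * (1 + t))"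
proof -
  have "(\<Prod>p\<in>P. 1 + 2 * real k / (real p)\<^sup>2) \<le> exp (\<Sum>p\<in>P. 2 * real k / (real p)\<^sup>2)"
    by (rule prod_one_plus_le_exp) auto
  also have "(\<Sum>p\<in>P. 2 * real k / (real p)\<^sup>2) = 2 * real k * (\<Sum>p\<in>P. 1 / (real p)\<^sup>2)"
    by (simp add: sum_distrib_left)
  also have "\<dots> \<le> 2 * real k * (1 / real D)"
    using P D by (intro mult_left_mono sum_inverse_squares_le) auto
  finally have 1: "(\<Prod>p\<in>P. 1 + 2 * real k / (real p)\<^sup>2) \<le> exp (2 * real k / real D)" by simp
  have 2: "osum (\<lambda>p. 1 / real p) P t \<le> 1 + ln (real (\<Prod>Z)) + (\<Prod>p\<in>Z. 1 - 1 / real p) * (1 + t)"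
    unfolding osum_alt[OF P(1)] by (rule sum_prod_inverse_le[OF P(1) _ Z PZ t]) (use P in auto)
  have "prime p \<and> 2 * k < p" if "p \<in> P" for p using P(2)[OF that] D by auto
  then have "osum (\<lambda>p. 1 / (real p - real k)) P t \<le>
    (\<Prod>p\<in>P. 1 + 2 * real k / (real p)\<^sup>2) * osum (\<lambda>p. 1 / real p) P t"
    by (intro osum_shift_le P(1)) auto
  also have "\<dots> \<le> exp (2 * real k / real D) * (1 + ln (real (\<Prod>Z)) + (\<Prod>p\<in>Z. 1 - 1 / real p) * (1 + t))"
    by (intro mult_mono 1 2 osum_nonneg) auto
  finally show ?thesis .
qed

text \<open>A set weighted by \<open>j\<close> to its cardinality is a set whose elements are
  distributed over \<open>j\<close> classes. Each class satisfies the cutoff by itself, and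
  forgetting the joint condition leaves a product of \<open>j\<close> sums.\<close>

lemma osum_mult_le_power:
  assumes P: "finite P" "\<And>p. p \<in> P \<Longrightarrow> prime p" and b: "\<And>p. p \<in> P \<Longrightarrow> 0 \<le> b p" and t: "t \<ge> 0"
  shows "osum (\<lambda>p. real j * b p) P t \<le> osum b P t ^ j"
proof (induction j)
  case 0
  have "osum (\<lambda>p. 0) P t = (\<Sum>A\<in>Pow P. if A = {} then 1 else 0)"
    unfolding osum_def using t P by (intro sum.cong) (auto simp: prod_zero_iff dest: finite_subset)
  also have "\<dots> = 1" using P by (simp add: sum.delta)
  finally show ?case by simp
next
  case (Suc j)
  have nn: "0 \<le> prod b B" "0 \<le> (\<Prod>p\<in>B. real j * b p)" "finite B" "0 \<le> lnsum B" if "B \<subseteq> P" for B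
    using that b P finite_subset[OF that P(1)] by (auto intro!: prod_nonneg mult_nonneg_nonneg lnsum_nonneg)
  have "osum (\<lambda>p. real (Suc j) * b p) P t = (\<Sum>A\<in>Pow P. (\<Prod>p\<in>A. real j * b p + b p) * of_bool (lnsum A \<le> t))"
    unfolding osum_def by (simp add: algebra_simps)
  also have "\<dots> = (\<Sum>A\<in>Pow P. (\<Prod>p\<in>A. real j * b p) *
     (\<Sum>B\<in>Pow (P - A). prod b B * of_bool (lnsum (A \<union> B) \<le> t)))"
    by (rule sum_Pow_split[OF P(1)])
  also have "\<dots> \<le> (\<Sum>A\<in>Pow P. (\<Prod>p\<in>A. real j * b p) * (of_bool (lnsum A \<le> t) * osum b P t))"
  proof (intro sum_mono mult_left_mono nn)
    fix A assume A: "A \<in> Pow P"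
    have "(\<Sum>B\<in>Pow (P - A). prod b B * of_bool (lnsum (A \<union> B) \<le> t)) \<le>
       (\<Sum>B\<in>Pow (P - A). prod b B * (of_bool (lnsum A \<le> t) * of_bool (lnsum B \<le> t)))"
    proof (intro sum_mono mult_left_mono nn)
      fix B assume B: "B \<in> Pow (P - A)"
      then have "B \<subseteq> P" by auto
      then have "lnsum (A \<union> B) = lnsum A + lnsum B"
        using A B nn by (intro lnsum_union) auto
      then show "(of_bool (lnsum (A \<union> B) \<le> t) :: real) \<le> of_bool (lnsum A \<le> t) * of_bool (lnsum B \<le> t)"
        using nn(4)[of A] nn(4)[OF \<open>B \<subseteq> P\<close>] A by auto
    qed auto
    also have "\<dots> \<le> (\<Sum>B\<in>Pow P. prod b B * (of_bool (lnsum A \<le> t) * of_bool (lnsum B \<le> t)))"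
      using P nn by (intro sum_mono2) auto
    also have "\<dots> = of_bool (lnsum A \<le> t) * osum b P t"
      by (simp add: osum_def sum_distrib_left algebra_simps)
    finally show "(\<Sum>B\<in>Pow (P - A). prod b B * of_bool (lnsum (A \<union> B) \<le> t)) \<le> of_bool (lnsum A \<le> t) * osum b P t" .
  qed auto
  also have "\<dots> = osum (\<lambda>p. real j * b p) P t * osum b P t"
    unfolding osum_def[of "\<lambda>p. real j * b p"] sum_distrib_right by (simp only: mult.assoc)
  also have "\<dots> \<le> osum b P t ^ j * osum b P t"
    by (intro mult_right_mono Suc.IH osum_nonneg b)
  finally show ?case by (simp add: mult.commute)
qed

lemma msum_le_osum:
  assumes "finite P" "\<And>p. p \<in> P \<Longrightarrow> prime p" "\<And>p. p \<in> P \<Longrightarrow> 0 \<le> a p" "X \<ge> 0" "q \<ge> 1"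
  shows "msum a P q X \<le> X ^ q * osum a P X"
proof -
  have "msum a P q X \<le> (\<Sum>A\<in>Pow P. prod a A * (X ^ q * of_bool (lnsum A \<le> X)))"
    unfolding msum_def
  proof (intro sum_mono mult_left_mono)
    fix A assume A: "A \<in> Pow P"
    show "0 \<le> prod a A" using A assms by (intro prod_nonneg) auto
    have "0 \<le> lnsum A" using A assms by (intro lnsum_nonneg) auto
    then have "max 0 (X - lnsum A) ^ q \<le> X ^ q" using assms by (intro power_mono) auto
    then show "max 0 (X - lnsum A) ^ q \<le> X ^ q * of_bool (lnsum A \<le> X)"
      using assms(5) by (auto simp: max_def power_0_left)
  qed
  then show ?thesis by (simp add: osum_def sum_distrib_left algebra_simps)
qed

section \<open>Changing the dimension of a sum by one\<close>

lemma msum_split: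
  assumes "finite P"
  shows "msum (\<lambda>p. a p + b p) P q X = (\<Sum>A\<in>Pow P. prod a A * msum b (P - A) q (X - lnsum A))"
proof -
  have "msum (\<lambda>p. a p + b p) P q X = (\<Sum>A\<in>Pow P. prod a A *
     (\<Sum>B\<in>Pow (P - A). prod b B * max 0 (X - lnsum (A \<union> B)) ^ q))"
    unfolding msum_def by (rule sum_Pow_split[OF assms])
  also have "\<dots> = (\<Sum>A\<in>Pow P. prod a A * msum b (P - A) q (X - lnsum A))"
    unfolding msum_def
  proof (intro sum.cong refl arg_cong2[of _ _ _ _ "(*)"])
    fix A B assume "A \<in> Pow P" "B \<in> Pow (P - A)"
    then have "lnsum (A \<union> B) = lnsum A + lnsum B"
      using assms by (intro lnsum_union) (auto intro: finite_subset)
    then show "max 0 (X - lnsum (A \<union> B)) ^ q = max 0 (X - lnsum A - lnsum B) ^ q"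
      by (simp add: algebra_simps)
  qed
  finally show ?thesis .
qed

lemma msum_neg_eq_0:
  assumes "\<And>p. p \<in> P \<Longrightarrow> prime p" "X \<le> 0" "q \<ge> 1"
  shows "msum b P q X = 0"
  unfolding msum_def
proof (intro sum.neutral ballI)
  fix A assume "A \<in> Pow P"
  then have "0 \<le> lnsum A" using assms by (intro lnsum_nonneg) auto
  then have "max 0 (X - lnsum A) = 0" using assms by simp
  then show "prod b A * max 0 (X - lnsum A) ^ q = 0" using assms by simp
qed

text \<open>For fixed \<open>A\<close> the sum over the part with weights \<open>b\<close> has
  dimension one, and partial summation raises the power of \<open>X - lnsum A\<close> from
  \<open>q\<close> to \<open>q + 1\<close>. The disjointness of the two parts is given up.\<close>

lemma msum_dim_upper:
  assumes P: "finite P" "\<And>p. p \<in> P \<Longrightarrow> prime p"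
    and a: "\<And>p. p \<in> P \<Longrightarrow> 0 \<le> a p" and b: "\<And>p. p \<in> P \<Longrightarrow> 0 \<le> b p"
    and bd: "\<And>t. 0 \<le> t \<Longrightarrow> osum b P t \<le> \<alpha> * t + \<beta>" and q: "q \<ge> 1"
  shows "msum (\<lambda>p. a p + b p) P q X \<le> \<alpha> / real (q + 1) * msum a P (q + 1) X + \<beta> * msum a P q X"
proof -
  have nn: "0 \<le> prod a B" "0 \<le> prod b B" "finite B" "0 \<le> lnsum B" if "B \<subseteq> P" for B
    using that a b P finite_subset[OF that P(1)] by (auto intro!: prod_nonneg mult_nonneg_nonneg lnsum_nonneg)
  have "msum (\<lambda>p. a p + b p) P q X = (\<Sum>A\<in>Pow P. prod a A * msum b (P - A) q (X - lnsum A))"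
    by (rule msum_split[OF P(1)])
  also have "\<dots> \<le> (\<Sum>A\<in>Pow P. prod a A *
     (\<alpha> * max 0 (X - lnsum A) ^ (q + 1) / real (q + 1) + \<beta> * max 0 (X - lnsum A) ^ q))"
  proof (intro sum_mono mult_left_mono nn)
    fix A assume A: "A \<in> Pow P"
    show "msum b (P - A) q (X - lnsum A) \<le>
      \<alpha> * max 0 (X - lnsum A) ^ (q + 1) / real (q + 1) + \<beta> * max 0 (X - lnsum A) ^ q"
    proof (cases "X - lnsum A \<le> 0")
      case True
      then have "msum b (P - A) q (X - lnsum A) = 0" using P q by (intro msum_neg_eq_0) auto
      then show ?thesis using True q by (simp add: max_def power_0_left)
    next
      case False
      have "msum b (P - A) q (X - lnsum A) \<le> msum b P q (X - lnsum A)"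
        unfolding msum_def using P nn by (intro sum_mono2) auto
      also have "\<dots> \<le> \<alpha> * (X - lnsum A) ^ (q + 1) / real (q + 1) + \<beta> * (X - lnsum A) ^ q"
        unfolding msum_def
      proof (rule sum_power_max_abel)
        show "(\<Sum>B | B \<in> Pow P \<and> lnsum B \<le> t. prod b B) \<le> \<alpha> * t + \<beta>" if "0 \<le> t" for t
          using bd[OF that] by (simp add: osum_alt[OF P(1)])
      qed (use P nn q False in auto)
      finally show ?thesis using False by (simp add: max_def)
    qed
  qed auto
  also have "\<dots> = \<alpha> / real (q + 1) * msum a P (q + 1) X + \<beta> * msum a P q X"
    by (simp add: msum_def sum.distrib sum_distrib_left algebra_simps sum_divide_distrib)
  finally show ?thesis .
qed

text \<open>After a split the inner sum avoids the primes of \<open>A\<close> in addition to those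
  of \<open>Z\<close>, so the bound of dimension one is applied to the union; this is the source of
  the product over \<open>A\<close>.\<close>

lemma msum_totient_lower_Diff:
  assumes Z: "finite Z" "\<And>p. p \<in> Z \<Longrightarrow> prime p" and q: "q \<ge> 1"
    and P: "P = {p. prime p \<and> ln (real p) \<le> X} - Z" and A: "A \<subseteq> P"
  shows "(\<Prod>p\<in>Z. 1 - 1 / real p) * (\<Prod>p\<in>A. 1 - 1 / real p) * (max 0 (X - lnsum A) ^ (q + 1) / real (q + 1))
     \<le> msum (\<lambda>p. 1 / (real p - 1)) (P - A) q (X - lnsum A)"
proof (cases "X - lnsum A \<le> 0")
  case True
  have "0 \<le> msum (\<lambda>p. 1 / (real p - 1)) (P - A) q (X - lnsum A)"
    by (intro msum_nonneg) (auto simp: P dest: prime_ge_1_nat)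
  moreover have "max 0 (X - lnsum A) = 0" using True by simp
  ultimately show ?thesis by simp
next
  case False
  have fin: "finite A" using A P by (auto intro: finite_subset[of _ "{p. prime p \<and> ln (real p) \<le> X}"])
  have "0 \<le> lnsum A" using A P by (intro lnsum_nonneg) auto
  moreover have "P - A = {p. prime p \<and> ln (real p) \<le> X} - (Z \<union> A)" by (auto simp: P)
  moreover have "(\<Prod>p\<in>Z \<union> A. 1 - 1 / real p) = (\<Prod>p\<in>Z. 1 - 1 / real p) * (\<Prod>p\<in>A. 1 - 1 / real p)"
    using Z A P fin by (intro prod.union_disjoint) auto
  ultimately show ?thesis
    using msum_totient_lower[of "Z \<union> A" "X - lnsum A" X q] Z A P fin q False by (auto simp: max_def)
qed

text \<open>Split \<open>j / (p - j)\<close> into \<open>(j - 1) / (p - j)\<close> and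
  \<open>1 / (p - j)\<close>. The factors \<open>1 - 1 / p\<close> lost on \<open>A\<close> are paid
  for by lowering the first weight to \<open>(j - 1) / (p - (j - 1))\<close>, which has the right
  shape for dimension \<open>j - 1\<close>, so the step can be iterated.\<close>

lemma msum_dim_lower:
  assumes Z: "finite Z" "\<And>p. p \<in> Z \<Longrightarrow> prime p" and q: "q \<ge> 1"
    and P: "P = {p. prime p \<and> ln (real p) \<le> X} - Z" and j: "j \<ge> 1" "\<And>p. p \<in> P \<Longrightarrow> p > j"
  shows "(\<Prod>p\<in>Z. 1 - 1 / real p) / real (q + 1) * msum (\<lambda>p. (real j - 1) / (real p - (real j - 1))) P (q + 1) X
    \<le> msum (\<lambda>p. real j / (real p - real j)) P q X"
proof -
  let ?a = "\<lambda>p::nat. (real j - 1) / (real p - real j)"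
  let ?b = "\<lambda>p::nat. 1 / (real p - real j)"
  let ?c = "\<lambda>p::nat. (real j - 1) / (real p - (real j - 1))"
  let ?\<Phi> = "\<Prod>p\<in>Z. 1 - 1 / real p"
  have finP: "finite P" and prP: "\<And>p. p \<in> P \<Longrightarrow> prime p" using P by auto
  have \<Phi>: "?\<Phi> \<ge> 0" using Z by (intro prod_nonneg) (auto simp: divide_le_eq_1 prime_ge_1_nat)
  have "?\<Phi> / real (q + 1) * msum ?c P (q + 1) X =
    (\<Sum>A\<in>Pow P. prod ?c A * (?\<Phi> * (max 0 (X - lnsum A) ^ (q + 1) / real (q + 1))))"
    unfolding msum_def sum_distrib_left by (intro sum.cong refl) simp
  also have "\<dots> \<le> (\<Sum>A\<in>Pow P. (prod ?a A * (\<Prod>p\<in>A. 1 - 1 / real p)) *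
      (?\<Phi> * (max 0 (X - lnsum A) ^ (q + 1) / real (q + 1))))"
  proof (intro sum_mono mult_right_mono)
    fix A assume A: "A \<in> Pow P"
    have "prod ?c A \<le> (\<Prod>p\<in>A. ?a p * (1 - 1 / real p))"
    proof (rule prod_mono, safe)
      fix p assume "p \<in> A"
      then have p: "real p > real j" "real j \<ge> 1" using A j by auto
      then show "0 \<le> ?c p" by simp
      have "1 / (real p - (real j - 1)) \<le> 1 / (real p - real j) * (1 - 1 / real p)"
        using p by (simp add: divide_simps) (simp add: algebra_simps)
      from mult_left_mono[OF this, of "real j - 1"] show "?c p \<le> ?a p * (1 - 1 / real p)"
        using p by simp
    qed
    then show "prod ?c A \<le> prod ?a A * (\<Prod>p\<in>A. 1 - 1 / real p)" by (simp only: prod.distrib)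
  qed (use \<Phi> in auto)
  also have "\<dots> = (\<Sum>A\<in>Pow P. prod ?a A * (?\<Phi> * (\<Prod>p\<in>A. 1 - 1 / real p) * (max 0 (X - lnsum A) ^ (q + 1) / real (q + 1))))"
    by (intro sum.cong refl) (simp only: mult_ac)
  also have "\<dots> \<le> (\<Sum>A\<in>Pow P. prod ?a A * msum ?b (P - A) q (X - lnsum A))"
  proof (intro sum_mono mult_left_mono)
    fix A assume A: "A \<in> Pow P"
    show "0 \<le> prod ?a A" using A j by (intro prod_nonneg divide_nonneg_pos) auto
    have "?\<Phi> * (\<Prod>p\<in>A. 1 - 1 / real p) * (max 0 (X - lnsum A) ^ (q + 1) / real (q + 1)) \<le>
      msum (\<lambda>p. 1 / (real p - 1)) (P - A) q (X - lnsum A)"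
      using A by (intro msum_totient_lower_Diff Z q P) auto
    also have "\<dots> \<le> msum ?b (P - A) q (X - lnsum A)"
      unfolding msum_def
    proof (intro sum_mono mult_right_mono prod_mono)
      fix B p assume "B \<in> Pow (P - A)" "p \<in> B"
      then have p: "real p > real j" "real j \<ge> 1" using j by auto
      then show "0 \<le> 1 / (real p - 1) \<and> 1 / (real p - 1) \<le> ?b p" by (auto intro!: divide_left_mono)
    qed auto
    finally show "?\<Phi> * (\<Prod>p\<in>A. 1 - 1 / real p) * (max 0 (X - lnsum A) ^ (q + 1) / real (q + 1)) \<le> \<dots>" .
  qed
  also have "\<dots> = msum (\<lambda>p. ?a p + ?b p) P q X" by (rule msum_split[OF finP, symmetric])
  also have "(\<lambda>p. ?a p + ?b p) = (\<lambda>p. real j / (real p - real j))"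
    by (simp add: add_divide_distrib[symmetric])
  finally show ?thesis .
qed

text \<open>Induction on the dimension \<open>j\<close>, starting from the empty set alone.
  \<open>msum_dim_lower\<close> gains a dimension but loses a power of the cutoff; the moment
  inequality, with half of \<open>X\<close> spent on its lower order term, restores that
  power.\<close>

lemma msum_lower:
  assumes Z: "finite Z" "\<And>p. p \<in> Z \<Longrightarrow> prime p" and q: "q \<ge> 1"
    and P: "P = {p. prime p \<and> ln (real p) \<le> X} - Z" and m: "\<And>p. p \<in> P \<Longrightarrow> p > 2 * m"
    and mert: "\<And>t. 0 \<le> t \<Longrightarrow> (\<Sum>p | p \<in> P \<and> ln (real p) \<le> t. ln (real p) / (real p - real m)) \<le> t + D"
    and X: "X \<ge> 2 * real m * D" "X \<ge> 0" and D: "D \<ge> 0" and j: "j \<le> m"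
  shows "((\<Prod>p\<in>Z. 1 - 1 / real p) * X / (2 * real (q + 1) * real (m + 1))) ^ j * X ^ q
    \<le> msum (\<lambda>p. real j / (real p - real j)) P q X"
  using j
proof (induction j)
  case 0
  have "X ^ q = (\<Prod>p\<in>({}::nat set). 0) * max 0 (X - lnsum {}) ^ q" using X by simp
  also have "\<dots> \<le> msum (\<lambda>p. 0) P q X"
    unfolding msum_def by (rule member_le_sum) (auto simp: P prod_nonneg)
  finally show ?case by simp
next
  case (Suc j)
  let ?\<Phi> = "\<Prod>p\<in>Z. 1 - 1 / real p"
  let ?a = "\<lambda>p::nat. real j / (real p - real j)"
  have finP: "finite P" and prP: "\<And>p. p \<in> P \<Longrightarrow> prime p" using P by auto
  have \<Phi>: "?\<Phi> \<ge> 0" using Z by (intro prod_nonneg) (auto simp: divide_le_eq_1 prime_ge_1_nat)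
  have jm: "real j \<le> real m" using Suc.prems by simp
  have pm: "real p > real m" if "p \<in> P" for p using m[OF that] by linarith
  have pj: "real p > real j" if "p \<in> P" for p using pm[OF that] jm by linarith
  have a0: "0 \<le> ?a p" if "p \<in> P" for p using pj[OF that] by simp
  have "X * msum ?a P q X \<le> (1 + real j / real (q + 1)) * msum ?a P (q + 1) X + (real j * D) * msum ?a P q X"
  proof (rule msum_moment_ineq[OF finP prP a0 _ q])
    fix t :: real assume t: "0 \<le> t"
    have "(\<Sum>p | p \<in> P \<and> ln (real p) \<le> t. ?a p * ln (real p)) \<le>
      (\<Sum>p | p \<in> P \<and> ln (real p) \<le> t. real j * (ln (real p) / (real p - real m)))"
    proof (rule sum_mono)
      fix p assume p: "p \<in> {p. p \<in> P \<and> ln (real p) \<le> t}"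
      have "1 / (real p - real j) \<le> 1 / (real p - real m)"
        using p pm[of p] pj[of p] jm by (intro divide_left_mono) auto
      moreover have "0 \<le> real j * ln (real p)" using p prP[of p] ln_prime_pos[of p] by auto
      ultimately show "?a p * ln (real p) \<le> real j * (ln (real p) / (real p - real m))"
        using mult_left_mono[of "1 / (real p - real j)" "1 / (real p - real m)" "real j * ln (real p)"]
        by simp
    qed
    also have "\<dots> = real j * (\<Sum>p | p \<in> P \<and> ln (real p) \<le> t. ln (real p) / (real p - real m))"
      by (simp add: sum_distrib_left)
    also have "\<dots> \<le> real j * (t + D)" by (intro mult_left_mono mert t) auto
    finally show "(\<Sum>p | p \<in> P \<and> ln (real p) \<le> t. ?a p * ln (real p)) \<le> real j * t + real j * D"
      by (simp add: algebra_simps)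
  qed
  moreover have "real j * D * msum ?a P q X \<le> X / 2 * msum ?a P q X"
  proof (intro mult_right_mono msum_nonneg a0)
    have "real j * D \<le> real m * D" using jm D by (intro mult_right_mono) auto
    then show "real j * D \<le> X / 2" using X by simp
  qed
  moreover have "(1 + real j / real (q + 1)) * msum ?a P (q + 1) X \<le> real (m + 1) * msum ?a P (q + 1) X"
  proof (intro mult_right_mono msum_nonneg a0)
    have "real j / real (q + 1) \<le> real j / 1" by (intro divide_left_mono) auto
    then show "1 + real j / real (q + 1) \<le> real (m + 1)" using jm by simp
  qed
  ultimately have mom: "X / 2 * msum ?a P q X \<le> real (m + 1) * msum ?a P (q + 1) X" by argo
  let ?K = "?\<Phi> * X / (2 * real (q + 1) * real (m + 1))"
  have "?K ^ Suc j * X ^ q = ?K * (?K ^ j * X ^ q)" by simp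
  also have "\<dots> \<le> ?K * msum ?a P q X"
    using \<Phi> X Suc by (intro mult_left_mono Suc.IH) auto
  also have "\<dots> = ?\<Phi> / real (q + 1) * (X / 2 * msum ?a P q X / real (m + 1))"
    by (simp add: field_simps)
  also have "\<dots> \<le> ?\<Phi> / real (q + 1) * msum ?a P (q + 1) X"
    using mom \<Phi> by (intro mult_left_mono) (auto simp: field_simps)
  also have "\<dots> \<le> msum (\<lambda>p. real (Suc j) / (real p - real (Suc j))) P q X"
  proof -
    have "p > Suc j" if "p \<in> P" for p using m[OF that] Suc.prems by linarith
    from msum_dim_lower[OF Z q P _ this] show ?thesis by simp
  qed
  finally show ?case .
qed

subsection \<open>Residue classes\<close>

definition crt_classes :: "nat \<Rightarrow> nat \<Rightarrow> (nat \<Rightarrow> nat set) \<Rightarrow> nat set \<Rightarrow> nat set" where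
  "crt_classes W \<nu> \<Omega> S = {c. c < W * \<Prod>S \<and> c mod W = \<nu> \<and> (\<forall>p\<in>S. c mod p \<in> \<Omega> p)}"

lemma mod_in_crt_classes_iff:
  assumes "finite S" "W * \<Prod>S > 0"
  shows "n mod (W * \<Prod>S) \<in> crt_classes W \<nu> \<Omega> S \<longleftrightarrow> n mod W = \<nu> \<and> (\<forall>p\<in>S. n mod p \<in> \<Omega> p)"
proof -
  have "n mod (W * \<Prod>S) mod p = n mod p" if "p \<in> S" for p
    using assms that by (intro mod_mod_cancel dvd_mult) auto
  moreover have "n mod (W * \<Prod>S) mod W = n mod W" by (intro mod_mod_cancel) auto
  ultimately show ?thesis using assms by (auto simp: crt_classes_def)
qed

lemma prod_primes_pos: "(\<And>p. p \<in> S \<Longrightarrow> prime (p::nat)) \<Longrightarrow> \<Prod>S > 0"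
  by (intro prod_pos) (auto simp: prime_gt_0_nat)

lemma finite_crt_classes [simp]: "finite (crt_classes W \<nu> \<Omega> S)"
  by (rule finite_subset[of _ "{..<W * \<Prod>S}"]) (auto simp: crt_classes_def)

lemma card_crt_classes:
  assumes "finite S" "\<And>p. p \<in> S \<Longrightarrow> prime p \<and> coprime p W \<and> \<Omega> p \<subseteq> {..<p}" "\<nu> < W"
  shows "card (crt_classes W \<nu> \<Omega> S) = (\<Prod>p\<in>S. card (\<Omega> p))"
  using assms
proof (induction S rule: finite_induct)
  case empty
  then have "crt_classes W \<nu> \<Omega> {} = {\<nu>}" by (auto simp: crt_classes_def)
  then show ?case by simp
next
  case (insert p S)
  define q where "q = W * \<Prod>S"
  have p: "prime p" "coprime p W" "\<Omega> p \<subseteq> {..<p}" "p > 0" using insert.prems prime_gt_0_nat by auto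
  have q: "q > 0" unfolding q_def using insert.prems prod_primes_pos[of S] by auto
  have pq: "coprime q p"
    unfolding q_def using p insert.prems insert.hyps
    by (auto simp: coprime_commute[of p] intro!: prod_coprime_left primes_coprime)
  have Q: "W * \<Prod>(insert p S) = p * q" using insert.hyps by (simp add: q_def mult_ac)
  have "bij_betw (\<lambda>c. (c mod q, c mod p)) (crt_classes W \<nu> \<Omega> (insert p S)) (crt_classes W \<nu> \<Omega> S \<times> \<Omega> p)"
  proof (rule bij_betwI')
    fix x y assume x: "x \<in> crt_classes W \<nu> \<Omega> (insert p S)" and y: "y \<in> crt_classes W \<nu> \<Omega> (insert p S)"
    have lt: "x < p * q" "y < p * q" using x y Q by (auto simp: crt_classes_def)
    show "((x mod q, x mod p) = (y mod q, y mod p)) = (x = y)"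
    proof
      assume "(x mod q, x mod p) = (y mod q, y mod p)"
      then have "[x = y] (mod q * p)" using pq by (intro coprime_cong_mult_nat) (auto simp: unique_euclidean_semiring_class.cong_def)
      then show "x = y" using lt by (simp add: unique_euclidean_semiring_class.cong_def mult.commute)
    qed simp
    show "(x mod q, x mod p) \<in> crt_classes W \<nu> \<Omega> S \<times> \<Omega> p"
      using x mod_in_crt_classes_iff[OF insert.hyps(1), of W x \<nu> \<Omega>] q by (auto simp: q_def[symmetric] crt_classes_def)
  next
    fix y assume y: "y \<in> crt_classes W \<nu> \<Omega> S \<times> \<Omega> p"
    obtain a b where ab: "y = (a, b)" "a \<in> crt_classes W \<nu> \<Omega> S" "b \<in> \<Omega> p" using y by auto
    have lt: "a < q" "b < p" using ab p by (auto simp: crt_classes_def q_def)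
    obtain x where x: "[x = a] (mod q)" "[x = b] (mod p)"
      using binary_chinese_remainder_nat[OF pq] by blast
    define z where "z = x mod (p * q)"
    have z: "z mod q = a" "z mod p = b"
      using x lt by (simp_all add: z_def mod_mod_cancel unique_euclidean_semiring_class.cong_def)
    have "z mod q \<in> crt_classes W \<nu> \<Omega> S" using z ab by simp
    then have "z mod W = \<nu> \<and> (\<forall>p\<in>S. z mod p \<in> \<Omega> p)"
      using mod_in_crt_classes_iff[OF insert.hyps(1), of W z \<nu> \<Omega>] q by (auto simp: q_def)
    moreover have "z < p * q" using q p by (simp add: z_def)
    ultimately have "z \<in> crt_classes W \<nu> \<Omega> (insert p S)"
      using z ab unfolding crt_classes_def Q by auto
    then show "\<exists>x\<in>crt_classes W \<nu> \<Omega> (insert p S). y = (x mod q, x mod p)" using z ab by auto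
  qed
  then have "card (crt_classes W \<nu> \<Omega> (insert p S)) = card (crt_classes W \<nu> \<Omega> S) * card (\<Omega> p)"
    by (simp add: bij_betw_same_card card_cartesian_product)
  then show ?case using insert by simp
qed

lemma card_residue_atMost:
  assumes "c < q"
  shows "(real m - real c) / real q \<le> real (card {n \<in> {..m}. n mod q = c})"
    "real (card {n \<in> {..m}. n mod q = c}) \<le> (real m - real c) / real q + 1"
proof -
  have "(real m - real c) / real q \<le> real (card {n \<in> {..m}. n mod q = c}) \<and>
    real (card {n \<in> {..m}. n mod q = c}) \<le> (real m - real c) / real q + 1"
  proof (cases "c \<le> m")
    case True
    have "{n \<in> {..m}. n mod q = c} = (\<lambda>i. q * i + c) ` {..(m - c) div q}"
    proof (intro equalityI subsetI)
      fix n assume n: "n \<in> {n \<in> {..m}. n mod q = c}"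
      then have "n = q * (n div q) + c" using mult_div_mod_eq[of q n] by auto
      moreover from this have "q * (n div q) \<le> m - c" using n by (metis (no_types, lifting) add_diff_cancel_right' atMost_iff diff_le_mono mem_Collect_eq)
      then have "n div q \<le> (m - c) div q" using assms by (simp add: less_eq_div_iff_mult_less_eq mult.commute)
      ultimately show "n \<in> (\<lambda>i. q * i + c) ` {..(m - c) div q}" by blast
    next
      fix n assume "n \<in> (\<lambda>i. q * i + c) ` {..(m - c) div q}"
      then obtain i where i: "n = q * i + c" "i \<le> (m - c) div q" by auto
      then have "q * i \<le> m - c" using assms by (simp add: less_eq_div_iff_mult_less_eq mult.commute)
      then show "n \<in> {n \<in> {..m}. n mod q = c}" using i True assms by auto
    qed
    moreover have "inj_on (\<lambda>i. q * i + c) {..(m - c) div q}" using assms by (auto simp: inj_on_def)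
    ultimately have card: "card {n \<in> {..m}. n mod q = c} = (m - c) div q + 1" by (simp add: card_image)
    have "real (m - c) = real q * real ((m - c) div q) + real ((m - c) mod q)"
      by (metis mult_div_mod_eq of_nat_add of_nat_mult)
    moreover have "real ((m - c) mod q) \<le> real q" using assms by (simp add: less_imp_le)
    moreover have "real ((m - c) mod q) \<ge> 0" by simp
    ultimately show ?thesis using True assms unfolding card by (simp add: field_simps of_nat_diff)
  next
    case False
    then have "n mod q \<noteq> c" if "n \<le> m" for n using that mod_less_eq_dividend[of n q] by linarith
    then have "{n \<in> {..m}. n mod q = c} = {}" by auto
    then have c0: "real (card {n \<in> {..m}. n mod q = c}) = 0" by (simp only: card.empty of_nat_0)
    show ?thesis unfolding c0 using False assms by (simp add: field_simps)
  qed
  then show "(real m - real c) / real q \<le> real (card {n \<in> {..m}. n mod q = c})"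
    "real (card {n \<in> {..m}. n mod q = c}) \<le> (real m - real c) / real q + 1" by auto
qed

text \<open>Each one-sided count exceeds \<open>(m - c) / q\<close> by an amount between 0 and 1, so
  the two amounts cancel up to 1 in the difference.\<close>

lemma card_residue_interval:
  assumes "c < q" "a \<le> b"
  shows "\<bar>real (card {n \<in> {a<..b}. n mod q = c}) - (real b - real a) / real q\<bar> \<le> 1"
proof -
  have "{n \<in> {..b}. n mod q = c} = {n \<in> {..a}. n mod q = c} \<union> {n \<in> {a<..b}. n mod q = c}"
    using assms by auto
  then have "card {n \<in> {..b}. n mod q = c} = card {n \<in> {..a}. n mod q = c} + card {n \<in> {a<..b}. n mod q = c}"
    by (simp only:) (rule card_Un_disjoint, auto)
  moreover have "(real b - real a) / real q = (real b - real c) / real q - (real a - real c) / real q"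
    by (simp add: diff_divide_distrib)
  ultimately show ?thesis
    using card_residue_atMost[OF assms(1), of a] card_residue_atMost[OF assms(1), of b] by simp
qed

subsection \<open>Expanding the square\<close>

lemma sum_square_expand:
  fixes l :: "'a set \<Rightarrow> real" and g :: "'b \<Rightarrow> real"
  assumes P: "finite P" and D: "\<And>n. n \<in> I \<Longrightarrow> D n \<subseteq> P" and I: "finite I"
  shows "(\<Sum>n\<in>I. g n * (\<Sum>A\<in>Pow (D n). l A)\<^sup>2) =
    (\<Sum>A\<in>Pow P. \<Sum>B\<in>Pow P. l A * l B * (\<Sum>n | n \<in> I \<and> A \<union> B \<subseteq> D n. g n))"
proof -
  have "(\<Sum>n\<in>I. g n * (\<Sum>A\<in>Pow (D n). l A)\<^sup>2) =
     (\<Sum>n\<in>I. \<Sum>A\<in>Pow P. \<Sum>B\<in>Pow P. l A * l B * (if A \<union> B \<subseteq> D n then g n else 0))"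
  proof (rule sum.cong[OF refl])
    fix n assume n: "n \<in> I"
    have "Pow (D n) = {A \<in> Pow P. A \<subseteq> D n}" using D[OF n] by auto
    then have "(\<Sum>A\<in>Pow (D n). l A) = (\<Sum>A\<in>Pow P. if A \<subseteq> D n then l A else 0)"
      using P by (simp only: sum.inter_filter finite_Pow_iff)
    then have "(\<Sum>A\<in>Pow (D n). l A)\<^sup>2 =
      (\<Sum>A\<in>Pow P. \<Sum>B\<in>Pow P. (if A \<subseteq> D n then l A else 0) * (if B \<subseteq> D n then l B else 0))"
      by (simp only: power2_eq_square sum_product)
    then have "g n * (\<Sum>A\<in>Pow (D n). l A)\<^sup>2 =
      (\<Sum>A\<in>Pow P. \<Sum>B\<in>Pow P. g n * ((if A \<subseteq> D n then l A else 0) * (if B \<subseteq> D n then l B else 0)))"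
      by (simp only: sum_distrib_left)
    also have "\<dots> = (\<Sum>A\<in>Pow P. \<Sum>B\<in>Pow P. l A * l B * (if A \<union> B \<subseteq> D n then g n else 0))"
      by (intro sum.cong refl) auto
    finally show "g n * (\<Sum>A\<in>Pow (D n). l A)\<^sup>2 = \<dots>" .
  qed
  also have "\<dots> = (\<Sum>A\<in>Pow P. \<Sum>B\<in>Pow P. \<Sum>n\<in>I. l A * l B * (if A \<union> B \<subseteq> D n then g n else 0))"
    by (subst sum.swap, intro sum.cong refl, subst sum.swap, rule refl)
  also have "\<dots> = (\<Sum>A\<in>Pow P. \<Sum>B\<in>Pow P. l A * l B * (\<Sum>n | n \<in> I \<and> A \<union> B \<subseteq> D n. g n))"
    unfolding sum_distrib_left[symmetric] by (simp only: sum.inter_filter[OF I])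
  finally show ?thesis .
qed

text \<open>The error bound depends on \<open>S\<close> because the application to shifted primes
  controls the errors only on average over the moduli.\<close>

lemma sum_square_approx:
  fixes l :: "'a set \<Rightarrow> real" and g :: "'b \<Rightarrow> real"
  assumes P: "finite P" and D: "\<And>n. n \<in> I \<Longrightarrow> D n \<subseteq> P" and I: "finite I"
    and E: "\<And>S. S \<subseteq> P \<Longrightarrow> \<bar>(\<Sum>n | n \<in> I \<and> S \<subseteq> D n. g n) - \<kappa> * (\<Prod>p\<in>S. u p)\<bar> \<le> E S"
  shows "\<bar>(\<Sum>n\<in>I. g n * (\<Sum>A\<in>Pow (D n). l A)\<^sup>2) - \<kappa> * quad_form u P l\<bar> \<le>
    (\<Sum>A\<in>Pow P. \<Sum>B\<in>Pow P. \<bar>l A\<bar> * \<bar>l B\<bar> * E (A \<union> B))"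
proof -
  have eq: "(\<Sum>n\<in>I. g n * (\<Sum>A\<in>Pow (D n). l A)\<^sup>2) =
    (\<Sum>A\<in>Pow P. \<Sum>B\<in>Pow P. l A * l B * (\<Sum>n | n \<in> I \<and> A \<union> B \<subseteq> D n. g n))"
    by (rule sum_square_expand) (use P D I in auto)
  have "(\<Sum>n\<in>I. g n * (\<Sum>A\<in>Pow (D n). l A)\<^sup>2) - \<kappa> * quad_form u P l =
    (\<Sum>A\<in>Pow P. \<Sum>B\<in>Pow P. l A * l B * ((\<Sum>n | n \<in> I \<and> A \<union> B \<subseteq> D n. g n) - \<kappa> * (\<Prod>p\<in>A \<union> B. u p)))"
    unfolding eq quad_form_def
    by (simp only: sum_distrib_left sum_subtractf[symmetric] right_diff_distrib mult.left_commute[of \<kappa>])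
  also have "\<bar>\<dots>\<bar> \<le> (\<Sum>A\<in>Pow P. \<Sum>B\<in>Pow P. \<bar>l A\<bar> * \<bar>l B\<bar> * E (A \<union> B))"
  proof (intro order.trans[OF sum_abs] sum_mono)
    fix A B assume "A \<in> Pow P" "B \<in> Pow P"
    then have "A \<union> B \<subseteq> P" by auto
    from E[OF this] show "\<bar>l A * l B * ((\<Sum>n | n \<in> I \<and> A \<union> B \<subseteq> D n. g n) - \<kappa> * prod u (A \<union> B))\<bar>
      \<le> \<bar>l A\<bar> * \<bar>l B\<bar> * E (A \<union> B)"
      unfolding abs_mult by (intro mult_left_mono) auto
  qed
  finally show ?thesis .
qed

section \<open>Integers and shifted primes in prescribed residue classes\<close>

definition sieving_primes :: "nat set \<Rightarrow> nat set \<Rightarrow> nat \<Rightarrow> nat set" where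
  "sieving_primes P H n = {p \<in> P. \<exists>h\<in>H. p dvd n + h}"

definition bad_residues :: "nat set \<Rightarrow> nat \<Rightarrow> nat set" where
  "bad_residues H p = {w. w < p \<and> (\<exists>h\<in>H. p dvd w + h)}"

lemma dvd_add_mod_iff: "(p::nat) dvd n mod p + h \<longleftrightarrow> p dvd n + h"
  by (simp add: dvd_eq_mod_eq_0 mod_add_left_eq)

lemma mod_in_bad_residues: "p > 0 \<Longrightarrow> n mod p \<in> bad_residues H p \<longleftrightarrow> (\<exists>h\<in>H. p dvd n + h)"
  by (simp add: bad_residues_def dvd_add_mod_iff)

lemma bad_residues_eq:
  assumes "p > 0"
  shows "bad_residues H p = (\<lambda>h. (p - h mod p) mod p) ` H"
proof -
  have *: "p dvd w + h \<longleftrightarrow> w = (p - h mod p) mod p" if "w < p" for w h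
  proof -
    have hp: "h mod p < p" using assms by simp
    have "p dvd w + h \<longleftrightarrow> p dvd w + h mod p" by (simp add: dvd_eq_mod_eq_0 mod_add_right_eq)
    also have "\<dots> \<longleftrightarrow> w + h mod p = 0 \<or> w + h mod p = p"
    proof
      assume "p dvd w + h mod p"
      then obtain j where j: "w + h mod p = p * j" by auto
      have "p * j < p * 2" using that hp j by linarith
      then have "j < 2" by simp
      then show "w + h mod p = 0 \<or> w + h mod p = p" using j by (auto simp: less_2_cases_iff)
    qed auto
    also have "\<dots> \<longleftrightarrow> w = (p - h mod p) mod p"
      using that hp by (cases "h mod p = 0") auto
    finally show ?thesis .
  qed
  show ?thesis using * assms by (auto simp: bad_residues_def)
qed

lemma card_bad_residues:
  assumes "p > 0" "finite H" "inj_on (\<lambda>h. h mod p) H"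
  shows "card (bad_residues H p) = card H"
proof -
  have "bad_residues H p = (\<lambda>h. (p - h mod p) mod p) ` H" by (rule bad_residues_eq[OF assms(1)])
  moreover have "inj_on (\<lambda>h. (p - h mod p) mod p) H"
  proof (rule inj_onI)
    fix h h' assume h: "h \<in> H" "h' \<in> H" "(p - h mod p) mod p = (p - h' mod p) mod p"
    have lt: "h mod p < p" "h' mod p < p" using assms by auto
    have "h mod p = h' mod p"
      using h(3) lt by (cases "h mod p = 0"; cases "h' mod p = 0") auto
    then show "h = h'" using assms(3) h by (auto dest: inj_onD)
  qed
  ultimately show ?thesis by (simp add: card_image)
qed

lemma card_sieving_primes_approx:
  assumes S: "finite S" "\<And>p. p \<in> S \<Longrightarrow> prime p \<and> coprime p W \<and> inj_on (\<lambda>h. h mod p) H" "S \<subseteq> P"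
    and H: "finite H" and \<nu>: "\<nu> < W"
  shows "\<bar>real (card {n \<in> {N<..2 * N}. n mod W = \<nu> \<and> S \<subseteq> sieving_primes P H n}) -
      real N / real W * (\<Prod>p\<in>S. real (card H) / real p)\<bar> \<le> real (card H) ^ card S"
proof -
  define q where "q = W * \<Prod>S"
  have q: "q > 0" unfolding q_def using S \<nu> prod_primes_pos[of S] by auto
  define C where "C = crt_classes W \<nu> (bad_residues H) S"
  have pos: "p > 0" if "p \<in> S" for p using S(2)[OF that] prime_gt_0_nat by auto
  have cC: "card C = card H ^ card S"
  proof -
    have "card C = (\<Prod>p\<in>S. card (bad_residues H p))"
      unfolding C_def using S \<nu> by (intro card_crt_classes) (auto simp: bad_residues_def)
    also have "\<dots> = (\<Prod>p\<in>S. card H)" using S H pos by (intro prod.cong card_bad_residues) auto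
    finally show ?thesis by simp
  qed
  have "{n \<in> {N<..2 * N}. n mod W = \<nu> \<and> S \<subseteq> sieving_primes P H n} = (\<Union>c\<in>C. {n \<in> {N<..2 * N}. n mod q = c})"
    using mod_in_crt_classes_iff[OF S(1), of W _ \<nu> "bad_residues H"] q S(3) pos
    by (auto simp: C_def q_def mod_in_bad_residues sieving_primes_def subset_iff)
  then have "card {n \<in> {N<..2 * N}. n mod W = \<nu> \<and> S \<subseteq> sieving_primes P H n} =
     (\<Sum>c\<in>C. card {n \<in> {N<..2 * N}. n mod q = c})"
    by (simp only:) (rule card_UN_disjoint, auto simp: C_def)
  moreover have "real N / real W * (\<Prod>p\<in>S. real (card H) / real p) = (\<Sum>c\<in>C. (real (2 * N) - real N) / real q)"
    by (simp add: cC prod_dividef q_def)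
  ultimately have "\<bar>real (card {n \<in> {N<..2 * N}. n mod W = \<nu> \<and> S \<subseteq> sieving_primes P H n}) -
      real N / real W * (\<Prod>p\<in>S. real (card H) / real p)\<bar> =
     \<bar>\<Sum>c\<in>C. real (card {n \<in> {N<..2 * N}. n mod q = c}) - (real (2 * N) - real N) / real q\<bar>"
    by (simp add: sum_subtractf)
  also have "\<dots> \<le> (\<Sum>c\<in>C. 1)"
    by (intro order.trans[OF sum_abs] sum_mono card_residue_interval) (auto simp: C_def crt_classes_def q_def)
  also have "\<dots> = real (card H) ^ card S" by (simp add: cC)
  finally show ?thesis .
qed

definition theta_error :: "nat \<Rightarrow> nat \<Rightarrow> real" where
  "theta_error M q = Max ((\<lambda>a. \<bar>theta_progression M q a - real M / real (totient q)\<bar>) ` totatives q)"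

text \<open>The representative is \<open>a mod q\<close>. It is nonzero only because
  \<open>q > 1\<close>: \<open>totatives 1\<close> is \<open>{1}\<close>, while remainders modulo 1
  are 0.\<close>

lemma theta_error_ge:
  assumes "q > 1" "coprime a q"
  shows "\<bar>theta_progression M q a - real M / real (totient q)\<bar> \<le> theta_error M q"
proof -
  have "a mod q \<in> totatives q"
  proof -
    have "coprime (a mod q) q" using assms by simp
    moreover from this have "a mod q \<noteq> 0" using assms by (intro notI) simp
    ultimately show ?thesis using assms by (auto simp: totatives_def less_imp_le)
  qed
  moreover have "theta_progression M q a = theta_progression M q (a mod q)"
    by (simp add: theta_progression_def unique_euclidean_semiring_class.cong_def)
  ultimately show ?thesis unfolding theta_error_def by (intro Max_ge) auto
qed

lemma theta_error_nonneg: "q \<ge> 1 \<Longrightarrow> 0 \<le> theta_error M q"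
proof -
  assume "q \<ge> 1"
  then have "1 \<in> totatives q" by (auto simp: totatives_def)
  then have "\<bar>theta_progression M q 1 - real M / real (totient q)\<bar> \<le> theta_error M q"
    unfolding theta_error_def by (intro Max_ge) auto
  then show ?thesis by linarith
qed

text \<open>At each \<open>p\<close> in \<open>S\<close> there are \<open>card H - 1\<close> classes
  among the \<open>p - 1\<close> coprime ones: as the shifts are distinct modulo \<open>p\<close>, a
  \<open>p\<close> dividing another \<open>n + h'\<close> cannot divide \<open>n + h\<close>. The
  range of \<open>n\<close> is a difference of two initial segments, hence two error terms.\<close>

lemma sum_ln_sieving_primes_approx:
  assumes S: "finite S" "\<And>p. p \<in> S \<Longrightarrow> prime p \<and> coprime p W \<and> inj_on (\<lambda>h. h mod p) H" "S \<subseteq> P"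
    and H: "finite H" "h \<in> H" and \<nu>: "\<nu> < W" "coprime (\<nu> + h) W" and W: "W > 1"
  shows "\<bar>(\<Sum>n | n \<in> {N<..2 * N} \<and> n mod W = \<nu> \<and> prime (n + h) \<and> S \<subseteq> sieving_primes P (H - {h}) n. ln (real (n + h)))
       - real N / real (totient W) * (\<Prod>p\<in>S. (real (card H) - 1) / (real p - 1))\<bar>
     \<le> real (card H) ^ card S * (theta_error (2 * N + h) (W * \<Prod>S) + theta_error (N + h) (W * \<Prod>S))"
proof -
  define q where "q = W * \<Prod>S"
  have PS: "\<Prod>S > 0" using S prod_primes_pos[of S] by auto
  have q: "q > 1" unfolding q_def using PS W by (metis One_nat_def less_1_mult less_one linorder_neqE_nat mult.right_neutral not_less0)
  define C where "C = crt_classes W \<nu> (bad_residues (H - {h})) S"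
  have pos: "p > 0" if "p \<in> S" for p using S(2)[OF that] prime_gt_0_nat by auto
  have cC: "real (card C) = (\<Prod>p\<in>S. real (card H) - 1)"
  proof -
    have "card C = (\<Prod>p\<in>S. card (bad_residues (H - {h}) p))"
      unfolding C_def using S \<nu> by (intro card_crt_classes) (auto simp: bad_residues_def)
    also have "\<dots> = (\<Prod>p\<in>S. card (H - {h}))"
      using S H pos by (intro prod.cong card_bad_residues) (auto intro: inj_on_subset)
    finally have "real (card C) = (\<Prod>p\<in>S. real (card (H - {h})))" by simp
    moreover have "real (card (H - {h})) = real (card H) - 1" using card_Suc_Diff1[OF H] by linarith
    ultimately show ?thesis by simp
  qed
  have cop: "coprime (c + h) q" if "c \<in> C" for c
  proof -
    have c: "c mod W = \<nu>" "\<forall>p\<in>S. c mod p \<in> bad_residues (H - {h}) p" using that by (auto simp: C_def crt_classes_def)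
    have "coprime (c + h) W" using \<nu>(2) c(1)
      by (metis coprime_mod_left_iff mod_add_left_eq neq0_conv not_less0 \<nu>(1))
    moreover have "coprime (c + h) p" if p: "p \<in> S" for p
    proof -
      have "prime p" "inj_on (\<lambda>h. h mod p) H" using S(2)[OF p] by auto
      obtain h' where h': "h' \<in> H" "h' \<noteq> h" "p dvd c + h'"
        using c(2) p pos[OF p] mod_in_bad_residues[of p c "H - {h}"] by auto
      have "\<not> p dvd c + h"
      proof
        assume "p dvd c + h"
        then have "(c + h) mod p = (c + h') mod p" using h' by simp
        then have "[h = h'] (mod p)" using cong_add_lcancel_nat[of c h h' p] by (simp add: unique_euclidean_semiring_class.cong_def)
        then have "h = h'" using \<open>inj_on _ H\<close> H(2) h'(1) by (auto simp: unique_euclidean_semiring_class.cong_def dest: inj_onD)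
        then show False using h' by simp
      qed
      then show ?thesis using prime_imp_coprime[OF \<open>prime p\<close>, of "c + h"] coprime_commute by blast
    qed
    ultimately show ?thesis unfolding q_def by (auto intro: prod_coprime_right)
  qed
  let ?I = "\<lambda>c. {n. n \<in> {N<..2 * N} \<and> n mod q = c \<and> prime (n + h)}"
  have theta: "(\<Sum>n\<in>?I c. ln (real (n + h))) = theta_progression (2 * N + h) q (c + h) - theta_progression (N + h) q (c + h)"
    if c: "c \<in> C" for c
  proof -
    have clt: "c < q" using c by (simp add: C_def crt_classes_def q_def)
    have iff: "[n + h = c + h] (mod q) \<longleftrightarrow> n mod q = c" for n
      using cong_add_rcancel_nat[of n h c q] clt by (simp add: unique_euclidean_semiring_class.cong_def)
    have "theta_progression (2 * N + h) q (c + h) = theta_progression (N + h) q (c + h) +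
       (\<Sum>p | prime p \<and> N + h < p \<and> p \<le> 2 * N + h \<and> [p = c + h] (mod q). ln (real p))"
      unfolding theta_progression_def by (subst sum.union_disjoint[symmetric]) (auto intro!: sum.cong)
    moreover have "(\<Sum>p | prime p \<and> N + h < p \<and> p \<le> 2 * N + h \<and> [p = c + h] (mod q). ln (real p)) =
       (\<Sum>n\<in>?I c. ln (real (n + h)))"
    proof (rule sum.reindex_bij_witness[of _ "\<lambda>n. n + h" "\<lambda>p. p - h"])
      fix p assume "p \<in> {p. prime p \<and> N + h < p \<and> p \<le> 2 * N + h \<and> [p = c + h] (mod q)}"
      then show "p - h + h = p" "p - h \<in> ?I c" "ln (real (p - h + h)) = ln (real p)"
        using iff[of "p - h"] by auto
    qed (use iff in auto)
    ultimately show ?thesis by simp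
  qed
  have "{n. n \<in> {N<..2 * N} \<and> n mod W = \<nu> \<and> prime (n + h) \<and> S \<subseteq> sieving_primes P (H - {h}) n} = (\<Union>c\<in>C. ?I c)"
    using mod_in_crt_classes_iff[OF S(1), of W _ \<nu> "bad_residues (H - {h})"] W PS S(3) pos
    by (auto simp: C_def q_def mod_in_bad_residues sieving_primes_def subset_iff)
  then have "(\<Sum>n | n \<in> {N<..2 * N} \<and> n mod W = \<nu> \<and> prime (n + h) \<and> S \<subseteq> sieving_primes P (H - {h}) n. ln (real (n + h))) =
     (\<Sum>c\<in>C. \<Sum>n\<in>?I c. ln (real (n + h)))"
    by (simp only:) (rule sum.UNION_disjoint, auto simp: C_def)
  also have "\<dots> = (\<Sum>c\<in>C. theta_progression (2 * N + h) q (c + h) - theta_progression (N + h) q (c + h))"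
    by (intro sum.cong refl theta)
  finally have eq1: "(\<Sum>n | n \<in> {N<..2 * N} \<and> n mod W = \<nu> \<and> prime (n + h) \<and> S \<subseteq> sieving_primes P (H - {h}) n. ln (real (n + h))) = \<dots>" .
  have "totient q = totient W * (\<Prod>p\<in>S. p - 1)"
  proof -
    have "coprime W (\<Prod>S)" using S by (intro prod_coprime_right) (auto simp: coprime_commute)
    then have "totient q = totient W * totient (\<Prod>S)" unfolding q_def by (rule totient_mult_coprime)
    moreover have "totient (\<Prod>S) = (\<Prod>p\<in>S. totient p)"
      using S by (subst totient_prod_coprime) (auto simp: pairwise_def intro!: primes_coprime)
    ultimately show ?thesis using S by (simp add: totient_prime cong: prod.cong)
  qed
  then have "real (totient q) = real (totient W) * (\<Prod>p\<in>S. real p - 1)"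
    using pos by (simp add: of_nat_diff Suc_le_eq)
  then have eq2: "real N / real (totient W) * (\<Prod>p\<in>S. (real (card H) - 1) / (real p - 1)) =
     (\<Sum>c\<in>C. real (2 * N + h) / real (totient q) - real (N + h) / real (totient q))"
    by (simp add: cC prod_dividef diff_divide_distrib[symmetric])
  have "\<bar>(\<Sum>c\<in>C. theta_progression (2 * N + h) q (c + h) - theta_progression (N + h) q (c + h)) -
      (\<Sum>c\<in>C. real (2 * N + h) / real (totient q) - real (N + h) / real (totient q))\<bar> \<le>
     (\<Sum>c\<in>C. theta_error (2 * N + h) q + theta_error (N + h) q)"
    unfolding sum_subtractf[symmetric]
  proof (intro order.trans[OF sum_abs] sum_mono)
    fix c assume "c \<in> C"
    from theta_error_ge[OF q cop[OF this], of "2 * N + h"] theta_error_ge[OF q cop[OF this], of "N + h"]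
    show "\<bar>theta_progression (2 * N + h) q (c + h) - theta_progression (N + h) q (c + h) -
      (real (2 * N + h) / real (totient q) - real (N + h) / real (totient q))\<bar> \<le>
      theta_error (2 * N + h) q + theta_error (N + h) q" by linarith
  qed
  also have "\<dots> = real (card C) * (theta_error (2 * N + h) q + theta_error (N + h) q)" by simp
  also have "\<dots> \<le> real (card H) ^ card S * (theta_error (2 * N + h) q + theta_error (N + h) q)"
  proof (rule mult_right_mono)
    have "real (card H) - 1 \<ge> 0" using H by (auto simp: Suc_le_eq card_gt_0_iff)
    then show "real (card C) \<le> real (card H) ^ card S" unfolding cC by (simp add: power_mono)
    have "coprime 1 q" by simp
    from theta_error_ge[OF q this, of "2 * N + h"] theta_error_ge[OF q this, of "N + h"]
    show "0 \<le> theta_error (2 * N + h) q + theta_error (N + h) q" by linarith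
  qed
  finally show ?thesis unfolding eq1 eq2 q_def .
qed

subsection \<open>The sieve weights\<close>

text \<open>Shifts distinct modulo every prime of \<open>P\<close> make the density of a prime
  exactly \<open>k / p\<close>, and \<open>p > 2 * k\<close> keeps this below one half, so that the
  diagonal weights \<open>k / (p - k)\<close> are nonnegative and of the size of
  \<open>k / p\<close>.\<close>

locale sieve_setup =
  fixes H Z P :: "nat set" and X :: real and k l :: nat
  assumes finZ: "finite Z" and primeZ: "\<And>p. p \<in> Z \<Longrightarrow> prime p"
    and P_def: "P = {p. prime p \<and> ln (real p) \<le> X} - Z"
    and finH: "finite H" and cardH: "card H = k" and k: "k \<ge> 1" and l: "l \<ge> 1"
    and P_gt: "\<And>p. p \<in> P \<Longrightarrow> p > 2 * k"
    and H_inj: "\<And>p. p \<in> P \<Longrightarrow> inj_on (\<lambda>h. h mod p) H"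
    and X: "X \<ge> 0"
begin

definition u :: "nat \<Rightarrow> real" where "u p = real k / real p"

definition y :: "nat set \<Rightarrow> real" where "y M = max 0 (X - lnsum M) ^ l"

definition lam :: "nat set \<Rightarrow> real" where "lam = selberg u P y"

definition weight :: "nat \<Rightarrow> real" where
  "weight n = (\<Sum>A\<in>Pow (sieving_primes P H n). lam A)\<^sup>2"

text \<open>The number of residue classes over all moduli up to \<open>exp X\<close>, squared: it
  bounds the accumulated rounding errors when the coefficients are normalised by
  \<open>lam {}\<close>.\<close>

definition error :: real where "error = (osum (\<lambda>p. real k) P X)\<^sup>2"

definition \<Phi> :: real where "\<Phi> = (\<Prod>p\<in>Z. 1 - 1 / real p)"

lemma finP: "finite P" by (simp add: P_def)

lemma primeP: "p \<in> P \<Longrightarrow> prime p" by (simp add: P_def)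

lemma P_real: "p \<in> P \<Longrightarrow> real p > 2 * real k"
  using P_gt[of p] by (metis of_nat_less_iff of_nat_mult of_nat_numeral)

lemma u01: "p \<in> P \<Longrightarrow> 0 \<le> u p \<and> u p < 1"
  using P_real[of p] k by (auto simp: u_def divide_simps)

lemma u_neq1: "p \<in> P \<Longrightarrow> u p \<noteq> 1"
  using u01 by force

lemma v_eq: "p \<in> P \<Longrightarrow> u p / (1 - u p) = real k / (real p - real k)"
  using P_real[of p] by (simp add: u_def divide_simps)

lemma v_nonneg: "p \<in> P \<Longrightarrow> 0 \<le> real k / (real p - real k)"
  using P_real[of p] by simp

lemma v_prod_nonneg: "M \<subseteq> P \<Longrightarrow> 0 \<le> (\<Prod>p\<in>M. real k / (real p - real k))"
  by (intro prod_nonneg) (blast intro: v_nonneg)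

lemma y_nonneg: "0 \<le> y M" by (simp add: y_def)

lemma y_antimono: "M \<subseteq> M' \<Longrightarrow> M' \<subseteq> P \<Longrightarrow> y M' \<le> y M"
  unfolding y_def using finP primeP
  by (intro power_max_le diff_left_mono lnsum_mono) (auto intro: finite_subset)

lemma lnsum_mono_P: "A \<subseteq> B \<Longrightarrow> B \<subseteq> P \<Longrightarrow> lnsum A \<le> lnsum B"
  using finP primeP by (intro lnsum_mono) (auto intro: finite_subset)

lemma lam_le: "A \<subseteq> P \<Longrightarrow> \<bar>lam A\<bar> \<le> lam {}"
  unfolding lam_def by (intro selberg_abs_le finP u01 y_nonneg y_antimono) auto

lemma lam_eq_0:
  assumes "A \<subseteq> P" "lnsum A > X"
  shows "lam A = 0"
proof -
  have "y (A \<union> B) = 0" if "B \<in> Pow (P - A)" for B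
  proof -
    have "lnsum A \<le> lnsum (A \<union> B)" using assms that by (intro lnsum_mono_P) auto
    then have "max 0 (X - lnsum (A \<union> B)) = 0" using assms by simp
    then show ?thesis using l by (simp add: y_def)
  qed
  then show ?thesis by (simp add: lam_def selberg_def)
qed

lemma lam_nonneg: "0 \<le> lam {}" using lam_le[of "{}"] by simp

lemma lam_le_of_bool: "A \<subseteq> P \<Longrightarrow> \<bar>lam A\<bar> \<le> lam {} * of_bool (lnsum A \<le> X)"
  using lam_le[of A] lam_eq_0[of A] by (cases "lnsum A \<le> X") auto

lemma lam_empty: "lam {} = msum (\<lambda>p. real k / (real p - real k)) P l X"
proof -
  have "lam {} = (\<Sum>B\<in>Pow P. (\<Prod>p\<in>B. u p / (1 - u p)) * y B)"
    by (simp add: lam_def selberg_def)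
  also have "\<dots> = (\<Sum>B\<in>Pow P. (\<Prod>p\<in>B. real k / (real p - real k)) * y B)"
    by (intro sum.cong refl arg_cong2[of _ _ _ _ "(*)"] prod.cong) (auto simp: v_eq)
  finally show ?thesis by (simp add: msum_def y_def)
qed

lemma quad_form_lam: "quad_form u P lam = msum (\<lambda>p. real k / (real p - real k)) P (2 * l) X"
proof -
  have "quad_form u P lam = (\<Sum>M\<in>Pow P. (\<Prod>p\<in>M. u p / (1 - u p)) * (y M)\<^sup>2)"
    unfolding lam_def by (intro quad_form_selberg finP u_neq1)
  also have "\<dots> = (\<Sum>M\<in>Pow P. (\<Prod>p\<in>M. real k / (real p - real k)) * (y M)\<^sup>2)"
    by (intro sum.cong refl arg_cong2[of _ _ _ _ "(*)"] prod.cong) (auto simp: v_eq)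
  finally show ?thesis by (simp add: msum_def y_def power_mult[symmetric] mult.commute)
qed

lemma card_Un_power_le:
  assumes "A \<subseteq> P" "B \<subseteq> P"
  shows "real k ^ card (A \<union> B) \<le> (\<Prod>p\<in>A. real k) * (\<Prod>p\<in>B. real k)"
proof -
  have "real k ^ card (A \<union> B) \<le> real k ^ (card A + card B)"
    using k by (intro power_increasing card_Un_le) auto
  then show ?thesis by (simp add: power_add)
qed

lemma error_sum_le:
  assumes L: "\<And>A. A \<subseteq> Q \<Longrightarrow> \<bar>L A\<bar> \<le> c * of_bool (lnsum A \<le> X)" and Q: "Q \<subseteq> P" and c: "c \<ge> 0"
  shows "(\<Sum>A\<in>Pow Q. \<Sum>B\<in>Pow Q. \<bar>L A\<bar> * \<bar>L B\<bar> * real k ^ card (A \<union> B)) \<le> c\<^sup>2 * error"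
proof -
  have "(\<Sum>A\<in>Pow Q. \<Sum>B\<in>Pow Q. \<bar>L A\<bar> * \<bar>L B\<bar> * real k ^ card (A \<union> B)) \<le>
    (\<Sum>A\<in>Pow Q. \<Sum>B\<in>Pow Q. (c * of_bool (lnsum A \<le> X)) * (c * of_bool (lnsum B \<le> X)) *
       ((\<Prod>p\<in>A. real k) * (\<Prod>p\<in>B. real k)))"
    using L Q c by (intro sum_mono mult_mono card_Un_power_le) (auto intro!: mult_nonneg_nonneg)
  also have "\<dots> = (\<Sum>A\<in>Pow Q. \<Sum>B\<in>Pow Q. c\<^sup>2 * (((\<Prod>p\<in>A. real k) * of_bool (lnsum A \<le> X)) *
       ((\<Prod>p\<in>B. real k) * of_bool (lnsum B \<le> X))))"
    by (intro sum.cong refl) (simp only: power2_eq_square mult_ac)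
  also have "\<dots> = c\<^sup>2 * (osum (\<lambda>p. real k) Q X)\<^sup>2"
    unfolding osum_def power2_eq_square[of "sum _ _"] sum_product by (simp only: sum_distrib_left)
  also have "\<dots> \<le> c\<^sup>2 * error"
  proof -
    have "osum (\<lambda>p. real k) Q X \<le> osum (\<lambda>p. real k) P X"
      unfolding osum_def using Q finP by (intro sum_mono2) auto
    moreover have "0 \<le> osum (\<lambda>p. real k) Q X" by (intro osum_nonneg) auto
    ultimately show ?thesis unfolding error_def by (intro mult_left_mono power_mono) auto
  qed
  finally show ?thesis .
qed

text \<open>Below the cutoff the product of the primes of \<open>A\<close> is at most
  \<open>exp X\<close>. Inserting \<open>exp X\<close> divided by this product turns the count into
  a sum with weights \<open>k / p\<close>, bounded by the \<open>k\<close>-th power of a harmonic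
  sum.\<close>

lemma error_le: "error \<le> exp (2 * X) * (2 + X) ^ (2 * k)"
proof -
  have "osum (\<lambda>p. real k) P X \<le> (\<Sum>A\<in>Pow P. exp X * ((\<Prod>p\<in>A. real k * (1 / real p)) * of_bool (lnsum A \<le> X)))"
    unfolding osum_def
  proof (rule sum_mono)
    fix A assume A: "A \<in> Pow P"
    have A': "\<And>p. p \<in> A \<Longrightarrow> prime p" using A primeP by auto
    have pos: "0 < (\<Prod>p\<in>A. real p)" using A' by (intro prod_pos) (auto simp: prime_gt_0_nat)
    show "(\<Prod>p\<in>A. real k) * of_bool (lnsum A \<le> X) \<le> exp X * ((\<Prod>p\<in>A. real k * (1 / real p)) * of_bool (lnsum A \<le> X))"
    proof (cases "lnsum A \<le> X")
      case True
      have "(\<Prod>p\<in>A. real p) \<le> exp X"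
        using True lnsum_eq_ln_prod[OF A'] pos by (simp add: ln_le_iff_le_exp)
      then have "(\<Prod>p\<in>A. real k) * 1 \<le> (\<Prod>p\<in>A. real k) * (exp X / (\<Prod>p\<in>A. real p))"
        using pos by (intro mult_left_mono) auto
      then show ?thesis using True by (simp add: prod_dividef field_simps)
    qed simp
  qed
  also have "\<dots> = exp X * osum (\<lambda>p. real k * (1 / real p)) P X"
    by (simp only: osum_def sum_distrib_left)
  also have "\<dots> \<le> exp X * osum (\<lambda>p. 1 / real p) P X ^ k"
    using finP primeP X by (intro mult_left_mono osum_mult_le_power) auto
  also have "\<dots> \<le> exp X * (2 + X) ^ k"
  proof (intro mult_left_mono power_mono osum_nonneg)
    have "osum (\<lambda>p. 1 / real p) P X \<le> 1 + ln (real (\<Prod>{})) + (\<Prod>p\<in>{}. 1 - 1 / real p) * (1 + X)"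
      unfolding osum_alt[OF finP] by (rule sum_prod_inverse_le) (use finP primeP X in auto)
    then show "osum (\<lambda>p. 1 / real p) P X \<le> 2 + X" by simp
  qed auto
  finally have "(osum (\<lambda>p. real k) P X)\<^sup>2 \<le> (exp X * (2 + X) ^ k)\<^sup>2"
    by (intro power_mono osum_nonneg) auto
  also have "\<dots> = exp (2 * X) * (2 + X) ^ (2 * k)"
    by (simp add: power_mult_distrib power_mult[symmetric] mult.commute exp_double[symmetric])
  finally show ?thesis by (simp add: error_def)
qed

lemma sum_weight_approx:
  assumes W: "\<nu> < W" "\<And>p. p \<in> P \<Longrightarrow> coprime p W"
  shows "\<bar>(\<Sum>n | n \<in> {N<..2 * N} \<and> n mod W = \<nu>. weight n) -
    real N / real W * msum (\<lambda>p. real k / (real p - real k)) P (2 * l) X\<bar> \<le> (lam {})\<^sup>2 * error"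
proof -
  let ?I = "{n. n \<in> {N<..2 * N} \<and> n mod W = \<nu>}"
  have "\<bar>(\<Sum>n\<in>?I. 1 * (\<Sum>A\<in>Pow (sieving_primes P H n). lam A)\<^sup>2) - real N / real W * quad_form u P lam\<bar> \<le>
    (\<Sum>A\<in>Pow P. \<Sum>B\<in>Pow P. \<bar>lam A\<bar> * \<bar>lam B\<bar> * real k ^ card (A \<union> B))"
  proof (rule sum_square_approx[OF finP])
    fix S assume S: "S \<subseteq> P"
    have "(\<Sum>n | n \<in> ?I \<and> S \<subseteq> sieving_primes P H n. 1) =
      real (card {n \<in> {N<..2 * N}. n mod W = \<nu> \<and> S \<subseteq> sieving_primes P H n})"
      by (simp add: conj_assoc)
    moreover have "\<bar>\<dots> - real N / real W * (\<Prod>p\<in>S. real (card H) / real p)\<bar> \<le> real (card H) ^ card S"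
      using S W finP primeP H_inj finH
      by (intro card_sieving_primes_approx) (auto intro: finite_subset)
    ultimately show "\<bar>(\<Sum>n | n \<in> ?I \<and> S \<subseteq> sieving_primes P H n. 1) - real N / real W * (\<Prod>p\<in>S. u p)\<bar> \<le> real k ^ card S"
      by (simp add: u_def cardH)
  qed (auto simp: sieving_primes_def)
  also have "\<dots> \<le> (lam {})\<^sup>2 * error"
    by (intro error_sum_le lam_le_of_bool lam_nonneg) auto
  finally show ?thesis by (simp add: weight_def quad_form_lam)
qed

text \<open>Adding \<open>p\<close> lowers the argument by at most \<open>ln p\<close>, so the
  \<open>l\<close>-th powers differ by at most \<open>l * ln p\<close> times the power with exponent
  \<open>l - 1\<close>.\<close>

lemma y_diff_le:
  assumes "M \<subseteq> P - {p}" "p \<in> P"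
  shows "(y M - y (insert p M))\<^sup>2 \<le> (real l)\<^sup>2 * (ln (real p))\<^sup>2 * max 0 (X - lnsum M) ^ (2 * l - 2)"
proof -
  obtain m where m: "l = Suc m" using l by (cases l) auto
  let ?a = "max 0 (X - lnsum M)" and ?b = "max 0 (X - lnsum (insert p M))"
  have lp: "ln (real p) > 0" using assms primeP ln_prime_pos by auto
  have ins: "lnsum (insert p M) = ln (real p) + lnsum M"
    using assms finP by (intro lnsum_insert) (auto intro: finite_subset)
  have ab: "?b \<le> ?a" "?a - ?b \<le> ln (real p)" "0 \<le> ?b" using lp by (auto simp: ins)
  have "?a ^ Suc m - ?b ^ Suc m = (?a - ?b) * (\<Sum>i<Suc m. ?a ^ i * ?b ^ (m - i))"
    using diff_power_eq_sum[of ?a m ?b] by simp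
  also have "\<dots> \<le> ln (real p) * (\<Sum>i<Suc m. ?a ^ m)"
  proof (intro mult_mono ab sum_mono)
    fix i assume "i \<in> {..<Suc m}"
    then have "?a ^ m = ?a ^ i * ?a ^ (m - i)" by (simp add: power_add[symmetric])
    then show "?a ^ i * ?b ^ (m - i) \<le> ?a ^ m"
      using ab by (auto intro!: mult_left_mono power_mono)
  qed (use lp ab in \<open>auto intro!: sum_nonneg add_nonneg_nonneg mult_nonneg_nonneg\<close>)
  finally have "y M - y (insert p M) \<le> ln (real p) * (real l * ?a ^ m)"
    unfolding y_def unfolding m by simp
  moreover have "0 \<le> y M - y (insert p M)"
    using ab by (auto simp: y_def intro: power_mono)
  ultimately have "(y M - y (insert p M))\<^sup>2 \<le> (ln (real p) * (real l * ?a ^ m))\<^sup>2"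
    by (intro power_mono)
  also have "\<dots> = (real l)\<^sup>2 * (ln (real p))\<^sup>2 * ?a ^ (2 * l - 2)"
    by (simp add: m power_mult_distrib power_mult[symmetric] mult_ac)
  finally show ?thesis .
qed

text \<open>Conditioning on \<open>p\<close> dividing the product replaces \<open>y M\<close> by \<open>y M - y (insert p M)\<close>,
  which is small when \<open>p\<close> is a small power of the sieving level.\<close>

lemma sum_weight_dvd_le:
  assumes W: "\<nu> < W" "\<And>p. p \<in> P \<Longrightarrow> coprime p W" and p0: "p0 \<in> P"
  shows "(\<Sum>n | n \<in> {N<..2 * N} \<and> n mod W = \<nu> \<and> p0 \<in> sieving_primes P H n. weight n) \<le>
    real N / real W * (real k / real p0) * (real l)\<^sup>2 * (ln (real p0))\<^sup>2 *
      msum (\<lambda>p. real k / (real p - real k)) P (2 * l - 2) X + 4 * real k * (lam {})\<^sup>2 * error"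
proof -
  define Q where "Q = P - {p0}"
  have Q: "P = insert p0 Q" "p0 \<notin> Q" "finite Q" "Q \<subseteq> P" using p0 finP by (auto simp: Q_def)
  let ?I = "{n. n \<in> {N<..2 * N} \<and> n mod W = \<nu> \<and> p0 \<in> sieving_primes P H n}"
  let ?D = "\<lambda>n. sieving_primes P H n - {p0}"
  define L where "L A = lam A + lam (insert p0 A)" for A
  have wt: "weight n = (\<Sum>A\<in>Pow (?D n). L A)\<^sup>2" if n: "n \<in> ?I" for n
  proof -
    have "sieving_primes P H n = insert p0 (?D n)" using n by auto
    moreover have "finite (?D n)" using finP by (auto simp: sieving_primes_def)
    ultimately have "(\<Sum>A\<in>Pow (sieving_primes P H n). lam A) = (\<Sum>A\<in>Pow (?D n). L A)"
      unfolding L_def using sum_Pow_insert[of "?D n" p0 lam] by auto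
    then show ?thesis by (simp add: weight_def)
  qed
  have "\<bar>(\<Sum>n\<in>?I. 1 * (\<Sum>A\<in>Pow (?D n). L A)\<^sup>2) - (real N / real W * u p0) * quad_form u Q L\<bar> \<le>
    (\<Sum>A\<in>Pow Q. \<Sum>B\<in>Pow Q. \<bar>L A\<bar> * \<bar>L B\<bar> * (real k * real k ^ card (A \<union> B)))"
  proof (rule sum_square_approx[OF Q(3)])
    fix S assume S: "S \<subseteq> Q"
    have fS: "finite S" "p0 \<notin> S" using S Q by (auto intro: finite_subset)
    have "{n. n \<in> ?I \<and> S \<subseteq> ?D n} = {n \<in> {N<..2 * N}. n mod W = \<nu> \<and> insert p0 S \<subseteq> sieving_primes P H n}"
      using S Q by auto
    then have "(\<Sum>n | n \<in> ?I \<and> S \<subseteq> ?D n. 1) =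
      real (card {n \<in> {N<..2 * N}. n mod W = \<nu> \<and> insert p0 S \<subseteq> sieving_primes P H n})" by simp
    moreover have "\<bar>\<dots> - real N / real W * (\<Prod>p\<in>insert p0 S. real (card H) / real p)\<bar> \<le> real (card H) ^ card (insert p0 S)"
      using S W finP primeP H_inj finH Q fS
      by (intro card_sieving_primes_approx) auto
    ultimately show "\<bar>(\<Sum>n | n \<in> ?I \<and> S \<subseteq> ?D n. 1) - real N / real W * u p0 * (\<Prod>p\<in>S. u p)\<bar> \<le> real k * real k ^ card S"
      using fS by (simp add: u_def cardH)
  qed (auto simp: sieving_primes_def Q_def)
  moreover have "(\<Sum>A\<in>Pow Q. \<Sum>B\<in>Pow Q. \<bar>L A\<bar> * \<bar>L B\<bar> * (real k * real k ^ card (A \<union> B))) =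
     real k * (\<Sum>A\<in>Pow Q. \<Sum>B\<in>Pow Q. \<bar>L A\<bar> * \<bar>L B\<bar> * real k ^ card (A \<union> B))"
    unfolding sum_distrib_left by (intro sum.cong refl) (simp only: mult_ac)
  \<comment> \<open>Each \<open>L A\<close> is a sum of two values of \<open>lam\<close>; doubling
    the bound for the coefficients produces the factor 4 in the error.\<close>
  moreover have "(\<Sum>A\<in>Pow Q. \<Sum>B\<in>Pow Q. \<bar>L A\<bar> * \<bar>L B\<bar> * real k ^ card (A \<union> B)) \<le> (2 * lam {})\<^sup>2 * error"
  proof (rule error_sum_le[OF _ Q(4)])
    fix A assume A: "A \<subseteq> Q"
    have le: "lnsum A \<le> lnsum (insert p0 A)" using A Q by (intro lnsum_mono_P) auto
    have "\<bar>lam A\<bar> \<le> lam {} * of_bool (lnsum A \<le> X)" using A Q by (intro lam_le_of_bool) auto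
    moreover have "\<bar>lam (insert p0 A)\<bar> \<le> lam {} * of_bool (lnsum A \<le> X)"
      using lam_le_of_bool[of "insert p0 A"] A Q le lam_nonneg
      by (cases "lnsum (insert p0 A) \<le> X"; cases "lnsum A \<le> X") auto
    ultimately show "\<bar>L A\<bar> \<le> 2 * lam {} * of_bool (lnsum A \<le> X)" unfolding L_def by linarith
  qed (simp add: lam_nonneg)
  then have "real k * (\<Sum>A\<in>Pow Q. \<Sum>B\<in>Pow Q. \<bar>L A\<bar> * \<bar>L B\<bar> * real k ^ card (A \<union> B)) \<le> real k * ((2 * lam {})\<^sup>2 * error)"
    by (rule mult_left_mono) simp
  moreover have "quad_form u Q L \<le> (real l)\<^sup>2 * (ln (real p0))\<^sup>2 * msum (\<lambda>p. real k / (real p - real k)) P (2 * l - 2) X"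
  proof -
    have "quad_form u Q L = quad_form u Q (selberg u Q (\<lambda>M. y M - y (insert p0 M)))"
      unfolding L_def lam_def
      using selberg_add_insert[where u = u, OF Q(3,2) _ u_neq1[OF p0], folded Q(1)] by (intro quad_form_cong) auto
    also have "\<dots> = (\<Sum>M\<in>Pow Q. (\<Prod>p\<in>M. u p / (1 - u p)) * (y M - y (insert p0 M))\<^sup>2)"
      using Q u_neq1 by (intro quad_form_selberg) auto
    also have "\<dots> = (\<Sum>M\<in>Pow Q. (\<Prod>p\<in>M. real k / (real p - real k)) * (y M - y (insert p0 M))\<^sup>2)"
      using Q(4) by (intro sum.cong refl arg_cong2[of _ _ _ _ "(*)"] prod.cong) (auto simp: v_eq)
    also have "\<dots> \<le> (\<Sum>M\<in>Pow Q. (\<Prod>p\<in>M. real k / (real p - real k)) *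
        ((real l)\<^sup>2 * (ln (real p0))\<^sup>2 * max 0 (X - lnsum M) ^ (2 * l - 2)))"
    proof (intro sum_mono mult_left_mono)
      fix M assume M: "M \<in> Pow Q"
      then show "(y M - y (insert p0 M))\<^sup>2 \<le> (real l)\<^sup>2 * (ln (real p0))\<^sup>2 * max 0 (X - lnsum M) ^ (2 * l - 2)"
        using p0 by (intro y_diff_le) (auto simp: Q_def)
      show "0 \<le> (\<Prod>p\<in>M. real k / (real p - real k))" using M Q(4) by (intro v_prod_nonneg) auto
    qed
    also have "\<dots> \<le> (\<Sum>M\<in>Pow P. (\<Prod>p\<in>M. real k / (real p - real k)) *
        ((real l)\<^sup>2 * (ln (real p0))\<^sup>2 * max 0 (X - lnsum M) ^ (2 * l - 2)))"
    proof (intro sum_mono2)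
      fix M assume "M \<in> Pow P - Pow Q"
      then have "0 \<le> (\<Prod>p\<in>M. real k / (real p - real k))" by (intro v_prod_nonneg) auto
      then show "0 \<le> (\<Prod>p\<in>M. real k / (real p - real k)) *
        ((real l)\<^sup>2 * (ln (real p0))\<^sup>2 * max 0 (X - lnsum M) ^ (2 * l - 2))"
        by (intro mult_nonneg_nonneg) auto
    qed (use Q(4) finP in auto)
    also have "\<dots> = (real l)\<^sup>2 * (ln (real p0))\<^sup>2 * msum (\<lambda>p. real k / (real p - real k)) P (2 * l - 2) X"
      unfolding msum_def sum_distrib_left by (intro sum.cong refl) (simp only: mult_ac)
    finally show ?thesis .
  qed
  then have "real N / real W * u p0 * quad_form u Q L \<le> real N / real W * u p0 *
     ((real l)\<^sup>2 * (ln (real p0))\<^sup>2 * msum (\<lambda>p. real k / (real p - real k)) P (2 * l - 2) X)"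
    by (intro mult_left_mono) (auto simp: u_def)
  moreover have "(\<Sum>n\<in>?I. weight n) = (\<Sum>n\<in>?I. 1 * (\<Sum>A\<in>Pow (?D n). L A)\<^sup>2)"
    by (intro sum.cong refl) (simp only: wt mult_1)
  ultimately show ?thesis by (simp add: u_def power_mult_distrib algebra_simps)
qed

text \<open>The sets that occur are unions of two sets below the cutoff \<open>X\<close>, hence the
  bound \<open>2 * X\<close>. The parameter \<open>b\<close> becomes \<open>4 * k\<close>: per
  prime, \<open>k\<close> bounds the residue classes and 4 the ways to write a set as a union of
  two.\<close>

definition theta_err :: "nat \<Rightarrow> nat \<Rightarrow> nat \<Rightarrow> real" where
  "theta_err M W b = (\<Sum>S | S \<in> Pow P \<and> lnsum S \<le> 2 * X. real b ^ card S * theta_error M (W * \<Prod>S))"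

text \<open>Change the density to \<open>u' p = (k - 1) / (p - 1)\<close>. Then
  \<open>(u p - u' p) / (1 - u p)\<close> is exactly \<open>1 / (p - 1)\<close>, so the new diagonal
  variables are sums of dimension one, for which the elementary lower bound holds; being
  nonnegative, these lower bounds may be squared.\<close>

lemma sum_ln_weight_ge:
  assumes W: "\<nu> < W" "W > 1" "\<And>p. p \<in> P \<Longrightarrow> coprime p W" and h: "h \<in> H" "coprime (\<nu> + h) W"
    and XN: "X < ln (real N)" and k2: "k \<ge> 2"
  shows "(\<Sum>n | n \<in> {N<..2 * N} \<and> n mod W = \<nu> \<and> prime (n + h). ln (real (n + h)) * weight n) \<ge>
     real N / real (totient W) * \<Phi>\<^sup>2 / (real (l + 1))\<^sup>2 *
        msum (\<lambda>p. (real k - 1) / (real p - real k)) P (2 * l + 2) X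
     - (lam {})\<^sup>2 * (theta_err (2 * N + h) W (4 * k) + theta_err (N + h) W (4 * k))"
proof -
  define u' where "u' p = (real k - 1) / (real p - 1)" for p :: nat
  have N0: "real N > 0" "N > 0" using XN X by (auto intro!: Nat.gr0I)
  have pN: "real p < real N" if "p \<in> P" for p
  proof -
    have "ln (real p) < ln (real N)" using that XN by (auto simp: P_def)
    then show ?thesis using primeP[OF that] prime_gt_0_nat[of p] N0 by simp
  qed
  have pk: "real p > 2 * real k" "real p > 1" "real k \<ge> 2" "real p - real k > 0" if "p \<in> P" for p
    using P_real[OF that] k2 by auto
  have u'1: "u' p \<noteq> 1" if "p \<in> P" for p using pk[OF that] by (simp add: u'_def divide_simps)
  let ?I = "{n. n \<in> {N<..2 * N} \<and> n mod W = \<nu> \<and> prime (n + h)}"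
  let ?D = "\<lambda>n. sieving_primes P (H - {h}) n"
  let ?E = "\<lambda>S. real k ^ card S * (theta_error (2 * N + h) (W * \<Prod>S) + theta_error (N + h) (W * \<Prod>S))"
  have D: "sieving_primes P H n = ?D n" if "n \<in> ?I" for n
  proof -
    have "\<not> p dvd n + h" if "p \<in> P" for p
    proof
      assume "p dvd n + h"
      then have "p = n + h" using \<open>n \<in> ?I\<close> primeP[OF that] by (auto intro: primes_dvd_imp_eq)
      then show False using pN[OF that] \<open>n \<in> ?I\<close> by auto
    qed
    then show ?thesis by (auto simp: sieving_primes_def)
  qed
  have W1: "W * \<Prod>S > 1" if "S \<subseteq> P" for S
    using W(2) prod_primes_pos[of S] primeP that by (metis One_nat_def less_1_mult less_one linorder_neqE_nat mult.right_neutral not_less0 subset_iff)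
  have E0: "0 \<le> ?E S" if "S \<subseteq> P" for S
    using theta_error_nonneg[OF less_imp_le[OF W1[OF that]]] by (intro mult_nonneg_nonneg add_nonneg_nonneg) auto
  have "\<bar>(\<Sum>n\<in>?I. ln (real (n + h)) * (\<Sum>A\<in>Pow (?D n). lam A)\<^sup>2) - real N / real (totient W) * quad_form u' P lam\<bar> \<le>
    (\<Sum>A\<in>Pow P. \<Sum>B\<in>Pow P. \<bar>lam A\<bar> * \<bar>lam B\<bar> * ?E (A \<union> B))"
  proof (rule sum_square_approx[OF finP])
    fix S assume S: "S \<subseteq> P"
    have "{n. n \<in> ?I \<and> S \<subseteq> ?D n} = {n. n \<in> {N<..2 * N} \<and> n mod W = \<nu> \<and> prime (n + h) \<and> S \<subseteq> ?D n}" by auto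
    moreover have "\<bar>(\<Sum>n | n \<in> {N<..2 * N} \<and> n mod W = \<nu> \<and> prime (n + h) \<and> S \<subseteq> ?D n. ln (real (n + h)))
       - real N / real (totient W) * (\<Prod>p\<in>S. (real (card H) - 1) / (real p - 1))\<bar>
     \<le> real (card H) ^ card S * (theta_error (2 * N + h) (W * \<Prod>S) + theta_error (N + h) (W * \<Prod>S))"
      using S W finP primeP H_inj finH h
      by (intro sum_ln_sieving_primes_approx) (auto intro: finite_subset)
    ultimately show "\<bar>(\<Sum>n | n \<in> ?I \<and> S \<subseteq> ?D n. ln (real (n + h))) - real N / real (totient W) * (\<Prod>p\<in>S. u' p)\<bar> \<le> ?E S"
      by (simp only: u'_def cardH)
  qed (auto simp: sieving_primes_def)
  moreover have "(\<Sum>A\<in>Pow P. \<Sum>B\<in>Pow P. \<bar>lam A\<bar> * \<bar>lam B\<bar> * ?E (A \<union> B)) \<le>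
     (lam {})\<^sup>2 * (theta_err (2 * N + h) W (4 * k) + theta_err (N + h) W (4 * k))"
  proof -
    let ?F = "{S. S \<in> Pow P \<and> lnsum S \<le> 2 * X}"
    have "(\<Sum>A\<in>Pow P. \<Sum>B\<in>Pow P. \<bar>lam A\<bar> * \<bar>lam B\<bar> * ?E (A \<union> B)) \<le>
      (\<Sum>A\<in>Pow P. \<Sum>B\<in>Pow P. (lam {})\<^sup>2 * (of_bool (A \<union> B \<in> ?F) * ?E (A \<union> B)))"
    proof (intro sum_mono)
      fix A B assume AB: "A \<in> Pow P" "B \<in> Pow P"
      have "lnsum (A \<union> B) \<le> lnsum A + lnsum B"
      proof -
        have "lnsum (A \<union> B) = lnsum (A \<union> (B - A))" by simp
        also have "\<dots> = lnsum A + lnsum (B - A)"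
          using AB finP by (intro lnsum_union) (auto intro: finite_subset)
        also have "lnsum (B - A) \<le> lnsum B" using AB by (intro lnsum_mono_P) auto
        finally show ?thesis by simp
      qed
      then have "(of_bool (lnsum A \<le> X) * of_bool (lnsum B \<le> X) :: real) \<le> of_bool (A \<union> B \<in> ?F)"
        using AB by (auto simp: of_bool_def)
      then have 1: "(lam {})\<^sup>2 * (of_bool (lnsum A \<le> X) * of_bool (lnsum B \<le> X)) \<le> (lam {})\<^sup>2 * of_bool (A \<union> B \<in> ?F)"
        by (rule mult_left_mono) simp
      have "\<bar>lam A\<bar> * \<bar>lam B\<bar> \<le> (lam {} * of_bool (lnsum A \<le> X)) * (lam {} * of_bool (lnsum B \<le> X))"
        using AB lam_nonneg by (intro mult_mono lam_le_of_bool) auto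
      also have "\<dots> \<le> (lam {})\<^sup>2 * of_bool (A \<union> B \<in> ?F)" using 1 by (simp only: power2_eq_square mult_ac)
      finally have "\<bar>lam A\<bar> * \<bar>lam B\<bar> * ?E (A \<union> B) \<le> (lam {})\<^sup>2 * of_bool (A \<union> B \<in> ?F) * ?E (A \<union> B)"
        using AB by (intro mult_right_mono E0) auto
      then show "\<bar>lam A\<bar> * \<bar>lam B\<bar> * ?E (A \<union> B) \<le> (lam {})\<^sup>2 * (of_bool (A \<union> B \<in> ?F) * ?E (A \<union> B))"
        by (simp only: mult.assoc)
    qed
    also have "\<dots> = (lam {})\<^sup>2 * (\<Sum>(A, B)\<in>Pow P \<times> Pow P. of_bool (A \<union> B \<in> ?F) * ?E (A \<union> B))"
      by (simp only: sum_distrib_left[symmetric] sum.cartesian_product)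
    also have "(\<Sum>(A, B)\<in>Pow P \<times> Pow P. of_bool (A \<union> B \<in> ?F) * ?E (A \<union> B)) \<le> (\<Sum>S\<in>?F. 4 ^ card S * ?E S)"
    proof -
      let ?g = "\<lambda>S. of_bool (S \<in> ?F) * ?E S"
      have "(\<Sum>(A, B)\<in>Pow P \<times> Pow P. ?g (A \<union> B)) =
         (\<Sum>S\<in>Pow P. \<Sum>AB | AB \<in> Pow P \<times> Pow P \<and> fst AB \<union> snd AB = S. ?g (fst AB \<union> snd AB))"
        by (subst sum.group) (use finP in \<open>auto simp: case_prod_unfold\<close>)
      also have "\<dots> = (\<Sum>S\<in>Pow P. real (card {AB. AB \<in> Pow P \<times> Pow P \<and> fst AB \<union> snd AB = S}) * ?g S)"
        by (intro sum.cong refl) simp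
      also have "\<dots> \<le> (\<Sum>S\<in>Pow P. 4 ^ card S * ?g S)"
      proof (intro sum_mono mult_right_mono)
        fix S assume S: "S \<in> Pow P"
        then have fS: "finite S" using finP by (auto intro: finite_subset)
        have "card {AB. AB \<in> Pow P \<times> Pow P \<and> fst AB \<union> snd AB = S} \<le> card (Pow S \<times> Pow S)"
          using fS by (intro card_mono) auto
        also have "\<dots> = 4 ^ card S" using fS by (simp add: card_Pow card_cartesian_product power_mult_distrib[symmetric])
        finally have "real (card {AB. AB \<in> Pow P \<times> Pow P \<and> fst AB \<union> snd AB = S}) \<le> real (4 ^ card S)"
          by (rule of_nat_mono)
        then show "real (card {AB. AB \<in> Pow P \<times> Pow P \<and> fst AB \<union> snd AB = S}) \<le> 4 ^ card S" by simp
        show "0 \<le> ?g S" using S by (intro mult_nonneg_nonneg E0) auto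
      qed
      also have "\<dots> = (\<Sum>S\<in>?F. 4 ^ card S * ?E S)"
        using finP by (intro sum.mono_neutral_cong_right) auto
      finally show ?thesis .
    qed
    also have "(\<Sum>S\<in>?F. 4 ^ card S * ?E S) = theta_err (2 * N + h) W (4 * k) + theta_err (N + h) W (4 * k)"
      unfolding theta_err_def sum.distrib[symmetric]
      by (intro sum.cong refl) (simp add: power_mult_distrib algebra_simps)
    finally show ?thesis by (simp add: mult_left_mono)
  qed
  moreover have "quad_form u' P lam \<ge> \<Phi>\<^sup>2 / (real (l + 1))\<^sup>2 * msum (\<lambda>p. (real k - 1) / (real p - real k)) P (2 * l + 2) X"
  proof -
    let ?y = "selberg_change u u' P y"
    let ?v = "\<lambda>p::nat. (real k - 1) / (real p - real k)"
    have "quad_form u' P lam = quad_form u' P (selberg u' P ?y)"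
      unfolding lam_def using finP u_neq1 u'1
      by (intro quad_form_cong selberg_eq_selberg_change) auto
    also have "\<dots> = (\<Sum>M\<in>Pow P. (\<Prod>p\<in>M. u' p / (1 - u' p)) * (?y M)\<^sup>2)"
      using finP u'1 by (intro quad_form_selberg) auto
    also have "\<dots> = (\<Sum>M\<in>Pow P. prod ?v M * (?y M)\<^sup>2)"
    proof (intro sum.cong refl arg_cong2[of _ _ _ _ "(*)"] prod.cong)
      fix M p assume "M \<in> Pow P" "p \<in> M"
      then have "p \<in> P" by auto
      from pk[OF this] show "u' p / (1 - u' p) = ?v p" by (simp add: u'_def divide_simps)
    qed
    also have "\<dots> \<ge> (\<Sum>M\<in>Pow P. prod ?v M * (\<Phi> * (max 0 (X - lnsum M) ^ (l + 1) / real (l + 1)))\<^sup>2)"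
    proof (intro sum_mono mult_left_mono power_mono)
      fix M assume M: "M \<in> Pow P"
      have MP: "p \<in> P" if "p \<in> M" for p using M that by auto
      show "0 \<le> prod ?v M" using pk MP by (intro prod_nonneg divide_nonneg_pos) force+
      have \<Phi>0: "\<Phi> \<ge> 0" unfolding \<Phi>_def using primeZ
        by (intro prod_nonneg) (auto simp: divide_le_eq_1 dest: prime_ge_1_nat)
      show "0 \<le> \<Phi> * (max 0 (X - lnsum M) ^ (l + 1) / real (l + 1))" using \<Phi>0 by simp
      have "?y M = (\<Prod>p\<in>M. real p / (real p - 1)) * msum (\<lambda>p. 1 / (real p - 1)) (P - M) l (X - lnsum M)"
        unfolding selberg_change_def msum_def
      proof (intro arg_cong2[of _ _ _ _ "(*)"] prod.cong sum.cong refl)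
        fix p assume "p \<in> M"
        from pk[OF MP[OF this]] show "(1 - u' p) / (1 - u p) = real p / (real p - 1)"
          by (simp add: u'_def u_def divide_simps)
      next
        fix B p assume "B \<in> Pow (P - M)" "p \<in> B"
        then have "p \<in> P" by auto
        from pk[OF this] show "(u p - u' p) / (1 - u p) = 1 / (real p - 1)"
          by (simp add: u'_def u_def divide_simps) (simp add: algebra_simps)
      next
        fix B assume "B \<in> Pow (P - M)"
        then have "lnsum (M \<union> B) = lnsum M + lnsum B"
          using M finP by (intro lnsum_union) (auto intro: finite_subset)
        then show "y (M \<union> B) = max 0 (X - lnsum M - lnsum B) ^ l" by (simp add: y_def algebra_simps)
      qed
      also have "\<dots> \<ge> (\<Prod>p\<in>M. real p / (real p - 1)) *
        (\<Phi> * (\<Prod>p\<in>M. 1 - 1 / real p) * (max 0 (X - lnsum M) ^ (l + 1) / real (l + 1)))"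
      proof (rule mult_left_mono)
        show "\<Phi> * (\<Prod>p\<in>M. 1 - 1 / real p) * (max 0 (X - lnsum M) ^ (l + 1) / real (l + 1)) \<le>
          msum (\<lambda>p. 1 / (real p - 1)) (P - M) l (X - lnsum M)"
          unfolding \<Phi>_def using M by (intro msum_totient_lower_Diff finZ primeZ l P_def) auto
        show "0 \<le> (\<Prod>p\<in>M. real p / (real p - 1))" using pk MP by (intro prod_nonneg divide_nonneg_pos) force+
      qed
      also have "(\<Prod>p\<in>M. real p / (real p - 1)) *
        (\<Phi> * (\<Prod>p\<in>M. 1 - 1 / real p) * (max 0 (X - lnsum M) ^ (l + 1) / real (l + 1))) =
        (\<Prod>p\<in>M. real p / (real p - 1) * (1 - 1 / real p)) * (\<Phi> * (max 0 (X - lnsum M) ^ (l + 1) / real (l + 1)))"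
        by (simp only: prod.distrib mult_ac)
      \<comment> \<open>The factors \<open>p / (p - 1)\<close> from the change of density cancel the
        factors \<open>1 - 1 / p\<close> lost by avoiding the primes of \<open>M\<close>; only the
        cutoff still depends on \<open>M\<close>.\<close>
      also have "(\<Prod>p\<in>M. real p / (real p - 1) * (1 - 1 / real p)) = 1"
      proof (rule prod.neutral, safe)
        fix p assume "p \<in> M"
        from pk[OF MP[OF this]] show "real p / (real p - 1) * (1 - 1 / real p) = 1"
          by (simp add: divide_simps)
      qed
      finally show "\<Phi> * (max 0 (X - lnsum M) ^ (l + 1) / real (l + 1)) \<le> ?y M" by simp
    qed
    also have "(\<Sum>M\<in>Pow P. prod ?v M * (\<Phi> * (max 0 (X - lnsum M) ^ (l + 1) / real (l + 1)))\<^sup>2) =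
      \<Phi>\<^sup>2 / (real (l + 1))\<^sup>2 * msum ?v P (2 * l + 2) X"
    proof -
      have "(max 0 (X - lnsum M) ^ (l + 1))\<^sup>2 = max 0 (X - lnsum M) ^ (2 * l + 2)" for M
        unfolding power_mult[symmetric] by (rule arg_cong2[of _ _ _ _ "(^)"]) auto
      then show ?thesis unfolding msum_def sum_distrib_left power_mult_distrib power_divide
        by (intro sum.cong refl) simp
    qed
    finally show ?thesis .
  qed
  then have "real N / real (totient W) * quad_form u' P lam \<ge> real N / real (totient W) *
     (\<Phi>\<^sup>2 / (real (l + 1))\<^sup>2 * msum (\<lambda>p. (real k - 1) / (real p - real k)) P (2 * l + 2) X)"
    by (intro mult_left_mono) auto
  moreover have "(\<Sum>n\<in>?I. ln (real (n + h)) * weight n) = (\<Sum>n\<in>?I. ln (real (n + h)) * (\<Sum>A\<in>Pow (?D n). lam A)\<^sup>2)"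
    by (intro sum.cong refl) (simp only: weight_def D)
  ultimately show ?thesis by (simp add: algebra_simps)
qed

text \<open>This serves to remove the weights at the end: numbers free of small primes have a
  bounded number of sieving primes, so a large weighted sum over them forces a large count.\<close>

lemma weight_le:
  assumes "card (sieving_primes P H n) \<le> r"
  shows "weight n \<le> (2 ^ r * lam {})\<^sup>2"
proof -
  let ?D = "sieving_primes P H n"
  have fD: "finite ?D" "?D \<subseteq> P" using finP by (auto simp: sieving_primes_def)
  have "\<bar>\<Sum>A\<in>Pow ?D. lam A\<bar> \<le> (\<Sum>A\<in>Pow ?D. lam {})"
    using fD by (intro order.trans[OF sum_abs] sum_mono lam_le) auto
  also have "\<dots> = 2 ^ card ?D * lam {}" using fD by (simp add: card_Pow)
  also have "\<dots> \<le> 2 ^ r * lam {}"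
    using assms lam_nonneg by (intro mult_right_mono power_increasing) auto
  finally have "\<bar>\<Sum>A\<in>Pow ?D. lam A\<bar>\<^sup>2 \<le> (2 ^ r * lam {})\<^sup>2" by (intro power_mono) auto
  then show ?thesis by (simp add: weight_def)
qed

lemma weight_rough:
  assumes "sieving_primes P H n = {}"
  shows "weight n = (lam {})\<^sup>2"
  using assms by (simp add: weight_def)

lemma weight_nonneg: "0 \<le> weight n"
  by (simp add: weight_def)

end

text \<open>The \<open>i\<close>-th smallest element of \<open>Z\<close> is at least
  \<open>i + 1\<close>, so the product is at least the telescoping product of
  \<open>i / (i + 1)\<close>. As the cardinality of \<open>Z\<close> is at most logarithmic in its
  product, this crude bound suffices.\<close>

lemma prod_one_minus_inverse_ge:
  assumes "finite Z" "\<And>p. p \<in> Z \<Longrightarrow> (p::nat) \<ge> 2"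
  shows "(\<Prod>p\<in>Z. 1 - 1 / real p) \<ge> 1 / (real (card Z) + 1)"
  using assms
proof (induction Z rule: finite_linorder_max_induct)
  case (insert p Z)
  have "Z \<subseteq> {2..<p}" using insert by force
  then have "card Z \<le> card {2..<p}" by (intro card_mono) auto
  then have p: "real p \<ge> real (card Z) + 2" using insert.prems[of p] by auto
  have notin: "p \<notin> Z" using insert by auto
  have "1 / (real (card Z) + 2) = (1 - 1 / (real (card Z) + 2)) * (1 / (real (card Z) + 1))"
    by (simp add: field_simps)
  also have "\<dots> \<le> (1 - 1 / real p) * (\<Prod>p\<in>Z. 1 - 1 / real p)"
    using p insert by (intro mult_mono) (auto simp: frac_le intro!: divide_nonneg_nonneg)
  finally show ?case using insert.hyps notin by (simp add: add_ac)
qed simp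

lemma card_primes_le_ln_prod:
  assumes "finite Z" "\<And>p. p \<in> Z \<Longrightarrow> prime (p::nat)"
  shows "real (card Z) \<le> 2 * ln (real (\<Prod>Z))"
proof -
  have "(\<Prod>p\<in>Z. 2) \<le> \<Prod>Z" using assms prime_ge_2_nat by (intro prod_mono) auto
  then have "2 ^ card Z \<le> \<Prod>Z" by simp
  then have "real (2 ^ card Z) \<le> real (\<Prod>Z)" by (simp only: of_nat_le_iff)
  then have "ln (real (2 ^ card Z)) \<le> ln (real (\<Prod>Z))" by (intro ln_mono) simp_all
  then have "real (card Z) * ln 2 \<le> ln (real (\<Prod>Z))" by (simp add: ln_realpow)
  moreover have "ln 2 \<ge> (1/2::real)" using ln2_ge_two_thirds by simp
  ultimately show ?thesis using mult_left_mono[of "1/2" "ln 2" "real (card Z)"] by linarith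
qed

lemma sum_UNION_le:
  fixes f :: "'a \<Rightarrow> real"
  assumes "finite I" "\<And>i. i \<in> I \<Longrightarrow> finite (A i)" "\<And>x. 0 \<le> f x"
  shows "sum f (\<Union>i\<in>I. A i) \<le> (\<Sum>i\<in>I. sum f (A i))"
  using assms
proof (induction I rule: finite_induct)
  case (insert i I)
  have "sum f (A i \<union> (\<Union>i\<in>I. A i)) \<le> sum f (A i) + sum f (\<Union>i\<in>I. A i)"
    using insert sum.union_inter[of "A i" "\<Union>i\<in>I. A i" f] sum_nonneg[of "A i \<inter> (\<Union>i\<in>I. A i)" f]
    by fastforce
  then show ?case using insert by simp
qed simp

section \<open>Comparison of the main terms\<close>

context sieve_setup
begin

lemma ln_prod_Z_nonneg: "0 \<le> ln (real (\<Prod>Z))"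
proof -
  have "\<Prod>Z > 0" by (rule prod_primes_pos) (rule primeZ)
  then have "1 \<le> real (\<Prod>Z)" by (metis One_nat_def Suc_leI of_nat_1 of_nat_le_iff)
  then show ?thesis by (rule ln_ge_zero)
qed

lemma \<Phi>_bounds: "0 < \<Phi>" "\<Phi> \<le> 1" "1 / \<Phi> \<le> 1 + 2 * ln (real (\<Prod>Z))"
proof -
  have ge: "\<Phi> \<ge> 1 / (real (card Z) + 1)"
    unfolding \<Phi>_def using finZ primeZ prime_ge_2_nat by (intro prod_one_minus_inverse_ge) auto
  show 0: "0 < \<Phi>" by (rule less_le_trans[OF _ ge]) simp
  show "\<Phi> \<le> 1" unfolding \<Phi>_def using primeZ
    by (intro prod_le_1) (auto simp: divide_le_eq_1 dest: prime_ge_1_nat)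
  have "1 / \<Phi> \<le> real (card Z) + 1" using ge 0 by (simp add: field_simps)
  then show "1 / \<Phi> \<le> 1 + 2 * ln (real (\<Prod>Z))"
    using card_primes_le_ln_prod[OF finZ primeZ] by linarith
qed

lemma error_nonneg: "0 \<le> error"
  by (simp add: error_def)

lemma osum_bound:
  assumes D: "D \<ge> 1" "D \<ge> 2 * k" "\<And>p. p \<in> P \<Longrightarrow> p > D" and t: "t \<ge> 0"
  shows "osum (\<lambda>p. 1 / (real p - real k)) P t \<le>
    exp (2 * real k / real D) * (1 + ln (real (\<Prod>Z)) + \<Phi> * (1 + t))"
  unfolding \<Phi>_def
proof (rule osum_shift_upper[OF finP _ D(1,2) finZ primeZ _ t])
  show "prime p \<and> p > D" if "p \<in> P" for p using D(3)[OF that] primeP[OF that] by simp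
  show "P \<inter> Z = {}" unfolding P_def by blast
qed

lemma moment:
  assumes mert: "\<And>t. 0 \<le> t \<Longrightarrow> (\<Sum>p | p \<in> P \<and> ln (real p) \<le> t. ln (real p) / (real p - real k)) \<le> t + Dm"
    and c: "c \<ge> 0" and q: "q \<ge> 1"
  shows "(X - c * Dm) * msum (\<lambda>p. c / (real p - real k)) P q X \<le>
    (1 + c / real (q + 1)) * msum (\<lambda>p. c / (real p - real k)) P (q + 1) X"
proof -
  have "X * msum (\<lambda>p. c / (real p - real k)) P q X \<le>
    (1 + c / real (q + 1)) * msum (\<lambda>p. c / (real p - real k)) P (q + 1) X +
    c * Dm * msum (\<lambda>p. c / (real p - real k)) P q X"
  proof (rule msum_moment_ineq[OF finP primeP _ _ q])
    show "0 \<le> c / (real p - real k)" if "p \<in> P" for p using P_real[OF that] c by simp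
    fix t :: real assume t: "0 \<le> t"
    have "(\<Sum>p | p \<in> P \<and> ln (real p) \<le> t. c / (real p - real k) * ln (real p)) =
      c * (\<Sum>p | p \<in> P \<and> ln (real p) \<le> t. ln (real p) / (real p - real k))"
      by (simp add: sum_distrib_left)
    also have "\<dots> \<le> c * (t + Dm)" by (intro mult_left_mono mert t c)
    finally show "(\<Sum>p | p \<in> P \<and> ln (real p) \<le> t. c / (real p - real k) * ln (real p)) \<le> c * t + c * Dm"
      by (simp add: algebra_simps)
  qed
  then show ?thesis by (simp add: algebra_simps)
qed

abbreviation Mk :: "nat \<Rightarrow> real" where "Mk q \<equiv> msum (\<lambda>p. real k / (real p - real k)) P q X"
abbreviation Mk1 :: "nat \<Rightarrow> real" where "Mk1 q \<equiv> msum (\<lambda>p. (real k - 1) / (real p - real k)) P q X"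

lemma Mk_nonneg: "0 \<le> Mk q"
  by (intro msum_nonneg v_nonneg)

lemma Mk1_nonneg: "0 \<le> Mk1 q"
  using P_real k by (intro msum_nonneg divide_nonneg_nonneg) force+

lemma lam_pos: "X > 0 \<Longrightarrow> 0 < lam {}"
proof -
  assume X: "X > 0"
  have "0 < X ^ l" using X by simp
  also have "X ^ l = (\<Prod>p\<in>{}. real k / (real p - real k)) * max 0 (X - lnsum {}) ^ l" using X by simp
  also have "\<dots> \<le> Mk l"
    unfolding msum_def using finP by (intro member_le_sum mult_nonneg_nonneg v_prod_nonneg) auto
  finally show ?thesis by (simp add: lam_empty)
qed

text \<open>Split off dimension one from \<open>k / (p - k)\<close> and sum it. This leaves the main
  term with \<open>Mk1 (2 * l + 1)\<close> and a lower order term with \<open>Mk1 (2 * l)\<close>,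
  which the moment inequality absorbs. One factor \<open>1 + \<tau>\<close> pays for
  \<open>1 / (p - k)\<close> against \<open>1 / p\<close>, the other for the lower order
  term.\<close>

lemma Mk_le_Mk1:
  assumes mert: "\<And>t. 0 \<le> t \<Longrightarrow> (\<Sum>p | p \<in> P \<and> ln (real p) \<le> t. ln (real p) / (real p - real k)) \<le> t + Dm"
    and D: "D \<ge> 1" "D \<ge> 2 * k" "\<And>p. p \<in> P \<Longrightarrow> p > D" and \<tau>: "\<tau> > 0" "exp (2 * real k / real D) \<le> 1 + \<tau>"
    and \<beta>: "\<beta> = (real k - 1) * Dm" "X - \<beta> > 0"
    and big: "(2 + ln (real (\<Prod>Z))) * real (2 * l + k) \<le> \<tau> * \<Phi> * (X - \<beta>)"
  shows "Mk (2 * l) \<le> (1 + \<tau>)\<^sup>2 * \<Phi> / real (2 * l + 1) * Mk1 (2 * l + 1)"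
proof -
  let ?E = "exp (2 * real k / real D)"
  let ?b = "?E * (1 + ln (real (\<Prod>Z)) + \<Phi>)"
  note lnW = ln_prod_Z_nonneg
  have "msum (\<lambda>p. (real k - 1) / (real p - real k) + 1 / (real p - real k)) P (2 * l) X \<le>
    ?E * \<Phi> / real (2 * l + 1) * Mk1 (2 * l + 1) + ?b * Mk1 (2 * l)"
  proof (rule msum_dim_upper[OF finP primeP])
    show "0 \<le> (real k - 1) / (real p - real k)" "0 \<le> 1 / (real p - real k)" if "p \<in> P" for p
      using P_real[OF that] k by auto
    fix t :: real assume t: "0 \<le> t"
    show "osum (\<lambda>p. 1 / (real p - real k)) P t \<le> ?E * \<Phi> * t + ?b"
      using osum_bound[OF D t] by (simp add: algebra_simps)
  qed (use l in auto)
  then have "Mk (2 * l) \<le> ?E * \<Phi> / real (2 * l + 1) * Mk1 (2 * l + 1) + ?b * Mk1 (2 * l)"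
    by (simp add: add_divide_distrib[symmetric])
  moreover have "?b * Mk1 (2 * l) \<le> ?E * \<Phi> * \<tau> / real (2 * l + 1) * Mk1 (2 * l + 1)"
  proof -
    have "(X - \<beta>) * Mk1 (2 * l) \<le> (1 + (real k - 1) / real (2 * l + 1)) * Mk1 (2 * l + 1)"
      unfolding \<beta>(1) using k l by (intro moment mert) auto
    also have "1 + (real k - 1) / real (2 * l + 1) = real (2 * l + k) / real (2 * l + 1)"
      by (simp add: field_simps)
    finally have "Mk1 (2 * l) \<le> real (2 * l + k) / real (2 * l + 1) * Mk1 (2 * l + 1) / (X - \<beta>)"
      unfolding pos_le_divide_eq[OF \<beta>(2)] by (simp only: mult.commute)
    then have "?b * Mk1 (2 * l) \<le> ?b * (real (2 * l + k) / real (2 * l + 1) * Mk1 (2 * l + 1) / (X - \<beta>))"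
      using lnW \<Phi>_bounds by (intro mult_left_mono) auto
    also have "\<dots> = ?E * ((1 + ln (real (\<Prod>Z)) + \<Phi>) * real (2 * l + k)) / (real (2 * l + 1) * (X - \<beta>)) * Mk1 (2 * l + 1)"
      by (simp add: mult_ac)
    also have "\<dots> \<le> ?E * (\<tau> * \<Phi> * (X - \<beta>)) / (real (2 * l + 1) * (X - \<beta>)) * Mk1 (2 * l + 1)"
    proof (intro mult_right_mono divide_right_mono mult_left_mono Mk1_nonneg)
      have "(1 + ln (real (\<Prod>Z)) + \<Phi>) * real (2 * l + k) \<le> (2 + ln (real (\<Prod>Z))) * real (2 * l + k)"
        using \<Phi>_bounds by (intro mult_right_mono) auto
      then show "(1 + ln (real (\<Prod>Z)) + \<Phi>) * real (2 * l + k) \<le> \<tau> * \<Phi> * (X - \<beta>)" using big by linarith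
    qed (use \<beta> in auto)
    also have "\<dots> = ?E * \<Phi> * \<tau> / real (2 * l + 1) * Mk1 (2 * l + 1)" using \<beta>(2) by simp
    finally show ?thesis .
  qed
  ultimately have "Mk (2 * l) \<le> ?E * \<Phi> / real (2 * l + 1) * Mk1 (2 * l + 1) +
      ?E * \<Phi> * \<tau> / real (2 * l + 1) * Mk1 (2 * l + 1)"
    by linarith
  also have "\<dots> = ?E * (1 + \<tau>) * (\<Phi> / real (2 * l + 1) * Mk1 (2 * l + 1))"
  proof -
    have "e * f / c * m + e * f * \<tau> / c * m = e * (1 + \<tau>) * (f / c * m)" for e f c m :: real
      by (simp add: algebra_simps add_divide_distrib)
    then show ?thesis .
  qed
  also have "\<dots> \<le> (1 + \<tau>) * (1 + \<tau>) * (\<Phi> / real (2 * l + 1) * Mk1 (2 * l + 1))"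
    using \<tau> \<Phi>_bounds Mk1_nonneg by (intro mult_right_mono) auto
  finally show ?thesis by (simp add: power2_eq_square)
qed

text \<open>Of the two factors \<open>\<Phi>\<close> in the prime sum, one cancels against
  \<open>W / totient W\<close>, the other is used up by going back from dimension
  \<open>k - 1\<close> to \<open>k\<close>. The ratio to the sum of all weights is therefore
  independent of \<open>W\<close>.\<close>

lemma S2_lower:
  assumes mert: "\<And>t. 0 \<le> t \<Longrightarrow> (\<Sum>p | p \<in> P \<and> ln (real p) \<le> t. ln (real p) / (real p - real k)) \<le> t + Dm"
    and D: "D \<ge> 1" "D \<ge> 2 * k" "\<And>p. p \<in> P \<Longrightarrow> p > D" and \<tau>: "\<tau> > 0" "exp (2 * real k / real D) \<le> 1 + \<tau>"
    and \<beta>: "\<beta> = (real k - 1) * Dm" "X - \<beta> > 0"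
    and big: "(2 + ln (real (\<Prod>Z))) * real (2 * l + k) \<le> \<tau> * \<Phi> * (X - \<beta>)"
    and kl: "k = l ^ 2" "k \<ge> 2"
    and W: "W = \<Prod>Z" "W > 1" "\<nu> < W" and cop: "\<And>h. h \<in> H \<Longrightarrow> coprime (\<nu> + h) W"
    and XN: "X < ln (real N)" and Err: "\<And>h. h \<in> H \<Longrightarrow> theta_err (2 * N + h) W (4 * k) + theta_err (N + h) W (4 * k) \<le> Err"
  shows "(\<Sum>h\<in>H. \<Sum>n | n \<in> {N<..2 * N} \<and> n mod W = \<nu> \<and> prime (n + h). ln (real (n + h)) * weight n) \<ge>
    real N / real W * (2 * real k * real (2 * l + 1) / (real (l + 1) ^ 3 * (1 + \<tau>)\<^sup>2)) * (X - \<beta>) * Mk (2 * l)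
      - real k * ((lam {})\<^sup>2 * Err)"
proof -
  have copP: "coprime p W" if "p \<in> P" for p
    unfolding W(1)
  proof (intro prod_coprime_right primes_coprime primeP[OF that] primeZ)
    show "p \<noteq> q" if "q \<in> Z" for q using that \<open>p \<in> P\<close> by (auto simp: P_def)
  qed
  have tot: "real (totient W) = real W * \<Phi>"
  proof -
    have "real (totient W) / real W = \<Phi>" unfolding W(1) \<Phi>_def by (rule totient_prod_primes[OF finZ primeZ])
    then show ?thesis using W(2) by (auto simp: field_simps)
  qed
  have l1: "real (l + 1) > 0" by simp
  have "(X - \<beta>) * Mk1 (2 * l + 1) \<le> (1 + (real k - 1) / real (2 * l + 2)) * Mk1 (2 * l + 2)"
    unfolding \<beta>(1) using moment[OF mert, of "real k - 1" "2 * l + 1"] k by simp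
  \<comment> \<open>With \<open>k = l ^ 2\<close> the numerator \<open>2 * l + 2 + (k - 1)\<close>
    is the perfect square of \<open>l + 1\<close>.\<close>
  also have "1 + (real k - 1) / real (2 * l + 2) = real (l + 1) ^ 2 / real (2 * l + 2)"
    unfolding kl(1) by (simp add: divide_simps power2_eq_square algebra_simps)
  finally have m1: "Mk1 (2 * l + 2) \<ge> real (2 * l + 2) / real (l + 1) ^ 2 * ((X - \<beta>) * Mk1 (2 * l + 1))"
    using l1 by (simp add: divide_simps mult.commute)
  have m2: "\<Phi> * Mk1 (2 * l + 1) \<ge> real (2 * l + 1) / (1 + \<tau>)\<^sup>2 * Mk (2 * l)"
    using Mk_le_Mk1[OF mert D \<tau> \<beta> big] \<tau> by (simp add: divide_simps mult_ac)
  have each: "(\<Sum>n | n \<in> {N<..2 * N} \<and> n mod W = \<nu> \<and> prime (n + h). ln (real (n + h)) * weight n) \<ge>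
     real N / real W * (2 * real (2 * l + 1) / (real (l + 1) ^ 3 * (1 + \<tau>)\<^sup>2)) * (X - \<beta>) * Mk (2 * l)
     - (lam {})\<^sup>2 * Err" if h: "h \<in> H" for h
  proof -
    have "real N / real W * (2 * real (2 * l + 1) / (real (l + 1) ^ 3 * (1 + \<tau>)\<^sup>2)) * (X - \<beta>) * Mk (2 * l) =
      real N / real W * (2 / real (l + 1) ^ 3) * (X - \<beta>) * (real (2 * l + 1) / (1 + \<tau>)\<^sup>2 * Mk (2 * l))"
      by (simp add: divide_simps)
    also have "\<dots> \<le> real N / real W * (2 / real (l + 1) ^ 3) * (X - \<beta>) * (\<Phi> * Mk1 (2 * l + 1))"
      using \<beta>(2) by (intro mult_left_mono m2) auto
    also have "\<dots> = real N / real W * \<Phi> / (real (l + 1))\<^sup>2 *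
        (real (2 * l + 2) / real (l + 1) ^ 2 * ((X - \<beta>) * Mk1 (2 * l + 1)))"
    proof -
      have "2 / real (l + 1) ^ 3 = 1 / (real (l + 1))\<^sup>2 * (real (2 * l + 2) / real (l + 1) ^ 2)"
        using l1 by (simp add: divide_simps power2_eq_square power3_eq_cube)
      moreover have "a * (1 / b * (c / d)) * x * (f * m) = a * f / b * (c / d * (x * m))" for a b c d x f m :: real
        by (simp add: mult_ac)
      ultimately show ?thesis by (simp only:)
    qed
    also have "\<dots> \<le> real N / real W * \<Phi> / (real (l + 1))\<^sup>2 * Mk1 (2 * l + 2)"
      using \<Phi>_bounds by (intro mult_left_mono m1) auto
    also have "\<dots> = real N / real (totient W) * \<Phi>\<^sup>2 / (real (l + 1))\<^sup>2 * Mk1 (2 * l + 2)"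
      using \<Phi>_bounds by (simp add: tot power2_eq_square divide_simps)
    finally have a: "real N / real W * (2 * real (2 * l + 1) / (real (l + 1) ^ 3 * (1 + \<tau>)\<^sup>2)) * (X - \<beta>) * Mk (2 * l) \<le>
      real N / real (totient W) * \<Phi>\<^sup>2 / (real (l + 1))\<^sup>2 * Mk1 (2 * l + 2)" .
    have "(lam {})\<^sup>2 * (theta_err (2 * N + h) W (4 * k) + theta_err (N + h) W (4 * k)) \<le> (lam {})\<^sup>2 * Err"
      by (intro mult_left_mono Err h) simp
    with a sum_ln_weight_ge[OF W(3,2) copP h cop[OF h] XN kl(2)] show ?thesis by linarith
  qed
  have "(\<Sum>h\<in>H. real N / real W * (2 * real (2 * l + 1) / (real (l + 1) ^ 3 * (1 + \<tau>)\<^sup>2)) * (X - \<beta>) * Mk (2 * l)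
     - (lam {})\<^sup>2 * Err) \<le>
     (\<Sum>h\<in>H. \<Sum>n | n \<in> {N<..2 * N} \<and> n mod W = \<nu> \<and> prime (n + h). ln (real (n + h)) * weight n)"
    by (intro sum_mono each)
  then show ?thesis by (simp add: cardH algebra_simps)
qed

text \<open>Sum the bound for a single prime over all primes up to \<open>exp t\<close>: by Mertens'
  bound \<open>(ln p) ^ 2 / p\<close> adds up to at most \<open>2 * t ^ 2\<close>, and two moment
  steps from \<open>2 * l - 2\<close> to \<open>2 * l\<close> gain \<open>1 / X ^ 2\<close>. The
  proportion \<open>(t / X) ^ 2\<close> is small if \<open>t\<close> is a small multiple of
  \<open>X\<close>.\<close>

lemma S_bad:
  assumes mert: "\<And>t. 0 \<le> t \<Longrightarrow> (\<Sum>p | p \<in> P \<and> ln (real p) \<le> t. ln (real p) / (real p - real k)) \<le> t + Dm"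
    and l2: "l \<ge> 2" and XD: "X \<ge> 2 * real k * Dm" "X > 0" and t: "t \<ge> Dm" "t \<ge> 0"
    and W: "\<nu> < W" "\<And>p. p \<in> P \<Longrightarrow> coprime p W"
  shows "(\<Sum>n | n \<in> {N<..2 * N} \<and> n mod W = \<nu> \<and> (\<exists>p\<in>sieving_primes P H n. ln (real p) \<le> t). weight n) \<le>
     real N / real W * (8 * real k * (real l)\<^sup>2 * (1 + real k)\<^sup>2 * (t / X)\<^sup>2) * Mk (2 * l)
       + exp t * (4 * real k * (lam {})\<^sup>2 * error)"
proof -
  let ?Q = "{p. p \<in> P \<and> ln (real p) \<le> t}"
  let ?I = "\<lambda>p. {n. n \<in> {N<..2 * N} \<and> n mod W = \<nu> \<and> p \<in> sieving_primes P H n}"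
  let ?e = "4 * real k * (lam {})\<^sup>2 * error"
  have fQ: "finite ?Q" using finP by simp
  have e0: "?e \<ge> 0" by (simp add: error_def)
  have "{n. n \<in> {N<..2 * N} \<and> n mod W = \<nu> \<and> (\<exists>p\<in>sieving_primes P H n. ln (real p) \<le> t)} = (\<Union>p\<in>?Q. ?I p)"
    by (auto simp: sieving_primes_def)
  then have "(\<Sum>n | n \<in> {N<..2 * N} \<and> n mod W = \<nu> \<and> (\<exists>p\<in>sieving_primes P H n. ln (real p) \<le> t). weight n) =
    sum weight (\<Union>p\<in>?Q. ?I p)" by simp
  also have "\<dots> \<le> (\<Sum>p\<in>?Q. sum weight (?I p))"
    using fQ by (intro sum_UNION_le) (auto simp: weight_nonneg)
  also have "\<dots> \<le> (\<Sum>p\<in>?Q. real N / real W * (real k * (real l)\<^sup>2 * Mk (2 * l - 2)) * (ln (real p))\<^sup>2 / real p + ?e)"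
  proof (rule sum_mono)
    fix p assume "p \<in> ?Q"
    then have "sum weight (?I p) \<le> real N / real W * (real k / real p) * (real l)\<^sup>2 * (ln (real p))\<^sup>2 * Mk (2 * l - 2) + ?e"
      using sum_weight_dvd_le[OF W, of p N] by simp
    then show "sum weight (?I p) \<le> real N / real W * (real k * (real l)\<^sup>2 * Mk (2 * l - 2)) * (ln (real p))\<^sup>2 / real p + ?e"
      by (simp add: mult_ac)
  qed
  also have "\<dots> = real N / real W * (real k * (real l)\<^sup>2 * Mk (2 * l - 2)) * (\<Sum>p\<in>?Q. (ln (real p))\<^sup>2 / real p) + real (card ?Q) * ?e"
    by (simp add: sum.distrib sum_distrib_left)
  also have "\<dots> \<le> real N / real W * (real k * (real l)\<^sup>2 * (4 * (1 + real k)\<^sup>2 / X\<^sup>2 * Mk (2 * l))) * (2 * t\<^sup>2) + exp t * ?e"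
  proof (intro add_mono mult_mono)
    show "real (card ?Q) \<le> exp t"
    proof -
      have "?Q \<subseteq> {1..nat \<lfloor>exp t\<rfloor>}"
      proof
        fix p assume p: "p \<in> ?Q"
        then have p0: "p > 0" using primeP prime_gt_0_nat by auto
        then have "real p \<le> exp t" using p by (simp add: ln_le_iff_le_exp)
        then show "p \<in> {1..nat \<lfloor>exp t\<rfloor>}" using p0 by (simp add: le_nat_iff le_floor_iff)
      qed
      then have "card ?Q \<le> nat \<lfloor>exp t\<rfloor>" using card_mono[of "{1..nat \<lfloor>exp t\<rfloor>}" ?Q] by simp
      then have "real (card ?Q) \<le> real (nat \<lfloor>exp t\<rfloor>)" by (rule of_nat_mono)
      also have "\<dots> \<le> exp t" by simp
      finally show ?thesis .
    qed
    have "(\<Sum>p\<in>?Q. (ln (real p))\<^sup>2 / real p) \<le> (\<Sum>p\<in>?Q. t * (ln (real p) / (real p - real k)))"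
    proof (rule sum_mono)
      fix p assume p: "p \<in> ?Q"
      have lp: "0 < ln (real p)" using p primeP ln_prime_pos by auto
      have pk: "real p > 2 * real k" "real k \<ge> 1" using p P_real k by auto
      have "(ln (real p))\<^sup>2 / real p = ln (real p) * (ln (real p) / real p)" by (simp add: power2_eq_square)
      also have "\<dots> \<le> t * (ln (real p) / (real p - real k))"
        using p lp pk t by (intro mult_mono divide_left_mono) auto
      finally show "(ln (real p))\<^sup>2 / real p \<le> t * (ln (real p) / (real p - real k))" .
    qed
    also have "\<dots> = t * (\<Sum>p\<in>?Q. ln (real p) / (real p - real k))" by (simp add: sum_distrib_left)
    also have "\<dots> \<le> t * (t + Dm)" by (intro mult_left_mono mert t)
    also have "\<dots> \<le> t * (t + t)" using t by (intro mult_left_mono) auto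
    finally show "(\<Sum>p\<in>?Q. (ln (real p))\<^sup>2 / real p) \<le> 2 * t\<^sup>2" by (simp add: power2_eq_square)
    show "Mk (2 * l - 2) \<le> 4 * (1 + real k)\<^sup>2 / X\<^sup>2 * Mk (2 * l)"
    proof -
      have st: "X / 2 * Mk q \<le> (1 + real k) * Mk (q + 1)" if "q \<ge> 1" for q
      proof -
        have "X / 2 * Mk q \<le> (X - real k * Dm) * Mk q"
          using XD by (intro mult_right_mono Mk_nonneg) auto
        also have "\<dots> \<le> (1 + real k / real (q + 1)) * Mk (q + 1)" by (intro moment mert that) auto
        also have "\<dots> \<le> (1 + real k) * Mk (q + 1)"
          by (intro mult_right_mono Mk_nonneg) (auto simp: divide_le_eq algebra_simps)
        finally show ?thesis .
      qed
      define q where "q = 2 * l - 2"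
      have q: "q \<ge> 1" "2 * l = q + 1 + 1" using l2 by (auto simp: q_def)
      have "(X / 2)\<^sup>2 * Mk q = X / 2 * (X / 2 * Mk q)" by (simp add: power2_eq_square)
      also have "\<dots> \<le> X / 2 * ((1 + real k) * Mk (q + 1))" using XD st[OF q(1)] by (intro mult_left_mono) auto
      also have "\<dots> = (1 + real k) * (X / 2 * Mk (q + 1))" by simp
      also have "\<dots> \<le> (1 + real k) * ((1 + real k) * Mk (q + 1 + 1))" by (intro mult_left_mono st) auto
      finally have "(X / 2)\<^sup>2 * Mk q \<le> (1 + real k)\<^sup>2 * Mk (2 * l)"
        unfolding q(2) by (simp add: power2_eq_square mult_ac)
      then show ?thesis unfolding q_def[symmetric] using XD by (simp add: divide_simps power_divide mult_ac)
    qed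
  qed (use Mk_nonneg e0 error_nonneg in \<open>auto intro!: mult_nonneg_nonneg sum_nonneg divide_nonneg_nonneg\<close>)
  also have "\<dots> = real N / real W * (8 * real k * (real l)\<^sup>2 * (1 + real k)\<^sup>2 * (t / X)\<^sup>2) * Mk (2 * l) + exp t * ?e"
    by (simp add: power_divide mult_ac)
  finally show ?thesis .
qed

text \<open>Main terms are multiples of \<open>Mk (2 * l)\<close>, whereas errors and single weights
  are measured by the square of \<open>lam {}\<close>, that is of \<open>Mk l\<close>; this converts
  one into the other. One factor \<open>Mk l\<close> reaches exponent \<open>2 * l\<close> by
  \<open>l\<close> moment steps, the other is bounded by the sharp cutoff sum.\<close>

lemma Mk_ge_lam:
  assumes mert: "\<And>t. 0 \<le> t \<Longrightarrow> (\<Sum>p | p \<in> P \<and> ln (real p) \<le> t. ln (real p) / (real p - real k)) \<le> t + Dm"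
    and D: "D \<ge> 1" "D \<ge> 2 * k" "\<And>p. p \<in> P \<Longrightarrow> p > D" and \<tau>: "\<tau> > 0" "exp (2 * real k / real D) \<le> 1 + \<tau>"
    and XD: "X \<ge> 2 * real k * Dm" "X \<ge> 1" and big: "1 + ln (real (\<Prod>Z)) \<le> \<Phi> * X"
  shows "(lam {})\<^sup>2 \<le> (2 * (1 + real k)) ^ l * (3 * (1 + \<tau>) * \<Phi> * X) ^ k * Mk (2 * l)"
proof -
  have st: "(X / (2 * (1 + real k))) ^ j * Mk l \<le> Mk (l + j)" for j
  proof (induction j)
    case (Suc j)
    have "X / 2 * Mk (l + j) \<le> (X - real k * Dm) * Mk (l + j)"
      using XD by (intro mult_right_mono Mk_nonneg) auto
    also have "\<dots> \<le> (1 + real k / real (l + j + 1)) * Mk (l + j + 1)" using l by (intro moment mert) auto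
    also have "\<dots> \<le> (1 + real k) * Mk (l + j + 1)"
      by (intro mult_right_mono Mk_nonneg) (auto simp: divide_le_eq algebra_simps)
    finally have "X / (2 * (1 + real k)) * Mk (l + j) \<le> Mk (l + j + 1)" by (simp add: field_simps)
    moreover have "X / (2 * (1 + real k)) * ((X / (2 * (1 + real k))) ^ j * Mk l) \<le> X / (2 * (1 + real k)) * Mk (l + j)"
      using XD Suc by (intro mult_left_mono) auto
    ultimately show ?case by (simp add: mult.assoc)
  qed simp
  have a: "X ^ l * Mk l \<le> (2 * (1 + real k)) ^ l * Mk (2 * l)"
    using st[of l, folded mult_2] by (simp add: power_divide field_simps)
  have "Mk l \<le> X ^ l * (3 * (1 + \<tau>) * \<Phi> * X) ^ k"
  proof -
    have "Mk l \<le> X ^ l * osum (\<lambda>p. real k * (1 / (real p - real k))) P X"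
      using msum_le_osum[OF finP primeP v_nonneg X l] by simp
    also have "\<dots> \<le> X ^ l * (osum (\<lambda>p. 1 / (real p - real k)) P X) ^ k"
      using X P_real finP primeP by (intro mult_left_mono osum_mult_le_power) force+
    also have "\<dots> \<le> X ^ l * (3 * (1 + \<tau>) * \<Phi> * X) ^ k"
    proof (intro mult_left_mono power_mono)
      have "osum (\<lambda>p. 1 / (real p - real k)) P X \<le>
        exp (2 * real k / real D) * (1 + ln (real (\<Prod>Z)) + \<Phi> * (1 + X))"
        by (rule osum_bound[OF D X])
      also have "\<dots> \<le> (1 + \<tau>) * (3 * \<Phi> * X)"
      proof (rule mult_mono)
        have "\<Phi> * 1 \<le> \<Phi> * X" using XD \<Phi>_bounds by (intro mult_left_mono) auto
        then show "1 + ln (real (\<Prod>Z)) + \<Phi> * (1 + X) \<le> 3 * \<Phi> * X" using big by (simp add: algebra_simps)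
        show "0 \<le> 1 + ln (real (\<Prod>Z)) + \<Phi> * (1 + X)" using \<Phi>_bounds X ln_prod_Z_nonneg by (intro add_nonneg_nonneg mult_nonneg_nonneg) auto
      qed (use \<tau> in auto)
      finally show "osum (\<lambda>p. 1 / (real p - real k)) P X \<le> 3 * (1 + \<tau>) * \<Phi> * X" by (simp add: mult_ac)
      show "0 \<le> osum (\<lambda>p. 1 / (real p - real k)) P X" using P_real by (intro osum_nonneg) force
    qed (use X in auto)
    finally show ?thesis .
  qed
  then have "(Mk l)\<^sup>2 \<le> (X ^ l * (3 * (1 + \<tau>) * \<Phi> * X) ^ k) * Mk l"
    unfolding power2_eq_square by (intro mult_right_mono Mk_nonneg)
  also have "\<dots> = (3 * (1 + \<tau>) * \<Phi> * X) ^ k * (X ^ l * Mk l)" by simp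
  also have "\<dots> \<le> (3 * (1 + \<tau>) * \<Phi> * X) ^ k * ((2 * (1 + real k)) ^ l * Mk (2 * l))"
    using \<Phi>_bounds X \<tau> a by (intro mult_left_mono) auto
  finally show ?thesis by (simp add: lam_empty mult_ac)
qed

end

lemma prod_primes_dvd:
  assumes "finite S" "\<And>p. p \<in> S \<Longrightarrow> prime (p::nat)" "\<And>p. p \<in> S \<Longrightarrow> p dvd m"
  shows "\<Prod>S dvd m"
  using assms
proof (induction S rule: finite_induct)
  case (insert p S)
  have "coprime p (\<Prod>S)" using insert by (intro prod_coprime_right primes_coprime) auto
  then show ?case using insert by (simp add: divides_mult)
qed simp

section \<open>Counting integers with two primes among their shifts\<close>

context sieve_setup
begin

text \<open>An \<open>n\<close> with at most one prime shift contributes at most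
  \<open>ln (3 * N)\<close> times its weight to the prime sum. That sum is at least
  \<open>1 + \<tau>\<close> times \<open>ln (3 * N)\<close> times the main term of all weights, so
  the excess comes from \<open>n\<close> with two prime shifts or with a small prime factor. Of the
  surplus \<open>\<tau>\<close>, a quarter is lost to the small prime factors and a quarter to the
  errors.\<close>

theorem good_count:
  assumes mert: "\<And>t. 0 \<le> t \<Longrightarrow> (\<Sum>p | p \<in> P \<and> ln (real p) \<le> t. ln (real p) / (real p - real k)) \<le> t + Dm"
    and D: "D \<ge> 1" "D \<ge> 2 * k" "\<And>p. p \<in> P \<Longrightarrow> p > D" and \<tau>: "\<tau> > 0" "exp (2 * real k / real D) \<le> 1 + \<tau>"
    and \<beta>: "\<beta> = (real k - 1) * Dm" "X - \<beta> > 0"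
    and big: "(2 + ln (real (\<Prod>Z))) * real (2 * l + k) \<le> \<tau> * \<Phi> * (X - \<beta>)"
    and kl: "k = l ^ 2" "l \<ge> 2"
    and W: "W = \<Prod>Z" "W > 1" "\<nu> < W" and cop: "\<And>h. h \<in> H \<Longrightarrow> coprime (\<nu> + h) W"
    and XN: "X < ln (real N)" and Err: "\<And>h. h \<in> H \<Longrightarrow> theta_err (2 * N + h) W (4 * k) + theta_err (N + h) W (4 * k) \<le> Err"
    and XD: "X \<ge> 2 * real k * Dm" "X \<ge> 1" and big': "1 + ln (real (\<Prod>Z)) \<le> \<Phi> * X"
    and t: "t \<ge> Dm" "t > 0" "t \<le> X"
    and HN: "\<And>h. h \<in> H \<Longrightarrow> h \<le> N"
    and \<rho>: "real k * real (2 * l + 1) * \<theta> / real (l + 1) ^ 3 \<ge> (1 + \<tau>) ^ 4"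
    and X\<theta>: "X - \<beta> \<ge> \<theta> / 2 * ln (3 * real N) / (1 + \<tau>)"
    and t\<tau>: "8 * real k * (real l)\<^sup>2 * (1 + real k)\<^sup>2 * (t / X)\<^sup>2 * real k \<le> \<tau> / 4"
    and r: "real k * ln (3 * real N) < (real r + 1) * t"
    and err: "real k * Err + ln (3 * real N) * error + real k * ln (3 * real N) * (exp t * (4 * real k * error)) \<le>
      \<tau> / 4 * ln (3 * real N) * (real N / real W) / ((2 * (1 + real k)) ^ l * (3 * (1 + \<tau>) * \<Phi> * X) ^ k)"
  shows "real (card {n \<in> {N<..2 * N}. n mod W = \<nu> \<and>
      (\<forall>h\<in>H. \<forall>p. prime p \<and> ln (real p) \<le> t \<longrightarrow> \<not> p dvd n + h) \<and> 2 \<le> card {h \<in> H. prime (n + h)}}) * (real k * 4 ^ r) \<ge>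
      \<tau> / 2 * (real N / real W) / ((2 * (1 + real k)) ^ l * (3 * (1 + \<tau>) * \<Phi> * X) ^ k)"
proof -
  define Ln where "Ln = ln (3 * real N)"
  define K where "K = (2 * (1 + real k)) ^ l * (3 * (1 + \<tau>) * \<Phi> * X) ^ k"
  define G where "G = {n \<in> {N<..2 * N}. n mod W = \<nu> \<and>
      (\<forall>h\<in>H. \<forall>p. prime p \<and> ln (real p) \<le> t \<longrightarrow> \<not> p dvd n + h) \<and> 2 \<le> card {h \<in> H. prime (n + h)}}"
  let ?I = "{n. n \<in> {N<..2 * N} \<and> n mod W = \<nu>}"
  define B where "B = {n. n \<in> {N<..2 * N} \<and> n mod W = \<nu> \<and> (\<exists>p\<in>sieving_primes P H n. ln (real p) \<le> t)}"
  have N1: "real N > 1"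
  proof (rule ccontr)
    assume "\<not> real N > 1"
    then have "N = 0 \<or> N = 1" by linarith
    then have "ln (real N) = 0" by auto
    then show False using XN XD by simp
  qed
  have Ln: "Ln > 0" unfolding Ln_def using N1 by simp
  have K0: "K > 0" unfolding K_def using \<tau> \<Phi>_bounds XD by (intro mult_pos_pos zero_less_power) auto
  have k2: "k \<ge> 2" using kl(2) power_mono[of 2 l 2] by (simp add: kl(1))
  have lam0: "lam {} > 0" using XD by (intro lam_pos) auto
  have lnle: "ln (real (n + h)) \<le> Ln" "0 \<le> ln (real (n + h))" if "n \<in> ?I" "h \<in> H" for n h
  proof -
    have "n + h \<le> 3 * N" "n + h > 0" using that HN[of h] by auto
    then have "real (n + h) \<le> 3 * real N" "real (n + h) > 0" by linarith+
    then show "ln (real (n + h)) \<le> Ln" unfolding Ln_def by (intro ln_mono)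
    show "0 \<le> ln (real (n + h))" using \<open>n + h > 0\<close> by (intro ln_ge_zero) linarith
  qed
  have copP: "coprime p W" if "p \<in> P" for p
    unfolding W(1)
  proof (intro prod_coprime_right primes_coprime primeP[OF that] primeZ)
    show "p \<noteq> q" if "q \<in> Z" for q using that \<open>p \<in> P\<close> by (auto simp: P_def)
  qed
  \<comment> \<open>Primes of \<open>Z\<close> cannot divide \<open>n + h\<close> by the choice of
    the class \<open>\<nu>\<close>; the other primes up to \<open>exp t\<close> belong to
    \<open>P\<close> because \<open>t \<le> X\<close>.\<close>
  have rough: "\<forall>h\<in>H. \<forall>p. prime p \<and> ln (real p) \<le> t \<longrightarrow> \<not> p dvd n + h" if n: "n \<in> ?I" "n \<notin> B" for n
  proof (intro ballI allI impI notI)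
    fix h p assume h: "h \<in> H" and p: "prime p \<and> ln (real p) \<le> t" and dvd: "p dvd n + h"
    show False
    proof (cases "p \<in> Z")
      case True
      then have pW: "p dvd W" unfolding W(1) using finZ by auto
      have "(n + h) mod W = (\<nu> + h) mod W" using n by (auto simp: mod_add_left_eq)
      then have "(n + h) mod p = (\<nu> + h) mod p" using pW by (metis mod_mod_cancel)
      then have "p dvd \<nu> + h" using dvd by (simp add: dvd_eq_mod_eq_0)
      then have "is_unit p" using cop[OF h] pW coprime_common_divisor by blast
      then show False using p by auto
    next
      case False
      then have "p \<in> P" using p t by (auto simp: P_def)
      then have "p \<in> sieving_primes P H n" using h dvd by (auto simp: sieving_primes_def)
      then show False using n p by (auto simp: B_def)
    qed
  qed
  have pointwise: "(\<Sum>h | h \<in> H \<and> prime (n + h). ln (real (n + h))) * weight n \<le>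
     Ln * weight n + real k * Ln * (of_bool (n \<in> G) * weight n + of_bool (n \<in> B) * weight n)" if n: "n \<in> ?I" for n
  proof -
    let ?S = "{h \<in> H. prime (n + h)}"
    have "(\<Sum>h\<in>?S. ln (real (n + h))) \<le> (\<Sum>h\<in>?S. Ln)" using n lnle by (intro sum_mono) auto
    then have S: "(\<Sum>h\<in>?S. ln (real (n + h))) \<le> real (card ?S) * Ln" by simp
    have "card ?S \<le> k" using card_mono[OF finH, of ?S] cardH by auto
    then have "real (card ?S) * Ln \<le> real k * Ln" using Ln by (intro mult_right_mono) auto
    with S have Sk: "(\<Sum>h\<in>?S. ln (real (n + h))) \<le> real k * Ln" by linarith
    show ?thesis
    proof (cases "n \<in> B \<or> n \<in> G")
      case True
      have "(\<Sum>h\<in>?S. ln (real (n + h))) * weight n \<le> real k * Ln * weight n"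
        by (intro mult_right_mono Sk weight_nonneg)
      also have "\<dots> \<le> real k * Ln * (of_bool (n \<in> G) * weight n + of_bool (n \<in> B) * weight n)"
        using True weight_nonneg[of n] Ln by (intro mult_left_mono) auto
      finally have "(\<Sum>h\<in>?S. ln (real (n + h))) * weight n \<le>
        real k * Ln * (of_bool (n \<in> G) * weight n + of_bool (n \<in> B) * weight n)" .
      moreover have "0 \<le> Ln * weight n" using Ln weight_nonneg[of n] by simp
      ultimately show ?thesis by linarith
    next
      case False
      then have "card ?S \<le> 1" using rough[OF n] n by (force simp: G_def)
      then have "real (card ?S) * Ln \<le> 1 * Ln" using Ln by (intro mult_right_mono) auto
      with S have "(\<Sum>h\<in>?S. ln (real (n + h))) \<le> Ln" by linarith
      then have "(\<Sum>h\<in>?S. ln (real (n + h))) * weight n \<le> Ln * weight n"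
        by (intro mult_right_mono weight_nonneg)
      then show ?thesis using False by simp
    qed
  qed
  define T where "T = (\<Sum>h\<in>H. \<Sum>n | n \<in> {N<..2 * N} \<and> n mod W = \<nu> \<and> prime (n + h). ln (real (n + h)) * weight n)"
  have fI: "finite ?I" by simp
  have GI: "G \<subseteq> ?I" "B \<subseteq> ?I" by (auto simp: G_def B_def)
  have "T = (\<Sum>n\<in>?I. (\<Sum>h | h \<in> H \<and> prime (n + h). ln (real (n + h))) * weight n)"
  proof -
    have "T = (\<Sum>h\<in>H. \<Sum>n\<in>?I. if prime (n + h) then ln (real (n + h)) * weight n else 0)"
      unfolding T_def
    proof (rule sum.cong[OF refl])
      fix h
      have "{n. n \<in> {N<..2 * N} \<and> n mod W = \<nu> \<and> prime (n + h)} = {n \<in> ?I. prime (n + h)}" by auto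
      then show "(\<Sum>n | n \<in> {N<..2 * N} \<and> n mod W = \<nu> \<and> prime (n + h). ln (real (n + h)) * weight n) =
        (\<Sum>n\<in>?I. if prime (n + h) then ln (real (n + h)) * weight n else 0)"
        by (simp only: sum.inter_filter[OF fI])
    qed
    also have "\<dots> = (\<Sum>n\<in>?I. \<Sum>h\<in>H. if prime (n + h) then ln (real (n + h)) * weight n else 0)"
      by (rule sum.swap)
    also have "\<dots> = (\<Sum>n\<in>?I. \<Sum>h | h \<in> H \<and> prime (n + h). ln (real (n + h)) * weight n)"
      by (rule sum.cong[OF refl]) (simp only: sum.inter_filter[OF finH])
    finally show ?thesis by (simp add: sum_distrib_right)
  qed
  also have "\<dots> \<le> (\<Sum>n\<in>?I. Ln * weight n + real k * Ln * (of_bool (n \<in> G) * weight n + of_bool (n \<in> B) * weight n))"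
    by (intro sum_mono pointwise)
  also have "\<dots> = Ln * (\<Sum>n\<in>?I. weight n) + real k * Ln * ((\<Sum>n\<in>G. weight n) + (\<Sum>n\<in>B. weight n))"
  proof -
    have "(\<Sum>n\<in>?I. of_bool (n \<in> S) * weight n) = (\<Sum>n\<in>S. weight n)" if "S \<subseteq> ?I" for S
      using that fI by (intro sum.mono_neutral_cong_right) auto
    then show ?thesis using GI by (simp only: sum.distrib sum_distrib_left[symmetric])
  qed
  finally have T_le: "T \<le> Ln * (\<Sum>n\<in>?I. weight n) + real k * Ln * ((\<Sum>n\<in>G. weight n) + (\<Sum>n\<in>B. weight n))" .
  have S1: "(\<Sum>n\<in>?I. weight n) \<le> real N / real W * Mk (2 * l) + (lam {})\<^sup>2 * error"
    using sum_weight_approx[OF W(3) copP, of N] by linarith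
  have SB: "(\<Sum>n\<in>B. weight n) \<le> real N / real W * (8 * real k * (real l)\<^sup>2 * (1 + real k)\<^sup>2 * (t / X)\<^sup>2) * Mk (2 * l)
       + exp t * (4 * real k * (lam {})\<^sup>2 * error)"
    unfolding B_def using XD t by (intro S_bad[OF mert kl(2)] W(3) copP) auto
  have SG: "(\<Sum>n\<in>G. weight n) \<le> real (card G) * (4 ^ r * (lam {})\<^sup>2)"
  proof -
    have "weight n \<le> 4 ^ r * (lam {})\<^sup>2" if n: "n \<in> G" for n
    proof -
      let ?Dn = "sieving_primes P H n"
      have fD: "finite ?Dn" "\<And>p. p \<in> ?Dn \<Longrightarrow> prime p" using finP primeP by (auto simp: sieving_primes_def)
      have nI: "n \<in> ?I" using n GI by auto
      have lnt: "t \<le> ln (real p)" if pD: "p \<in> ?Dn" for p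
      proof -
        obtain h where h: "h \<in> H" "p dvd n + h" "p \<in> P" using pD by (auto simp: sieving_primes_def)
        then have "\<not> (prime p \<and> ln (real p) \<le> t)" using n unfolding G_def by blast
        then show ?thesis using primeP[OF h(3)] by linarith
      qed
      \<comment> \<open>The product of the sieving primes divides a number of size at most
        \<open>(3 * N) ^ k\<close>, and each of them has logarithm at least \<open>t\<close>; this
        limits their number to \<open>r\<close>.\<close>
      have "\<Prod>?Dn dvd (\<Prod>h\<in>H. n + h)"
      proof (intro prod_primes_dvd fD)
        fix p assume "p \<in> ?Dn"
        then obtain h where "h \<in> H" "p dvd n + h" by (auto simp: sieving_primes_def)
        then show "p dvd (\<Prod>h\<in>H. n + h)" using dvd_prodI[OF finH, of h "\<lambda>h. n + h"] dvd_trans by blast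
      qed
      have "real (card ?Dn) * t \<le> lnsum ?Dn"
        unfolding lnsum_def using sum_mono[of ?Dn "\<lambda>_. t" "\<lambda>p. ln (real p)"] lnt by simp
      also have "\<dots> = ln (real (\<Prod>?Dn))" by (intro lnsum_eq_ln_prod fD)
      also have "\<dots> \<le> ln (real (\<Prod>h\<in>H. n + h))"
      proof (rule ln_mono)
        show "0 < real (\<Prod>?Dn)" using prod_primes_pos[of ?Dn] fD by (simp only: of_nat_0_less_iff)
        have "0 < (\<Prod>h\<in>H. n + h)" using nI by (intro prod_pos) auto
        with \<open>\<Prod>?Dn dvd _\<close> show "real (\<Prod>?Dn) \<le> real (\<Prod>h\<in>H. n + h)"
          unfolding of_nat_le_iff by (intro dvd_imp_le)
      qed
      also have "\<dots> = (\<Sum>h\<in>H. ln (real (n + h)))" using nI finH by (subst of_nat_prod, subst ln_prod) auto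
      also have "\<dots> \<le> (\<Sum>h\<in>H. Ln)" using nI lnle by (intro sum_mono) auto
      also have "\<dots> = real k * Ln" by (simp add: cardH)
      also have "\<dots> < (real r + 1) * t" using r by (simp add: Ln_def)
      finally have "real (card ?Dn) < real r + 1" using t by simp
      then have "card ?Dn \<le> r" by linarith
      from weight_le[OF this] show ?thesis by (simp add: power_mult_distrib power_mult[symmetric] mult.commute[of r] power_mult[of "2::real" 2])
    qed
    from sum_bounded_above[of G weight, OF this] show ?thesis by simp
  qed
  have T_ge: "T \<ge> (1 + \<tau>) * Ln * (real N / real W * Mk (2 * l)) - real k * ((lam {})\<^sup>2 * Err)"
  proof -
    have "T \<ge> real N / real W * (2 * real k * real (2 * l + 1) / (real (l + 1) ^ 3 * (1 + \<tau>)\<^sup>2)) * (X - \<beta>) * Mk (2 * l)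
      - real k * ((lam {})\<^sup>2 * Err)"
      unfolding T_def by (rule S2_lower[OF mert D \<tau> \<beta> big kl(1) k2 W cop XN Err])
    \<comment> \<open>Of the four factors \<open>1 + \<tau>\<close> granted by the choice of
      parameters, two pay for the comparison of main terms and one for \<open>X - \<beta>\<close>
      falling short of \<open>\<theta> / 2 * ln (3 * N)\<close>; one remains as the gain.\<close>
    moreover have "(1 + \<tau>) * Ln \<le> 2 * real k * real (2 * l + 1) / (real (l + 1) ^ 3 * (1 + \<tau>)\<^sup>2) * (X - \<beta>)"
    proof -
      have "(1 + \<tau>) * Ln = (1 + \<tau>) ^ 4 * Ln / (1 + \<tau>) ^ 3"
      proof -
        have cancel: "s * Ln = s ^ 4 * Ln / s ^ 3" if "s > 0" for s :: real
          using that by (simp add: power_numeral_reduce)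
        show ?thesis by (rule cancel) (use \<tau>(1) in simp)
      qed
      also have "\<dots> \<le> (real k * real (2 * l + 1) * \<theta> / real (l + 1) ^ 3) * Ln / (1 + \<tau>) ^ 3"
        using \<tau> Ln by (intro divide_right_mono mult_right_mono \<rho>) auto
      also have "\<dots> = 2 * real k * real (2 * l + 1) / (real (l + 1) ^ 3 * (1 + \<tau>)\<^sup>2) * (\<theta> / 2 * Ln / (1 + \<tau>))"
      proof -
        have "a * b * \<theta> / c * Ln / s ^ 3 = 2 * a * b / (c * s\<^sup>2) * (\<theta> / 2 * Ln / s)" for a b c s :: real
          by (simp add: power_numeral_reduce mult_ac)
        then show ?thesis .
      qed
      also have "\<dots> \<le> 2 * real k * real (2 * l + 1) / (real (l + 1) ^ 3 * (1 + \<tau>)\<^sup>2) * (X - \<beta>)"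
        using X\<theta> by (intro mult_left_mono) (auto simp: Ln_def)
      finally show ?thesis .
    qed
    from mult_right_mono[OF this, of "real N / real W * Mk (2 * l)"]
    have "(1 + \<tau>) * Ln * (real N / real W * Mk (2 * l)) \<le>
       real N / real W * (2 * real k * real (2 * l + 1) / (real (l + 1) ^ 3 * (1 + \<tau>)\<^sup>2)) * (X - \<beta>) * Mk (2 * l)"
      using Mk_nonneg[of "2 * l"] by (simp only: mult_ac) (simp add: mult_ac)
    ultimately show ?thesis by linarith
  qed
  define w0 where "w0 = real N / real W / K"
  define Y where "Y = real N / real W * Mk (2 * l)"
  have Y0: "Y \<ge> 0" unfolding Y_def using Mk_nonneg by simp
  have Yge: "Y \<ge> (lam {})\<^sup>2 * w0"
  proof -
    have "(lam {})\<^sup>2 \<le> K * Mk (2 * l)"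
      unfolding K_def by (rule Mk_ge_lam[OF mert D \<tau> XD big'])
    then have "(lam {})\<^sup>2 / K \<le> Mk (2 * l)" using K0 by (simp add: field_simps)
    from mult_left_mono[OF this, of "real N / real W"] show ?thesis unfolding Y_def w0_def by (simp add: mult_ac)
  qed
  have kB: "real k * (\<Sum>n\<in>B. weight n) \<le> \<tau> / 4 * Y + real k * (exp t * (4 * real k * (lam {})\<^sup>2 * error))"
  proof -
    have "real k * (\<Sum>n\<in>B. weight n) \<le> real k * (real N / real W * (8 * real k * (real l)\<^sup>2 * (1 + real k)\<^sup>2 * (t / X)\<^sup>2) * Mk (2 * l)
       + exp t * (4 * real k * (lam {})\<^sup>2 * error))" by (intro mult_left_mono SB) simp
    also have "\<dots> = (8 * real k * (real l)\<^sup>2 * (1 + real k)\<^sup>2 * (t / X)\<^sup>2 * real k) * Y + real k * (exp t * (4 * real k * (lam {})\<^sup>2 * error))"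
      unfolding Y_def by (simp only: distrib_left mult_ac)
    also have "\<dots> \<le> \<tau> / 4 * Y + real k * (exp t * (4 * real k * (lam {})\<^sup>2 * error))"
      using Y0 t\<tau> by (intro add_right_mono mult_right_mono)
    finally show ?thesis .
  qed
  define E where "E = real k * Err + Ln * error + real k * Ln * (exp t * (4 * real k * error))"
  have E: "E \<le> \<tau> / 4 * Ln * w0"
    using err unfolding E_def Ln_def K_def w0_def by simp
  have "(1 + \<tau>) * Ln * Y - real k * ((lam {})\<^sup>2 * Err) \<le>
     Ln * (Y + (lam {})\<^sup>2 * error) + Ln * (real k * (\<Sum>n\<in>G. weight n)) + Ln * (\<tau> / 4 * Y + real k * (exp t * (4 * real k * (lam {})\<^sup>2 * error)))"
  proof -
    have "Ln * (\<Sum>n\<in>?I. weight n) \<le> Ln * (Y + (lam {})\<^sup>2 * error)"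
      using S1 Ln by (intro mult_left_mono) (auto simp: Y_def)
    moreover have "Ln * (real k * (\<Sum>n\<in>B. weight n)) \<le> Ln * (\<tau> / 4 * Y + real k * (exp t * (4 * real k * (lam {})\<^sup>2 * error)))"
      using kB Ln by (intro mult_left_mono) auto
    moreover have "real k * Ln * ((\<Sum>n\<in>G. weight n) + (\<Sum>n\<in>B. weight n)) =
      Ln * (real k * (\<Sum>n\<in>G. weight n)) + Ln * (real k * (\<Sum>n\<in>B. weight n))" by (simp add: algebra_simps)
    ultimately show ?thesis using T_le T_ge unfolding Y_def[symmetric] by linarith
  qed
  then have "Ln * (3 * \<tau> / 4 * Y) \<le> Ln * (real k * (\<Sum>n\<in>G. weight n)) + (lam {})\<^sup>2 * E"
    unfolding E_def by (simp add: algebra_simps)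
  also have "\<dots> \<le> Ln * (real k * (real (card G) * (4 ^ r * (lam {})\<^sup>2))) + (lam {})\<^sup>2 * (\<tau> / 4 * Ln * w0)"
    using Ln by (intro add_mono mult_left_mono SG E) auto
  finally have "Ln * (3 * \<tau> / 4 * Y) \<le> Ln * (real k * (real (card G) * (4 ^ r * (lam {})\<^sup>2))) + (lam {})\<^sup>2 * (\<tau> / 4 * Ln * w0)" .
  moreover have "Ln * (3 * \<tau> / 4 * ((lam {})\<^sup>2 * w0)) \<le> Ln * (3 * \<tau> / 4 * Y)"
    using Ln \<tau> Yge by (intro mult_left_mono) auto
  ultimately have "(Ln * (lam {})\<^sup>2) * (\<tau> / 2 * w0) \<le> (Ln * (lam {})\<^sup>2) * (real (card G) * (real k * 4 ^ r))"
    by (simp add: algebra_simps)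
  moreover have "Ln * (lam {})\<^sup>2 > 0" using Ln lam0 by simp
  ultimately have "\<tau> / 2 * w0 \<le> real (card G) * (real k * 4 ^ r)"
    by (simp only: mult_le_cancel_left_pos)
  then show ?thesis unfolding G_def K_def w0_def by simp
qed

end

subsection \<open>The error term in the prime sum\<close>

lemma level_of_distributionE:
  assumes "level_of_distribution \<theta>" "A > 0" "\<epsilon> > 0"
  obtains C where "\<And>N. N \<ge> 2 \<Longrightarrow>
    (\<Sum>q | 1 \<le> q \<and> real q \<le> real N powr (\<theta> - \<epsilon>). theta_error N q) \<le> C * (real N / ln (real N) powr A)"
  using assms(1)[unfolded level_of_distribution_def, rule_format, OF assms(2,3), folded theta_error_def]
  by blast

text \<open>Primes are counted as if they were all integers of the class. The loss of a logarithm is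
  harmless, since the bound only enters Cauchy's inequality opposite a saving of an arbitrary power
  of \<open>ln M\<close>.\<close>

lemma theta_error_trivial:
  assumes "1 \<le> q" "q \<le> M"
  shows "theta_error M q \<le> 2 * (real M / real q) * ln (real M) + real M / real (totient q)"
  unfolding theta_error_def
proof (rule Max.boundedI)
  show "(\<lambda>a. \<bar>theta_progression M q a - real M / real (totient q)\<bar>) ` totatives q \<noteq> {}"
    using assms by (auto simp: totatives_def)
  fix x assume "x \<in> (\<lambda>a. \<bar>theta_progression M q a - real M / real (totient q)\<bar>) ` totatives q"
  then obtain a where x: "x = \<bar>theta_progression M q a - real M / real (totient q)\<bar>" by auto
  have "0 \<le> theta_progression M q a"
    unfolding theta_progression_def using ln_prime_pos by (intro sum_nonneg) (auto intro: less_imp_le)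
  moreover have "theta_progression M q a \<le> 2 * (real M / real q) * ln (real M)"
  proof -
    have lnM: "0 \<le> ln (real M)" using assms by simp
    let ?S = "{p. prime p \<and> p \<le> M \<and> [p = a] (mod q)}"
    let ?T = "{n \<in> {..M}. n mod q = a mod q}"
    have "theta_progression M q a \<le> (\<Sum>p\<in>?S. ln (real M))"
      unfolding theta_progression_def by (intro sum_mono ln_mono) (auto simp: prime_gt_0_nat)
    also have "\<dots> = real (card ?S) * ln (real M)" by simp
    also have "\<dots> \<le> real (card ?T) * ln (real M)"
      using lnM by (intro mult_right_mono of_nat_mono card_mono) (auto simp: unique_euclidean_semiring_class.cong_def)
    also have "\<dots> \<le> (2 * (real M / real q)) * ln (real M)"
    proof (intro mult_right_mono lnM)
      have "real (card ?T) \<le> (real M - real (a mod q)) / real q + 1"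
        using assms by (intro card_residue_atMost) auto
      also have "\<dots> \<le> real M / real q + real M / real q"
        using assms by (intro add_mono divide_right_mono) (auto simp: divide_simps)
      finally show "real (card ?T) \<le> 2 * (real M / real q)" by simp
    qed
    finally show ?thesis .
  qed
  moreover have "0 \<le> real M / real (totient q)" by simp
  ultimately show "x \<le> 2 * (real M / real q) * ln (real M) + real M / real (totient q)"
    unfolding x by linarith
qed simp

lemma filterlim_ln_nat: "filterlim (\<lambda>N::nat. ln (real N)) at_top sequentially"
  by real_asymp

lemma eventually_power_le_exp: "\<epsilon> > 0 \<Longrightarrow> \<forall>\<^sub>F x::real in at_top. c * x ^ n \<le> exp (\<epsilon> * x)"
  by real_asymp

lemma eventually_ln_nat:
  assumes "\<forall>\<^sub>F x in at_top. Q (x::real)"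
  shows "\<forall>\<^sub>F N::nat in sequentially. Q (ln (real N))"
  using eventually_compose_filterlim[OF assms filterlim_ln_nat] by simp

text \<open>The multiplicities \<open>b ^ card S\<close> are unbounded, so the level of distribution
  does not apply directly. Cauchy's inequality separates them: with the trivial bound the squared
  multiplicities lose a fixed power \<open>B\<close> of \<open>ln M\<close>, the plain errors save
  the power \<open>2 * A + B\<close>, and the square root leaves a saving of
  \<open>A\<close>.\<close>

theorem theta_error_sum:
  fixes \<theta> \<theta>' A :: real and K b :: nat
  assumes lev: "level_of_distribution \<theta>" and \<theta>': "\<theta>' < \<theta>" "0 < \<theta>'" "\<theta>' < 1" and A: "A > 0"
  obtains C where "C \<ge> 0" "\<forall>\<^sub>F M in sequentially. \<forall>P Z X. finite P \<and> (\<forall>p\<in>P. prime p) \<and> finite Z \<and> (\<forall>p\<in>Z. prime p) \<and>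
     P \<inter> Z = {} \<and> 1 < \<Prod>Z \<and> real (\<Prod>Z) \<le> ln (real M) ^ K \<and> 0 \<le> X \<and> 2 * X \<le> \<theta>' * ln (real M) \<longrightarrow>
     (\<Sum>S | S \<in> Pow P \<and> lnsum S \<le> 2 * X. real b ^ card S * theta_error M (\<Prod>Z * \<Prod>S)) \<le> C * (real M / ln (real M) powr A)"
proof -
  define \<epsilon> where "\<epsilon> = (\<theta> - \<theta>') / 2"
  have \<epsilon>: "\<epsilon> > 0" using \<theta>' by (simp add: \<epsilon>_def)
  \<comment> \<open>Squaring gives \<open>b ^ 2\<close> for each prime, and the trivial error bound
    adds a factor 2 per prime.\<close>
  define e where "e = 2 * b ^ 2"
  define B where "B = K + 2 + 2 * e"
  define A' where "A' = 2 * A + real B"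
  have "A' > 0" using A by (simp add: A'_def)
  from level_of_distributionE[OF lev this \<epsilon>]
  obtain C0 where C0: "\<And>N. N \<ge> 2 \<Longrightarrow> (\<Sum>q | 1 \<le> q \<and> real q \<le> real N powr (\<theta> - \<epsilon>). theta_error N q) \<le> C0 * (real N / ln (real N) powr A')"
    by blast
  \<comment> \<open>Room for the factor \<open>\<Prod>Z\<close>, at most a power of
    \<open>ln M\<close>: the moduli stay below both \<open>M powr (\<theta> - \<epsilon>)\<close>
    and \<open>M\<close>.\<close>
  define \<delta> where "\<delta> = min \<epsilon> (1 - \<theta>')"
  have \<delta>: "\<delta> > 0" using \<epsilon> \<theta>' by (simp add: \<delta>_def)
  have "\<forall>\<^sub>F x::real in at_top. 1 * x ^ K \<le> exp (\<delta> * x) \<and> x \<ge> 3 + \<theta>'"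
    using \<delta> by (intro eventually_conj eventually_power_le_exp eventually_ge_at_top)
  then have ev: "\<forall>\<^sub>F M::nat in sequentially. ln (real M) ^ K \<le> exp (\<delta> * ln (real M)) \<and> ln (real M) \<ge> 3 + \<theta>'"
    by (intro eventually_ln_nat) simp
  show thesis
  proof (rule that[of "sqrt \<bar>C0\<bar>"])
    show "sqrt \<bar>C0\<bar> \<ge> 0" by simp
    show "\<forall>\<^sub>F M in sequentially. \<forall>P Z X. finite P \<and> (\<forall>p\<in>P. prime p) \<and> finite Z \<and> (\<forall>p\<in>Z. prime p) \<and>
     P \<inter> Z = {} \<and> 1 < \<Prod>Z \<and> real (\<Prod>Z) \<le> ln (real M) ^ K \<and> 0 \<le> X \<and> 2 * X \<le> \<theta>' * ln (real M) \<longrightarrow>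
     (\<Sum>S | S \<in> Pow P \<and> lnsum S \<le> 2 * X. real b ^ card S * theta_error M (\<Prod>Z * \<Prod>S)) \<le>
       sqrt \<bar>C0\<bar> * (real M / ln (real M) powr A)"
      using ev eventually_ge_at_top[of "2::nat"]
    proof eventually_elim
      case (elim M)
      define L where "L = ln (real M)"
      have M: "M \<ge> 2" "real M = exp L" using elim by (auto simp: L_def)
      have L: "L \<ge> 3 + \<theta>'" "L ^ K \<le> exp (\<delta> * L)" using elim by (auto simp: L_def)
      have L3: "L \<ge> 3" "L > 0" using L \<theta>' by auto
      show ?case
      proof (intro allI impI, elim conjE)
        fix P Z :: "nat set" and X :: real
        assume P: "finite P" "\<forall>p\<in>P. prime p" and Z: "finite Z" "\<forall>p\<in>Z. prime p" and PZ: "P \<inter> Z = {}"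
          and W: "1 < \<Prod>Z" "real (\<Prod>Z) \<le> ln (real M) ^ K" and X: "0 \<le> X" "2 * X \<le> \<theta>' * ln (real M)"
        define W where "W = \<Prod>Z"
        have "W > 1" "real W \<le> L ^ K" using W unfolding W_def L_def by auto
        then have W1: "W > 1" "real W \<le> L ^ K" "real W \<ge> 1" by auto
        let ?F = "{S. S \<in> Pow P \<and> lnsum S \<le> 2 * X}"
        define t where "t S = theta_error M (W * \<Prod>S)" for S
        have FS: "finite S" "\<And>p. p \<in> S \<Longrightarrow> prime p" "S \<inter> Z = {}" "\<Prod>S > 0" if "S \<in> ?F" for S
          using that P PZ by (auto intro: finite_subset intro!: prod_primes_pos)
        have finF: "finite ?F" using P by simp
        have prodS: "real (\<Prod>S) \<le> exp (\<theta>' * L)" if "S \<in> ?F" for S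
        proof -
          have "ln (real (\<Prod>S)) \<le> \<theta>' * L" using lnsum_eq_ln_prod[of S] FS[OF that] that X by (auto simp: L_def)
          then show ?thesis using FS(4)[OF that] by (simp only: ln_le_iff_le_exp of_nat_0_less_iff)
        qed
        have q_le: "real (W * \<Prod>S) \<le> exp ((\<theta>' + \<delta>) * L)" if "S \<in> ?F" for S
        proof -
          have "real (W * \<Prod>S) \<le> exp (\<delta> * L) * exp (\<theta>' * L)"
            unfolding of_nat_mult using W1 L prodS[OF that] by (intro mult_mono) (auto simp del: of_nat_prod)
          then show ?thesis by (simp add: exp_add[symmetric] algebra_simps)
        qed
        have q_le1: "real (W * \<Prod>S) \<le> real M powr (\<theta> - \<epsilon>)" if "S \<in> ?F" for S
        proof -
          have "(\<theta>' + \<delta>) * L \<le> (\<theta> - \<epsilon>) * L"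
          proof (intro mult_right_mono)
            have "\<delta> \<le> (\<theta> - \<theta>') / 2" unfolding \<delta>_def \<epsilon>_def by (rule min.cobounded1)
            moreover have "\<theta> - \<epsilon> = \<theta>' + (\<theta> - \<theta>') / 2" by (simp add: \<epsilon>_def field_simps)
            ultimately show "\<theta>' + \<delta> \<le> \<theta> - \<epsilon>" by linarith
          qed (use L3 in simp)
          then have "exp ((\<theta>' + \<delta>) * L) \<le> exp ((\<theta> - \<epsilon>) * L)" by simp
          also have "\<dots> = real M powr (\<theta> - \<epsilon>)" using M by (simp add: powr_def)
          finally show ?thesis using q_le[OF that] by linarith
        qed
        have q_le2: "W * \<Prod>S \<le> M" if "S \<in> ?F" for S
        proof -
          have "(\<theta>' + \<delta>) * L \<le> 1 * L" using L3 by (intro mult_right_mono) (auto simp: \<delta>_def)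
          then have "exp ((\<theta>' + \<delta>) * L) \<le> real M" unfolding M(2) by simp
          then have "real (W * \<Prod>S) \<le> real M" using q_le[OF that] by linarith
          then show ?thesis by (simp only: of_nat_le_iff)
        qed
        have q_ge: "1 \<le> W * \<Prod>S" if "S \<in> ?F" for S using FS(4)[OF that] W1 by (simp add: Suc_le_eq)
        have t0: "0 \<le> t S" if "S \<in> ?F" for S unfolding t_def by (intro theta_error_nonneg q_ge that)
        have sum1: "(\<Sum>S\<in>?F. t S) \<le> \<bar>C0\<bar> * (real M / L powr A')"
        proof -
          have inj: "inj_on (\<lambda>S. W * \<Prod>S) ?F"
          proof (rule inj_onI)
            fix S S' assume "S \<in> ?F" "S' \<in> ?F" "W * \<Prod>S = W * \<Prod>S'"
            moreover have "inj_on (\<lambda>S. \<Prod>S) ?F" using FS by (intro inj_on_prod_primes) auto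
            ultimately show "S = S'" using W1 by (auto dest: inj_onD)
          qed
          have "(\<Sum>S\<in>?F. t S) = (\<Sum>q\<in>(\<lambda>S. W * \<Prod>S) ` ?F. theta_error M q)"
            unfolding t_def by (subst sum.reindex[OF inj]) (simp add: o_def)
          also have "\<dots> \<le> (\<Sum>q | 1 \<le> q \<and> real q \<le> real M powr (\<theta> - \<epsilon>). theta_error M q)"
          proof (rule sum_mono2)
            show "finite {q. 1 \<le> q \<and> real q \<le> real M powr (\<theta> - \<epsilon>)}"
            proof (rule finite_subset)
              show "{q. 1 \<le> q \<and> real q \<le> real M powr (\<theta> - \<epsilon>)} \<subseteq> {..nat \<lfloor>real M powr (\<theta> - \<epsilon>)\<rfloor>}"
                by (auto simp: le_nat_iff le_floor_iff)
            qed simp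
            show "(\<lambda>S. W * \<Prod>S) ` ?F \<subseteq> {q. 1 \<le> q \<and> real q \<le> real M powr (\<theta> - \<epsilon>)}"
              using q_ge q_le1 by blast
          qed (auto intro: theta_error_nonneg)
          also have "\<dots> \<le> C0 * (real M / L powr A')" using C0[OF M(1)] by (simp add: L_def)
          also have "\<dots> \<le> \<bar>C0\<bar> * (real M / L powr A')" by (intro mult_right_mono) auto
          finally show ?thesis .
        qed
        \<comment> \<open>Every \<open>1 - 1 / p\<close> is at least one half. This costs a factor 2
          for each prime of \<open>S\<close>, while the powers of 2 for the primes of
          \<open>Z\<close> are bounded by \<open>W\<close> itself.\<close>
        have triv: "t S \<le> real M * (2 * L + real W) * (\<Prod>p\<in>S. 2 * (1 / real p))" if S: "S \<in> ?F" for S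
        proof -
          define q where "q = W * \<Prod>S"
          have q: "1 \<le> q" "q \<le> M" using q_ge[OF S] q_le2[OF S] by (simp_all add: q_def)
          have "q = \<Prod>(Z \<union> S)" unfolding q_def W_def using Z FS[OF S] by (subst prod.union_disjoint) auto
          then have "real (totient q) / real q = (\<Prod>p\<in>Z \<union> S. 1 - 1 / real p)"
            using Z FS[OF S] by (simp only:) (intro totient_prod_primes, auto)
          also have "\<dots> \<ge> (\<Prod>p\<in>Z \<union> S. 1 / 2)"
          proof (intro prod_mono)
            fix p assume "p \<in> Z \<union> S"
            then have "prime p" using Z FS[OF S] by auto
            then have "real p \<ge> 2" using prime_ge_2_nat[of p] by simp
            then show "0 \<le> (1 / 2::real) \<and> 1 / 2 \<le> 1 - 1 / real p" by (simp add: field_simps)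
          qed
          also have "(\<Prod>p\<in>Z \<union> S. 1 / 2 :: real) = (1 / 2) ^ card Z * (1 / 2) ^ card S"
            using Z FS[OF S] by (subst prod.union_disjoint) auto
          finally have "real q \<le> 2 ^ card Z * 2 ^ card S * real (totient q)"
            using q by (simp add: field_simps)
          moreover have "totient q > 0" using q by simp
          ultimately have "1 / real (totient q) \<le> 2 ^ card Z * 2 ^ card S / real q"
            using q by (simp add: field_simps)
          moreover have "(2::real) ^ card Z \<le> real W"
          proof -
            have "(\<Prod>p\<in>Z. 2) \<le> \<Prod>Z" using Z prime_ge_2_nat by (intro prod_mono) auto
            then have "2 ^ card Z \<le> W" by (simp add: W_def)
            then have "real (2 ^ card Z) \<le> real W" by (simp only: of_nat_le_iff)
            then show ?thesis by simp
          qed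
          then have "2 ^ card Z * 2 ^ card S / real q \<le> real W * 2 ^ card S / real q"
            by (intro divide_right_mono mult_right_mono) auto
          ultimately have tot: "1 / real (totient q) \<le> real W * 2 ^ card S / real q" by linarith
          have "t S \<le> 2 * (real M / real q) * L + real M * (1 / real (totient q))"
            unfolding t_def using theta_error_trivial[OF q] by (simp add: L_def q_def)
          also have "\<dots> \<le> 2 * (real M / real q) * L * 2 ^ card S + real M * (real W * 2 ^ card S / real q)"
          proof (intro add_mono mult_left_mono tot)
            have "2 * (real M / real q) * L * 1 \<le> 2 * (real M / real q) * L * 2 ^ card S"
              using L3 by (intro mult_left_mono) auto
            then show "2 * (real M / real q) * L \<le> 2 * (real M / real q) * L * 2 ^ card S" by simp
          qed simp
          also have "\<dots> = real M * (2 * L + real W) * 2 ^ card S / real q"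
            by (simp add: algebra_simps add_divide_distrib)
          also have "\<dots> \<le> real M * (2 * L + real W) * 2 ^ card S / real (\<Prod>S)"
          proof (rule divide_left_mono)
            have "\<Prod>S \<le> q" using W1 by (simp add: q_def)
            then show "real (\<Prod>S) \<le> real q" by (simp only: of_nat_le_iff)
            show "0 \<le> real M * (2 * L + real W) * 2 ^ card S" using L3 by (intro mult_nonneg_nonneg) auto
            have "0 < real q" "0 < real (\<Prod>S)" using q FS(4)[OF S] by (simp_all only: of_nat_0_less_iff)
            then show "0 < real q * real (\<Prod>S)" by (rule mult_pos_pos)
          qed
          also have "\<dots> = real M * (2 * L + real W) * (\<Prod>p\<in>S. 2 * (1 / real p))"
            by (simp add: prod.distrib prod_dividef)
          finally show ?thesis .
        qed
        have sum2: "(\<Sum>S\<in>?F. (real b ^ card S)\<^sup>2 * t S) \<le> real M * L ^ B"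
        proof -
          have "(\<Sum>S\<in>?F. (real b ^ card S)\<^sup>2 * t S) \<le>
            (\<Sum>S\<in>?F. real M * (2 * L + real W) * (\<Prod>p\<in>S. real e * (1 / real p)))"
          proof (rule sum_mono)
            fix S assume S: "S \<in> ?F"
            have "(real b ^ card S)\<^sup>2 * t S \<le> (real b ^ card S)\<^sup>2 * (real M * (2 * L + real W) * (\<Prod>p\<in>S. 2 * (1 / real p)))"
              by (intro mult_left_mono triv S) simp
            also have "(real b ^ card S)\<^sup>2 * (real M * (2 * L + real W) * (\<Prod>p\<in>S. 2 * (1 / real p))) =
               real M * (2 * L + real W) * (\<Prod>p\<in>S. (real b)\<^sup>2 * (2 * (1 / real p)))"
            proof -
              have "(real b ^ card S)\<^sup>2 = (\<Prod>p\<in>S. (real b)\<^sup>2)" by (simp add: power_mult[symmetric] mult.commute)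
              then show ?thesis by (simp only: prod.distrib mult_ac)
            qed
            also have "(\<Prod>p\<in>S. (real b)\<^sup>2 * (2 * (1 / real p))) = (\<Prod>p\<in>S. real e * (1 / real p))"
              by (intro prod.cong refl) (simp add: e_def)
            finally show "(real b ^ card S)\<^sup>2 * t S \<le> real M * (2 * L + real W) * (\<Prod>p\<in>S. real e * (1 / real p))" .
          qed
          also have "\<dots> = real M * (2 * L + real W) * osum (\<lambda>p. real e * (1 / real p)) P (2 * X)"
            unfolding osum_alt[OF P(1)] by (simp only: sum_distrib_left)
          also have "\<dots> \<le> real M * (2 * L + real W) * (2 + 2 * X) ^ e"
          proof (intro mult_left_mono)
            have "osum (\<lambda>p. real e * (1 / real p)) P (2 * X) \<le> osum (\<lambda>p. 1 / real p) P (2 * X) ^ e"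
              using P X by (intro osum_mult_le_power) auto
            also have "\<dots> \<le> (2 + 2 * X) ^ e"
            proof (intro power_mono osum_nonneg)
              have "osum (\<lambda>p. 1 / real p) P (2 * X) \<le> 1 + ln (real (\<Prod>{})) + (\<Prod>p\<in>{}. 1 - 1 / real p) * (1 + 2 * X)"
                unfolding osum_alt[OF P(1)] by (rule sum_prod_inverse_le) (use P X in auto)
              then show "osum (\<lambda>p. 1 / real p) P (2 * X) \<le> 2 + 2 * X" by simp
            qed auto
            finally show "osum (\<lambda>p. real e * (1 / real p)) P (2 * X) \<le> (2 + 2 * X) ^ e" .
          qed (use L3 in \<open>auto intro!: mult_nonneg_nonneg\<close>)
          also have "\<dots> \<le> real M * L ^ (K + 2) * (L ^ 2) ^ e"
          proof (intro mult_mono power_mono mult_left_mono)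
            have "1 \<le> L ^ K" using L3 by (intro one_le_power) auto
            then have "2 * L + L ^ K \<le> 2 * L * L ^ K + L * L ^ K"
              using L3 by (intro add_mono) (auto simp: mult_le_cancel_right1 mult_le_cancel_left1)
            also have "\<dots> \<le> L * (L * L ^ K)" using L3 by (simp add: mult_right_mono)
            finally show "2 * L + real W \<le> L ^ (K + 2)" using W1 by (simp add: power_add power2_eq_square mult_ac)
            have "2 * 1 + \<theta>' * L \<le> 2 * L + \<theta>' * L" using L3 by simp
            also have "\<dots> \<le> L * L" unfolding distrib_right[symmetric] using L L3 \<theta>' by (intro mult_right_mono) auto
            finally show "2 + 2 * X \<le> L ^ 2" using X by (simp add: power2_eq_square L_def)
          qed (use L3 X in auto)
          also have "\<dots> = real M * L ^ B"
            by (simp only: B_def power_add[of L "K + 2" "2 * e"] power_mult mult.assoc)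
          finally show ?thesis .
        qed
        have "(\<Sum>S\<in>?F. real b ^ card S * t S)\<^sup>2 = (\<Sum>S\<in>?F. (real b ^ card S * sqrt (t S)) * sqrt (t S))\<^sup>2"
          using t0 by (intro arg_cong[of _ _ "\<lambda>x. x\<^sup>2"] sum.cong refl) (auto simp: mult.assoc)
        also have "\<dots> \<le> (\<Sum>S\<in>?F. (real b ^ card S * sqrt (t S))\<^sup>2) * (\<Sum>S\<in>?F. (sqrt (t S))\<^sup>2)"
          by (rule Cauchy_Schwarz_ineq_sum)
        also have "\<dots> = (\<Sum>S\<in>?F. (real b ^ card S)\<^sup>2 * t S) * (\<Sum>S\<in>?F. t S)"
          using t0 by (intro arg_cong2[of _ _ _ _ "(*)"] sum.cong refl) (auto simp: power_mult_distrib)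
        also have "\<dots> \<le> (real M * L ^ B) * (\<bar>C0\<bar> * (real M / L powr A'))"
          using t0 L3 by (intro mult_mono sum1 sum2 sum_nonneg) auto
        also have "\<dots> = \<bar>C0\<bar> * (real M)\<^sup>2 / (L powr A)\<^sup>2"
        proof -
          have "A' = A + A + real B" by (simp add: A'_def)
          then have "L powr A' = L powr A * L powr A * L ^ B"
            by (simp only: powr_add powr_realpow[OF L3(2)])
          then show ?thesis using L3 by (simp add: power2_eq_square)
        qed
        also have "\<dots> = (sqrt \<bar>C0\<bar> * (real M / L powr A))\<^sup>2"
          by (simp add: power_mult_distrib power_divide)
        finally have "(\<Sum>S\<in>?F. real b ^ card S * t S) \<le> sqrt \<bar>C0\<bar> * (real M / L powr A)"
          by (rule power2_le_imp_le) simp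
        then show "(\<Sum>S | S \<in> Pow P \<and> lnsum S \<le> 2 * X. real b ^ card S * theta_error M (\<Prod>Z * \<Prod>S)) \<le>
           sqrt \<bar>C0\<bar> * (real M / ln (real M) powr A)"
          by (simp only: t_def W_def L_def)
      qed
    qed
  qed
qed

text \<open>With \<open>\<epsilon> = \<theta>\<close> and \<open>A = 1\<close> only the modulus 1
  remains, so the hypothesis already contains a prime number estimate and Chebyshev's bound needs no
  separate proof.\<close>

lemma chebyshev_of_level:
  assumes "level_of_distribution \<theta>" "\<theta> > 0"
  obtains C where "\<And>n::nat. (\<Sum>p | prime p \<and> p \<le> n. ln (real p)) \<le> C * real n"
proof -
  from level_of_distributionE[OF assms(1) zero_less_one assms(2)]
  obtain C0 where C0: "\<And>N. N \<ge> 2 \<Longrightarrow> (\<Sum>q | 1 \<le> q \<and> real q \<le> real N powr (\<theta> - \<theta>). theta_error N q) \<le> C0 * (real N / ln (real N) powr 1)"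
    by blast
  show thesis
  proof (rule that[of "1 + \<bar>C0\<bar> / ln 2"])
    fix n :: nat
    show "(\<Sum>p | prime p \<and> p \<le> n. ln (real p)) \<le> (1 + \<bar>C0\<bar> / ln 2) * real n"
    proof (cases "n \<ge> 2")
      case False
      then have "\<not> (prime p \<and> p \<le> n)" for p using prime_ge_2_nat[of p] by auto
      then have "{p. prime p \<and> p \<le> n} = {}" by blast
      then have "(\<Sum>p | prime p \<and> p \<le> n. ln (real p)) = 0" by (simp only: sum.empty)
      then show ?thesis by simp
    next
      case True
      have q1: "{q::nat. 1 \<le> q \<and> real q \<le> real n powr (\<theta> - \<theta>)} = {1}" using True by auto
      have "\<bar>theta_progression n 1 1 - real n / real (totient 1)\<bar> \<le> theta_error n 1"
        unfolding theta_error_def by (intro Max_ge) (auto simp: totatives_def)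
      also have "theta_error n 1 \<le> C0 * (real n / ln (real n))" using C0[OF True] unfolding q1 using True by simp
      also have "\<dots> \<le> \<bar>C0\<bar> * (real n / ln 2)"
        using True by (intro mult_mono divide_left_mono mult_pos_pos) auto
      finally have "theta_progression n 1 1 \<le> real n + \<bar>C0\<bar> * (real n / ln 2)" by simp
      then show ?thesis by (simp add: theta_progression_def field_simps)
    qed
  qed
qed

subsection \<open>Lower and upper bounds for tuples\<close>

definition rough :: "real \<Rightarrow> nat \<Rightarrow> bool" where
  "rough t n \<longleftrightarrow> (\<forall>p. prime p \<and> ln (real p) \<le> t \<longrightarrow> \<not> p dvd n)"

text \<open>\<open>L\<close> stands for \<open>ln N\<close>. The last condition says that
  \<open>Z\<close> contains every prime dividing a difference of two shifts, and the power of
  \<open>L\<close> bounding the product of \<open>Z\<close> keeps its logarithm negligible.\<close>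

definition separated :: "nat \<Rightarrow> nat \<Rightarrow> real \<Rightarrow> nat set \<Rightarrow> nat set \<Rightarrow> bool" where
  "separated D K L Z H \<longleftrightarrow> finite Z \<and> (\<forall>p\<in>Z. prime p) \<and> (\<forall>p. prime p \<and> p \<le> D \<longrightarrow> p \<in> Z) \<and>
     real (\<Prod>Z) \<le> L ^ K \<and> finite H \<and> (\<forall>h\<in>H. real h \<le> L) \<and>
     (\<forall>p. prime p \<and> p \<notin> Z \<longrightarrow> inj_on (\<lambda>h. h mod p) H)"

text \<open>The ratio tends to \<open>2 * \<theta> > 1\<close>, which fixes \<open>l\<close>; a
  fourth root distributes the surplus over four equal factors \<open>1 + \<tau>\<close>; then
  \<open>D\<close> is taken large in terms of both. The square of \<open>k = l ^ 2\<close> below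
  \<open>D\<close> is for the later count of admissible residue classes.\<close>

lemma gpy_parameters:
  fixes \<theta> :: real
  assumes "\<theta> > 1 / 2"
  obtains l D :: nat and \<tau> :: real where "l \<ge> 2" "\<tau> > 0"
    "real (l ^ 2) * real (2 * l + 1) * \<theta> / real (l + 1) ^ 3 \<ge> (1 + \<tau>) ^ 4"
    "D \<ge> 2 * l ^ 2" "D \<ge> (l ^ 2) ^ 2" "D \<ge> 2" "exp (2 * real (l ^ 2) / real D) \<le> 1 + \<tau>"
proof -
  have "((\<lambda>l::nat. real (l ^ 2) * real (2 * l + 1) * \<theta> / real (l + 1) ^ 3) \<longlongrightarrow> 2 * \<theta>) sequentially"
    by real_asymp
  then have "\<forall>\<^sub>F l::nat in sequentially. real (l ^ 2) * real (2 * l + 1) * \<theta> / real (l + 1) ^ 3 > 1"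
    by (rule order_tendstoD(1)) (use assms in simp)
  then have "\<forall>\<^sub>F l::nat in sequentially. real (l ^ 2) * real (2 * l + 1) * \<theta> / real (l + 1) ^ 3 > 1 \<and> l \<ge> 2"
    by (intro eventually_conj eventually_ge_at_top)
  then obtain l :: nat where l: "real (l ^ 2) * real (2 * l + 1) * \<theta> / real (l + 1) ^ 3 > 1" "l \<ge> 2"
    using eventually_happens'[OF sequentially_bot] by blast
  define \<rho> where "\<rho> = real (l ^ 2) * real (2 * l + 1) * \<theta> / real (l + 1) ^ 3"
  define \<tau> where "\<tau> = root 4 \<rho> - 1"
  have "\<rho> > 1" using l by (simp add: \<rho>_def)
  then have \<tau>: "\<tau> > 0" "(1 + \<tau>) ^ 4 = \<rho>" by (auto simp: \<tau>_def real_root_pow_pos2)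
  have "((\<lambda>D::nat. exp (2 * real (l ^ 2) / real D)) \<longlongrightarrow> 1) sequentially"
    by real_asymp
  then have "\<forall>\<^sub>F D::nat in sequentially. exp (2 * real (l ^ 2) / real D) < 1 + \<tau>"
    by (rule order_tendstoD(2)) (use \<tau> in simp)
  then have "\<forall>\<^sub>F D::nat in sequentially. exp (2 * real (l ^ 2) / real D) < 1 + \<tau> \<and> D \<ge> 2 * l ^ 2 \<and> D \<ge> (l ^ 2) ^ 2 \<and> D \<ge> 2"
    by (intro eventually_conj eventually_ge_at_top)
  then obtain D :: nat where "exp (2 * real (l ^ 2) / real D) < 1 + \<tau> \<and> D \<ge> 2 * l ^ 2 \<and> D \<ge> (l ^ 2) ^ 2 \<and> D \<ge> 2"
    using eventually_happens'[OF sequentially_bot] by blast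
  then show thesis using l \<tau> by (intro that[of l \<tau> D]) (auto simp: \<rho>_def)
qed

text \<open>\<open>k\<close> and \<open>D\<close> precede \<open>K\<close> in the quantifiers since
  the exponent \<open>K\<close> used later depends on \<open>k\<close>. The constants depend on
  \<open>K\<close> but neither on the shifts nor on the class \<open>\<nu>\<close>.\<close>

theorem tuple_lower_bound:
  fixes \<theta> :: real
  assumes \<theta>: "\<theta> > 1 / 2" and lev: "level_of_distribution \<theta>"
  obtains k D :: nat where "k \<ge> 2" "D \<ge> k ^ 2" "D \<ge> 2 * (k + 1)"
    "\<forall>K. \<exists>c>0. \<exists>\<delta>>0. \<forall>\<^sub>F N in sequentially. \<forall>Z H \<nu>. separated D K (ln (real N)) Z H \<and> card H = k \<and>
       \<nu> < \<Prod>Z \<and> (\<forall>h\<in>H. coprime (\<nu> + h) (\<Prod>Z)) \<longrightarrow>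
       c * (real N / real (\<Prod>Z)) / ((\<Prod>p\<in>Z. 1 - 1 / real p) * ln (real N)) ^ k \<le>
       real (card {n \<in> {N<..2 * N}. n mod \<Prod>Z = \<nu> \<and> (\<forall>h\<in>H. rough (\<delta> * ln (real N)) (n + h)) \<and> 2 \<le> card {h \<in> H. prime (n + h)}})"
proof -
  \<comment> \<open>Strictly between \<open>1 / 2\<close> and \<open>min \<theta> 1\<close>: above
    \<open>1 / 2\<close> for the sieve to succeed, below \<open>\<theta>\<close> for the prime sums,
    and below 1 because counting integers has an error near \<open>N powr \<theta>'\<close>.\<close>
  define \<theta>' where "\<theta>' = (1 / 2 + min \<theta> 1) / 2"
  have \<theta>': "1 / 2 < \<theta>'" "\<theta>' < \<theta>" "\<theta>' < 1" "0 < \<theta>'" using \<theta> by (auto simp: \<theta>'_def min_def)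
  obtain l D \<tau> where par: "l \<ge> 2" "\<tau> > 0"
    "real (l ^ 2) * real (2 * l + 1) * \<theta>' / real (l + 1) ^ 3 \<ge> (1 + \<tau>) ^ 4"
    "D \<ge> 2 * l ^ 2" "D \<ge> (l ^ 2) ^ 2" "D \<ge> 2" "exp (2 * real (l ^ 2) / real D) \<le> 1 + \<tau>"
    using gpy_parameters[OF \<theta>'(1)] by metis
  define k where "k = l ^ 2"
  note par = par[folded k_def]
  have k: "k \<ge> 2" "k \<ge> 1" using power_mono[of 2 l 2] par(1) by (auto simp: k_def)
  obtain Cb where Cb: "\<And>n::nat. (\<Sum>p | prime p \<and> p \<le> n. ln (real p)) \<le> Cb * real n"
    using chebyshev_of_level[OF lev] \<theta> by force
  obtain Dm where Dm: "Dm \<ge> 0" "\<And>P t. finite P \<Longrightarrow> (\<And>p. p \<in> P \<Longrightarrow> prime p \<and> p > 2 * k) \<Longrightarrow> 0 \<le> t \<Longrightarrow>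
       (\<Sum>p | p \<in> P \<and> ln (real p) \<le> t. ln (real p) / (real p - real k)) \<le> t + Dm"
    using mertens_shift[OF Cb, of k] by blast
  define \<beta> where "\<beta> = (real k - 1) * Dm"
  define Q where "Q = 8 * real k * (real l)\<^sup>2 * (1 + real k)\<^sup>2 * real k"
  have Q: "Q > 0" using k par(1) by (auto simp: Q_def)
  define s where "s = min 1 (\<tau> / (4 * Q))"
  have s: "0 < s" "s \<le> 1" "Q * s\<^sup>2 \<le> \<tau> / 4"
  proof -
    show s0: "0 < s" "s \<le> 1" using par Q by (auto simp: s_def)
    have "s\<^sup>2 \<le> s" using s0 by (simp add: power2_eq_square mult_left_le)
    also have "s \<le> \<tau> / (4 * Q)" by (simp add: s_def)
    finally show "Q * s\<^sup>2 \<le> \<tau> / 4" using Q by (simp add: field_simps)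
  qed
  \<comment> \<open>The first entry keeps the \<open>n\<close> with small prime factors within
    \<open>\<tau> / 4\<close>; the second keeps \<open>\<theta>' + \<delta>\<close> at most
    \<open>(1 + \<theta>') / 2\<close>, so the extra factor \<open>exp t\<close> in the error is
    harmless.\<close>
  define \<delta> where "\<delta> = min (\<theta>' / 2 * s) ((1 - \<theta>') / 2)"
  have "\<delta> > 0" using s \<theta>' by (auto simp: \<delta>_def)
  moreover have "\<delta> \<le> \<theta>' / 2 * s" "\<delta> \<le> (1 - \<theta>') / 2"
    unfolding \<delta>_def by (rule min.cobounded1, rule min.cobounded2)
  ultimately have \<delta>: "\<delta> > 0" "\<delta> \<le> \<theta>' / 2 * s" "\<delta> \<le> (1 - \<theta>') / 2" by blast+
  \<comment> \<open>A product of \<open>k\<close> numbers up to \<open>3 * N \<le> N ^ 2\<close> has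
    at most \<open>2 * k / \<delta>\<close> prime factors above
    \<open>N powr \<delta>\<close>.\<close>
  define r where "r = nat \<lceil>2 * real k / \<delta>\<rceil>"
  have r: "2 * real k \<le> real r * \<delta>"
  proof -
    have "2 * real k / \<delta> \<le> real r" unfolding r_def by linarith
    then show ?thesis using \<delta> by (simp add: field_simps)
  qed
  define C1 where "C1 = (2 * (1 + real k)) ^ l * (3 * (1 + \<tau>)) ^ k"
  have C1: "C1 > 0" using par by (simp add: C1_def)
  define c where "c = \<tau> / 2 / C1 / (real k * 4 ^ r)"
  have c: "c > 0" using par C1 k by (simp add: c_def)
  show thesis
  proof (rule that[OF k(1) par(5) _ allI])
    have "2 * 2 \<le> k" unfolding k_def power2_eq_square using par(1) by (intro mult_mono) auto
    then have "4 * k \<le> k ^ 2" unfolding power2_eq_square by (intro mult_right_mono) auto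
    moreover have "2 * (k + 1) \<le> 4 * k" using \<open>2 * 2 \<le> k\<close> by simp
    ultimately show "2 * (k + 1) \<le> D" using par(5) by (meson order.trans)
  next
    fix K
    \<comment> \<open>The saving asked of the prime sums: \<open>W\<close> can be as large as
      \<open>L ^ K\<close>, and the main term is divided by at most a constant times
      \<open>L ^ k\<close>. An additional factor \<open>L\<close> in the main term then beats any
      constant.\<close>
    have A0: "real (K + k) > 0" using k by simp
    obtain C where C: "C \<ge> 0" "\<forall>\<^sub>F M in sequentially. \<forall>P Z X. finite P \<and> (\<forall>p\<in>P. prime p) \<and> finite Z \<and> (\<forall>p\<in>Z. prime p) \<and>
     P \<inter> Z = {} \<and> 1 < \<Prod>Z \<and> real (\<Prod>Z) \<le> ln (real M) ^ K \<and> 0 \<le> X \<and> 2 * X \<le> \<theta>' * ln (real M) \<longrightarrow>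
     (\<Sum>S | S \<in> Pow P \<and> lnsum S \<le> 2 * X. real (4 * k) ^ card S * theta_error M (\<Prod>Z * \<Prod>S)) \<le> C * (real M / ln (real M) powr (real (K + k)))"
      by (rule theta_error_sum[OF lev \<theta>'(2,4,3) A0, where K = K and b = "4 * k"])
    from C(2) obtain M0 where M0: "\<forall>M\<ge>M0. \<forall>P Z X. finite P \<and> (\<forall>p\<in>P. prime p) \<and> finite Z \<and> (\<forall>p\<in>Z. prime p) \<and>
     P \<inter> Z = {} \<and> 1 < \<Prod>Z \<and> real (\<Prod>Z) \<le> ln (real M) ^ K \<and> 0 \<le> X \<and> 2 * X \<le> \<theta>' * ln (real M) \<longrightarrow>
     (\<Sum>S | S \<in> Pow P \<and> lnsum S \<le> 2 * X. real (4 * k) ^ card S * theta_error M (\<Prod>Z * \<Prod>S)) \<le> C * (real M / ln (real M) powr (real (K + k)))"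
      unfolding eventually_sequentially ..
    define c9 where "c9 = \<tau> / 4 / C1"
    have c9: "c9 > 0" using par C1 by (simp add: c9_def)
    define c8 where "c8 = 2 * (1 + 4 * real k * real k) * 4 ^ k * 2 / c9"
    have ev: "\<forall>\<^sub>F L::real in at_top.
       (2 + K * ln L) * real (2 * l + k) * (1 + 2 * (K * ln L)) \<le> \<tau> * (\<theta>' / 2 * L - \<beta>) \<and>
       \<theta>' / 2 * L - \<beta> > 0 \<and> \<theta>' / 2 * L \<ge> 2 * real k * Dm \<and> \<theta>' / 2 * L \<ge> 1 \<and> \<delta> * L \<ge> Dm \<and>
       (1 + K * ln L) * (1 + 2 * (K * ln L)) \<le> \<theta>' / 2 * L \<and>
       L \<le> exp L \<and> \<theta>' / 2 * (ln 3 + L) \<le> (\<theta>' / 2 * L - \<beta>) * (1 + \<tau>) \<and> ln 3 \<le> L \<and> L \<ge> 2 \<and>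
       12 * real k * C / c9 \<le> L \<and> c8 * L ^ (3 * k + K) \<le> exp ((1 - \<theta>') / 2 * L)"
    proof (intro eventually_conj eventually_power_le_exp eventually_ge_at_top)
      show "\<forall>\<^sub>F L::real in at_top. (2 + K * ln L) * real (2 * l + k) * (1 + 2 * (K * ln L)) \<le> \<tau> * (\<theta>' / 2 * L - \<beta>)"
        using par(2) \<theta>' by real_asymp
      show "\<forall>\<^sub>F L::real in at_top. \<theta>' / 2 * L - \<beta> > 0" using \<theta>' by real_asymp
      show "\<forall>\<^sub>F L::real in at_top. \<theta>' / 2 * L \<ge> 2 * real k * Dm" using \<theta>' by real_asymp
      show "\<forall>\<^sub>F L::real in at_top. \<theta>' / 2 * L \<ge> 1" using \<theta>' by real_asymp
      show "\<forall>\<^sub>F L::real in at_top. \<delta> * L \<ge> Dm" using \<delta>(1) by real_asymp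
      show "\<forall>\<^sub>F L::real in at_top. (1 + K * ln L) * (1 + 2 * (K * ln L)) \<le> \<theta>' / 2 * L" using \<theta>' by real_asymp
      show "\<forall>\<^sub>F L::real in at_top. L \<le> exp L" by real_asymp
      have "\<theta>' / 2 < \<theta>' / 2 * (1 + \<tau>)" using \<theta>' par(2) by simp
      then show "\<forall>\<^sub>F L::real in at_top. \<theta>' / 2 * (ln 3 + L) \<le> (\<theta>' / 2 * L - \<beta>) * (1 + \<tau>)"
        using \<theta>' par(2) by real_asymp
      show "(1 - \<theta>') / 2 > 0" using \<theta>' by simp
    qed
    have evN: "\<forall>\<^sub>F N::nat in sequentially. real N > 0 \<and> N \<ge> M0"
      by (intro eventually_conj eventually_ge_at_top) real_asymp
    have main: "\<forall>\<^sub>F N in sequentially. \<forall>Z H \<nu>. separated D K (ln (real N)) Z H \<and> card H = k \<and>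
       \<nu> < \<Prod>Z \<and> (\<forall>h\<in>H. coprime (\<nu> + h) (\<Prod>Z)) \<longrightarrow>
       c * (real N / real (\<Prod>Z)) / ((\<Prod>p\<in>Z. 1 - 1 / real p) * ln (real N)) ^ k \<le>
       real (card {n \<in> {N<..2 * N}. n mod \<Prod>Z = \<nu> \<and> (\<forall>h\<in>H. rough (\<delta> * ln (real N)) (n + h)) \<and> 2 \<le> card {h \<in> H. prime (n + h)}})"
      using eventually_ln_nat[OF ev] evN
    proof eventually_elim
      case (elim N)
      define L where "L = ln (real N)"
      define X where "X = \<theta>' / 2 * L"
      note e = elim(1)[folded L_def, folded X_def]
      have N: "real N = exp L" "real N > 0" "N \<ge> M0" using elim(2) by (auto simp: L_def)
      have L: "L \<ge> 2" using e by blast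
      show ?case
      proof (intro allI impI, elim conjE)
        fix Z H \<nu>
        assume sep: "separated D K (ln (real N)) Z H" and cH: "card H = k" and \<nu>: "\<nu> < \<Prod>Z" and cop: "\<forall>h\<in>H. coprime (\<nu> + h) (\<Prod>Z)"
        have Z: "finite Z" "\<And>p. p \<in> Z \<Longrightarrow> prime p" "\<And>p. prime p \<Longrightarrow> p \<le> D \<Longrightarrow> p \<in> Z" "real (\<Prod>Z) \<le> L ^ K"
          and H: "finite H" "\<And>h. h \<in> H \<Longrightarrow> real h \<le> L" "\<And>p. prime p \<Longrightarrow> p \<notin> Z \<Longrightarrow> inj_on (\<lambda>h. h mod p) H"
          using sep by (auto simp: separated_def L_def)
        define P where "P = {p. prime p \<and> ln (real p) \<le> X} - Z"
        have PD: "p > D" if "p \<in> P" for p using that Z(3)[of p] by (force simp: P_def)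
        have P2k: "p > 2 * k" if "p \<in> P" for p using PD[OF that] par(4) by linarith
        interpret sieve_setup H Z P X k l
          by unfold_locales (use Z H P_def cH k par P2k e in \<open>auto simp: P_def\<close>)
        define W where "W = \<Prod>Z"
        have W1: "W > 1"
        proof -
          have "2 dvd W" unfolding W_def using Z(1) Z(3)[of 2] par(6) by (intro dvd_prodI[of Z 2 "\<lambda>x. x", simplified]) auto
          moreover have "W > 0" unfolding W_def by (intro prod_primes_pos Z(2))
          ultimately show ?thesis by (auto dest: dvd_imp_le)
        qed
        have WL: "real W \<le> L ^ K" using Z(4) by (simp only: W_def)
        have lnW: "ln (real W) \<le> K * ln L" "0 \<le> ln (real W)"
        proof -
          have "ln (real W) \<le> ln (L ^ K)" using WL W1 by (intro ln_mono) auto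
          then show "ln (real W) \<le> K * ln L" using L by (simp add: ln_realpow)
          show "0 \<le> ln (real W)" using W1 by simp
        qed
        have \<Phi>: "1 \<le> \<Phi> * (1 + 2 * (K * ln L))"
        proof -
          have "1 / \<Phi> \<le> 1 + 2 * (K * ln L)" using \<Phi>_bounds(3)[folded W_def] lnW by linarith
          then show ?thesis using \<Phi>_bounds(1) by (simp add: field_simps)
        qed
        have X: "X \<ge> 1" "X > 0" using e by auto
        have X\<beta>: "X - \<beta> > 0" using e by blast
        have big: "(2 + ln (real (\<Prod>Z))) * real (2 * l + k) \<le> \<tau> * \<Phi> * (X - \<beta>)"
        proof -
          have "(2 + ln (real W)) * real (2 * l + k) * 1 \<le> (2 + K * ln L) * real (2 * l + k) * (\<Phi> * (1 + 2 * (K * ln L)))"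
            using lnW \<Phi> by (intro mult_mono) auto
          also have "\<dots> = \<Phi> * ((2 + K * ln L) * real (2 * l + k) * (1 + 2 * (K * ln L)))" by (simp only: mult_ac)
          also have "\<dots> \<le> \<Phi> * (\<tau> * (X - \<beta>))" using e \<Phi>_bounds(1) by (intro mult_left_mono) auto
          finally show ?thesis by (simp add: W_def mult_ac)
        qed
        have big': "1 + ln (real (\<Prod>Z)) \<le> \<Phi> * X"
        proof -
          have "(1 + ln (real W)) * 1 \<le> (1 + K * ln L) * (\<Phi> * (1 + 2 * (K * ln L)))"
            using lnW \<Phi> by (intro mult_mono) auto
          also have "\<dots> = \<Phi> * ((1 + K * ln L) * (1 + 2 * (K * ln L)))" by (simp only: mult_ac)
          also have "\<dots> \<le> \<Phi> * X" using e \<Phi>_bounds(1) by (intro mult_left_mono) auto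
          finally show ?thesis by (simp add: W_def)
        qed
        have ln3N: "ln (3 * real N) = ln 3 + L" "ln 3 + L \<le> 2 * L" "L \<le> ln 3 + L"
        proof -
          show "ln (3 * real N) = ln 3 + L" unfolding L_def using N(2) by (intro ln_mult_pos) auto
          have "ln 3 \<le> L" using e by blast
          then show "ln 3 + L \<le> 2 * L" by simp
        qed simp
        define t where "t = \<delta> * L"
        have t: "t \<ge> Dm" "t > 0" "t \<le> X * s" "t \<le> X"
        proof -
          show "t \<ge> Dm" "t > 0" using e \<delta> L by (auto simp: t_def)
          have "\<delta> * L \<le> \<theta>' / 2 * s * L" using \<delta> L by (intro mult_right_mono) auto
          then show ts: "t \<le> X * s" by (simp add: t_def X_def mult_ac)
          have "X * s \<le> X * 1" using s X by (intro mult_left_mono) auto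
          then show "t \<le> X" using ts by simp
        qed
        have HN: "h \<le> N" if "h \<in> H" for h
        proof -
          have "L \<le> exp L" using e by blast
          then have "real h \<le> real N" using H(2)[OF that] N(1) by linarith
          then show ?thesis by simp
        qed
        define Err where "Err = 6 * C * (real N / L ^ (K + k))"
        have Err: "theta_err (2 * N + h) W (4 * k) + theta_err (N + h) W (4 * k) \<le> Err" if h: "h \<in> H" for h
        proof -
          have each: "theta_err M W (4 * k) \<le> 3 * C * (real N / L ^ (K + k))" if M: "M \<ge> N" "M \<le> 3 * N" for M
          proof -
            have MM: "M0 \<le> M" using M N by simp
            have LM: "L \<le> ln (real M)" unfolding L_def using M N by (intro ln_mono) auto
            have "theta_err M W (4 * k) \<le> C * (real M / ln (real M) powr (real (K + k)))"
              unfolding theta_err_def W_def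
            proof (rule M0[THEN spec, THEN mp, OF MM, THEN spec, THEN spec, THEN spec, THEN mp], intro conjI ballI)
              show "real (\<Prod>Z) \<le> ln (real M) ^ K"
                using Z(4) power_mono[OF LM, of K] L by linarith
              have "2 * X = \<theta>' * L" by (simp add: X_def)
              also have "\<dots> \<le> \<theta>' * ln (real M)" using \<theta>' LM by (intro mult_left_mono) auto
              finally show "2 * X \<le> \<theta>' * ln (real M)" .
              show "1 < \<Prod>Z" using W1 by (simp only: W_def)
              show "P \<inter> Z = {}" unfolding P_def by blast
              show "0 \<le> X" using X by simp
            qed (simp_all add: finP primeP Z)
            also have "ln (real M) powr (real (K + k)) = ln (real M) ^ (K + k)"
              using LM L by (intro powr_realpow) auto
            also have "C * (real M / ln (real M) ^ (K + k)) \<le> C * (3 * real N / L ^ (K + k))"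
            proof (intro mult_left_mono frac_le power_mono LM)
              show "real M \<le> 3 * real N" using M by linarith
            qed (use L C in auto)
            finally show ?thesis by (simp add: mult_ac)
          qed
          have "theta_err (2 * N + h) W (4 * k) \<le> 3 * C * (real N / L ^ (K + k))"
            "theta_err (N + h) W (4 * k) \<le> 3 * C * (real N / L ^ (K + k))"
            by (rule each; use HN[OF h] in simp)+
          then show ?thesis by (simp add: Err_def)
        qed
        have X\<theta>: "X - \<beta> \<ge> \<theta>' / 2 * ln (3 * real N) / (1 + \<tau>)"
        proof -
          have "1 + \<tau> > 0" using par(2) by simp
          then show ?thesis unfolding ln3N(1) pos_divide_le_eq[OF \<open>1 + \<tau> > 0\<close>] using e by blast
        qed
        have t\<tau>: "8 * real k * (real l)\<^sup>2 * (1 + real k)\<^sup>2 * (t / X)\<^sup>2 * real k \<le> \<tau> / 4"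
        proof -
          have "t / X \<le> s" using t X by (simp add: divide_le_eq mult.commute)
          then have "(t / X)\<^sup>2 \<le> s\<^sup>2" using t X by (intro power_mono) auto
          then have "Q * (t / X)\<^sup>2 \<le> Q * s\<^sup>2" using Q by (intro mult_left_mono) auto
          then show ?thesis using s(3) unfolding Q_def by (simp add: mult_ac)
        qed
        have rt: "real k * ln (3 * real N) < (real r + 1) * t"
        proof -
          have "real k * ln (3 * real N) \<le> real k * (2 * L)" unfolding ln3N(1) using ln3N by (intro mult_left_mono) auto
          also have "\<dots> = 2 * real k * L" by simp
          also have "\<dots> \<le> real r * \<delta> * L" using r L by (intro mult_right_mono) auto
          also have "\<dots> < (real r + 1) * t" using t L \<delta> by (simp add: t_def algebra_simps)
          finally show ?thesis .
        qed
        define w where "w = real N / L ^ (K + k)"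
        have low: "\<tau> / 4 * ln (3 * real N) * (real N / real W) / ((2 * (1 + real k)) ^ l * (3 * (1 + \<tau>) * \<Phi> * X) ^ k)
           \<ge> c9 * L * w"
        proof -
          have XL: "X \<le> L" using \<theta>' L unfolding X_def by (simp add: mult_le_cancel_right1)
          have "\<Phi> * X \<le> 1 * L" using \<Phi>_bounds X XL by (intro mult_mono) auto
          then have "3 * (1 + \<tau>) * (\<Phi> * X) \<le> 3 * (1 + \<tau>) * L" using par(2) by (intro mult_left_mono) auto
          then have "(3 * (1 + \<tau>) * (\<Phi> * X)) ^ k \<le> (3 * (1 + \<tau>) * L) ^ k"
            using par(2) \<Phi>_bounds X by (intro power_mono) auto
          then have "(2 * (1 + real k)) ^ l * (3 * (1 + \<tau>) * \<Phi> * X) ^ k \<le> (2 * (1 + real k)) ^ l * (3 * (1 + \<tau>) * L) ^ k"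
            by (intro mult_left_mono) (auto simp: mult.assoc)
          also have "\<dots> = C1 * L ^ k" by (simp add: C1_def power_mult_distrib)
          finally have d: "(2 * (1 + real k)) ^ l * (3 * (1 + \<tau>) * \<Phi> * X) ^ k \<le> C1 * L ^ k" .
          have "c9 * L * w = \<tau> / 4 * L * (real N / L ^ K) / (C1 * L ^ k)"
            by (simp add: c9_def w_def power_add)
          also have "\<dots> \<le> \<tau> / 4 * ln (3 * real N) * (real N / real W) / ((2 * (1 + real k)) ^ l * (3 * (1 + \<tau>) * \<Phi> * X) ^ k)"
          proof (rule frac_le)
            show "0 \<le> \<tau> / 4 * ln (3 * real N) * (real N / real W)" using ln3N L par(2) by simp
            show "\<tau> / 4 * L * (real N / L ^ K) \<le> \<tau> / 4 * ln (3 * real N) * (real N / real W)"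
              using ln3N L par(2) WL W1 by (intro mult_mono divide_left_mono) auto
            show "0 < (2 * (1 + real k)) ^ l * (3 * (1 + \<tau>) * \<Phi> * X) ^ k"
              using par(2) \<Phi>_bounds X by (intro mult_pos_pos zero_less_power) auto
          qed (rule d)
          finally show ?thesis .
        qed
        have err: "real k * Err + ln (3 * real N) * error + real k * ln (3 * real N) * (exp t * (4 * real k * error)) \<le>
          \<tau> / 4 * ln (3 * real N) * (real N / real W) / ((2 * (1 + real k)) ^ l * (3 * (1 + \<tau>) * \<Phi> * X) ^ k)"
        proof -
          have w0: "w > 0" using N L by (simp add: w_def)
          have "12 * real k * C \<le> c9 * L" using e c9 by (simp add: divide_le_eq mult.commute)
          then have "12 * real k * C * w \<le> c9 * L * w" using w0 by (intro mult_right_mono) auto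
          moreover have "real k * Err = 12 * real k * C * w / 2" by (simp add: Err_def w_def)
          ultimately have 1: "real k * Err \<le> c9 * L * w / 2" by linarith
          have "error \<le> exp (\<theta>' * L) * (2 + X) ^ (2 * k)" using error_le by (simp add: X_def)
          also have "\<dots> \<le> exp (\<theta>' * L) * (2 * L) ^ (2 * k)"
            using L X \<theta>' by (intro mult_left_mono power_mono) (auto simp: X_def mult_le_cancel_right1 intro!: add_mono[of 2 L "X" L, unfolded X_def, simplified])
          also have "(2 * L) ^ (2 * k) = 4 ^ k * L ^ (2 * k)" by (simp add: power_mult power_mult_distrib)
          finally have er: "error \<le> exp (\<theta>' * L) * (4 ^ k * L ^ (2 * k))" .
          have et: "1 \<le> exp t" using t by simp
          have "ln (3 * real N) * error + real k * ln (3 * real N) * (exp t * (4 * real k * error)) =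
            ln (3 * real N) * error * (1 + 4 * real k * real k * exp t)" by (simp add: algebra_simps)
          also have "\<dots> \<le> (2 * L) * (exp (\<theta>' * L) * (4 ^ k * L ^ (2 * k))) * (exp t + 4 * real k * real k * exp t)"
            unfolding ln3N(1) using ln3N er L et error_nonneg by (intro mult_mono add_mono) auto
          also have "\<dots> = L * (exp (\<theta>' * L) * exp t) * ((2 * (1 + 4 * real k * real k) * 4 ^ k) * L ^ (2 * k))"
            by (simp add: algebra_simps)
          also have "\<dots> \<le> L * exp ((1 + \<theta>') / 2 * L) * ((2 * (1 + 4 * real k * real k) * 4 ^ k) * L ^ (2 * k))"
          proof -
            have "\<theta>' * L + t \<le> \<theta>' * L + (1 - \<theta>') / 2 * L" using \<delta> L unfolding t_def by (intro add_mono mult_right_mono) auto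
            then have "exp (\<theta>' * L) * exp t \<le> exp ((1 + \<theta>') / 2 * L)" unfolding exp_add[symmetric] by (simp add: field_simps)
            then show ?thesis using L by (intro mult_right_mono mult_left_mono) auto
          qed
          also have "\<dots> \<le> c9 * L * w / 2"
          proof -
            have "c8 * L ^ (3 * k + K) \<le> exp ((1 - \<theta>') / 2 * L)" using e by blast
            then have "c8 * L ^ (3 * k + K) * exp ((1 + \<theta>') / 2 * L) \<le> exp ((1 - \<theta>') / 2 * L) * exp ((1 + \<theta>') / 2 * L)"
              by (intro mult_right_mono) auto
            also have "\<dots> = real N" unfolding N(1) exp_add[symmetric] by (simp add: field_simps)
            finally have "c8 * L ^ (3 * k + K) * exp ((1 + \<theta>') / 2 * L) / L ^ (K + k) \<le> w"
              unfolding w_def using L by (intro divide_right_mono) auto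
            also have "c8 * L ^ (3 * k + K) * exp ((1 + \<theta>') / 2 * L) / L ^ (K + k) = c8 * L ^ (2 * k) * exp ((1 + \<theta>') / 2 * L)"
            proof -
              have "L ^ (3 * k + K) = L ^ (2 * k) * L ^ (K + k)" unfolding power_add[symmetric] by (rule arg_cong[of _ _ "\<lambda>n. L ^ n"]) simp
              then show ?thesis using L by simp
            qed
            finally have "c9 / 2 * L * (c8 * L ^ (2 * k) * exp ((1 + \<theta>') / 2 * L)) \<le> c9 / 2 * L * w"
              using c9 L by (intro mult_left_mono) auto
            moreover have "2 * (1 + 4 * real k * real k) * 4 ^ k = c9 / 2 * c8" using c9 by (simp add: c8_def)
            then have "L * exp ((1 + \<theta>') / 2 * L) * ((2 * (1 + 4 * real k * real k) * 4 ^ k) * L ^ (2 * k)) =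
              c9 / 2 * L * (c8 * L ^ (2 * k) * exp ((1 + \<theta>') / 2 * L))"
              by (simp only: mult_ac)
            ultimately show ?thesis by linarith
          qed
          finally show ?thesis using 1 low by linarith
        qed
        have mert: "(\<Sum>p | p \<in> P \<and> ln (real p) \<le> t. ln (real p) / (real p - real k)) \<le> t + Dm" if "0 \<le> t" for t
          using finP primeP P2k that by (intro Dm(2)) auto
        have "real (card {n \<in> {N<..2 * N}. n mod W = \<nu> \<and>
          (\<forall>h\<in>H. \<forall>p. prime p \<and> ln (real p) \<le> t \<longrightarrow> \<not> p dvd n + h) \<and> 2 \<le> card {h \<in> H. prime (n + h)}}) * (real k * 4 ^ r) \<ge>
          \<tau> / 2 * (real N / real W) / ((2 * (1 + real k)) ^ l * (3 * (1 + \<tau>) * \<Phi> * X) ^ k)"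
        proof (rule good_count[OF mert _ par(4) PD par(2,7) \<beta>_def X\<beta> big k_def par(1) W_def W1 _ _ _ Err _ X(1) big' t(1,2,4) HN par(3) X\<theta> t\<tau> rt err])
          show "X < ln (real N)" using \<theta>' L unfolding X_def L_def[symmetric] by (simp add: mult_less_cancel_right1)
        qed (use par(6) \<nu> cop e in \<open>auto simp: W_def\<close>)
        then have "\<tau> / 2 * (real N / real W) / ((2 * (1 + real k)) ^ l * (3 * (1 + \<tau>) * \<Phi> * X) ^ k) / (real k * 4 ^ r) \<le>
          real (card {n \<in> {N<..2 * N}. n mod W = \<nu> \<and> (\<forall>h\<in>H. rough t (n + h)) \<and> 2 \<le> card {h \<in> H. prime (n + h)}})"
          unfolding rough_def by (subst pos_divide_le_eq) (use k in simp_all)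
        moreover have "c * (real N / real W) / (\<Phi> * L) ^ k \<le>
          \<tau> / 2 * (real N / real W) / ((2 * (1 + real k)) ^ l * (3 * (1 + \<tau>) * \<Phi> * X) ^ k) / (real k * 4 ^ r)"
        proof -
          have XL: "X \<le> L" using \<theta>' L unfolding X_def by (simp add: mult_le_cancel_right1)
          have "(\<Phi> * X) ^ k \<le> (\<Phi> * L) ^ k" using \<Phi>_bounds X XL by (intro power_mono mult_left_mono) auto
          then have "C1 * (\<Phi> * X) ^ k \<le> C1 * (\<Phi> * L) ^ k" using C1 by (intro mult_left_mono) auto
          moreover have "(2 * (1 + real k)) ^ l * (3 * (1 + \<tau>) * \<Phi> * X) ^ k = C1 * (\<Phi> * X) ^ k"
            by (simp add: C1_def power_mult_distrib mult.assoc)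
          moreover have "0 < C1 * (\<Phi> * X) ^ k" using C1 \<Phi>_bounds X by (intro mult_pos_pos zero_less_power) auto
          ultimately have "\<tau> / 2 * (real N / real W) / (C1 * (\<Phi> * L) ^ k) / (real k * 4 ^ r) \<le>
            \<tau> / 2 * (real N / real W) / ((2 * (1 + real k)) ^ l * (3 * (1 + \<tau>) * \<Phi> * X) ^ k) / (real k * 4 ^ r)"
            using par(2) by (intro divide_right_mono frac_le) auto
          moreover have "c * (real N / real W) / (\<Phi> * L) ^ k = \<tau> / 2 * (real N / real W) / (C1 * (\<Phi> * L) ^ k) / (real k * 4 ^ r)"
            by (simp add: c_def mult_ac)
          ultimately show ?thesis by simp
        qed
        ultimately show "c * (real N / real (\<Prod>Z)) / ((\<Prod>p\<in>Z. 1 - 1 / real p) * ln (real N)) ^ k \<le>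
          real (card {n \<in> {N<..2 * N}. n mod \<Prod>Z = \<nu> \<and> (\<forall>h\<in>H. rough (\<delta> * ln (real N)) (n + h)) \<and> 2 \<le> card {h \<in> H. prime (n + h)}})"
          unfolding W_def \<Phi>_def t_def L_def by linarith
      qed
    qed
    show "\<exists>c>0. \<exists>\<delta>>0. \<forall>\<^sub>F N in sequentially. \<forall>Z H \<nu>. separated D K (ln (real N)) Z H \<and> card H = k \<and>
       \<nu> < \<Prod>Z \<and> (\<forall>h\<in>H. coprime (\<nu> + h) (\<Prod>Z)) \<longrightarrow>
       c * (real N / real (\<Prod>Z)) / ((\<Prod>p\<in>Z. 1 - 1 / real p) * ln (real N)) ^ k \<le>
       real (card {n \<in> {N<..2 * N}. n mod \<Prod>Z = \<nu> \<and> (\<forall>h\<in>H. rough (\<delta> * ln (real N)) (n + h)) \<and> 2 \<le> card {h \<in> H. prime (n + h)}})"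
      using c \<delta>(1) main by blast
  qed
qed

text \<open>Selberg's upper bound sieve as the case \<open>l = 1\<close>, with modulus 1 in place of
  \<open>W\<close>. Rough \<open>n\<close> have weight equal to the square of \<open>lam {}\<close>,
  while the total weight is at most about \<open>N * X * lam {}\<close>; the quotient
  \<open>N * X / lam {}\<close> is then bounded by the lower bound for sums of dimension
  \<open>m\<close>.\<close>

theorem tuple_upper_bound:
  assumes Cb: "\<And>n::nat. (\<Sum>p | prime p \<and> p \<le> n. ln (real p)) \<le> Cb * real n"
    and m: "m \<ge> 1" "D \<ge> 2 * m" and \<delta>: "\<delta> > 0"
  obtains C where "C \<ge> 0" "\<forall>\<^sub>F N in sequentially. \<forall>Z H. separated D K (ln (real N)) Z H \<and> card H = m \<longrightarrow>
       real (card {n \<in> {N<..2 * N}. \<forall>h\<in>H. rough (\<delta> * ln (real N)) (n + h)}) \<le>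
       C * real N / ((\<Prod>p\<in>Z. 1 - 1 / real p) * ln (real N)) ^ m"
proof -
  \<comment> \<open>The value \<open>1 / 4\<close> keeps \<open>exp (2 * X)\<close> below the square
    root of \<open>N\<close>, so the error is negligible.\<close>
  define \<delta>' where "\<delta>' = min \<delta> (1 / 4)"
  have \<delta>': "\<delta>' > 0" "\<delta>' \<le> \<delta>" "\<delta>' \<le> 1 / 4" using \<delta> by (auto simp: \<delta>'_def)
  obtain Dm where Dm: "Dm \<ge> 0" "\<And>P t. finite P \<Longrightarrow> (\<And>p. p \<in> P \<Longrightarrow> prime p \<and> p > 2 * m) \<Longrightarrow> 0 \<le> t \<Longrightarrow>
       (\<Sum>p | p \<in> P \<and> ln (real p) \<le> t. ln (real p) / (real p - real m)) \<le> t + Dm"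
    using mertens_shift[OF Cb, of m] by blast
  define C2 where "C2 = (4 * real (m + 1) / \<delta>') ^ m"
  have C2: "C2 \<ge> 0" using \<delta>' by (simp add: C2_def)
  have ev: "\<forall>\<^sub>F L::real in at_top. \<delta>' * L \<ge> 2 * real m * Dm \<and> \<delta>' * L \<ge> 1 \<and> L \<ge> 2 \<and> 4 ^ m * L ^ (3 * m) \<le> exp (1 / 2 * L)"
  proof (intro eventually_conj eventually_power_le_exp eventually_ge_at_top)
    show "\<forall>\<^sub>F L::real in at_top. \<delta>' * L \<ge> 2 * real m * Dm" using \<delta>'(1) by real_asymp
    show "\<forall>\<^sub>F L::real in at_top. \<delta>' * L \<ge> 1" using \<delta>'(1) by real_asymp
  qed simp
  have evN: "\<forall>\<^sub>F N::nat in sequentially. real N > 0" by real_asymp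
  show thesis
  proof (rule that[of "C2 + 1"])
    show "0 \<le> C2 + 1" using C2 by simp
    show "\<forall>\<^sub>F N in sequentially. \<forall>Z H. separated D K (ln (real N)) Z H \<and> card H = m \<longrightarrow>
       real (card {n \<in> {N<..2 * N}. \<forall>h\<in>H. rough (\<delta> * ln (real N)) (n + h)}) \<le>
       (C2 + 1) * real N / ((\<Prod>p\<in>Z. 1 - 1 / real p) * ln (real N)) ^ m"
      using eventually_ln_nat[OF ev] evN
    proof eventually_elim
      case (elim N)
      define L where "L = ln (real N)"
      define X where "X = \<delta>' * L"
      note e = elim(1)[folded L_def, folded X_def]
      have N: "real N = exp L" using elim(2) by (auto simp: L_def)
      have L: "L \<ge> 2" using e by blast
      show ?case
      proof (intro allI impI, elim conjE)
        fix Z H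
        assume sep: "separated D K (ln (real N)) Z H" and cH: "card H = m"
        have Z: "finite Z" "\<And>p. p \<in> Z \<Longrightarrow> prime p" "\<And>p. prime p \<Longrightarrow> p \<le> D \<Longrightarrow> p \<in> Z"
          and H: "finite H" "\<And>p. prime p \<Longrightarrow> p \<notin> Z \<Longrightarrow> inj_on (\<lambda>h. h mod p) H"
          using sep by (auto simp: separated_def)
        define P where "P = {p. prime p \<and> ln (real p) \<le> X} - Z"
        have P2m: "p > 2 * m" if "p \<in> P" for p using that Z(3)[of p] m(2) by (force simp: P_def)
        interpret sieve_setup H Z P X m 1
          by unfold_locales (use Z H P_def cH m P2m e in \<open>auto simp: P_def\<close>)
        have X: "X \<ge> 1" "X > 0" using e by auto
        define R where "R = {n \<in> {N<..2 * N}. \<forall>h\<in>H. rough (\<delta> * L) (n + h)}"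
        have lam0: "lam {} > 0" using X by (intro lam_pos) auto
        have wR: "weight n = (lam {})\<^sup>2" if n: "n \<in> R" for n
        proof (rule weight_rough)
          have "X \<le> \<delta> * L" using \<delta>' L unfolding X_def by (intro mult_right_mono) auto
          then show "sieving_primes P H n = {}"
            using n by (auto simp: sieving_primes_def R_def rough_def P_def)
        qed
        have "real (card R) * (lam {})\<^sup>2 = (\<Sum>n\<in>R. weight n)" using wR by simp
        also have "\<dots> \<le> (\<Sum>n | n \<in> {N<..2 * N} \<and> n mod 1 = 0. weight n)"
          using weight_nonneg by (intro sum_mono2) (auto simp: R_def)
        also have "\<dots> \<le> real N / real 1 * msum (\<lambda>p. real m / (real p - real m)) P (2 * 1) X + (lam {})\<^sup>2 * error"
          using sum_weight_approx[of 0 1 N] by (simp add: abs_le_iff)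
        also have "msum (\<lambda>p. real m / (real p - real m)) P (2 * 1) X \<le> X * lam {}"
          unfolding lam_empty msum_def sum_distrib_left
        proof (rule sum_mono)
          fix A assume A: "A \<in> Pow P"
          have "0 \<le> lnsum A" using A primeP by (intro lnsum_nonneg) auto
          then have "max 0 (X - lnsum A) * max 0 (X - lnsum A) \<le> X * max 0 (X - lnsum A)"
            using X by (intro mult_right_mono) auto
          from mult_left_mono[OF this v_prod_nonneg[of A]] A
          show "(\<Prod>p\<in>A. real m / (real p - real m)) * max 0 (X - lnsum A) ^ (2 * 1) \<le>
            X * ((\<Prod>p\<in>A. real m / (real p - real m)) * max 0 (X - lnsum A) ^ 1)"
            by (simp add: power2_eq_square mult_ac)
        qed
        finally have "real (card R) * (lam {})\<^sup>2 \<le> real N * (X * lam {}) + (lam {})\<^sup>2 * error"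
          by (simp add: mult_left_mono)
        also have "\<dots> = (real N * X / lam {} + error) * (lam {})\<^sup>2"
          using lam0 by (simp add: field_simps power2_eq_square)
        finally have card1: "real (card R) \<le> real N * X / lam {} + error"
          using lam0 by simp
        have low: "(\<Phi> * X / (4 * real (m + 1))) ^ m * X \<le> lam {}"
        proof -
          have "((\<Prod>p\<in>Z. 1 - 1 / real p) * X / (2 * real (1 + 1) * real (m + 1))) ^ m * X ^ 1
            \<le> msum (\<lambda>p. real m / (real p - real m)) P 1 X"
          proof (rule msum_lower[OF Z(1,2) _ P_def P2m _ _ _ Dm(1)])
            show "(\<Sum>p | p \<in> P \<and> ln (real p) \<le> t. ln (real p) / (real p - real m)) \<le> t + Dm" if "0 \<le> t" for t
              using finP primeP P2m that by (intro Dm(2)) auto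
          qed (use e X in auto)
          then show ?thesis unfolding lam_empty \<Phi>_def by simp
        qed
        have pos: "0 < (\<Phi> * X / (4 * real (m + 1))) ^ m" using \<Phi>_bounds X by (intro zero_less_power divide_pos_pos mult_pos_pos) auto
        have "real N * X / lam {} \<le> real N * X / ((\<Phi> * X / (4 * real (m + 1))) ^ m * X)"
          using low pos X by (intro divide_left_mono mult_pos_pos lam0) auto
        also have "\<dots> = real N / (\<Phi> * X / (4 * real (m + 1))) ^ m" using X by simp
        also have "\<dots> = C2 * real N / (\<Phi> * L) ^ m"
          using \<delta>' by (simp add: C2_def X_def power_divide power_mult_distrib mult_ac)
        finally have card2: "real N * X / lam {} \<le> C2 * real N / (\<Phi> * L) ^ m" .
        have \<Phi>L: "0 < (\<Phi> * L) ^ m" "(\<Phi> * L) ^ m \<le> L ^ m"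
          using \<Phi>_bounds L by (auto intro!: power_mono mult_pos_pos zero_less_power simp: mult_le_cancel_right1)
        have card3: "error \<le> real N / (\<Phi> * L) ^ m"
        proof -
          have XL: "X \<le> L" "2 * X \<le> 1 / 2 * L" using mult_right_mono[OF \<delta>'(3), of L] L unfolding X_def by auto
          have "error \<le> exp (2 * X) * (2 + X) ^ (2 * m)" by (rule error_le)
          also have "\<dots> \<le> exp (1 / 2 * L) * (2 * L) ^ (2 * m)"
            using XL L X by (intro mult_mono power_mono) auto
          also have "(2 * L) ^ (2 * m) = 4 ^ m * L ^ (2 * m)" by (simp add: power_mult power_mult_distrib)
          also have "exp (1 / 2 * L) * (4 ^ m * L ^ (2 * m)) = exp (1 / 2 * L) * (4 ^ m * L ^ (3 * m)) / L ^ m"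
          proof -
            have "L ^ (3 * m) = L ^ (2 * m) * L ^ m" unfolding power_add[symmetric] by (rule arg_cong[of _ _ "\<lambda>n. L ^ n"]) simp
            then show ?thesis using L by simp
          qed
          also have "\<dots> \<le> exp (1 / 2 * L) * exp (1 / 2 * L) / L ^ m"
            using e L by (intro divide_right_mono mult_left_mono) auto
          also have "\<dots> = real N / L ^ m" unfolding N exp_add[symmetric] by simp
          also have "\<dots> \<le> real N / (\<Phi> * L) ^ m" using \<Phi>L L by (intro divide_left_mono) auto
          finally show ?thesis .
        qed
        show "real (card {n \<in> {N<..2 * N}. \<forall>h\<in>H. rough (\<delta> * ln (real N)) (n + h)}) \<le>
          (C2 + 1) * real N / ((\<Prod>p\<in>Z. 1 - 1 / real p) * ln (real N)) ^ m"
          using card1 card2 card3 unfolding R_def \<Phi>_def[symmetric] L_def[symmetric]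
          by (simp add: algebra_simps add_divide_distrib)
      qed
    qed
  qed
qed

subsection \<open>Averaging the singular series\<close>

lemma prod_one_plus_eq_sum:
  fixes f :: "'a \<Rightarrow> real"
  assumes "finite P"
  shows "(\<Prod>p\<in>P. 1 + f p) = (\<Sum>A\<in>Pow P. prod f A)"
  using assms
proof (induction P rule: finite_induct)
  case (insert p P)
  have "prod f (insert p A) = f p * prod f A" if "A \<in> Pow P" for A
    using that insert.hyps by (subst prod.insert) (auto intro: finite_subset)
  then show ?case using insert by (simp add: sum_Pow_insert sum.distrib sum_distrib_left[symmetric] algebra_simps)
qed simp

text \<open>For positive \<open>n\<close> this is \<open>n / totient n\<close>.\<close>

definition ratio :: "nat \<Rightarrow> real" where
  "ratio n = (\<Prod>p\<in>prime_factors n. 1 / (1 - 1 / real p))"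

lemma inverse_one_minus_ge1: "prime p \<Longrightarrow> 1 \<le> 1 / (1 - 1 / real p)"
proof -
  assume "prime p"
  then have "real p \<ge> 2" using prime_ge_2_nat[of p] by simp
  then show ?thesis by (simp add: field_simps)
qed

lemma ratio_ge1: "1 \<le> ratio n"
  unfolding ratio_def by (intro prod_ge_1 inverse_one_minus_ge1) (auto simp: in_prime_factors_iff)

text \<open>With \<open>y = 1 / (p - 1)\<close> in the unit interval, the convex function
  \<open>(1 + y) ^ s\<close> lies below its chord \<open>1 + (2 ^ s - 1) * y\<close>, and
  \<open>y \<le> 2 / p\<close>.\<close>

lemma inverse_power_le:
  assumes "prime p"
  shows "(1 / (1 - 1 / real p)) ^ s \<le> 1 + 2 ^ (s + 1) / real p"
proof -
  have p: "real p \<ge> 2" using assms prime_ge_2_nat[of p] by simp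
  define y where "y = 1 / (real p - 1)"
  have y: "0 \<le> y" "y \<le> 1" "y \<le> 2 / real p" using p by (auto simp: y_def field_simps)
  have "(1 + y) ^ s \<le> 1 + (2 ^ s - 1) * y"
  proof (induction s)
    case (Suc s)
    have "(1 + y) ^ Suc s \<le> (1 + y) * (1 + (2 ^ s - 1) * y)" using Suc y by (simp add: mult_left_mono)
    also have "\<dots> = 1 + y + (2 ^ s - 1) * y + (2 ^ s - 1) * y * y" by (simp add: algebra_simps)
    also have "(2 ^ s - 1) * y * y \<le> (2 ^ s - 1) * y * 1" using y by (intro mult_left_mono) auto
    also have "1 + y + (2 ^ s - 1) * y + (2 ^ s - 1) * y * 1 = 1 + (2 ^ Suc s - 1) * y" by (simp add: algebra_simps)
    finally show ?case by simp
  qed simp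
  also have "\<dots> \<le> 1 + 2 ^ s * (2 / real p)" using y by (intro add_left_mono mult_mono) auto
  also have "1 + y = 1 / (1 - 1 / real p)" using p by (simp add: y_def field_simps)
  finally show ?thesis by (simp add: mult.commute)
qed

text \<open>Bound the power by the product of \<open>1 + c / p\<close> over the primes of
  \<open>n\<close>, expand over squarefree divisors and exchange the sums. A divisor
  \<open>d\<close> occurs at most \<open>x / d\<close> times, which leaves \<open>x\<close> times a
  bounded product of \<open>1 + c / p ^ 2\<close>.\<close>

lemma sum_ratio_power_le: "(\<Sum>n\<in>{1..x}. ratio n ^ s) \<le> exp (2 ^ (s + 1)) * real x"
proof -
  define c :: real where "c = 2 ^ (s + 1)"
  have c: "c \<ge> 0" by (simp add: c_def)
  let ?Q = "{p::nat. prime p \<and> p \<le> x}"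
  have fQ: "finite ?Q" by simp
  have "ratio n ^ s \<le> (\<Sum>A\<in>Pow ?Q. (\<Prod>p\<in>A. c / real p) * of_bool (\<Prod>A dvd n))" if n: "n \<in> {1..x}" for n
  proof -
    have pf: "prime_factors n \<subseteq> ?Q" using n by (auto simp: in_prime_factors_iff dest!: dvd_imp_le)
    have "ratio n ^ s = (\<Prod>p\<in>prime_factors n. (1 / (1 - 1 / real p)) ^ s)"
      unfolding ratio_def by (rule prod_power_distrib)
    also have "\<dots> \<le> (\<Prod>p\<in>prime_factors n. 1 + c / real p)"
    proof (intro prod_mono conjI)
      fix p assume "p \<in> prime_factors n"
      then have "prime p" by (auto simp: in_prime_factors_iff)
      from inverse_one_minus_ge1[OF this] show "0 \<le> (1 / (1 - 1 / real p)) ^ s" by (intro zero_le_power) linarith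
      from inverse_power_le[OF \<open>prime p\<close>] show "(1 / (1 - 1 / real p)) ^ s \<le> 1 + c / real p" by (simp add: c_def)
    qed
    also have "\<dots> = (\<Sum>A\<in>Pow (prime_factors n). (\<Prod>p\<in>A. c / real p) * 1)"
      by (subst prod_one_plus_eq_sum) auto
    also have "\<dots> \<le> (\<Sum>A\<in>Pow (prime_factors n). (\<Prod>p\<in>A. c / real p) * of_bool (\<Prod>A dvd n))"
    proof (intro sum_mono mult_left_mono)
      fix A assume A: "A \<in> Pow (prime_factors n)"
      then have "\<Prod>A dvd n"
        by (intro prod_primes_dvd) (auto simp: in_prime_factors_iff intro: finite_subset[of A "prime_factors n"])
      then show "(1::real) \<le> of_bool (\<Prod>A dvd n)" by simp
    qed (use c in \<open>auto intro!: prod_nonneg\<close>)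
    also have "\<dots> \<le> (\<Sum>A\<in>Pow ?Q. (\<Prod>p\<in>A. c / real p) * of_bool (\<Prod>A dvd n))"
      using pf fQ c by (intro sum_mono2 Pow_mono) (auto intro!: prod_nonneg)
    finally show ?thesis .
  qed
  then have "(\<Sum>n\<in>{1..x}. ratio n ^ s) \<le> (\<Sum>n\<in>{1..x}. \<Sum>A\<in>Pow ?Q. (\<Prod>p\<in>A. c / real p) * of_bool (\<Prod>A dvd n))"
    by (intro sum_mono)
  also have "\<dots> = (\<Sum>A\<in>Pow ?Q. (\<Prod>p\<in>A. c / real p) * (\<Sum>n\<in>{1..x}. of_bool (\<Prod>A dvd n)))"
    by (subst sum.swap) (simp only: sum_distrib_left)
  also have "\<dots> \<le> (\<Sum>A\<in>Pow ?Q. (\<Prod>p\<in>A. c / real p) * (real x / real (\<Prod>A)))"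
  proof (intro sum_mono mult_left_mono)
    fix A assume "A \<in> Pow ?Q"
    define d where "d = \<Prod>A"
    have d: "d > 0" unfolding d_def using \<open>A \<in> Pow ?Q\<close> by (intro prod_primes_pos) auto
    have "(\<Sum>n\<in>{1..x}. of_bool (d dvd n) :: real) = real (card {n \<in> {1..x}. d dvd n})"
      by (simp add: of_bool_def sum.inter_filter[symmetric])
    also have "card {n \<in> {1..x}. d dvd n} \<le> card ((\<lambda>i. d * i) ` {1..x div d})"
    proof (rule card_mono)
      show "{n \<in> {1..x}. d dvd n} \<subseteq> (\<lambda>i. d * i) ` {1..x div d}"
      proof
        fix n assume "n \<in> {n \<in> {1..x}. d dvd n}"
        then obtain i where i: "n = d * i" "1 \<le> d * i" "d * i \<le> x" by auto
        then have "i \<in> {1..x div d}" using d by (auto simp: less_eq_div_iff_mult_less_eq mult.commute Suc_le_eq)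
        then show "n \<in> (\<lambda>i. d * i) ` {1..x div d}" using i by auto
      qed
    qed simp
    also have "\<dots> \<le> x div d" using card_image_le[of "{1..x div d}" "\<lambda>i. d * i"] by simp
    finally have "(\<Sum>n\<in>{1..x}. of_bool (d dvd n) :: real) \<le> real (x div d)" by simp
    also have "\<dots> \<le> real x / real d" by (rule of_nat_div_le_of_nat)
    finally show "(\<Sum>n\<in>{1..x}. of_bool (\<Prod>A dvd n)) \<le> real x / real (\<Prod>A)" unfolding d_def .
  qed (use c in \<open>auto intro!: prod_nonneg\<close>)
  also have "\<dots> = real x * (\<Sum>A\<in>Pow ?Q. \<Prod>p\<in>A. c / (real p)\<^sup>2)"
    unfolding sum_distrib_left by (intro sum.cong refl) (simp add: prod_dividef power2_eq_square prod.distrib)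
  also have "(\<Sum>A\<in>Pow ?Q. \<Prod>p\<in>A. c / (real p)\<^sup>2) = (\<Prod>p\<in>?Q. 1 + c / (real p)\<^sup>2)"
    by (rule prod_one_plus_eq_sum[OF fQ, symmetric])
  also have "real x * (\<Prod>p\<in>?Q. 1 + c / (real p)\<^sup>2) \<le> real x * exp c"
  proof (rule mult_left_mono)
    have "(\<Prod>p\<in>?Q. 1 + c / (real p)\<^sup>2) \<le> exp (\<Sum>p\<in>?Q. c / (real p)\<^sup>2)"
      using c by (intro prod_one_plus_le_exp) auto
    also have "(\<Sum>p\<in>?Q. c / (real p)\<^sup>2) = c * (\<Sum>p\<in>?Q. 1 / (real p)\<^sup>2)" by (simp add: sum_distrib_left)
    also have "c * (\<Sum>p\<in>?Q. 1 / (real p)\<^sup>2) \<le> c * (1 / real 1)"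
      using c fQ by (intro mult_left_mono sum_inverse_squares_le) (auto dest: prime_gt_1_nat)
    finally show "(\<Prod>p\<in>?Q. 1 + c / (real p)\<^sup>2) \<le> exp c" by simp
  qed simp
  finally show ?thesis by (simp add: c_def mult.commute)
qed

definition pairs :: "nat set \<Rightarrow> (nat \<times> nat) set" where
  "pairs G = {(a, b). a \<in> G \<and> b \<in> G \<and> a < b}"

text \<open>The smallest set \<open>Z\<close> that contains the primes up to \<open>D\<close> and
  leaves the elements of \<open>G\<close> distinct modulo all other primes.\<close>

definition bad_primes :: "nat \<Rightarrow> nat set \<Rightarrow> nat set" where
  "bad_primes D G = {p. prime p \<and> p \<le> D} \<union> (\<Union>(a, b)\<in>pairs G. prime_factors (b - a))"

lemma finite_pairs: "finite G \<Longrightarrow> finite (pairs G)"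
  by (rule finite_subset[of _ "G \<times> G"]) (auto simp: pairs_def)

lemma card_pairs_le: "finite G \<Longrightarrow> card (pairs G) \<le> card G ^ 2"
  using card_mono[of "G \<times> G" "pairs G"] by (force simp: pairs_def card_cartesian_product power2_eq_square)

lemma finite_bad_primes: "finite G \<Longrightarrow> finite (bad_primes D G)"
  unfolding bad_primes_def by (auto intro: finite_pairs)

lemma prime_bad_primes: "p \<in> bad_primes D G \<Longrightarrow> prime p"
  by (auto simp: bad_primes_def in_prime_factors_iff)

lemma prod_bad_primes_le:
  assumes G: "G \<subseteq> {1..x}"
  shows "\<Prod>(bad_primes D G) \<le> fact D * x ^ card (pairs G)"
proof -
  have fG: "finite G" using G finite_subset by blast
  have "\<Prod>(bad_primes D G) dvd fact D * (\<Prod>(a, b)\<in>pairs G. b - a)"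
  proof (rule prod_primes_dvd[OF finite_bad_primes[OF fG] prime_bad_primes])
    fix p assume "p \<in> bad_primes D G"
    then consider "prime p" "p \<le> D" | a b where "(a, b) \<in> pairs G" "p dvd b - a"
      by (auto simp: bad_primes_def in_prime_factors_iff)
    then show "p dvd fact D * (\<Prod>(a, b)\<in>pairs G. b - a)"
    proof cases
      case 1
      then show ?thesis using dvd_fact[of p D] prime_ge_1_nat[of p] by (intro dvd_mult2) simp
    next
      case 2
      have "b - a dvd (\<Prod>(a, b)\<in>pairs G. b - a)"
        using dvd_prodI[OF finite_pairs[OF fG] 2(1), of "\<lambda>(a, b). b - a"] by simp
      then show ?thesis using 2(2) by (meson dvd_mult dvd_trans)
    qed
  qed
  moreover have "0 < (\<Prod>(a, b)\<in>pairs G. b - a)" by (intro prod_pos) (auto simp: pairs_def)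
  ultimately have "\<Prod>(bad_primes D G) \<le> fact D * (\<Prod>(a, b)\<in>pairs G. b - a)"
    by (intro dvd_imp_le) auto
  also have "(\<Prod>(a, b)\<in>pairs G. b - a) \<le> (\<Prod>(a, b)\<in>pairs G. x)"
    using G by (intro prod_mono) (force simp: pairs_def)
  also have "\<dots> = x ^ card (pairs G)" by (simp add: case_prod_unfold)
  finally show ?thesis by simp
qed

lemma prod_Un_le:
  fixes f :: "'a \<Rightarrow> real"
  assumes "finite A" "finite B" "\<And>x. x \<in> A \<union> B \<Longrightarrow> 1 \<le> f x"
  shows "prod f (A \<union> B) \<le> prod f A * prod f B"
proof -
  have "prod f (A \<union> B) = prod f A * prod f (B - A)"
    using assms by (subst prod.union_disjoint[symmetric]) auto
  also have "\<dots> \<le> prod f A * prod f B"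
    using assms by (intro mult_left_mono prod_mono2 prod_nonneg) (auto intro: order.trans[OF zero_le_one])
  finally show ?thesis .
qed

lemma prod_UN_le:
  fixes f :: "'a \<Rightarrow> real"
  assumes "finite I" "\<And>i. i \<in> I \<Longrightarrow> finite (A i)" "\<And>i x. i \<in> I \<Longrightarrow> x \<in> A i \<Longrightarrow> 1 \<le> f x"
  shows "prod f (\<Union>i\<in>I. A i) \<le> (\<Prod>i\<in>I. prod f (A i))"
  using assms
proof (induction I rule: finite_induct)
  case (insert i I)
  have "prod f (A i \<union> (\<Union>i\<in>I. A i)) \<le> prod f (A i) * prod f (\<Union>i\<in>I. A i)"
    using insert by (intro prod_Un_le) auto
  also have "\<dots> \<le> prod f (A i) * (\<Prod>i\<in>I. prod f (A i))"
    using insert by (intro mult_left_mono prod_nonneg) (auto intro: order.trans[OF zero_le_one])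
  finally show ?case using insert by simp
qed simp

lemma prod_le_sum_power:
  fixes f :: "'a \<Rightarrow> real"
  assumes "finite E" "E \<noteq> {}" "\<And>e. e \<in> E \<Longrightarrow> 0 \<le> f e"
  shows "prod f E \<le> (\<Sum>e\<in>E. f e ^ card E)"
proof -
  have "Max (f ` E) \<in> f ` E" using assms by (intro Max_in) auto
  then obtain e where e: "e \<in> E" "f e = Max (f ` E)" by auto
  have "prod f E \<le> (\<Prod>_\<in>E. f e)" using assms e by (intro prod_mono) auto
  also have "\<dots> = f e ^ card E" by simp
  also have "\<dots> \<le> (\<Sum>e\<in>E. f e ^ card E)"
    using assms e by (intro member_le_sum) auto
  finally show ?thesis .
qed

text \<open>Spreading the bad primes over the pairs of \<open>G\<close> gives a product of values
  \<open>ratio (b - a)\<close>. A product of at most \<open>m ^ 2\<close> factors is at most the sum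
  of their \<open>m ^ 2\<close>-th powers, which decouples the pairs. A pair lies in at most
  \<open>x ^ (m - 2)\<close> sets, each difference belongs to at most \<open>x\<close> pairs, and
  the powers of \<open>ratio\<close> are bounded on average.\<close>

theorem sum_singular_series_le:
  assumes m: "m \<ge> 2"
  obtains C where "C \<ge> 0" "\<And>x. (\<Sum>G | G \<subseteq> {1..x} \<and> card G = m. 1 / (\<Prod>p\<in>bad_primes D G. 1 - 1 / real p) ^ m) \<le> C * real x ^ m"
proof -
  let ?f = "\<lambda>p::nat. 1 / (1 - 1 / real p)"
  define CD where "CD = (\<Prod>p | prime p \<and> p \<le> D. ?f p)"
  define s where "s = m * m ^ 2"
  have CD: "CD \<ge> 1" unfolding CD_def by (intro prod_ge_1 inverse_one_minus_ge1) auto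
  define C where "C = CD ^ m * exp (2 ^ (s + 1))"
  have C: "C \<ge> 0" using CD by (simp add: C_def)
  show thesis
  proof (rule that[OF C])
    fix x :: nat
    let ?GG = "{G. G \<subseteq> {1..x} \<and> card G = m}"
    let ?T = "pairs {1..x}"
    have fGG: "finite ?GG" by simp
    have fT: "finite ?T" by (simp add: finite_pairs)
    have each: "1 / (\<Prod>p\<in>bad_primes D G. 1 - 1 / real p) ^ m \<le> CD ^ m * (\<Sum>e\<in>?T. of_bool (e \<in> pairs G) * ratio (snd e - fst e) ^ s)"
      if G: "G \<in> ?GG" for G
    proof -
      have fG: "finite G" using G by (auto intro: finite_subset)
      have fp: "finite (pairs G)" by (rule finite_pairs[OF fG])
      have ne: "pairs G \<noteq> {}"
      proof -
        have "\<not> card G \<le> Suc 0" using G m by simp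
        then obtain a b where "a \<in> G" "b \<in> G" "a \<noteq> b" using fG by (auto simp: card_le_Suc0_iff_eq)
        then have "(a, b) \<in> pairs G \<or> (b, a) \<in> pairs G" by (auto simp: pairs_def)
        then show ?thesis by auto
      qed
      have "1 / (\<Prod>p\<in>bad_primes D G. 1 - 1 / real p) = prod ?f (bad_primes D G)"
        by (simp add: prod_dividef)
      also have "\<dots> \<le> CD * prod ?f (\<Union>(a, b)\<in>pairs G. prime_factors (b - a))"
        unfolding bad_primes_def CD_def using fp
        by (intro prod_Un_le inverse_one_minus_ge1) (auto simp: in_prime_factors_iff)
      also have "\<dots> \<le> CD * (\<Prod>e\<in>pairs G. ratio (snd e - fst e))"
      proof (intro mult_left_mono)
        show "prod ?f (\<Union>(a, b)\<in>pairs G. prime_factors (b - a)) \<le> (\<Prod>e\<in>pairs G. ratio (snd e - fst e))"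
          unfolding ratio_def case_prod_unfold using fp
          by (intro prod_UN_le inverse_one_minus_ge1) (auto simp: in_prime_factors_iff)
      qed (use CD in simp)
      finally have "(1 / (\<Prod>p\<in>bad_primes D G. 1 - 1 / real p)) ^ m \<le> (CD * (\<Prod>e\<in>pairs G. ratio (snd e - fst e))) ^ m"
      proof (rule power_mono)
        show "0 \<le> 1 / (\<Prod>p\<in>bad_primes D G. 1 - 1 / real p)"
        proof (intro divide_nonneg_nonneg prod_nonneg)
          fix p assume "p \<in> bad_primes D G"
          then have "real p \<ge> 1" using prime_bad_primes prime_ge_1_nat by fastforce
          then show "0 \<le> 1 - 1 / real p" by (simp add: field_simps)
        qed simp
      qed
      also have "\<dots> = CD ^ m * (\<Prod>e\<in>pairs G. ratio (snd e - fst e) ^ m)"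
        by (simp add: power_mult_distrib prod_power_distrib)
      also have "\<dots> \<le> CD ^ m * (\<Sum>e\<in>pairs G. (ratio (snd e - fst e) ^ m) ^ card (pairs G))"
        using CD ratio_ge1 fp ne by (intro mult_left_mono prod_le_sum_power) (auto intro: order.trans[OF zero_le_one])
      also have "\<dots> \<le> CD ^ m * (\<Sum>e\<in>pairs G. ratio (snd e - fst e) ^ s)"
      proof (intro mult_left_mono sum_mono)
        fix e
        have "card (pairs G) \<le> m ^ 2" using card_pairs_le[OF fG] G by simp
        then show "(ratio (snd e - fst e) ^ m) ^ card (pairs G) \<le> ratio (snd e - fst e) ^ s"
          unfolding power_mult[symmetric] s_def using ratio_ge1 by (intro power_increasing mult_left_mono) auto
      qed (use CD in simp)
      also have "(\<Sum>e\<in>pairs G. ratio (snd e - fst e) ^ s) = (\<Sum>e\<in>?T. of_bool (e \<in> pairs G) * ratio (snd e - fst e) ^ s)"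
        using fT G by (intro sum.mono_neutral_cong_left) (auto simp: pairs_def)
      finally show ?thesis by (simp add: power_divide)
    qed
    have count: "real (card {G \<in> ?GG. e \<in> pairs G}) \<le> real x ^ (m - 2)" if e: "e \<in> ?T" for e
    proof -
      obtain a b where ab: "e = (a, b)" "a < b" using e by (auto simp: pairs_def)
      let ?S = "{G \<in> ?GG. e \<in> pairs G}"
      have inG: "a \<in> G" "b \<in> G" "finite G" "card G = m" "G \<subseteq> {1..x}" if "G \<in> ?S" for G
        using that ab by (auto simp: pairs_def intro: finite_subset)
      have "card ?S \<le> card {G. G \<subseteq> {1..x} \<and> card G = m - 2}"
      proof (rule card_inj_on_le)
        show "inj_on (\<lambda>G. G - {a, b}) ?S"
        proof (rule inj_onI)
          fix G G' assume "G \<in> ?S" "G' \<in> ?S" "G - {a, b} = G' - {a, b}"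
          then show "G = G'" using inG[of G] inG[of G'] by blast
        qed
        show "(\<lambda>G. G - {a, b}) ` ?S \<subseteq> {G. G \<subseteq> {1..x} \<and> card G = m - 2}"
        proof (rule image_subsetI)
          fix G assume G: "G \<in> ?S"
          have "card (G - {a, b}) = m - 2" using inG[OF G] ab(2) by (subst card_Diff_subset) auto
          then show "G - {a, b} \<in> {G. G \<subseteq> {1..x} \<and> card G = m - 2}" using inG(5)[OF G] by blast
        qed
      qed simp
      also have "\<dots> = x choose (m - 2)" by (simp add: n_subsets)
      also have "\<dots> \<le> x ^ (m - 2)" by (cases "m - 2 \<le> x") (simp_all add: binomial_le_pow binomial_eq_0)
      finally have "real (card ?S) \<le> real (x ^ (m - 2))" by (rule of_nat_mono)
      then show ?thesis by (simp only: of_nat_power)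
    qed
    have "(\<Sum>G\<in>?GG. 1 / (\<Prod>p\<in>bad_primes D G. 1 - 1 / real p) ^ m) \<le>
      (\<Sum>G\<in>?GG. CD ^ m * (\<Sum>e\<in>?T. of_bool (e \<in> pairs G) * ratio (snd e - fst e) ^ s))"
      by (intro sum_mono each)
    also have "\<dots> = CD ^ m * (\<Sum>e\<in>?T. \<Sum>G\<in>?GG. of_bool (e \<in> pairs G) * ratio (snd e - fst e) ^ s)"
      unfolding sum_distrib_left[symmetric] by (subst sum.swap) simp
    also have "\<dots> = CD ^ m * (\<Sum>e\<in>?T. real (card {G \<in> ?GG. e \<in> pairs G}) * ratio (snd e - fst e) ^ s)"
    proof -
      have "(\<Sum>G\<in>?GG. of_bool (e \<in> pairs G) :: real) = real (card {G \<in> ?GG. e \<in> pairs G})" for e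
        unfolding of_bool_def using sum.inter_filter[OF fGG, of "\<lambda>_. 1::real" "\<lambda>G. e \<in> pairs G"] by simp
      then show ?thesis by (simp only: sum_distrib_right[symmetric])
    qed
    also have "\<dots> \<le> CD ^ m * (\<Sum>e\<in>?T. real x ^ (m - 2) * ratio (snd e - fst e) ^ s)"
      using CD ratio_ge1 by (intro mult_left_mono sum_mono mult_right_mono count zero_le_power) (auto intro: order.trans[OF zero_le_one])
    also have "\<dots> = CD ^ m * real x ^ (m - 2) * (\<Sum>e\<in>?T. ratio (snd e - fst e) ^ s)"
      by (simp add: sum_distrib_left mult.assoc)
    also have "\<dots> \<le> CD ^ m * real x ^ (m - 2) * (real x * (exp (2 ^ (s + 1)) * real x))"
    proof (rule mult_left_mono)
      have rn: "0 \<le> ratio n ^ s" for n using ratio_ge1[of n] by (intro zero_le_power) linarith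
      have "(\<Sum>e\<in>?T. ratio (snd e - fst e) ^ s) = (\<Sum>(a, d)\<in>(\<lambda>(a, b). (a, b - a)) ` ?T. ratio d ^ s)"
        by (subst sum.reindex) (auto simp: inj_on_def pairs_def case_prod_unfold)
      also have "\<dots> \<le> (\<Sum>(a, d)\<in>{1..x} \<times> {1..x}. ratio d ^ s)"
        by (intro sum_mono2) (auto simp: pairs_def rn)
      also have "\<dots> = real x * (\<Sum>d\<in>{1..x}. ratio d ^ s)" by (simp add: sum.cartesian_product[symmetric])
      also have "\<dots> \<le> real x * (exp (2 ^ (s + 1)) * real x)" by (intro mult_left_mono sum_ratio_power_le) simp
      finally show "(\<Sum>e\<in>?T. ratio (snd e - fst e) ^ s) \<le> real x * (exp (2 ^ (s + 1)) * real x)" .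
    qed (use CD in simp)
    also have "\<dots> = C * real x ^ m"
    proof -
      have "real x ^ (m - 2 + 2) = real x ^ (m - 2) * (real x * real x)"
        by (simp only: power_add power2_eq_square)
      then have "real x ^ m = real x ^ (m - 2) * (real x * real x)" unfolding le_add_diff_inverse2[OF m] .
      then show ?thesis by (simp only: C_def mult_ac)
    qed
    finally show "(\<Sum>G\<in>?GG. 1 / (\<Prod>p\<in>bad_primes D G. 1 - 1 / real p) ^ m) \<le> C * real x ^ m" .
  qed
qed

subsection \<open>Small gaps\<close>

text \<open>Multiply by \<open>1 + k * x\<close>, which Bernoulli's inequality puts below
  \<open>(1 + x) ^ k\<close>: the left side becomes at most 1, and the bound on
  \<open>k * (k - 1) * x\<close> keeps the right side at least 1.\<close>

lemma one_minus_power_le: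
  fixes x :: real
  assumes "0 \<le> x" "x \<le> 1" "real k * (real k - 1) * x \<le> 1" "k \<ge> 1"
  shows "(1 - x) ^ k \<le> 1 - (real k - 1) * x"
proof -
  have pos: "1 + real k * x > 0" using assms by (intro add_pos_nonneg) auto
  have "(1 - x) ^ k * (1 + real k * x) \<le> (1 - x) ^ k * (1 + x) ^ k"
    using assms Bernoulli_inequality[of x k] by (intro mult_left_mono) auto
  also have "\<dots> = (1 - x * x) ^ k" unfolding power_mult_distrib[symmetric] by (simp add: algebra_simps)
  also have "\<dots> \<le> 1" using assms by (intro power_le_one) (auto simp: mult_le_one)
  also have "1 \<le> 1 + x * (1 - real k * (real k - 1) * x)" using assms by simp
  also have "\<dots> = (1 - (real k - 1) * x) * (1 + real k * x)" by (simp add: algebra_simps)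
  finally show ?thesis using pos by simp
qed

text \<open>At a prime up to \<open>D\<close> all shifts vanish, because \<open>fact D\<close>
  divides them, and \<open>p - 1\<close> classes remain. At a larger prime of \<open>Z\<close> two
  shifts coincide, so at least \<open>p - (k - 1)\<close> classes remain, enough because
  \<open>p \<ge> k ^ 2\<close>. The resulting \<open>k\<close>-th power cancels the one in the
  denominator of the bound for a single class.\<close>

lemma card_coprime_shifts_ge:
  assumes H: "finite H" "card H = k" "k \<ge> 1" "\<And>h. h \<in> H \<Longrightarrow> fact D dvd h" and D: "D \<ge> k ^ 2"
    and Z: "Z = bad_primes D H"
  shows "real (\<Prod>Z) * (\<Prod>p\<in>Z. 1 - 1 / real p) ^ k \<le>
    real (card {\<nu>. \<nu> < \<Prod>Z \<and> (\<forall>h\<in>H. coprime (\<nu> + h) (\<Prod>Z))})"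
proof -
  have fZ: "finite Z" and pZ: "\<And>p. p \<in> Z \<Longrightarrow> prime p"
    unfolding Z using finite_bad_primes[OF H(1)] prime_bad_primes by auto
  define \<Omega> where "\<Omega> p = {..<p} - bad_residues H p" for p
  let ?C = "crt_classes 1 0 \<Omega> Z"
  have cC: "card ?C = (\<Prod>p\<in>Z. card (\<Omega> p))"
    by (rule card_crt_classes[OF fZ]) (auto simp: pZ \<Omega>_def)
  have sub: "?C \<subseteq> {\<nu>. \<nu> < \<Prod>Z \<and> (\<forall>h\<in>H. coprime (\<nu> + h) (\<Prod>Z))}"
  proof
    fix c assume c: "c \<in> ?C"
    have "coprime (c + h) p" if "h \<in> H" "p \<in> Z" for h p
    proof -
      have "p > 0" "prime p" using pZ[OF that(2)] prime_gt_0_nat by auto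
      have "c mod p \<in> \<Omega> p" using c that by (auto simp: crt_classes_def)
      then have "\<not> p dvd c + h" using that mod_in_bad_residues[OF \<open>p > 0\<close>, of c H] by (auto simp: \<Omega>_def)
      then show ?thesis using prime_imp_coprime[OF \<open>prime p\<close>, of "c + h"] coprime_commute by blast
    qed
    then show "c \<in> {\<nu>. \<nu> < \<Prod>Z \<and> (\<forall>h\<in>H. coprime (\<nu> + h) (\<Prod>Z))}"
      using c by (auto simp: crt_classes_def intro!: prod_coprime_right)
  qed
  have each: "real p * (1 - 1 / real p) ^ k \<le> real (card (\<Omega> p))" if p: "p \<in> Z" for p
  proof -
    have pr: "prime p" and p2: "real p \<ge> 2" and p0: "p > 0"
      using pZ[OF p] prime_ge_2_nat[of p] prime_gt_0_nat[of p] by auto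
    let ?I = "(\<lambda>h. h mod p) ` H"
    have "bad_residues H p = (\<lambda>r. (p - r) mod p) ` ?I"
      unfolding bad_residues_eq[OF p0] image_image ..
    then have bad: "card (bad_residues H p) \<le> card ?I" using H(1) by (simp add: card_image_le)
    have "bad_residues H p \<subseteq> {..<p}" by (auto simp: bad_residues_def)
    then have card\<Omega>: "real (card (\<Omega> p)) = real p - real (card (bad_residues H p))"
      unfolding \<Omega>_def by (subst card_Diff_subset) (auto intro: finite_subset simp: of_nat_diff card_mono[of "{..<p}", simplified])
    have x01: "0 \<le> 1 - 1 / real p" "1 - 1 / real p \<le> 1" using p2 by (auto simp: field_simps)
    show ?thesis
    proof (cases "p \<le> D")
      case True
      have "h mod p = 0" if "h \<in> H" for h
      proof -
        have "p dvd fact D" using dvd_fact[of p D] True p0 by simp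
        then have "p dvd h" using H(4)[OF that] by (rule dvd_trans)
        then show ?thesis by simp
      qed
      then have "?I \<subseteq> {0}" by auto
      then have "card ?I \<le> 1" using card_mono[of "{0}" ?I] by simp
      then have "real p - 1 \<le> real (card (\<Omega> p))" using bad card\<Omega> by linarith
      moreover have "real p * (1 - 1 / real p) ^ k \<le> real p * (1 - 1 / real p) ^ 1"
        using x01 H(3) by (intro mult_left_mono power_decreasing) auto
      moreover have "real p * (1 - 1 / real p) ^ 1 = real p - 1" using p2 by (simp add: field_simps)
      ultimately show ?thesis by linarith
    next
      case False
      then obtain a b where ab: "a \<in> H" "b \<in> H" "a < b" "p dvd b - a"
        using p by (auto simp: Z bad_primes_def pairs_def in_prime_factors_iff)
      then have "a mod p = b mod p" by (metis less_imp_le mod_eq_dvd_iff_nat)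
      then have "\<not> inj_on (\<lambda>h. h mod p) H" using ab by (auto simp: inj_on_def)
      then have "card ?I \<noteq> card H" using eq_card_imp_inj_on[OF H(1)] by blast
      then have "card ?I < k" using card_image_le[OF H(1), of "\<lambda>h. h mod p"] H(2) by simp
      then have "real p - (real k - 1) \<le> real (card (\<Omega> p))" using bad card\<Omega> by linarith
      moreover have "(1 - 1 / real p) ^ k \<le> 1 - (real k - 1) * (1 / real p)"
      proof (rule one_minus_power_le)
        have "k ^ 2 \<le> p" using D False by linarith
        then have "real k * real k \<le> real p" by (metis of_nat_le_iff of_nat_mult power2_eq_square)
        then have "real k * (real k - 1) \<le> real p" unfolding right_diff_distrib by linarith
        then show "real k * (real k - 1) * (1 / real p) \<le> 1" using p2 by (simp add: divide_le_eq_1)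
      qed (use p2 H(3) in auto)
      then have "real p * (1 - 1 / real p) ^ k \<le> real p * (1 - (real k - 1) * (1 / real p))"
        by (intro mult_left_mono) auto
      moreover have "real p * (1 - (real k - 1) * (1 / real p)) = real p - (real k - 1)"
        using p2 by (simp add: field_simps)
      ultimately show ?thesis by linarith
    qed
  qed
  have "real (\<Prod>Z) * (\<Prod>p\<in>Z. 1 - 1 / real p) ^ k = (\<Prod>p\<in>Z. real p * (1 - 1 / real p) ^ k)"
    by (simp add: prod.distrib prod_power_distrib)
  also have "\<dots> \<le> (\<Prod>p\<in>Z. real (card (\<Omega> p)))"
  proof (intro prod_mono conjI each)
    fix p assume "p \<in> Z"
    then have "real p \<ge> 1" using pZ prime_ge_1_nat by fastforce
    then show "0 \<le> real p * (1 - 1 / real p) ^ k" by simp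
  qed
  also have "\<dots> = real (card ?C)" by (simp only: cC of_nat_prod)
  also have "\<dots> \<le> real (card {\<nu>. \<nu> < \<Prod>Z \<and> (\<forall>h\<in>H. coprime (\<nu> + h) (\<Prod>Z))})"
    using sub by (intro of_nat_mono card_mono) (auto intro: finite_subset[of _ "{..<\<Prod>Z}"])
  finally show ?thesis .
qed

text \<open>At most \<open>card H ^ 2\<close> differences occur, each at most \<open>x\<close>, and
  \<open>fact D\<close> takes one more factor \<open>L\<close>; hence the exponent.\<close>

lemma separated_bad_primes:
  assumes H: "H \<subseteq> {1..x}" and x: "real x \<le> L" and L: "L \<ge> 1" "fact D \<le> L" and K: "card H ^ 2 + 1 \<le> K"
  shows "separated D K L (bad_primes D H) H"
proof -
  have fH: "finite H" using H finite_subset by blast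
  have bd: "real (\<Prod>(bad_primes D H)) \<le> L ^ K"
  proof -
    have "real (\<Prod>(bad_primes D H)) \<le> real (fact D * x ^ card (pairs H))"
      by (intro of_nat_mono prod_bad_primes_le H)
    also have "\<dots> = fact D * real x ^ card (pairs H)" by simp
    also have "\<dots> \<le> L * L ^ card (pairs H)" using x L by (intro mult_mono power_mono) auto
    also have "\<dots> = L ^ (card (pairs H) + 1)" by simp
    also have "\<dots> \<le> L ^ K" using card_pairs_le[OF fH] K L by (intro power_increasing) auto
    finally show ?thesis .
  qed
  have hL: "real h \<le> L" if "h \<in> H" for h
  proof -
    have "h \<le> x" using that H by auto
    then show ?thesis using x by linarith
  qed
  have inj: "inj_on (\<lambda>h. h mod p) H" if p: "prime p" "p \<notin> bad_primes D H" for p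
  proof (rule inj_onI, rule ccontr)
    fix a b assume ab: "a \<in> H" "b \<in> H" "a mod p = b mod p" "a \<noteq> b"
    have "p \<in> bad_primes D H" if "a \<in> H" "b \<in> H" "a mod p = b mod p" "a < b" for a b
    proof -
      have "p dvd b - a" using that by (metis less_imp_le mod_eq_dvd_iff_nat)
      then have "p \<in> prime_factors (b - a)" using p that by (auto simp: in_prime_factors_iff)
      then show ?thesis using that by (auto simp: bad_primes_def pairs_def)
    qed
    from this[of a b] this[of b a] ab p show False by (metis linorder_neqE_nat)
  qed
  show ?thesis unfolding separated_def
  proof (intro conjI ballI allI impI)
    show "p \<in> bad_primes D H" if "prime p \<and> p \<le> D" for p using that by (simp add: bad_primes_def)
  qed (use fH finite_bad_primes[OF fH] prime_bad_primes bd hL inj in blast)+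
qed

lemma card_eq_sum_of_bool: "finite A \<Longrightarrow> real (card {x \<in> A. Q x}) = (\<Sum>x\<in>A. of_bool (Q x))"
  unfolding of_bool_def by (subst sum.inter_filter[symmetric]) auto

section \<open>Consecutive primes at small distance\<close>

lemma strict_mono_nth_prime: "i < j \<Longrightarrow> nth_prime i < nth_prime j"
  unfolding nth_prime_def by (intro enumerate_mono primes_infinite)

lemma prime_eq_nth_prime: "prime p \<Longrightarrow> \<exists>j. nth_prime j = p"
  unfolding nth_prime_def using enumerate_Ex[OF primes_infinite, of p] by auto

lemma nth_prime_Suc_le:
  assumes "prime q" "nth_prime j < q"
  shows "nth_prime (Suc j) \<le> q"
proof -
  obtain i where i: "nth_prime i = q" using prime_eq_nth_prime[OF assms(1)] by blast
  have "j < i"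
  proof (rule ccontr)
    assume "\<not> j < i"
    then have "i = j \<or> i < j" by auto
    then show False using strict_mono_nth_prime[of i j] i assms(2) by auto
  qed
  then have "Suc j = i \<or> Suc j < i" by auto
  then show ?thesis using strict_mono_nth_prime[of "Suc j" i] i by auto
qed

lemma finite_small_gap_indices: "finite (small_gap_indices \<eta> N)"
proof -
  have inj: "inj nth_prime"
    by (rule injI) (metis linorder_neqE_nat order_less_irrefl strict_mono_nth_prime)
  have "finite (nth_prime -` {..2 * N})" by (rule finite_vimageI[OF _ inj]) simp
  then show ?thesis by (rule rev_finite_subset) (auto simp: small_gap_indices_def)
qed

text \<open>Each consecutive pair at distance at most \<open>x\<close> accounts for at most \<open>x\<close> values of \<open>n\<close>.\<close>

lemma card_two_primes_le:
  assumes x: "real x \<le> \<eta> * ln (real N)"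
    and S: "S \<subseteq> {N<..2 * N}" "\<And>n. n \<in> S \<Longrightarrow> \<exists>h h'. 1 \<le> h \<and> h < h' \<and> h' \<le> x \<and> prime (n + h) \<and> prime (n + h')"
  shows "card S \<le> card (small_gap_indices \<eta> N) * x + x"
proof -
  let ?J = "small_gap_indices \<eta> N"
  have "S \<subseteq> (\<lambda>(j, i). nth_prime j - i) ` (?J \<times> {1..x}) \<union> {2 * N - x<..2 * N}"
  proof
    fix n assume n: "n \<in> S"
    show "n \<in> (\<lambda>(j, i). nth_prime j - i) ` (?J \<times> {1..x}) \<union> {2 * N - x<..2 * N}"
    proof (cases "n \<le> 2 * N - x")
      case False
      then show ?thesis using n S(1) by auto
    next
      case True
      obtain h h' where h: "1 \<le> h" "h < h'" "h' \<le> x" "prime (n + h)" "prime (n + h')" using S(2)[OF n] by blast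
      obtain j where j: "nth_prime j = n + h" using prime_eq_nth_prime[OF h(4)] by blast
      have "nth_prime (Suc j) \<le> n + h'" using h j by (intro nth_prime_Suc_le) auto
      then have "real (nth_prime (Suc j)) - real (nth_prime j) \<le> real x" using j h by linarith
      moreover have "N < n" using n S(1) by auto
      then have "n + h \<le> 2 * N" using True h by arith
      ultimately have "j \<in> ?J" using j n S(1) x h by (auto simp: small_gap_indices_def)
      then have "(j, h) \<in> ?J \<times> {1..x}" using h by auto
      moreover have "n = (\<lambda>(j, i). nth_prime j - i) (j, h)" using j by simp
      ultimately show ?thesis by blast
    qed
  qed
  then have "card S \<le> card ((\<lambda>(j, i). nth_prime j - i) ` (?J \<times> {1..x}) \<union> {2 * N - x<..2 * N})"
    using finite_small_gap_indices by (intro card_mono) auto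
  also have "\<dots> \<le> card ((\<lambda>(j, i). nth_prime j - i) ` (?J \<times> {1..x})) + card {2 * N - x<..2 * N}"
    by (rule card_Un_le)
  also have "\<dots> \<le> card (?J \<times> {1..x}) + x"
    using finite_small_gap_indices[of \<eta> N] by (intro add_mono card_image_le) auto
  finally show ?thesis by (simp add: card_cartesian_product)
qed

text \<open>Double counting over shift sets. The pairs of \<open>n\<close> and a good
  \<open>k\<close>-set number at least a constant times \<open>\<eta> ^ k * N\<close>, but a few
  \<open>n\<close> could own most of them. Such \<open>n\<close> have many rough shifts, hence many
  rough \<open>(k + 1)\<close>-sets, and the upper bound for those limits their share.\<close>

theorem theorem4:
  fixes \<theta> :: real
  assumes "\<theta> > 1 / 2" and "level_of_distribution \<theta>"
  shows "\<exists>(k::int) (c::real). c > 0 \<and>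
    (\<exists>\<eta>\<^sub>0>0. \<forall>\<eta>::real. 0 < \<eta> \<and> \<eta> < \<eta>\<^sub>0 \<longrightarrow>
      liminf (\<lambda>N::nat. ereal (real (card (small_gap_indices \<eta> N)) / (real N / ln (real N))))
        \<ge> ereal (c * \<eta> powi (k - 1)))"
proof -
  obtain k D :: nat where k: "k \<ge> 2" "D \<ge> k ^ 2" "D \<ge> 2 * (k + 1)" and
    low: "\<forall>K. \<exists>c>0. \<exists>\<delta>>0. \<forall>\<^sub>F N in sequentially. \<forall>Z H \<nu>. separated D K (ln (real N)) Z H \<and> card H = k \<and>
       \<nu> < \<Prod>Z \<and> (\<forall>h\<in>H. coprime (\<nu> + h) (\<Prod>Z)) \<longrightarrow>
       c * (real N / real (\<Prod>Z)) / ((\<Prod>p\<in>Z. 1 - 1 / real p) * ln (real N)) ^ k \<le>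
       real (card {n \<in> {N<..2 * N}. n mod \<Prod>Z = \<nu> \<and> (\<forall>h\<in>H. rough (\<delta> * ln (real N)) (n + h)) \<and> 2 \<le> card {h \<in> H. prime (n + h)}})"
    by (rule tuple_lower_bound[OF assms])
  define m where "m = k + 1"
  define K where "K = m ^ 2 + 1"
  obtain c \<delta> where c: "c > 0" and \<delta>: "\<delta> > 0" and
    evA: "\<forall>\<^sub>F N in sequentially. \<forall>Z H \<nu>. separated D K (ln (real N)) Z H \<and> card H = k \<and>
       \<nu> < \<Prod>Z \<and> (\<forall>h\<in>H. coprime (\<nu> + h) (\<Prod>Z)) \<longrightarrow>
       c * (real N / real (\<Prod>Z)) / ((\<Prod>p\<in>Z. 1 - 1 / real p) * ln (real N)) ^ k \<le>
       real (card {n \<in> {N<..2 * N}. n mod \<Prod>Z = \<nu> \<and> (\<forall>h\<in>H. rough (\<delta> * ln (real N)) (n + h)) \<and> 2 \<le> card {h \<in> H. prime (n + h)}})"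
    using low[THEN spec, of K] by blast
  have \<theta>0: "\<theta> > 0" using assms(1) by simp
  obtain Cb where Cb: "\<And>n::nat. (\<Sum>p | prime p \<and> p \<le> n. ln (real p)) \<le> Cb * real n"
    using chebyshev_of_level[OF assms(2) \<theta>0] by blast
  have m1: "m \<ge> 1" "D \<ge> 2 * m" "m \<ge> 2" using k by (auto simp: m_def)
  obtain Cu where Cu: "Cu \<ge> 0" and
    evB: "\<forall>\<^sub>F N in sequentially. \<forall>Z H. separated D K (ln (real N)) Z H \<and> card H = m \<longrightarrow>
       real (card {n \<in> {N<..2 * N}. \<forall>h\<in>H. rough (\<delta> * ln (real N)) (n + h)}) \<le>
       Cu * real N / ((\<Prod>p\<in>Z. 1 - 1 / real p) * ln (real N)) ^ m"
    by (rule tuple_upper_bound[OF Cb m1(1,2) \<delta>])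
  obtain Cs where Cs: "Cs \<ge> 0" "\<And>x. (\<Sum>G | G \<subseteq> {1..x} \<and> card G = m. 1 / (\<Prod>p\<in>bad_primes D G. 1 - 1 / real p) ^ m) \<le> Cs * real x ^ m"
    using sum_singular_series_le[OF m1(3), of D] by blast
  define B :: nat where "B = fact D"
  have B: "B > 0" by (simp add: B_def)
  define c1 where "c1 = c / (2 * real B * real k) ^ k"
  have c1: "c1 > 0" using c B k by (simp add: c1_def)
  define C2 where "C2 = Cu * Cs"
  have C2: "C2 \<ge> 0" using Cu Cs by (simp add: C2_def)
  \<comment> \<open>Among \<open>r\<close> rough shifts the number of \<open>k\<close>-sets is
    \<open>(k + 1) / (r - k)\<close> times that of \<open>(k + 1)\<close>-sets. \<open>T\<close>
    makes this ratio at most \<open>c1 / (2 * (C2 + 1))\<close> for \<open>r > T\<close>, so that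
    such \<open>n\<close> carry at most half of the pairs.\<close>
  define T where "T = k + 1 + nat \<lceil>real (k + 1) * (2 * (C2 + 1)) / c1\<rceil>"
  have T: "T > k" "real (k + 1) * (2 * (C2 + 1)) \<le> c1 * (real T - real k)"
  proof -
    show "T > k" by (simp add: T_def)
    have "real (k + 1) * (2 * (C2 + 1)) / c1 \<le> real T - real k" unfolding T_def by linarith
    then show "real (k + 1) * (2 * (C2 + 1)) \<le> c1 * (real T - real k)" using c1 by (simp add: field_simps)
  qed
  define c3 where "c3 = c1 / 2 / real T ^ k"
  have c3: "c3 > 0" using c1 T by (simp add: c3_def)
  have main: "\<forall>\<^sub>F N in sequentially. c3 / 2 * \<eta> ^ (k - 1) \<le> real (card (small_gap_indices \<eta> N)) / (real N / ln (real N))"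
    if \<eta>: "0 < \<eta>" "\<eta> < 1" for \<eta>
  proof -
    have ev: "\<forall>\<^sub>F L::real in at_top. \<eta> * L \<ge> 2 + 2 * real B + 2 * real B * real k \<and> L \<ge> fact D \<and> L \<ge> 1 \<and> L \<le> c3 / 2 * \<eta> ^ (k - 1) * exp L"
    proof (intro eventually_conj eventually_ge_at_top)
      show "\<forall>\<^sub>F L::real in at_top. \<eta> * L \<ge> 2 + 2 * real B + 2 * real B * real k" using \<eta>(1) by real_asymp
      have "c3 / 2 * \<eta> ^ (k - 1) > 0" using c3 \<eta> by simp
      then show "\<forall>\<^sub>F L::real in at_top. L \<le> c3 / 2 * \<eta> ^ (k - 1) * exp L" by real_asymp
    qed
    have evN: "\<forall>\<^sub>F N::nat in sequentially. real N > 0" by real_asymp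
    show ?thesis using evA evB eventually_ln_nat[OF ev] evN
    proof eventually_elim
      case (elim N)
      define L where "L = ln (real N)"
      note A = elim(1)[folded L_def] and U = elim(2)[folded L_def] and e = elim(3)[folded L_def]
      have N: "real N = exp L" "real N > 0" using elim(4) by (auto simp: L_def)
      have L: "L \<ge> 1" "L > 0" using e by auto
      define x where "x = nat \<lfloor>\<eta> * L\<rfloor>"
      have \<eta>L: "\<eta> * L \<ge> 2 + 2 * real B + 2 * real B * real k" using e by blast
      have "0 \<le> 2 * real B * real k" by simp
      then have \<eta>L2: "\<eta> * L \<ge> 2" using \<eta>L by linarith
      have x: "real x \<le> \<eta> * L" "\<eta> * L < real x + 1" using \<eta>L2 unfolding x_def by linarith+
      have "\<eta> * L \<le> 1 * L" using \<eta> L by (intro mult_right_mono) auto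
      then have xL: "real x \<le> L" using x by linarith
      \<comment> \<open>With multiples of \<open>D!\<close> as shifts all of them agree modulo the
        primes up to \<open>D\<close>, so no such prime obstructs the choice of the class
        \<open>\<nu>\<close>.\<close>
      define AA where "AA = {g \<in> {1..x}. B dvd g}"
      have AA: "finite AA" "AA \<subseteq> {1..x}" by (auto simp: AA_def)
      have cAA: "\<eta> * L / (2 * real B) \<le> real (card AA)"
      proof -
        have "(\<lambda>i. B * i) ` {1..x div B} \<subseteq> AA"
          using B by (auto simp: AA_def less_eq_div_iff_mult_less_eq mult.commute Suc_le_eq)
        then have "card ((\<lambda>i. B * i) ` {1..x div B}) \<le> card AA" using AA by (intro card_mono)
        moreover have "card ((\<lambda>i. B * i) ` {1..x div B}) = x div B" using B by (subst card_image) (auto simp: inj_on_def)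
        ultimately have 1: "real (x div B) \<le> real (card AA)" by simp
        have "real x = real B * real (x div B) + real (x mod B)"
          by (metis mult_div_mod_eq of_nat_add of_nat_mult)
        moreover have "real (x mod B) \<le> real B" using B by (simp add: less_imp_le)
        ultimately have "real x \<le> real B * real (card AA) + real B"
          using mult_left_mono[OF 1, of "real B"] by simp
        then have "\<eta> * L \<le> 2 * (real B * real (card AA))" using x \<eta>L mult_nonneg_nonneg[of "real B" "real k"] by linarith
        then show ?thesis using B by (simp add: field_simps)
      qed
      have kAA: "k \<le> card AA"
      proof -
        have "2 * real B * real k \<le> \<eta> * L" using \<eta>L by linarith
        then have "real k \<le> \<eta> * L / (2 * real B)" using B by (simp add: field_simps)
        then show ?thesis using cAA by linarith
      qed
      define HH where "HH = {H. H \<subseteq> AA \<and> card H = k}"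
      define GG where "GG = {G. G \<subseteq> AA \<and> card G = m}"
      have fin: "finite HH" "finite GG" using AA by (auto simp: HH_def GG_def)
      let ?I = "{N<..2 * N}"
      define R where "R n = {g \<in> AA. rough (\<delta> * L) (n + g)}" for n
      define good where "good n H \<longleftrightarrow> H \<subseteq> R n \<and> 2 \<le> card {h \<in> H. prime (n + h)}" for n H
      have fR: "finite (R n)" for n using AA by (simp add: R_def)
      have goodH: "c * real N / L ^ k \<le> real (card {n \<in> ?I. good n H})" if H: "H \<in> HH" for H
      proof -
        have H': "H \<subseteq> AA" "card H = k" "finite H" "H \<subseteq> {1..x}" using H AA by (auto simp: HH_def intro: finite_subset)
        define Z where "Z = bad_primes D H"
        define W where "W = \<Prod>Z"
        define F where "F = (\<Prod>p\<in>Z. 1 - 1 / real p)"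
        have sep: "separated D K L Z H"
          unfolding Z_def using H' xL e by (intro separated_bad_primes) (auto simp: K_def m_def power_mono)
        have Zp: "prime p" if "p \<in> Z" for p using that prime_bad_primes by (auto simp: Z_def)
        have W0: "W > 0" unfolding W_def by (intro prod_primes_pos Zp)
        have F0: "F > 0" unfolding F_def
        proof (rule prod_pos)
          fix p assume "p \<in> Z"
          then have "real p \<ge> 2" using Zp prime_ge_2_nat by fastforce
          then show "0 < 1 - 1 / real p" by (simp add: field_simps)
        qed
        let ?V = "{\<nu>. \<nu> < W \<and> (\<forall>h\<in>H. coprime (\<nu> + h) W)}"
        let ?Y = "\<lambda>\<nu>. {n \<in> ?I. n mod W = \<nu> \<and> (\<forall>h\<in>H. rough (\<delta> * L) (n + h)) \<and> 2 \<le> card {h \<in> H. prime (n + h)}}"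
        have fV: "finite ?V" by simp
        have V: "real W * F ^ k \<le> real (card ?V)"
          unfolding W_def F_def using H' k by (intro card_coprime_shifts_ge[OF _ _ _ _ k(2) Z_def]) (auto simp: AA_def B_def)
        have "c * real N / L ^ k = real W * F ^ k * (c * (real N / real W) / (F * L) ^ k)"
          using W0 F0 by (simp add: power_mult_distrib)
        also have "\<dots> \<le> real (card ?V) * (c * (real N / real W) / (F * L) ^ k)"
          using V c F0 L by (intro mult_right_mono) auto
        also have "\<dots> = (\<Sum>\<nu>\<in>?V. c * (real N / real W) / (F * L) ^ k)" by simp
        also have "\<dots> \<le> (\<Sum>\<nu>\<in>?V. real (card (?Y \<nu>)))"
        proof (rule sum_mono)
          fix \<nu> assume \<nu>: "\<nu> \<in> ?V"
          have "separated D K L Z H \<and> card H = k \<and> \<nu> < \<Prod>Z \<and> (\<forall>h\<in>H. coprime (\<nu> + h) (\<Prod>Z))"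
            using sep H'(2) \<nu> unfolding W_def by blast
          from A[THEN spec, THEN spec, THEN spec, THEN mp, OF this]
          show "c * (real N / real W) / (F * L) ^ k \<le> real (card (?Y \<nu>))" unfolding W_def F_def .
        qed
        also have "\<dots> = real (\<Sum>\<nu>\<in>?V. card (?Y \<nu>))" by simp
        also have "(\<Sum>\<nu>\<in>?V. card (?Y \<nu>)) = card (\<Union>\<nu>\<in>?V. ?Y \<nu>)"
          by (rule card_UN_disjoint[symmetric]) (use fV in auto)
        also have "card (\<Union>\<nu>\<in>?V. ?Y \<nu>) \<le> card {n \<in> ?I. good n H}"
          using H'(1) by (intro card_mono) (auto simp: good_def R_def)
        finally show ?thesis by simp
      qed
      define a where "a n = real (card {H \<in> HH. good n H})" for n
      define b where "b n = real (card {G \<in> GG. G \<subseteq> R n})" for n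
      have suma: "c1 * \<eta> ^ k * real N \<le> (\<Sum>n\<in>?I. a n)"
      proof -
        have "c1 * \<eta> ^ k * real N = (\<eta> * L / (2 * real B) / real k) ^ k * (c * real N / L ^ k)"
          using L by (simp add: c1_def power_divide power_mult_distrib field_simps)
        also have "\<dots> \<le> (real (card AA) / real k) ^ k * (c * real N / L ^ k)"
          using cAA \<eta> L c by (intro mult_right_mono power_mono divide_right_mono) auto
        also have "\<dots> \<le> real (card AA choose k) * (c * real N / L ^ k)"
          using binomial_ge_n_over_k_pow_k[OF kAA, where 'a = real] L c by (intro mult_right_mono) auto
        also have "card AA choose k = card HH" unfolding HH_def by (rule n_subsets[OF AA(1), symmetric])
        also have "real (card HH) * (c * real N / L ^ k) = (\<Sum>H\<in>HH. c * real N / L ^ k)" by simp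
        also have "\<dots> \<le> (\<Sum>H\<in>HH. real (card {n \<in> ?I. good n H}))" by (intro sum_mono goodH)
        also have "\<dots> = (\<Sum>n\<in>?I. a n)"
          unfolding a_def by (simp only: card_eq_sum_of_bool[OF fin(1)] card_eq_sum_of_bool[OF finite_greaterThanAtMost]) (rule sum.swap)
        finally show ?thesis .
      qed
      have sumb: "(\<Sum>n\<in>?I. b n) \<le> C2 * \<eta> ^ k * real N"
      proof -
        have "(\<Sum>n\<in>?I. b n) = (\<Sum>G\<in>GG. real (card {n \<in> ?I. G \<subseteq> R n}))"
          unfolding b_def by (simp only: card_eq_sum_of_bool[OF fin(2)] card_eq_sum_of_bool[OF finite_greaterThanAtMost]) (rule sum.swap)
        also have "\<dots> \<le> (\<Sum>G\<in>GG. Cu * real N / L ^ m * (1 / (\<Prod>p\<in>bad_primes D G. 1 - 1 / real p) ^ m))"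
        proof (rule sum_mono)
          fix G assume G: "G \<in> GG"
          then have G': "G \<subseteq> AA" "card G = m" "G \<subseteq> {1..x}" using AA by (auto simp: GG_def)
          have "separated D K L (bad_primes D G) G \<and> card G = m"
            using G' xL e by (intro conjI separated_bad_primes) (auto simp: K_def)
          from U[THEN spec, THEN spec, THEN mp, OF this]
          have "real (card {n \<in> ?I. \<forall>h\<in>G. rough (\<delta> * L) (n + h)}) \<le> Cu * real N / ((\<Prod>p\<in>bad_primes D G. 1 - 1 / real p) * L) ^ m" .
          moreover have "{n \<in> ?I. G \<subseteq> R n} = {n \<in> ?I. \<forall>h\<in>G. rough (\<delta> * L) (n + h)}"
            using G'(1) by (auto simp: R_def)
          ultimately show "real (card {n \<in> ?I. G \<subseteq> R n}) \<le> Cu * real N / L ^ m * (1 / (\<Prod>p\<in>bad_primes D G. 1 - 1 / real p) ^ m)"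
            by (simp add: power_mult_distrib mult.commute)
        qed
        also have "\<dots> = Cu * real N / L ^ m * (\<Sum>G\<in>GG. 1 / (\<Prod>p\<in>bad_primes D G. 1 - 1 / real p) ^ m)"
          by (simp only: sum_distrib_left)
        also have "\<dots> \<le> Cu * real N / L ^ m * (Cs * real x ^ m)"
        proof (rule mult_left_mono)
          have "(\<Sum>G\<in>GG. 1 / (\<Prod>p\<in>bad_primes D G. 1 - 1 / real p) ^ m) \<le>
            (\<Sum>G | G \<subseteq> {1..x} \<and> card G = m. 1 / (\<Prod>p\<in>bad_primes D G. 1 - 1 / real p) ^ m)"
          proof (rule sum_mono2)
            show "GG \<subseteq> {G. G \<subseteq> {1..x} \<and> card G = m}" using AA(2) by (auto simp: GG_def)
            fix G
            have "0 \<le> (\<Prod>p\<in>bad_primes D G. 1 - 1 / real p)"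
            proof (rule prod_nonneg)
              fix p assume "p \<in> bad_primes D G"
              then have "real p \<ge> 1" using prime_bad_primes prime_ge_1_nat by fastforce
              then show "0 \<le> 1 - 1 / real p" by (simp add: field_simps)
            qed
            then show "0 \<le> 1 / (\<Prod>p\<in>bad_primes D G. 1 - 1 / real p) ^ m" by simp
          qed simp
          then show "(\<Sum>G\<in>GG. 1 / (\<Prod>p\<in>bad_primes D G. 1 - 1 / real p) ^ m) \<le> Cs * real x ^ m"
            using Cs(2)[of x] by linarith
          show "0 \<le> Cu * real N / L ^ m" using Cu L by simp
        qed
        also have "\<dots> \<le> Cu * real N / L ^ m * (Cs * (\<eta> * L) ^ m)"
          using Cu Cs L x by (intro mult_left_mono power_mono) auto
        also have "\<dots> = C2 * \<eta> ^ m * real N" using L by (simp add: C2_def power_mult_distrib)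
        \<comment> \<open>The exponent \<open>k + 1\<close> is lowered to \<open>k\<close> to match
          the lower bound; the constant is compensated by \<open>T\<close>, which is independent of
          \<open>\<eta>\<close>.\<close>
        also have "\<dots> \<le> C2 * \<eta> ^ k * real N"
          using C2 \<eta> by (intro mult_right_mono mult_left_mono power_decreasing) (auto simp: m_def)
        finally show ?thesis .
      qed
      define S where "S = {n \<in> ?I. \<exists>H\<in>HH. good n H}"
      define \<kappa> where "\<kappa> = c1 / (2 * (C2 + 1))"
      have point: "a n \<le> of_bool (n \<in> S) * real T ^ k + \<kappa> * b n" if n: "n \<in> ?I" for n
      proof -
        let ?r = "card (R n)"
        have "card {H \<in> HH. good n H} \<le> card {H. H \<subseteq> R n \<and> card H = k}"
          using fR[of n] by (intro card_mono) (auto simp: HH_def good_def)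
        then have a_le: "a n \<le> real (?r choose k)" unfolding a_def by (simp add: n_subsets fR)
        have "{G \<in> GG. G \<subseteq> R n} = {G. G \<subseteq> R n \<and> card G = m}" by (auto simp: GG_def R_def)
        then have b_eq: "b n = real (?r choose m)" unfolding b_def by (simp add: n_subsets fR)
        have \<kappa>0: "\<kappa> \<ge> 0" using c1 C2 by (simp add: \<kappa>_def)
        show ?thesis
        proof (cases "n \<in> S")
          case False
          then have "{H \<in> HH. good n H} = {}" using n by (auto simp: S_def)
          then have "a n = 0" unfolding a_def by (simp only: card.empty of_nat_0)
          then show ?thesis using False \<kappa>0 b_eq by simp
        next
          case True
          show ?thesis
          proof (cases "?r \<le> T")
            case le: True
            have "?r choose k \<le> T ^ k"
            proof (cases "k \<le> ?r")
              case True
              then have "?r choose k \<le> ?r ^ k" by (rule binomial_le_pow)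
              also have "\<dots> \<le> T ^ k" using le by (intro power_mono) auto
              finally show ?thesis .
            qed (simp add: binomial_eq_0)
            then have "real (?r choose k) \<le> real (T ^ k)" by (rule of_nat_mono)
            then have "a n \<le> real T ^ k" using a_le unfolding of_nat_power by linarith
            then show ?thesis using True \<kappa>0 b_eq by (simp add: add_increasing2)
          next
            case False
            have "real (?r - k) * real (?r choose k) = real (k + 1) * real (?r choose m)"
              using binomial_absorb_comp[of ?r k] binomial_absorption[of k ?r] False T(1)
              unfolding m_def of_nat_mult[symmetric]
              by (metis Suc_eq_plus1 binomial_absorb_comp binomial_absorption times_binomial_minus1_eq mult.commute)
            then have eq: "(real ?r - real k) * real (?r choose k) = real (k + 1) * b n"
              using False T(1) by (simp add: b_eq of_nat_diff)
            have "real (k + 1) \<le> \<kappa> * (real T - real k)"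
            proof -
              have "real (k + 1) \<le> c1 * (real T - real k) / (2 * (C2 + 1))"
                using T(2) C2 by (subst pos_le_divide_eq) auto
              then show ?thesis by (simp add: \<kappa>_def)
            qed
            also have "\<dots> \<le> \<kappa> * (real ?r - real k)" using False \<kappa>0 by (intro mult_left_mono) auto
            finally have "real (k + 1) * b n \<le> \<kappa> * (real ?r - real k) * b n"
              by (intro mult_right_mono) (simp_all add: b_eq)
            then have "(real ?r - real k) * real (?r choose k) \<le> (real ?r - real k) * (\<kappa> * b n)"
              unfolding eq by (simp only: mult_ac)
            moreover have "real ?r - real k > 0" using False T(1) by simp
            ultimately have "real (?r choose k) \<le> \<kappa> * b n" by (simp only: mult_le_cancel_left_pos)
            then show ?thesis using a_le by (simp add: add_increasing)
          qed
        qed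
      qed
      have cS: "c3 * \<eta> ^ k * real N \<le> real (card S)"
      proof -
        have "c1 * \<eta> ^ k * real N \<le> (\<Sum>n\<in>?I. of_bool (n \<in> S) * real T ^ k + \<kappa> * b n)"
          using suma sum_mono[of ?I a, OF point] by linarith
        also have "\<dots> = real (card S) * real T ^ k + \<kappa> * (\<Sum>n\<in>?I. b n)"
        proof -
          have "S = {n \<in> ?I. n \<in> S}" by (auto simp: S_def)
          then have "real (card S) = (\<Sum>n\<in>?I. of_bool (n \<in> S))"
            using card_eq_sum_of_bool[of ?I "\<lambda>n. n \<in> S"] by simp
          then show ?thesis by (simp only: sum.distrib sum_distrib_left sum_distrib_right)
        qed
        also have "\<kappa> * (\<Sum>n\<in>?I. b n) \<le> \<kappa> * (C2 * \<eta> ^ k * real N)"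
          using c1 C2 by (intro mult_left_mono sumb) (simp add: \<kappa>_def)
        also have "\<kappa> * (C2 * \<eta> ^ k * real N) = (c1 / 2 * \<eta> ^ k * real N) * (C2 / (C2 + 1))"
          by (simp add: \<kappa>_def)
        also have "\<dots> \<le> (c1 / 2 * \<eta> ^ k * real N) * 1"
          using c1 C2 \<eta> by (intro mult_left_mono) auto
        finally have "c1 / 2 * \<eta> ^ k * real N \<le> real (card S) * real T ^ k" by simp
        then have "c1 / 2 * \<eta> ^ k * real N / real T ^ k \<le> real (card S)"
          using T(1) by (subst pos_divide_le_eq) auto
        then show ?thesis by (simp add: c3_def)
      qed
      have "card S \<le> card (small_gap_indices \<eta> N) * x + x"
      proof (rule card_two_primes_le)
        show "real x \<le> \<eta> * ln (real N)" using x by (simp add: L_def)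
        show "S \<subseteq> {N<..2 * N}" by (auto simp: S_def)
        fix n assume "n \<in> S"
        then obtain H where H: "H \<in> HH" "good n H" by (auto simp: S_def)
        let ?Q = "{h \<in> H. prime (n + h)}"
        have fQ: "finite ?Q" "?Q \<subseteq> {1..x}" using H AA by (auto simp: HH_def intro: finite_subset)
        have "\<not> card ?Q \<le> Suc 0" using H(2) by (simp add: good_def)
        then obtain g g' where g: "g \<in> ?Q" "g' \<in> ?Q" "g \<noteq> g'" using fQ(1) by (auto simp: card_le_Suc0_iff_eq)
        have "\<exists>h h'. h \<in> ?Q \<and> h' \<in> ?Q \<and> h < h'" using g by (metis linorder_neqE_nat)
        then obtain h h' where "h \<in> ?Q" "h' \<in> ?Q" "h < h'" by blast
        moreover from this have "1 \<le> h" "h' \<le> x" using fQ(2) by auto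
        ultimately show "\<exists>h h'. 1 \<le> h \<and> h < h' \<and> h' \<le> x \<and> prime (n + h) \<and> prime (n + h')" by blast
      qed
      then have "real (card S) \<le> real (card (small_gap_indices \<eta> N) * x + x)" by (rule of_nat_mono)
      \<comment> \<open>The factor \<open>x \<le> \<eta> * L\<close> on the right cancels one power
        of \<open>\<eta>\<close>, leaving the exponent \<open>k - 1\<close>; the summand 1 stems
        from the end of the range and costs half of the constant.\<close>
      then have "c3 * \<eta> ^ k * real N \<le> (real (card (small_gap_indices \<eta> N)) + 1) * real x"
        using cS by (simp add: algebra_simps)
      also have "\<dots> \<le> (real (card (small_gap_indices \<eta> N)) + 1) * (\<eta> * L)"
        using x by (intro mult_left_mono) auto
      finally have "\<eta> * (c3 * \<eta> ^ (k - 1) * real N) \<le> \<eta> * ((real (card (small_gap_indices \<eta> N)) + 1) * L)"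
        using k(1) by (simp add: power_eq_if mult_ac split: if_splits)
      then have "c3 * \<eta> ^ (k - 1) * real N \<le> (real (card (small_gap_indices \<eta> N)) + 1) * L"
        using \<eta>(1) by simp
      moreover have "L \<le> c3 / 2 * \<eta> ^ (k - 1) * real N" using e unfolding N(1) by blast
      ultimately have "c3 / 2 * \<eta> ^ (k - 1) * real N \<le> real (card (small_gap_indices \<eta> N)) * L"
        by (simp add: algebra_simps)
      then have "c3 / 2 * \<eta> ^ (k - 1) * (real N / L) \<le> real (card (small_gap_indices \<eta> N))"
        using L by (simp add: field_simps)
      then show ?case using N L unfolding L_def[symmetric] by (subst pos_le_divide_eq) auto
    qed
  qed
  have "\<exists>\<eta>\<^sub>0>0. \<forall>\<eta>::real. 0 < \<eta> \<and> \<eta> < \<eta>\<^sub>0 \<longrightarrow>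
      liminf (\<lambda>N::nat. ereal (real (card (small_gap_indices \<eta> N)) / (real N / ln (real N))))
        \<ge> ereal (c3 / 2 * \<eta> powi (int k - 1))"
  \<comment> \<open>The bound \<open>main\<close> is available for all positive
    \<open>\<eta>\<close> below 1, so 1 serves as the threshold.\<close>
  proof (rule exI[of _ "1::real"], intro conjI allI impI)
    fix \<eta> :: real assume \<eta>: "0 < \<eta> \<and> \<eta> < 1"
    have "int k - 1 = int (k - 1)" using k(1) by simp
    then have "\<eta> powi (int k - 1) = \<eta> ^ (k - 1)" by (simp only: power_int_of_nat)
    then have "\<forall>\<^sub>F N in sequentially. ereal (c3 / 2 * \<eta> powi (int k - 1)) \<le>
       ereal (real (card (small_gap_indices \<eta> N)) / (real N / ln (real N)))"
      using main[of \<eta>] \<eta> by simp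
    then show "liminf (\<lambda>N::nat. ereal (real (card (small_gap_indices \<eta> N)) / (real N / ln (real N))))
        \<ge> ereal (c3 / 2 * \<eta> powi (int k - 1))"
      by (rule Liminf_bounded)
  qed simp
  moreover have "c3 / 2 > 0" using c3 by simp
  ultimately show ?thesis by blast
qed

end
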